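(* Let $A$ be a contractible differential graded commutative Frobenius algebra whose scalar product $\langle-,-\rangle_A$ is odd, symmetric and nondegenerate. Let $V$ be the canonical symplectic superspace of dimension $2n|m$, with Lie algebras $\mathfrak{g}_{2n|m}$ and $\mathfrak{osp}_{2n|m}$, and let $S_A^L$ be the functional defined in the context. (1) For any maximally isotropic subspace $L\subset A$ satisfying $A=L\oplus d(A)$, the functional $$S_A^L:C_\bullet(\mathfrak{g}_{2n|m},\mathfrak{osp}_{2n|m})\to\mathbb{R}$$ is a Chevalley-Eilenberg cocycle, i.e. $S_A^L\circ\delta=0$. (2) The cohomology class of $S_A^L$ in $H^\bullet(\mathfrak{g}_{2n|m},\mathfrak{osp}_{2n|m})$ does not depend on the choice of the maximally isotropic subspace $L$ satisfying $A=L\oplus d(A)$.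
   Context: Conventions. All vector spaces are $\mathbb{Z}/2$-graded (super) over $\mathbb{R}$, and $A$ and $V$ are finite-dimensional; $|x|$ is the parity of $x$, and $(-1)^x$ means $(-1)^{|x|}$. The Koszul sign rule is used. $S(W^* )=\bigoplus_n S^n(W^* )$, $S^n(W^* )=[(W^* )^{\otimes n}]_{S_n}$, is the algebra of polynomial superfunctions on $W$. Tensors are regarded as functionals via $(f_1\otimes\cdots\otimes f_n)(w_1\otimes\cdots\otimes w_n)=f_1(w_1)\cdots f_n(w_n)$, and $A^*\otimes W^*=(A\otimes W)^*$ via $(f\otimes g)(a\otimes w)=f(a)g(w)$. Let $\pi_n:[(W^* )^{\otimes n}]^{S_n}\to S^n(W^* )$ be $\frac1{n!}$ times the quotient map. Polynomial forms. $\Omega^\bullet(W)$ is the supercommutative algebra freely generated over $S(W^* )$ by symbols $dy$, $y\in W^*$ (linear in $y$), of parity $|y|+1$; $d$ is the odd derivation with $y\mapsto dy$, $dy\mapsto 0$. A vector field is a derivation $\eta$ of $S(W^* )$; $i_\eta$ is the derivation of $\Omega^\bullet(W)$ of parity $|\eta|+1$ with $i_\eta(y)=0$, $i_\eta(dy)=\eta(y)$. A constant 2-form $\sum dy_idz_i$ ($y_i,z_i\in W^*$) corresponds to a skew-symmetric bilinear form on $W$ via $\Upsilon(dx\,dy)=(-1)^x[x\otimes y-(-1)^{xy}y\otimes x]$; it is a symplectic form if it is nondegenerate. A function $a\in S(W^* )$ then determines a vector field $\alpha$ by $i_\alpha(\omega)=da$. Lie algebras. $V$ has coordinates $p_1,\dots,p_n,q_1,\dots,q_n$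 (even), $x_1,\dots,x_m$ (odd), a basis of $V^*$, and even symplectic form $\omega=\sum dp_idq_i+\frac12\sum dx_idx_i$, with associated skew-symmetric form $\langle-,-\rangle_V=\Upsilon(\omega)$. $\mathfrak{g}_{2n|m}:=\bigoplus_{i\ge2}S^i(V^* )$ with bracket $\{a,b\}:=(-1)^a\alpha(b)$; $\tilde{\mathfrak g}_{2n|m}:=\bigoplus_{i\ge3}S^i(V^* )$; $\mathfrak{osp}_{2n|m}:=S^2(V^* )$ (linear symplectic vector fields). Chevalley-Eilenberg complex. For a Lie superalgebra $\mathfrak l$, $C_\bullet(\mathfrak l)=\Lambda^\bullet(\mathfrak l)$ is the quotient of $T(\mathfrak l)$ by $g\otimes h=-(-1)^{|g||h|}h\otimes g$, with differential $$\delta(g_1\wedge\cdots\wedge g_r)=\sum_{i<j}(-1)^{q}[g_i,g_j]\wedge g_1\wedge\cdots\hat{g_i}\cdots\hat{g_j}\cdots\wedge g_r,$$ $q=|g_i|(|g_1|+\cdots+|g_{i-1}|)+|g_j|(|g_1|+\cdots+|g_{j-1}|)+|g_i||g_j|+i+j-1$. The relative complex $C_\bullet(\mathfrak{g}_{2n|m},\mathfrak{osp}_{2n|m})$ is the space of $\mathfrak{osp}_{2n|m}$-coinvariants $C_\bullet(\tilde{\mathfrak g}_{2n|m})_{\mathfrak{osp}_{2n|m}}$ (adjoint action) with differential $\delta$; $H^\bullet(\mathfrak{g}_{2n|m},\mathfrak{osp}_{2n|m})$ is the cohomology of its $\mathbb{R}$-linear dual. Frobenius algebra. $A$ is a $\mathbb{Z}/2$-graded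 (super)commutative associative algebra with an odd differential $d$ (a derivation with $d^2=0$) and a scalar product with $\langle ab,c\rangle_A=\langle a,bc\rangle_A$ and $\langle d(a),b\rangle_A+(-1)^a\langle a,d(b)\rangle_A=0$. Contractible means that $(A,d)$ has zero homology. A subspace is isotropic if $\langle-,-\rangle_A$ vanishes on it, and maximally isotropic if it is isotropic of maximal dimension. Put $\langle a_1,a_2\rangle_d:=(-1)^{a_1}\langle a_1,d(a_2)\rangle_A$. On $A\otimes V$ let $$\langle a_1\otimes w_1,a_2\otimes w_2\rangle_{\tilde d}:=(-1)^{w_1a_2}\langle a_1,a_2\rangle_d\langle w_1,w_2\rangle_V,$$ an even symmetric form, and $\tilde\sigma:=\pi_2(\langle-,-\rangle_{\tilde d})\in S^2(A^*\otimes V^* )$. If $L$ is maximally isotropic with $A=L\oplus d(A)$, then the restriction of $\langle-,-\rangle_{\tilde d}$ to $L\otimes V$ is nondegenerate. The map $\Psi_A$. Let $\tilde m_k\in(A^* )^{\otimes k+1}$ be the odd symmetric tensor $\tilde m_k(a_1,\dots,a_{k+1}):=\langle a_1\cdots a_k,a_{k+1}\rangle_A$. The odd linear map $\Psi_A:S^{k+1}(V^* )\to S^{k+1}(A^*\otimes V^* )$ is induced by $x\mapsto\tilde m_k\otimes x$, $(V^* )^{\otimes k+1}\to(A^* )^{\otimes k+1}\otimes(V^* )^{\otimes k+1}=(A^*\otimes V^* )^{\otimes k+1}$ (Koszul reshuffling). The functional. For $h_1,\dots,h_l\in\mathfrak{g}_{2n|m}$, $$S_A^L(h_1\wedge\cdots\wedge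 h_l):=(-1)^{p(h)}\frac{\int_{L\otimes V}\Psi_A(h_1)\cdots\Psi_A(h_l)\,e^{-\tilde\sigma}}{\int_{L\otimes V}e^{-\tilde\sigma}},$$ where $(-1)^{p(h)}$ is the Koszul sign from moving the odd maps $\Psi_A$ past the $h_i$, i.e. $p(h)=\sum_i(l-i)|h_i|$. This functional is $\mathfrak{osp}_{2n|m}$-invariant, so (restricting to $h_i\in\tilde{\mathfrak g}_{2n|m}$) it defines a functional on $C_\bullet(\mathfrak{g}_{2n|m},\mathfrak{osp}_{2n|m})$. Integrals. Functions are restricted to $X=L\otimes V$, and $X$ is identified with $\mathbb{R}^{N|M}$ by linear coordinates (the ratio is independent of the choice). Odd variables are integrated by Berezin integration. The remaining Gaussian integral over $\mathbb{R}^N$ is defined by Wick rotation: choosing coordinates in which the even part of the exponent is $-\frac12(\sum_{i\le k}x_i^2-\sum_{i>k}x_i^2)$, the integral of $f(x)$ times the exponential is $g(\sqrt{-1})$, where $g$ is the analytic continuation to nonzero complex $t$ of $g(t)=\int_{\mathbb{R}^N}f(x)e^{-\frac12[\sum_{i\le k}x_i^2+\sum_{i>k}(tx_i)^2]}dx$ from $t>0$. *)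

theory Defs
  imports "HOL-Complex_Analysis.Complex_Analysis" "HOL-Library.Poly_Mapping"
begin

text \<open>Words form the free monoid under concatenation, so the convolution ring
  \<^typ>\<open>'v list \<Rightarrow>\<^sub>0 real\<close> of \<^theory>\<open>HOL-Library.Poly_Mapping\<close> is the tensor algebra on the
  vector space with basis \<open>'v\<close>.\<close>

instantiation list :: (type) monoid_add
begin
definition zero_list :: "'a list" where "zero_list = []"
definition plus_list :: "'a list \<Rightarrow> 'a list \<Rightarrow> 'a list" where "plus_list = (@)"
instance by standard (simp_all add: zero_list_def plus_list_def)
end

instantiation poly_mapping :: (type, real_vector) real_vector
begin
lift_definition scaleR_poly_mapping :: "real \<Rightarrow> ('a \<Rightarrow>\<^sub>0 'b) \<Rightarrow> ('a \<Rightarrow>\<^sub>0 'b)"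
  is "\<lambda>c f x. c *\<^sub>R f x"
  by (erule finite_subset[rotated]) auto
instance
  by standard (transfer; simp add: fun_eq_iff scaleR_add_right scaleR_add_left)+
end

text \<open>The linear map on the free vector space over \<open>'w\<close> with given values on the basis.\<close>

definition lin_ext :: "('w \<Rightarrow> 'b::real_vector) \<Rightarrow> ('w \<Rightarrow>\<^sub>0 real) \<Rightarrow> 'b" where
  "lin_ext F x = (\<Sum>w\<in>Poly_Mapping.keys x. Poly_Mapping.lookup x w *\<^sub>R F w)"

text \<open>Parities are booleans, with \<^term>\<open>True\<close> for odd; \<open>sg p\<close> is $(-1)^p$.\<close>

definition sg :: "bool \<Rightarrow> real" where
  "sg p = (if p then -1 else 1)"

class super_index =
  fixes odd_ix :: "'a \<Rightarrow> bool"

definition odd_word :: "'v::super_index list \<Rightarrow> bool" where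
  "odd_word w = odd (length (filter odd_ix w))"

text \<open>Adjacent transpositions generate the symmetric groups, so in each degree the quotient of the
  tensors by this subspace is the space of coinvariants for the Koszul-signed action.\<close>

definition sym_rel :: "('v::super_index list \<Rightarrow>\<^sub>0 real) set" where
  "sym_rel = span {Poly_Mapping.single (us @ [v, w] @ vs) 1
      - sg (odd_ix v \<and> odd_ix w) *\<^sub>R Poly_Mapping.single (us @ [w, v] @ vs) 1 | us v w vs. True}"

lemma sym_rel_diff_trans: "x - z \<in> sym_rel" if "x - y \<in> sym_rel" "y - z \<in> sym_rel"
proof -
  have "(x - y) + (y - z) \<in> sym_rel"
    using that unfolding sym_rel_def by (rule span_add)
  then show ?thesis by simp
qed

lemma sym_rel_diff_sym: "y - x \<in> sym_rel" if "x - y \<in> sym_rel"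
proof -
  have "- (x - y) \<in> sym_rel"
    using that unfolding sym_rel_def by (rule span_neg)
  then show ?thesis by simp
qed

quotient_type (overloaded) 'v spoly = "'v::super_index list \<Rightarrow>\<^sub>0 real" / "\<lambda>x y. x - y \<in> sym_rel"
  morphisms rep_spoly abs_spoly
proof (rule equivpI)
  show "reflp (\<lambda>x y. x - y \<in> (sym_rel :: ('v list \<Rightarrow>\<^sub>0 real) set))"
    by (rule reflpI) (simp add: sym_rel_def span_zero)
  show "symp (\<lambda>x y. x - y \<in> (sym_rel :: ('v list \<Rightarrow>\<^sub>0 real) set))"
    by (rule sympI) (rule sym_rel_diff_sym)
  show "transp (\<lambda>x y. x - y \<in> (sym_rel :: ('v list \<Rightarrow>\<^sub>0 real) set))"
    by (rule transpI) (rule sym_rel_diff_trans)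
qed



lemma poly_mapping_single_induct [case_names zero add]:
  assumes "P 0" and "\<And>k v f. P f \<Longrightarrow> P (Poly_Mapping.single k v + f)"
  shows "P (x :: 'k \<Rightarrow>\<^sub>0 'b::comm_monoid_add)"
proof (induction x rule: update_induct)
  case const
  show ?case by (rule assms(1))
next
  case (update f a b)
  have "Poly_Mapping.update a b f = Poly_Mapping.single a b + f"
    using update.hyps(1)
    by (intro poly_mapping_eqI) (auto simp: update.rep_eq lookup_add lookup_single when_def in_keys_iff)
  with assms(2)[OF update.IH] show ?case by simp
qed

lemma scaleR_single_eq: "c *\<^sub>R Poly_Mapping.single w d = Poly_Mapping.single w (c *\<^sub>R d)"
  by (rule poly_mapping_eqI) (simp add: scaleR_poly_mapping.rep_eq lookup_single when_def)

lemma scaleR_conv_single_mult: "c *\<^sub>R x = Poly_Mapping.single 0 c * x"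
  for x :: "'v list \<Rightarrow>\<^sub>0 real"
  by (induction x rule: poly_mapping_single_induct)
    (simp_all add: scaleR_add_right distrib_left mult_single scaleR_single_eq)

lemma scaleR_conv_mult_single: "c *\<^sub>R x = x * Poly_Mapping.single 0 c"
  for x :: "'v list \<Rightarrow>\<^sub>0 real"
  by (induction x rule: poly_mapping_single_induct)
    (simp_all add: scaleR_add_right distrib_right mult_single scaleR_single_eq mult.commute)

lemma scaleR_poly_mapping_mult_left: "(c *\<^sub>R x) * y = c *\<^sub>R (x * y)"
  for x y :: "'v list \<Rightarrow>\<^sub>0 real"
  by (simp add: scaleR_conv_single_mult mult.assoc)

lemma scaleR_poly_mapping_mult_right: "x * (c *\<^sub>R y) = c *\<^sub>R (x * y)"
  for x y :: "'v list \<Rightarrow>\<^sub>0 real"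
  by (simp add: scaleR_conv_mult_single mult.assoc)

lemma poly_mapping_span_single:
  "(x :: 'v \<Rightarrow>\<^sub>0 real) \<in> span (range (\<lambda>w. Poly_Mapping.single w 1))"
proof (induction x rule: poly_mapping_single_induct)
  case zero
  show ?case by (rule span_zero)
next
  case (add k v f)
  have "v *\<^sub>R Poly_Mapping.single k (1::real) \<in> span (range (\<lambda>w. Poly_Mapping.single w 1))"
    by (intro span_scale span_base rangeI)
  with add show ?case by (simp add: scaleR_single_eq span_add)
qed

lemma sym_rel_mult_single_left: "Poly_Mapping.single u 1 * r \<in> sym_rel"
  if "r \<in> sym_rel" for u :: "'v::super_index list"
  using that unfolding sym_rel_def
proof (induction rule: span_induct_alt)
  case base
  show ?case by (simp add: span_zero)
next
  case (step c x y)
  then obtain us v w vs where x: "x = Poly_Mapping.single (us @ [v, w] @ vs) 1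
      - sg (odd_ix v \<and> odd_ix w) *\<^sub>R Poly_Mapping.single (us @ [w, v] @ vs) 1"
    by blast
  have "Poly_Mapping.single u 1 * x = Poly_Mapping.single ((u @ us) @ [v, w] @ vs) 1
      - sg (odd_ix v \<and> odd_ix w) *\<^sub>R Poly_Mapping.single ((u @ us) @ [w, v] @ vs) 1"
    by (simp add: x right_diff_distrib scaleR_poly_mapping_mult_right mult_single plus_list_def)
  then have "Poly_Mapping.single u 1 * x \<in> span {Poly_Mapping.single (us @ [v, w] @ vs) 1
      - sg (odd_ix v \<and> odd_ix w) *\<^sub>R Poly_Mapping.single (us @ [w, v] @ vs) 1 | us v w vs. True}"
    by (intro span_base) blast
  with step show ?case
    by (simp add: distrib_left scaleR_poly_mapping_mult_right span_add span_scale)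
qed

lemma sym_rel_mult_single_right: "r * Poly_Mapping.single u 1 \<in> sym_rel"
  if "r \<in> sym_rel" for u :: "'v::super_index list"
  using that unfolding sym_rel_def
proof (induction rule: span_induct_alt)
  case base
  show ?case by (simp add: span_zero)
next
  case (step c x y)
  then obtain us v w vs where x: "x = Poly_Mapping.single (us @ [v, w] @ vs) 1
      - sg (odd_ix v \<and> odd_ix w) *\<^sub>R Poly_Mapping.single (us @ [w, v] @ vs) 1"
    by blast
  have "x * Poly_Mapping.single u 1 = Poly_Mapping.single (us @ [v, w] @ (vs @ u)) 1
      - sg (odd_ix v \<and> odd_ix w) *\<^sub>R Poly_Mapping.single (us @ [w, v] @ (vs @ u)) 1"
    by (simp add: x left_diff_distrib scaleR_poly_mapping_mult_left mult_single plus_list_def)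
  then have "x * Poly_Mapping.single u 1 \<in> span {Poly_Mapping.single (us @ [v, w] @ vs) 1
      - sg (odd_ix v \<and> odd_ix w) *\<^sub>R Poly_Mapping.single (us @ [w, v] @ vs) 1 | us v w vs. True}"
    by (intro span_base) blast
  with step show ?case
    by (simp add: distrib_right scaleR_poly_mapping_mult_left span_add span_scale)
qed

lemma subspace_sym_rel: "subspace (sym_rel :: ('v::super_index list \<Rightarrow>\<^sub>0 real) set)"
  unfolding sym_rel_def by (rule subspace_span)

lemma sym_rel_mult_left: "x * r \<in> sym_rel"
  if r: "r \<in> sym_rel" for x :: "'v::super_index list \<Rightarrow>\<^sub>0 real"
  using poly_mapping_span_single[of x]
proof (induction rule: span_induct_alt)
  case base
  show ?case by (simp add: subspace_0 subspace_sym_rel)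
next
  case (step c x y)
  then show ?case
    using sym_rel_mult_single_left[OF r] subspace_sym_rel
    by (auto simp: distrib_right scaleR_poly_mapping_mult_left intro!: subspace_add subspace_scale)
qed

lemma sym_rel_mult_right: "r * x \<in> sym_rel"
  if r: "r \<in> sym_rel" for x :: "'v::super_index list \<Rightarrow>\<^sub>0 real"
  using poly_mapping_span_single[of x]
proof (induction rule: span_induct_alt)
  case base
  show ?case by (simp add: subspace_0 subspace_sym_rel)
next
  case (step c x y)
  then show ?case
    using sym_rel_mult_single_right[OF r] subspace_sym_rel
    by (auto simp: distrib_left scaleR_poly_mapping_mult_right intro!: subspace_add subspace_scale)
qed

lemma one_notin_sym_rel: "1 \<notin> (sym_rel :: ('v::super_index list \<Rightarrow>\<^sub>0 real) set)"
proof
  have "Poly_Mapping.lookup r [] = 0" if "r \<in> sym_rel" for r :: "'v list \<Rightarrow>\<^sub>0 real"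
    using that unfolding sym_rel_def
  proof (induction rule: span_induct_alt)
    case base
    show ?case by simp
  next
    case (step c x y)
    then show ?case
      by (auto simp: lookup_add lookup_minus scaleR_poly_mapping.rep_eq lookup_single)
  qed
  moreover assume "1 \<in> (sym_rel :: ('v list \<Rightarrow>\<^sub>0 real) set)"
  ultimately have "Poly_Mapping.lookup (1 :: 'v list \<Rightarrow>\<^sub>0 real) [] = 0" by blast
  then show False by (simp add: lookup_one zero_list_def)
qed

instantiation spoly :: (super_index) real_algebra_1
begin
lift_definition zero_spoly :: "'a spoly" is 0 .
lift_definition one_spoly :: "'a spoly" is 1 .
lift_definition plus_spoly :: "'a spoly \<Rightarrow> 'a spoly \<Rightarrow> 'a spoly" is "(+)"
  using subspace_add[OF subspace_sym_rel] by (fastforce simp: algebra_simps)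
lift_definition minus_spoly :: "'a spoly \<Rightarrow> 'a spoly \<Rightarrow> 'a spoly" is "(-)"
  using subspace_diff[OF subspace_sym_rel] by (fastforce simp: algebra_simps)
lift_definition uminus_spoly :: "'a spoly \<Rightarrow> 'a spoly" is uminus
  using subspace_neg[OF subspace_sym_rel] by fastforce
lift_definition times_spoly :: "'a spoly \<Rightarrow> 'a spoly \<Rightarrow> 'a spoly" is "(*)"
proof -
  fix x x' y y' :: "'a list \<Rightarrow>\<^sub>0 real"
  assume "x - x' \<in> sym_rel" "y - y' \<in> sym_rel"
  then have "(x - x') * y + x' * (y - y') \<in> sym_rel"
    by (intro subspace_add[OF subspace_sym_rel] sym_rel_mult_left sym_rel_mult_right)
  then show "x * y - x' * y' \<in> sym_rel"
    by (simp add: algebra_simps)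
qed
lift_definition scaleR_spoly :: "real \<Rightarrow> 'a spoly \<Rightarrow> 'a spoly" is "(*\<^sub>R)"
  using subspace_scale[OF subspace_sym_rel] by (fastforce simp: scaleR_diff_right[symmetric])
instance
proof
  show "(0 :: 'a spoly) \<noteq> 1"
    by transfer (use one_notin_sym_rel subspace_neg[OF subspace_sym_rel] in fastforce)
qed (transfer; simp add: algebra_simps scaleR_poly_mapping_mult_left
      scaleR_poly_mapping_mult_right subspace_0[OF subspace_sym_rel])+
end

text \<open>\<open>mon w\<close> is the image in the quotient of the tensor \<open>w\<close>, i.e. the product of its letters.\<close>

definition mon :: "'v::super_index list \<Rightarrow> 'v spoly" where
  "mon w = abs_spoly (Poly_Mapping.single w 1)"

text \<open>The linear map on the quotient induced by a linear map on tensors. The representative is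
  arbitrary, so this is meaningful only for \<open>F\<close> whose linear extension vanishes on
  \<^const>\<open>sym_rel\<close>; all uses below are of this kind.\<close>

definition induced :: "('v::super_index list \<Rightarrow> 'b::real_vector) \<Rightarrow> 'v spoly \<Rightarrow> 'b" where
  "induced F f = lin_ext F (rep_spoly f)"

definition homog :: "bool \<Rightarrow> 'v::super_index spoly set" where
  "homog p = span {mon w | w. odd_word w = p}"

text \<open>The parity of a homogeneous element, \<^term>\<open>0\<close> counting as even.\<close>

definition parity :: "'v::super_index spoly \<Rightarrow> bool" where
  "parity f \<longleftrightarrow> f \<notin> homog False"

definition component :: "bool \<Rightarrow> 'v::super_index spoly \<Rightarrow> 'v spoly" where
  "component p = induced (\<lambda>w. if odd_word w = p then mon w else 0)"

text \<open>The sum of the $S^k(W^*)$, \<open>k \<in> K\<close>, where \<open>I\<close> is the set of coordinates on \<open>W\<close>.\<close>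

definition sym_part :: "'v::super_index set \<Rightarrow> nat set \<Rightarrow> 'v spoly set" where
  "sym_part I K = span {mon w | w. set w \<subseteq> I \<and> length w \<in> K}"

text \<open>The derivation of parity \<open>p\<close> with value \<open>\<phi> v\<close> on the generator \<open>v\<close>; here \<open>\<phi> v\<close> must have
  parity \<open>p + |v|\<close>.\<close>

definition deriv_ext :: "bool \<Rightarrow> ('v::super_index \<Rightarrow> 'v spoly) \<Rightarrow> 'v spoly \<Rightarrow> 'v spoly" where
  "deriv_ext p \<phi> = induced (\<lambda>w. \<Sum>i<length w.
     sg (p \<and> odd_word (take i w)) *\<^sub>R (mon (take i w) * \<phi> (w ! i) * mon (drop (Suc i) w)))"

text \<open>\<open>'v form_ix spoly\<close> is $\Omega^\bullet(W)$, with \<open>Fn y\<close> the coordinate \<open>y\<close> and \<open>Df y\<close> the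
  symbol $dy$.\<close>

datatype 'v form_ix = Fn 'v | Df 'v

instantiation form_ix :: (super_index) super_index
begin
fun odd_ix_form_ix :: "'a form_ix \<Rightarrow> bool" where
  "odd_ix_form_ix (Fn v) = odd_ix v"
| "odd_ix_form_ix (Df v) = (\<not> odd_ix v)"
instance ..
end

definition fn_incl :: "'v::super_index spoly \<Rightarrow> 'v form_ix spoly" where
  "fn_incl = induced (\<lambda>w. mon (map Fn w))"

definition ext_d :: "'v::super_index form_ix spoly \<Rightarrow> 'v form_ix spoly" where
  "ext_d = deriv_ext True (\<lambda>u. case u of Fn v \<Rightarrow> mon [Df v] | Df v \<Rightarrow> 0)"

text \<open>Contraction $i_\eta$ with the vector field \<open>\<eta>\<close> of parity \<open>p\<close> given by \<open>\<eta>(v) = \<phi> v\<close>.\<close>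

definition contraction ::
  "bool \<Rightarrow> ('v::super_index \<Rightarrow> 'v spoly) \<Rightarrow> 'v form_ix spoly \<Rightarrow> 'v form_ix spoly" where
  "contraction p \<phi> = deriv_ext (\<not> p) (\<lambda>u. case u of Fn v \<Rightarrow> 0 | Df v \<Rightarrow> fn_incl (\<phi> v))"

text \<open>$\Upsilon$ of a constant 2-form. A bilinear form on \<open>W\<close> is given by its values on the basis of
  \<open>W\<close> dual to the coordinates.\<close>

definition upsilon :: "'v::super_index form_ix spoly \<Rightarrow> 'v \<Rightarrow> 'v \<Rightarrow> real" where
  "upsilon \<theta> v v' = induced (\<lambda>u. case u of
       [Df y, Df z] \<Rightarrow> sg (odd_ix y) *
         (of_bool (y = v \<and> z = v') - sg (odd_ix y \<and> odd_ix z) * of_bool (z = v \<and> y = v'))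
     | _ \<Rightarrow> 0) \<theta>"

datatype vix = P nat | Q nat | X nat

instantiation vix :: super_index
begin
fun odd_ix_vix :: "vix \<Rightarrow> bool" where
  "odd_ix_vix (X i) = True"
| "odd_ix_vix _ = False"
instance ..
end

text \<open>The coordinates on $V = \mathbb{R}^{2n|m}$.\<close>

definition coordsV :: "nat \<Rightarrow> nat \<Rightarrow> vix set" where
  "coordsV n m = P ` {..<n} \<union> Q ` {..<n} \<union> X ` {..<m}"

definition omega :: "nat \<Rightarrow> nat \<Rightarrow> vix form_ix spoly" where
  "omega n m = (\<Sum>i<n. mon [Df (P i), Df (Q i)]) + (1/2) *\<^sub>R (\<Sum>i<m. mon [Df (X i), Df (X i)])"

definition formV :: "nat \<Rightarrow> nat \<Rightarrow> vix \<Rightarrow> vix \<Rightarrow> real" where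
  "formV n m = upsilon (omega n m)"

text \<open>The values on the coordinates of a vector field of parity \<open>p\<close> on \<open>V\<close>.\<close>

definition vfieldV :: "nat \<Rightarrow> nat \<Rightarrow> bool \<Rightarrow> (vix \<Rightarrow> vix spoly) \<Rightarrow> bool" where
  "vfieldV n m p \<phi> \<longleftrightarrow>
     (\<forall>v\<in>coordsV n m. \<phi> v \<in> sym_part (coordsV n m) UNIV \<inter> homog (p \<noteq> odd_ix v)) \<and>
     (\<forall>v. v \<notin> coordsV n m \<longrightarrow> \<phi> v = 0)"

definition ham_vfield :: "nat \<Rightarrow> nat \<Rightarrow> bool \<Rightarrow> vix spoly \<Rightarrow> vix \<Rightarrow> vix spoly" where
  "ham_vfield n m p a = (THE \<phi>. vfieldV n m p \<phi> \<and>
     contraction p \<phi> (omega n m) = ext_d (fn_incl a))"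

text \<open>$\{a,b\} = (-1)^a \alpha(b)$, where $\alpha$ has the parity of \<open>a\<close>; extended linearly from
  homogeneous \<open>a\<close>.\<close>

definition poisson :: "nat \<Rightarrow> nat \<Rightarrow> vix spoly \<Rightarrow> vix spoly \<Rightarrow> vix spoly" where
  "poisson n m a b =
     (\<Sum>p\<in>UNIV. sg p *\<^sub>R deriv_ext p (ham_vfield n m p (component p a)) b)"

definition osp :: "nat \<Rightarrow> nat \<Rightarrow> vix spoly set" where
  "osp n m = sym_part (coordsV n m) {2}"

definition gtilde :: "nat \<Rightarrow> nat \<Rightarrow> vix spoly set" where
  "gtilde n m = sym_part (coordsV n m) {3..}"

definition gtilde_hom :: "nat \<Rightarrow> nat \<Rightarrow> vix spoly set" where
  "gtilde_hom n m = {g \<in> gtilde n m. \<exists>p. g \<in> homog p}"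

text \<open>The relative complex is the quotient \<open>rel_words n m / rel_relations n m\<close>: \<open>rel_words\<close> is free on
  the words \<open>[g\<^sub>1, \<dots>, g\<^sub>r]\<close> in homogeneous elements, and the four families of relations are
  additivity and homogeneity in each slot, the exterior relation, and passage to coinvariants.\<close>

type_synonym chain = "vix spoly list \<Rightarrow>\<^sub>0 real"

abbreviation word :: "vix spoly list \<Rightarrow> chain" where
  "word gs \<equiv> Poly_Mapping.single gs 1"

definition rel_words :: "nat \<Rightarrow> nat \<Rightarrow> chain set" where
  "rel_words n m = span {word gs | gs. set gs \<subseteq> gtilde_hom n m}"

definition adjoint :: "nat \<Rightarrow> nat \<Rightarrow> vix spoly \<Rightarrow> vix spoly list \<Rightarrow> chain" where
  "adjoint n m u gs = (\<Sum>i<length gs.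
     sg (parity u \<and> odd (\<Sum>r<i. of_bool (parity (gs ! r)) :: nat)) *\<^sub>R
       word (gs[i := poisson n m u (gs ! i)]))"

definition rel_relations :: "nat \<Rightarrow> nat \<Rightarrow> chain set" where
  "rel_relations n m = span
     ({word (us @ [g + h] @ vs) - word (us @ [g] @ vs) - word (us @ [h] @ vs) | us g h vs p.
         set (us @ vs) \<subseteq> gtilde_hom n m \<and> {g, h} \<subseteq> gtilde n m \<inter> homog p}
    \<union> {word (us @ [c *\<^sub>R g] @ vs) - c *\<^sub>R word (us @ [g] @ vs) | us c g vs.
         set (us @ [g] @ vs) \<subseteq> gtilde_hom n m}
    \<union> {word (us @ [g, h] @ vs) + sg (parity g \<and> parity h) *\<^sub>R word (us @ [h, g] @ vs) | us g h vs.
         set (us @ [g, h] @ vs) \<subseteq> gtilde_hom n m}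
    \<union> {adjoint n m u gs | u gs p. u \<in> osp n m \<inter> homog p \<and> set gs \<subseteq> gtilde_hom n m})"

text \<open>Positions start at 0 here, so the usual $i+j-1$ becomes \<open>i + j + 1\<close>.\<close>

definition ce_delta :: "nat \<Rightarrow> nat \<Rightarrow> chain \<Rightarrow> chain" where
  "ce_delta n m = lin_ext (\<lambda>gs. \<Sum>j<length gs. \<Sum>i<j.
     let deg = (\<lambda>r. of_bool (parity (gs ! r)) :: nat);
         q = deg i * (\<Sum>r<i. deg r) + deg j * (\<Sum>r<j. deg r) + deg i * deg j + i + j + 1
     in (-1) ^ q *\<^sub>R word (poisson n m (gs ! i) (gs ! j) # nths gs (- {i, j})))"

text \<open>The linear dual of the quotient: functionals vanishing on the relations. Only their values on
  \<^const>\<open>rel_words\<close> matter, and cochains agreeing there are identified in cohomology.\<close>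

definition ce_cochain :: "nat \<Rightarrow> nat \<Rightarrow> (chain \<Rightarrow> real) \<Rightarrow> bool" where
  "ce_cochain n m \<theta> \<longleftrightarrow> linear \<theta> \<and> (\<forall>c\<in>rel_relations n m. \<theta> c = 0)"

definition ce_cocycle :: "nat \<Rightarrow> nat \<Rightarrow> (chain \<Rightarrow> real) \<Rightarrow> bool" where
  "ce_cocycle n m \<theta> \<longleftrightarrow> ce_cochain n m \<theta> \<and> (\<forall>c\<in>rel_words n m. \<theta> (ce_delta n m c) = 0)"

definition ce_coboundary :: "nat \<Rightarrow> nat \<Rightarrow> (chain \<Rightarrow> real) \<Rightarrow> bool" where
  "ce_coboundary n m \<theta> \<longleftrightarrow>
     (\<exists>\<eta>. ce_cochain n m \<eta> \<and> (\<forall>c\<in>rel_words n m. \<theta> c = \<eta> (ce_delta n m c)))"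

definition ce_class :: "nat \<Rightarrow> nat \<Rightarrow> (chain \<Rightarrow> real) \<Rightarrow> (chain \<Rightarrow> real) set" where
  "ce_class n m \<theta> = {\<theta>'. ce_cocycle n m \<theta>' \<and> ce_coboundary n m (\<lambda>c. \<theta>' c - \<theta> c)}"

text \<open>A superspace is a product \<open>'e \<times> 'o\<close> of its even and its odd part.\<close>

definition graded_part :: "bool \<Rightarrow> ('e::real_vector \<times> 'o::real_vector) set" where
  "graded_part p = {a. if p then fst a = 0 else snd a = 0}"

text \<open>\<open>twist p a\<close> is $(-1)^{p|a|} a$, extended linearly from homogeneous \<open>a\<close>.\<close>

definition twist :: "bool \<Rightarrow> 'e::real_vector \<times> 'o::real_vector \<Rightarrow> 'e \<times> 'o" where
  "twist p a = (fst a, sg p *\<^sub>R snd a)"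

locale dg_frobenius =
  fixes mul :: "'e::real_vector \<times> 'o::real_vector \<Rightarrow> 'e \<times> 'o \<Rightarrow> 'e \<times> 'o"
    and d :: "'e \<times> 'o \<Rightarrow> 'e \<times> 'o"
    and form :: "'e \<times> 'o \<Rightarrow> 'e \<times> 'o \<Rightarrow> real"
  assumes fin_dim: "\<exists>B. finite B \<and> span B = (UNIV :: ('e \<times> 'o) set)"
    and mul_bilinear: "bilinear mul"
    and mul_parity: "\<lbrakk>a \<in> graded_part p; b \<in> graded_part q\<rbrakk> \<Longrightarrow> mul a b \<in> graded_part (p \<noteq> q)"
    and mul_assoc: "mul (mul a b) c = mul a (mul b c)"
    and mul_comm: "\<lbrakk>a \<in> graded_part p; b \<in> graded_part q\<rbrakk> \<Longrightarrow> mul a b = sg (p \<and> q) *\<^sub>R mul b a"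
    and d_linear: "linear d"
    and d_odd: "a \<in> graded_part p \<Longrightarrow> d a \<in> graded_part (\<not> p)"
    and d_square: "d (d a) = 0"
    and d_mul: "a \<in> graded_part p \<Longrightarrow> d (mul a b) = mul (d a) b + sg p *\<^sub>R mul a (d b)"
    and form_bilinear: "bilinear form"
    and form_mul: "form (mul a b) c = form a (mul b c)"
    and form_d: "a \<in> graded_part p \<Longrightarrow> form (d a) b + sg p * form a (d b) = 0"

locale contractible_odd_frobenius = dg_frobenius +
  assumes contractible: "d a = 0 \<Longrightarrow> a \<in> range d"
    and form_odd: "\<lbrakk>a \<in> graded_part p; b \<in> graded_part p\<rbrakk> \<Longrightarrow> form a b = 0"
    and form_sym: "\<lbrakk>a \<in> graded_part p; b \<in> graded_part q\<rbrakk> \<Longrightarrow> form a b = sg (p \<and> q) * form b a"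
    and form_nondeg: "(\<And>b. form a b = 0) \<Longrightarrow> a = 0"

definition graded_subspace :: "('e::real_vector \<times> 'o::real_vector) set \<Rightarrow> bool" where
  "graded_subspace L \<longleftrightarrow> subspace L \<and> (\<forall>a\<in>L. (fst a, 0) \<in> L \<and> (0, snd a) \<in> L)"

definition isotropic ::
  "('e::real_vector \<times> 'o::real_vector \<Rightarrow> 'e \<times> 'o \<Rightarrow> real) \<Rightarrow> ('e \<times> 'o) set \<Rightarrow> bool" where
  "isotropic form L \<longleftrightarrow> graded_subspace L \<and> (\<forall>a\<in>L. \<forall>b\<in>L. form a b = 0)"

definition max_isotropic ::
  "('e::real_vector \<times> 'o::real_vector \<Rightarrow> 'e \<times> 'o \<Rightarrow> real) \<Rightarrow> ('e \<times> 'o) set \<Rightarrow> bool" where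
  "max_isotropic form L \<longleftrightarrow> isotropic form L \<and> (\<forall>K. isotropic form K \<longrightarrow> dim K \<le> dim L)"

definition isotropic_complement ::
  "('e::real_vector \<times> 'o::real_vector \<Rightarrow> 'e \<times> 'o) \<Rightarrow> ('e \<times> 'o \<Rightarrow> 'e \<times> 'o \<Rightarrow> real) \<Rightarrow>
     ('e \<times> 'o) set \<Rightarrow> bool" where
  "isotropic_complement d form L \<longleftrightarrow>
     max_isotropic form L \<and> L \<inter> range d = {0} \<and> {l + d a | l a. l \<in> L} = UNIV"

text \<open>An element \<open>u :: vix \<Rightarrow>\<^sub>0 'e \<times> 'o\<close> of $A \otimes V$ stands for $\sum_v u(v) \otimes e_v$, where $e_v$ is
  the basis of \<open>V\<close> dual to the coordinates.\<close>

definition tensV :: "nat \<Rightarrow> nat \<Rightarrow> ('e::real_vector \<times> 'o::real_vector) set \<Rightarrow> (vix \<Rightarrow>\<^sub>0 'e \<times> 'o) set"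
  where
  "tensV n m L = {u. Poly_Mapping.keys u \<subseteq> coordsV n m \<and> (\<forall>v. Poly_Mapping.lookup u v \<in> L)}"

definition tens_part :: "bool \<Rightarrow> (vix \<Rightarrow>\<^sub>0 'e::real_vector \<times> 'o::real_vector) set" where
  "tens_part p = {u. \<forall>v. Poly_Mapping.lookup u v \<in> graded_part (p \<noteq> odd_ix v)}"

definition form_d ::
  "('e::real_vector \<times> 'o::real_vector \<Rightarrow> 'e \<times> 'o) \<Rightarrow> ('e \<times> 'o \<Rightarrow> 'e \<times> 'o \<Rightarrow> real) \<Rightarrow>
     'e \<times> 'o \<Rightarrow> 'e \<times> 'o \<Rightarrow> real" where
  "form_d d form a b = form (twist True a) (d b)"

definition form_tilde ::
  "('e::real_vector \<times> 'o::real_vector \<Rightarrow> 'e \<times> 'o) \<Rightarrow> ('e \<times> 'o \<Rightarrow> 'e \<times> 'o \<Rightarrow> real) \<Rightarrow> nat \<Rightarrow> nat \<Rightarrow>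
     (vix \<Rightarrow>\<^sub>0 'e \<times> 'o) \<Rightarrow> (vix \<Rightarrow>\<^sub>0 'e \<times> 'o) \<Rightarrow> real" where
  "form_tilde d form n m u u' = (\<Sum>v\<in>coordsV n m. \<Sum>v'\<in>coordsV n m.
     form_d d form (Poly_Mapping.lookup u v) (twist (odd_ix v) (Poly_Mapping.lookup u' v')) *
     formV n m v v')"

definition mtilde ::
  "('a \<Rightarrow> 'a \<Rightarrow> 'a) \<Rightarrow> ('a \<Rightarrow> 'a \<Rightarrow> real) \<Rightarrow> 'a list \<Rightarrow> real" where
  "mtilde mul form as = form (foldl mul (hd as) (tl (butlast as))) (last as)"

text \<open>The tensor $\tilde m_k \otimes x$, for \<open>x = w\<^sub>0 \<otimes> \<dots> \<otimes> w\<^sub>k\<close>, as a functional on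
  $(A \otimes V)^{\otimes k+1}$. Reshuffling moves the factor in $A^*$ with index \<open>i\<close> past
  \<open>w\<^sub>0, \<dots>, w\<^bsub>i-1\<^esub>\<close>; that factor only sees the component of its argument of the same parity, so the
  sign can be put on the argument. Words of length less than 2 do not occur.\<close>

definition psi_tensor ::
  "('e::real_vector \<times> 'o::real_vector \<Rightarrow> 'e \<times> 'o \<Rightarrow> 'e \<times> 'o) \<Rightarrow> ('e \<times> 'o \<Rightarrow> 'e \<times> 'o \<Rightarrow> real) \<Rightarrow>
     vix list \<Rightarrow> (vix \<Rightarrow>\<^sub>0 'e \<times> 'o) list \<Rightarrow> real" where
  "psi_tensor mul form w us = (if length w < 2 then 0 else
     mtilde mul form
       (map (\<lambda>i. twist (odd_word (take i w)) (Poly_Mapping.lookup (us ! i) (w ! i))) [0..<length w]))"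

text \<open>Coordinates \<open>Ev i\<close> (even) and \<open>Od j\<close> (odd) on a subspace \<open>X\<close> of $A \otimes V$, dual to a basis
  \<open>b\<close>. \<open>restr C b k T\<close> is the image in $S^k(X^*)$ of the restriction to \<open>X\<close> of the multilinear
  functional \<open>T\<close>.\<close>

datatype cix = Ev nat | Od nat

instantiation cix :: super_index
begin
fun odd_ix_cix :: "cix \<Rightarrow> bool" where
  "odd_ix_cix (Ev i) = False"
| "odd_ix_cix (Od j) = True"
instance ..
end

definition restr :: "cix set \<Rightarrow> (cix \<Rightarrow> 'u) \<Rightarrow> nat \<Rightarrow> ('u list \<Rightarrow> real) \<Rightarrow> cix spoly" where
  "restr C b k T = (\<Sum>cs | length cs = k \<and> set cs \<subseteq> C. T (map b cs) *\<^sub>R mon cs)"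

definition Psi ::
  "('e::real_vector \<times> 'o::real_vector \<Rightarrow> 'e \<times> 'o \<Rightarrow> 'e \<times> 'o) \<Rightarrow> ('e \<times> 'o \<Rightarrow> 'e \<times> 'o \<Rightarrow> real) \<Rightarrow>
     cix set \<Rightarrow> (cix \<Rightarrow> vix \<Rightarrow>\<^sub>0 'e \<times> 'o) \<Rightarrow> vix spoly \<Rightarrow> cix spoly" where
  "Psi mul form C b = induced (\<lambda>w. restr C b (length w) (psi_tensor mul form w))"

text \<open>$\tilde\sigma$ restricted to the span of the \<open>b c\<close>, \<open>c \<in> C\<close>; the factor 1/2 comes from $\pi_2$.\<close>

definition sigma ::
  "('e::real_vector \<times> 'o::real_vector \<Rightarrow> 'e \<times> 'o) \<Rightarrow> ('e \<times> 'o \<Rightarrow> 'e \<times> 'o \<Rightarrow> real) \<Rightarrow> nat \<Rightarrow> nat \<Rightarrow>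
     cix set \<Rightarrow> (cix \<Rightarrow> vix \<Rightarrow>\<^sub>0 'e \<times> 'o) \<Rightarrow> cix spoly" where
  "sigma d form n m C b =
     (1/2) *\<^sub>R restr C b 2 (\<lambda>us. form_tilde d form n m (us ! 0) (us ! 1))"

abbreviation evs :: "nat \<Rightarrow> cix set" where "evs N \<equiv> Ev ` {..<N}"
abbreviation ods :: "nat \<Rightarrow> cix set" where "ods M \<equiv> Od ` {..<M}"

text \<open>Linear coordinates identifying $L \otimes V$ with $\mathbb{R}^{N|M}$ in which the even part of the
  exponent $-\tilde\sigma$ is $-\frac12(\sum_{i<k} x_i^2 - \sum_{k\le i<N} x_i^2)$.\<close>

definition adapted_coords ::
  "('e::real_vector \<times> 'o::real_vector \<Rightarrow> 'e \<times> 'o) \<Rightarrow> ('e \<times> 'o \<Rightarrow> 'e \<times> 'o \<Rightarrow> real) \<Rightarrow> nat \<Rightarrow> nat \<Rightarrow>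
     ('e \<times> 'o) set \<Rightarrow> nat \<Rightarrow> nat \<Rightarrow> nat \<Rightarrow> (cix \<Rightarrow> vix \<Rightarrow>\<^sub>0 'e \<times> 'o) \<Rightarrow> bool" where
  "adapted_coords d form n m L N M k b \<longleftrightarrow>
     inj_on b (evs N \<union> ods M) \<and> independent (b ` (evs N \<union> ods M)) \<and>
     span (b ` (evs N \<union> ods M)) = tensV n m L \<and>
     b ` evs N \<subseteq> tens_part False \<and> b ` ods M \<subseteq> tens_part True \<and>
     k \<le> N \<and>
     sigma d form n m (evs N) b =
       (1/2) *\<^sub>R ((\<Sum>i<k. mon [Ev i, Ev i]) - (\<Sum>i\<in>{k..<N}. mon [Ev i, Ev i]))"

text \<open>Berezin integral over the odd coordinates, with the convention
  $\int \xi_0 \cdots \xi_{M-1} = 1$, evaluated at the even point \<open>x\<close>. The overall sign convention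
  cancels in the quotient defining the functional.\<close>

definition berezin :: "nat \<Rightarrow> cix spoly \<Rightarrow> (nat \<Rightarrow> real) \<Rightarrow> real" where
  "berezin M f x = induced (\<lambda>w.
     let js = [j. Od j \<leftarrow> w]
     in if distinct js \<and> set js = {..<M}
        then (-1) ^ card {(r, s). r < s \<and> s < length js \<and> js ! s < js ! r} *
          prod_list [x i. Ev i \<leftarrow> w]
        else 0) f"

definition gauss_integral :: "nat \<Rightarrow> nat \<Rightarrow> ((nat \<Rightarrow> real) \<Rightarrow> real) \<Rightarrow> real \<Rightarrow> real" where
  "gauss_integral N k F t = (LINT x | PiM {..<N} (\<lambda>_. lborel).
     F x * exp (- (1/2) * ((\<Sum>i<k. (x i)\<^sup>2) + (\<Sum>i\<in>{k..<N}. (t * x i)\<^sup>2))))"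

definition wick_integral :: "nat \<Rightarrow> nat \<Rightarrow> ((nat \<Rightarrow> real) \<Rightarrow> real) \<Rightarrow> complex" where
  "wick_integral N k F =
     (SOME G. G holomorphic_on (- {0}) \<and>
        (\<forall>t>0. G (of_real t) = of_real (gauss_integral N k F t))) \<i>"

text \<open>$\int_{L \otimes V} f e^{-\tilde\sigma}$ in adapted coordinates. As the form defining
  $\tilde\sigma$ is even, $\tilde\sigma$ is the sum of its restrictions to the even and to the odd
  coordinates. The exponential of the former is the Gaussian factor in \<^const>\<open>gauss_integral\<close>; the
  exponential series of the latter stops because a product of more than \<open>M\<close> odd coordinates is 0.\<close>

definition super_integral ::
  "('e::real_vector \<times> 'o::real_vector \<Rightarrow> 'e \<times> 'o) \<Rightarrow> ('e \<times> 'o \<Rightarrow> 'e \<times> 'o \<Rightarrow> real) \<Rightarrow> nat \<Rightarrow> nat \<Rightarrow>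
     nat \<Rightarrow> nat \<Rightarrow> nat \<Rightarrow> (cix \<Rightarrow> vix \<Rightarrow>\<^sub>0 'e \<times> 'o) \<Rightarrow> cix spoly \<Rightarrow> complex" where
  "super_integral d form n m N M k b f = wick_integral N k
     (berezin M (f * (\<Sum>r\<le>M. (1 / fact r) *\<^sub>R (- sigma d form n m (ods M) b) ^ r)))"

text \<open>The value on \<open>h\<^sub>1 \<and> \<dots> \<and> h\<^sub>l\<close>. The quotient is real (each Wick-rotated direction contributes an
  even power of \<open>\<i>\<close> relative to the denominator) and independent of the coordinates chosen.\<close>

definition SAL_word ::
  "('e::real_vector \<times> 'o::real_vector \<Rightarrow> 'e \<times> 'o \<Rightarrow> 'e \<times> 'o) \<Rightarrow> ('e \<times> 'o \<Rightarrow> 'e \<times> 'o) \<Rightarrow>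
     ('e \<times> 'o \<Rightarrow> 'e \<times> 'o \<Rightarrow> real) \<Rightarrow> nat \<Rightarrow> nat \<Rightarrow> ('e \<times> 'o) set \<Rightarrow> vix spoly list \<Rightarrow> real" where
  "SAL_word mul d form n m L hs =
     (let (N, M, k, b) = (SOME (N, M, k, b). adapted_coords d form n m L N M k b);
          p = (\<Sum>i<length hs. (length hs - 1 - i) * of_bool (parity (hs ! i)))
      in (-1) ^ p * Re
        (super_integral d form n m N M k b (prod_list (map (Psi mul form (evs N \<union> ods M) b) hs)) /
         super_integral d form n m N M k b 1))"

definition SAL ::
  "('e::real_vector \<times> 'o::real_vector \<Rightarrow> 'e \<times> 'o \<Rightarrow> 'e \<times> 'o) \<Rightarrow> ('e \<times> 'o \<Rightarrow> 'e \<times> 'o) \<Rightarrow>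
     ('e \<times> 'o \<Rightarrow> 'e \<times> 'o \<Rightarrow> real) \<Rightarrow> nat \<Rightarrow> nat \<Rightarrow> ('e \<times> 'o) set \<Rightarrow> chain \<Rightarrow> real" where
  "SAL mul d form n m L = lin_ext (SAL_word mul d form n m L)"

end

(* The normalised Gaussian integral over L tensor V is the Wick functional E_s on polynomial functions
   on A tensor V whose propagator is s tensor the inverse of the symplectic form, where s is the
   contracting homotopy of (A, d) with image L: both satisfy the same Schwinger-Dyson recursion.
   The differential d induces an odd derivation Q, and the scalar product an odd second order operator
   Delta. Since d s + s d = 1, E_s Q = E_s Delta. On products of superfields Psi(h) the derivation Q
   vanishes, while Delta vanishes on each factor and pairs two factors into the Psi of their Poisson
   bracket, so Delta computes the Chevalley-Eilenberg differential and E_s Psi is a cocycle.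
   Two homotopies s, s' are joined by a segment s_t; as d (s s') - (s s') d = s' - s, the derivative
   of E_(s_t) is E_(s_t) composed with the commutator of Q and the operator with propagator s s',
   and integrating over t gives a primitive of the difference. *)

theory Submission
  imports Defs "HOL-Probability.Distributions"
begin

text \<open>The functionals are compared on all of A tensor V because L then enters only through the
  propagator, and different L share one polynomial algebra. The price is a degenerate propagator
  without a Gaussian density, so a Wick functional is specified by its recursion, which fixes it up
  to its value at 1. Restriction to L tensor V followed by integration obeys that recursion and is
  therefore a multiple of E_s; normalising removes the multiple once it is known to be nonzero.

  Superfields need a family closed under differentiation. A need not have a unit, and the tensors
  m_k end in a scalar product instead of a product, so A is enlarged by a unit and a top element
  tau. Then m_k is the trace of a product, differentiating Psi(h) inserts a basis element into that
  trace, and the sum over dual bases glues two traces into one. Gluing fails on constant terms,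
  which is why degrees are tracked.

  The scalar product of A is odd, so Psi reverses parity. This shift turns supercommuting factors
  into wedge factors, and nearly all sign computations are finite case splits on parities. An entry
  of the wrong parity is zero, which is why so many of them begin by asking whether a coefficient
  vanishes.\<close>

lemma sg_simps [simp]: "sg False = 1" "sg True = -1" "sg p * sg p = 1" "sg p * (sg p * x) = x"
  "sg (\<not> p) = - sg p"
  by (simp_all add: sg_def)

lemma sg_and_neq: "sg (p \<and> a = (\<not> b)) = sg (p \<and> a) * sg (p \<and> b)"
  by (auto simp: sg_def)

section \<open>Linear maps on tensors and on the symmetric algebra\<close>

lemma lin_ext_superset:
  assumes "finite A" "Poly_Mapping.keys x \<subseteq> A"
  shows "lin_ext F x = (\<Sum>w\<in>A. Poly_Mapping.lookup x w *\<^sub>R F w)"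
  unfolding lin_ext_def using assms
  by (intro sum.mono_neutral_left) (auto simp: in_keys_iff)

lemma linear_lin_ext [simp]: "linear (lin_ext F)"
proof (rule linearI)
  fix x y :: "'a \<Rightarrow>\<^sub>0 real" and c :: real
  let ?A = "Poly_Mapping.keys x \<union> Poly_Mapping.keys y"
  have "Poly_Mapping.keys (x + y) \<subseteq> ?A" by (rule Poly_Mapping.keys_add)
  then show "lin_ext F (x + y) = lin_ext F x + lin_ext F y"
    using lin_ext_superset[of ?A "x + y" F] lin_ext_superset[of ?A x F] lin_ext_superset[of ?A y F]
    by (simp add: lookup_add scaleR_add_left sum.distrib)
  have "Poly_Mapping.keys (c *\<^sub>R x) \<subseteq> Poly_Mapping.keys x"
    by (auto simp: in_keys_iff scaleR_poly_mapping.rep_eq)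
  then show "lin_ext F (c *\<^sub>R x) = c *\<^sub>R lin_ext F x"
    using lin_ext_superset[of "Poly_Mapping.keys x" "c *\<^sub>R x" F]
    by (simp add: lin_ext_def scaleR_poly_mapping.rep_eq scaleR_sum_right)
qed

lemma lin_ext_single [simp]: "lin_ext F (Poly_Mapping.single w c) = c *\<^sub>R F w"
  using lin_ext_superset[of "{w}" "Poly_Mapping.single w c" F] by simp

text \<open>The well-definedness condition behind \<open>induced\<close>: a linear extension kills
  the generators of \<open>sym_rel\<close> exactly when it has this symmetry, and only then is the
  choice of a representative immaterial.\<close>

definition koszul_sym :: "('v::super_index list \<Rightarrow> 'b::real_vector) \<Rightarrow> bool" where
  "koszul_sym F \<longleftrightarrow> (\<forall>us v w vs. F (us @ [v, w] @ vs) =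
     sg (odd_ix v \<and> odd_ix w) *\<^sub>R F (us @ [w, v] @ vs))"

lemma koszul_symI:
  assumes "\<And>us v w vs. F (us @ v # w # vs) = sg (odd_ix v \<and> odd_ix w) *\<^sub>R F (us @ w # v # vs)"
  shows "koszul_sym F"
  unfolding koszul_sym_def append_Cons append_Nil using assms by blast

lemma lin_ext_sym_rel:
  assumes "koszul_sym F" "r \<in> sym_rel"
  shows "lin_ext F r = 0"
  using assms(2) unfolding sym_rel_def
proof (induction rule: span_induct_alt)
  case base
  show ?case by (simp add: linear_0)
next
  case (step c x y)
  then obtain us v w vs where x: "x = Poly_Mapping.single (us @ [v, w] @ vs) 1
      - sg (odd_ix v \<and> odd_ix w) *\<^sub>R Poly_Mapping.single (us @ [w, v] @ vs) 1"
    by blast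
  have "lin_ext F x = 0"
    unfolding x linear_diff[OF linear_lin_ext] linear_scale[OF linear_lin_ext] lin_ext_single
    using assms(1)[unfolded koszul_sym_def, rule_format, of us v w vs] by simp
  with step show ?case by (simp add: linear_add linear_scale)
qed

lemma rep_abs_spoly: "rep_spoly (abs_spoly x) - x \<in> sym_rel"
proof -
  have "abs_spoly (rep_spoly (abs_spoly x)) = abs_spoly x"
    by (rule Quotient3_abs_rep[OF Quotient3_spoly])
  then show ?thesis by (simp add: spoly.abs_eq_iff)
qed

lemma induced_abs:
  assumes "koszul_sym F"
  shows "induced F (abs_spoly x) = lin_ext F x"
  using lin_ext_sym_rel[OF assms rep_abs_spoly[of x]]
  by (simp add: induced_def linear_diff)

lemma abs_spoly_exhaust: obtains x where "f = abs_spoly x"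
  using Quotient3_abs_rep[OF Quotient3_spoly, of f] by metis

lemma linear_induced:
  assumes "koszul_sym F"
  shows "linear (induced F)"
proof (rule linearI)
  fix f g :: "'a spoly" and c :: real
  obtain x y where fg: "f = abs_spoly x" "g = abs_spoly y"
    by (metis abs_spoly_exhaust)
  show "induced F (f + g) = induced F f + induced F g" "induced F (c *\<^sub>R f) = c *\<^sub>R induced F f"
    by (simp_all add: fg induced_abs[OF assms] plus_spoly.abs_eq scaleR_spoly.abs_eq
        linear_add[OF linear_lin_ext] linear_scale[OF linear_lin_ext])
qed

lemma induced_mon: "koszul_sym F \<Longrightarrow> induced F (mon w) = F w"
  by (simp add: mon_def induced_abs)

lemma mon_append: "mon (u @ w) = mon u * mon w"
  by (simp add: mon_def times_spoly.abs_eq mult_single plus_list_def)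

lemma mon_Nil [simp]: "mon [] = 1"
  by (simp add: mon_def one_spoly.abs_eq single_one flip: zero_list_def)

lemma mon_Cons: "mon (v # w) = mon [v] * mon w"
  using mon_append[of "[v]" w] by simp

lemma mon_swap: "mon [v, w] = sg (odd_ix v \<and> odd_ix w) *\<^sub>R mon [w, v]"
proof -
  have "Poly_Mapping.single ([] @ [v, w] @ []) 1
      - sg (odd_ix v \<and> odd_ix w) *\<^sub>R Poly_Mapping.single ([] @ [w, v] @ []) 1 \<in> sym_rel"
    unfolding sym_rel_def by (rule span_base) blast
  then show ?thesis
    unfolding mon_def scaleR_spoly.abs_eq by (simp add: spoly.abs_eq_iff)
qed

lemma koszul_sym_mon: "koszul_sym mon"
  unfolding koszul_sym_def
proof (intro allI)
  fix us vs and v w :: 'a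
  show "mon (us @ [v, w] @ vs) = sg (odd_ix v \<and> odd_ix w) *\<^sub>R mon (us @ [w, v] @ vs)"
    unfolding mon_append by (subst mon_swap) simp
qed

lemma spoly_induct [case_names zero add]:
  assumes "Pr 0" and "\<And>c w f. Pr f \<Longrightarrow> Pr (c *\<^sub>R mon w + f)"
  shows "Pr (f :: 'v::super_index spoly)"
proof -
  obtain x where f: "f = abs_spoly x" by (rule abs_spoly_exhaust)
  have "Pr (abs_spoly x)"
  proof (induction x rule: poly_mapping_single_induct)
    case zero
    then show ?case using assms(1) by (simp add: zero_spoly_def)
  next
    case (add k v x)
    have "abs_spoly (Poly_Mapping.single k v + x) = v *\<^sub>R mon k + abs_spoly x"
      by (simp add: mon_def scaleR_spoly.abs_eq scaleR_single_eq plus_spoly.abs_eq)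
    with assms(2)[OF add] show ?case by simp
  qed
  then show ?thesis by (simp add: f)
qed

lemma linear_eq_mon:
  assumes "linear A" "linear B" "\<And>w. A (mon w) = B (mon w)"
  shows "A f = B f"
  by (induction f rule: spoly_induct) (use assms in \<open>auto simp: linear_0 linear_add linear_scale\<close>)

text \<open>Suited to operator identities: derivations and differential operators are known by how
  they commute with multiplication by one generator.\<close>

lemma linear_eq_gen:
  assumes "linear A" "linear B" "A 1 = B 1"
    and "\<And>i f. A f = B f \<Longrightarrow> A (mon [i] * f) = B (mon [i] * f)"
  shows "A f = B f"
proof (rule linear_eq_mon[OF assms(1,2)])
  fix w :: "'a list"
  show "A (mon w) = B (mon w)"
  proof (induction w)
    case (Cons v w)
    show ?case unfolding mon_Cons[of v w] by (rule assms(4)[OF Cons])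
  qed (simp add: assms(3))
qed

lemma linear_mult_l: "linear F \<Longrightarrow> linear (\<lambda>f. a * F f)" for a :: "'v::super_index spoly"
  by (intro linearI) (auto simp: linear_add linear_scale distrib_left)

lemma linear_mult_r: "linear F \<Longrightarrow> linear (\<lambda>f. F f * a)" for a :: "'v::super_index spoly"
  by (intro linearI) (auto simp: linear_add linear_scale distrib_right)

lemma linear_scaleR_compose: "linear F \<Longrightarrow> linear (\<lambda>f. c *\<^sub>R F f)"
  by (intro linearI) (auto simp: linear_add linear_scale scaleR_add_right)

lemma linear_add_compose: "linear F \<Longrightarrow> linear G \<Longrightarrow> linear (\<lambda>f. F f + G f)"
  by (intro linearI) (auto simp: linear_add linear_scale scaleR_add_right)

lemma linear_diff_compose: "linear F \<Longrightarrow> linear G \<Longrightarrow> linear (\<lambda>f. F f - G f)"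
  by (intro linearI) (auto simp: linear_add linear_scale algebra_simps)

lemma linear_sum_compose: "(\<And>i. i \<in> I \<Longrightarrow> linear (F i)) \<Longrightarrow> linear (\<lambda>f. \<Sum>i\<in>I. F i f)"
  by (intro linearI) (auto simp: linear_add linear_scale sum.distrib scaleR_sum_right)

lemma linear_fun_comp: "linear F \<Longrightarrow> linear G \<Longrightarrow> linear (\<lambda>f. F (G f))"
  by (intro linearI) (auto simp: linear_add linear_scale)

lemma linear_ident': "linear (\<lambda>f. f)"
  by (rule linearI) auto

lemma linear_real_mult: "linear F \<Longrightarrow> linear (\<lambda>f. (c::real) * F f)"
  using linear_scaleR_compose[of F c] by simp

named_theorems linear_intros
lemmas [linear_intros] = linear_mult_l linear_mult_r linear_scaleR_compose linear_add_compose
  linear_diff_compose linear_sum_compose linear_ident' linear_real_mult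

subsection \<open>Parity\<close>

lemma odd_word_simps [simp]: "odd_word [] = False" "odd_word (v # w) = (odd_ix v \<noteq> odd_word w)"
  "odd_word (u @ w) = (odd_word u \<noteq> odd_word w)"
  by (auto simp: odd_word_def)

lemma subspace_homog [simp]: "subspace (homog p)"
  by (simp add: homog_def)

lemma homog_mon: "odd_word w = p \<Longrightarrow> mon w \<in> homog p"
  unfolding homog_def by (rule span_base) blast

lemma homog_mon1 [simp]: "mon [v] \<in> homog (odd_ix v)"
  by (rule homog_mon) simp

lemma homog_one: "1 \<in> homog False"
  using homog_mon[of "[]" False] by simp

lemma homog_simps [simp]: "0 \<in> homog p"
  "a \<in> homog p \<Longrightarrow> b \<in> homog p \<Longrightarrow> a + b \<in> homog p"
  "a \<in> homog p \<Longrightarrow> b \<in> homog p \<Longrightarrow> a - b \<in> homog p"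
  "a \<in> homog p \<Longrightarrow> c *\<^sub>R a \<in> homog p"
  "a \<in> homog p \<Longrightarrow> - a \<in> homog p"
  by (simp_all add: subspace_0 subspace_add subspace_scale subspace_diff subspace_neg)

lemma homog_sum: "(\<And>i. i \<in> I \<Longrightarrow> F i \<in> homog p) \<Longrightarrow> sum F I \<in> homog p"
  by (rule subspace_sum[OF subspace_homog])

lemma homog_induct [consumes 1, case_names zero add]:
  assumes "f \<in> homog p" "Pr 0"
    "\<And>c w g. odd_word w = p \<Longrightarrow> g \<in> homog p \<Longrightarrow> Pr g \<Longrightarrow> Pr (c *\<^sub>R mon w + g)"
  shows "Pr f"
proof -
  have "f \<in> homog p \<and> Pr f"
    using assms(1) unfolding homog_def
  proof (induction rule: span_induct_alt)
    case base
    then show ?case using assms(2) by (simp add: span_0)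
  next
    case (step c x y)
    then obtain w where w: "x = mon w" "odd_word w = p" by blast
    have "c *\<^sub>R x + y \<in> homog p"
      using step w(2) homog_mon[of w p] unfolding w(1) by (intro homog_simps) (auto simp: homog_def)
    with step w assms(3)[of w y c] show ?case by (simp add: homog_def)
  qed
  then show ?thesis by simp
qed

lemma homog_mult:
  assumes "f \<in> homog p" "g \<in> homog q"
  shows "f * g \<in> homog (p \<noteq> q)"
  using assms(1)
proof (induction rule: homog_induct)
  case (add c w f)
  have "mon w * g \<in> homog (p \<noteq> q)"
    using assms(2)
    by (induction rule: homog_induct)
      (use add in \<open>auto simp: distrib_left simp flip: mon_append intro!: homog_mon homog_simps\<close>)
  then show ?case using add by (simp add: distrib_right)
qed simp

lemma mon1_commute: "mon [v] * mon w = sg (odd_ix v \<and> odd_word w) *\<^sub>R (mon w * mon [v])"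
proof (induction w)
  case (Cons u w)
  have "mon [v] * mon (u # w) = (mon [v, u]) * mon w"
    by (simp add: mon_Cons[of u w] mult.assoc mon_Cons[of v "[u]"])
  also have "\<dots> = sg (odd_ix v \<and> odd_ix u) *\<^sub>R (mon [u] * (mon [v] * mon w))"
    by (subst mon_swap) (simp add: mult.assoc mon_Cons[of u "[v]"])
  also have "\<dots> = (sg (odd_ix v \<and> odd_ix u) * sg (odd_ix v \<and> odd_word w)) *\<^sub>R (mon (u # w) * mon [v])"
    by (simp add: Cons mult.assoc mon_Cons[of u w])
  also have "sg (odd_ix v \<and> odd_ix u) * sg (odd_ix v \<and> odd_word w) = sg (odd_ix v \<and> odd_word (u # w))"
    by (auto simp: sg_def)
  finally show ?case .
qed simp

lemma mon_commute: "mon u * mon w = sg (odd_word u \<and> odd_word w) *\<^sub>R (mon w * mon u)"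
proof (induction u)
  case (Cons v u)
  have "mon (v # u) * mon w = sg (odd_word u \<and> odd_word w) *\<^sub>R (mon [v] * mon w * mon u)"
    by (simp add: mon_Cons[of v u] Cons mult.assoc)
  also have "\<dots> = (sg (odd_word u \<and> odd_word w) * sg (odd_ix v \<and> odd_word w)) *\<^sub>R (mon w * mon (v # u))"
    by (subst mon1_commute) (simp add: mon_Cons[of v u] mult.assoc)
  also have "sg (odd_word u \<and> odd_word w) * sg (odd_ix v \<and> odd_word w) = sg (odd_word (v # u) \<and> odd_word w)"
    by (auto simp: sg_def)
  finally show ?case .
qed simp

lemma supercommute:
  assumes "f \<in> homog p" "g \<in> homog q"
  shows "f * g = sg (p \<and> q) *\<^sub>R (g * f)"
  using assms(1)
proof (induction rule: homog_induct)
  case (add c w f)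
  have "mon w * g = sg (p \<and> q) *\<^sub>R (g * mon w)"
    using assms(2)
    by (induction rule: homog_induct)
      (use add mon_commute[of w] in \<open>auto simp: distrib_left distrib_right scaleR_add_right\<close>)
  then show ?case using add by (simp add: distrib_right distrib_left scaleR_add_right)
qed simp

lemma koszul_sym_parity_if: "koszul_sym (\<lambda>w. if odd_word w = p then mon w else 0)"
proof (rule koszul_symI)
  fix us v w vs
  show "(if odd_word (us @ v # w # vs) = p then mon (us @ v # w # vs) else (0::'a spoly)) =
    sg (odd_ix v \<and> odd_ix w) *\<^sub>R (if odd_word (us @ w # v # vs) = p then mon (us @ w # v # vs) else 0)"
    using koszul_sym_mon[unfolded koszul_sym_def, rule_format, of us v w vs] by auto
qed

lemma linear_component [simp]: "linear (component p)"
  unfolding component_def by (rule linear_induced[OF koszul_sym_parity_if])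

lemma component_homog: "f \<in> homog q \<Longrightarrow> component p f = (if p = q then f else 0)"
proof (induction rule: homog_induct)
  case (add c w g)
  then show ?case
    using induced_mon[OF koszul_sym_parity_if, of p w]
    by (simp add: linear_add[OF linear_component] linear_scale[OF linear_component]
        flip: component_def)
qed (simp add: linear_0)

lemma homog_cong: "f \<in> homog p \<Longrightarrow> p = q \<Longrightarrow> f \<in> homog q"
  by simp

text \<open>\<open>homog\<close> is only a span of monomials; the two projections
  \<open>component\<close> show that the even and the odd span meet in 0.\<close>

lemma homog_both: "f \<in> homog False \<Longrightarrow> f \<in> homog True \<Longrightarrow> f = 0"
  using component_homog[of f False True] component_homog[of f True True] by simp

lemma parity_homog: "f \<in> homog p \<Longrightarrow> f \<noteq> 0 \<Longrightarrow> parity f = p"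
  unfolding parity_def using homog_both by (cases p) auto

subsection \<open>Derivations\<close>

text \<open>The sum over positions in \<open>deriv_ext\<close>, reorganised as the Leibniz rule for
  a leading letter, which is the form that inductions on words need.\<close>

fun deriv_word :: "bool \<Rightarrow> ('v::super_index \<Rightarrow> 'v spoly) \<Rightarrow> 'v list \<Rightarrow> 'v spoly" where
  "deriv_word p \<phi> [] = 0"
| "deriv_word p \<phi> (v # w) = \<phi> v * mon w + sg (p \<and> odd_ix v) *\<^sub>R (mon [v] * deriv_word p \<phi> w)"

lemma deriv_word_eq: "(\<Sum>i<length w.
     sg (p \<and> odd_word (take i w)) *\<^sub>R (mon (take i w) * \<phi> (w ! i) * mon (drop (Suc i) w))) =
   deriv_word p \<phi> w"
proof (induction w)
  case (Cons v w)
  show ?case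
    by (simp add: sum.lessThan_Suc_shift mon_Cons[of v "take _ _"] sg_and_neq mult.assoc sum_distrib_left scaleR_sum_right
        flip: Cons del: sum.lessThan_Suc)
qed simp

lemma deriv_word_append: "deriv_word p \<phi> (u @ w) =
    deriv_word p \<phi> u * mon w + sg (p \<and> odd_word u) *\<^sub>R (mon u * deriv_word p \<phi> w)"
proof (induction u)
  case (Cons v u)
  show ?case
    by (simp add: Cons mon_append mon_Cons[of v u] sg_and_neq algebra_simps)
qed simp

definition super_vf :: "bool \<Rightarrow> ('v::super_index \<Rightarrow> 'v spoly) \<Rightarrow> bool" where
  "super_vf p \<phi> \<longleftrightarrow> (\<forall>v. \<phi> v \<in> homog (p \<noteq> odd_ix v))"

text \<open>The Leibniz rule for concatenation reduces the claim to two letters. There \<phi> v has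
  parity p + |v|, so it can be moved past the other letter, and the two terms for v w become those
  for w v.\<close>

lemma koszul_sym_deriv_word:
  assumes "super_vf p \<phi>"
  shows "koszul_sym (deriv_word p \<phi>)"
  unfolding koszul_sym_def
proof (intro allI)
  fix us vs and v w :: 'a
  have c: "mon [v] * \<phi> w = sg (odd_ix v \<and> (p \<noteq> odd_ix w)) *\<^sub>R (\<phi> w * mon [v])" for v w
    by (rule supercommute) (use assms in \<open>auto simp: super_vf_def\<close>)
  have sw: "deriv_word p \<phi> [v, w] = sg (odd_ix v \<and> odd_ix w) *\<^sub>R deriv_word p \<phi> [w, v]"
    by (simp add: c[of v w] c[of w v] scaleR_add_right)
       (cases "odd_ix v"; cases "odd_ix w"; cases p; simp)
  show "deriv_word p \<phi> (us @ [v, w] @ vs) = sg (odd_ix v \<and> odd_ix w) *\<^sub>R deriv_word p \<phi> (us @ [w, v] @ vs)"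
    unfolding deriv_word_append sw mon_append mon_swap[of v w] odd_word_simps
    by (simp add: algebra_simps eq_commute[of "odd_ix v" "\<not> odd_ix w"])
      (cases "odd_ix v"; cases "odd_ix w"; simp)
qed

lemma deriv_ext_def': "deriv_ext p \<phi> = induced (deriv_word p \<phi>)"
  unfolding deriv_ext_def by (simp add: deriv_word_eq cong: arg_cong[where f=induced])

lemma linear_deriv [linear_intros]: "super_vf p \<phi> \<Longrightarrow> linear (deriv_ext p \<phi>)"
  unfolding deriv_ext_def' by (intro linear_induced koszul_sym_deriv_word)

lemma linear_deriv_comp [linear_intros]:
  "super_vf p \<phi> \<Longrightarrow> linear F \<Longrightarrow> linear (\<lambda>f. deriv_ext p \<phi> (F f))"
  by (rule linear_fun_comp[OF linear_deriv])

lemma deriv_mon: "super_vf p \<phi> \<Longrightarrow> deriv_ext p \<phi> (mon w) = deriv_word p \<phi> w"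
  unfolding deriv_ext_def' by (intro induced_mon koszul_sym_deriv_word)

lemma deriv_gen [simp]: "super_vf p \<phi> \<Longrightarrow> deriv_ext p \<phi> (mon [v]) = \<phi> v"
  by (simp add: deriv_mon)

lemma deriv_one [simp]: "super_vf p \<phi> \<Longrightarrow> deriv_ext p \<phi> 1 = 0"
  using deriv_mon[of p \<phi> "[]"] by simp

lemma deriv_mult:
  assumes "super_vf p \<phi>" "f \<in> homog q"
  shows "deriv_ext p \<phi> (f * g) = deriv_ext p \<phi> f * g + sg (p \<and> q) *\<^sub>R (f * deriv_ext p \<phi> g)"
  using assms(2)
proof (induction rule: homog_induct)
  case zero
  then show ?case using linear_deriv[OF assms(1)] by (simp add: linear_0)
next
  case (add c w f)
  note L = linear_deriv[OF assms(1)]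
  have "deriv_ext p \<phi> (mon w * g) = deriv_ext p \<phi> (mon w) * g + sg (p \<and> q) *\<^sub>R (mon w * deriv_ext p \<phi> g)"
  proof (rule linear_eq_mon[where f=g])
    fix u
    show "deriv_ext p \<phi> (mon w * mon u) = deriv_ext p \<phi> (mon w) * mon u + sg (p \<and> q) *\<^sub>R (mon w * deriv_ext p \<phi> (mon u))"
      using add deriv_word_append[of p \<phi> w u] by (simp add: deriv_mon[OF assms(1)] flip: mon_append)
  qed (intro linear_intros L assms(1))+
  then show ?case using add by (simp add: linear_add[OF L] linear_scale[OF L] algebra_simps)
qed

lemma deriv_mult_gen:
  assumes "super_vf p \<phi>"
  shows "deriv_ext p \<phi> (mon [v] * g) = \<phi> v * g + sg (p \<and> odd_ix v) *\<^sub>R (mon [v] * deriv_ext p \<phi> g)"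
  using deriv_mult[OF assms homog_mon1] by (simp add: assms)

lemma deriv_homog:
  assumes "super_vf p \<phi>" "f \<in> homog q"
  shows "deriv_ext p \<phi> f \<in> homog (p \<noteq> q)"
  using assms(2)
proof (induction rule: homog_induct)
  case zero
  then show ?case using linear_deriv[OF assms(1)] by (simp add: linear_0)
next
  case (add c w f)
  have "deriv_word p \<phi> w \<in> homog (p \<noteq> odd_word w)" for w
  proof (induction w)
    case (Cons v w)
    have 1: "\<phi> v * mon w \<in> homog (p \<noteq> (odd_ix v \<noteq> odd_word w))"
      by (rule homog_cong[OF homog_mult[of "\<phi> v" "p \<noteq> odd_ix v" "mon w" "odd_word w"]])
        (use assms(1) homog_mon[of w] in \<open>auto simp: super_vf_def\<close>)
    have 2: "mon [v] * deriv_word p \<phi> w \<in> homog (p \<noteq> (odd_ix v \<noteq> odd_word w))"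
      by (rule homog_cong[OF homog_mult[OF homog_mon1 Cons, of v]]) auto
    show ?case using 1 2 by simp
  qed simp
  then have "deriv_word p \<phi> w \<in> homog (p \<noteq> q)" using add by blast
  then show ?case
    using add linear_deriv[OF assms(1)] by (simp add: linear_add linear_scale deriv_mon[OF assms(1)])
qed

subsection \<open>Algebra homomorphisms\<close>

definition hom_ext :: "('v::super_index \<Rightarrow> 'w::super_index spoly) \<Rightarrow> 'v spoly \<Rightarrow> 'w spoly" where
  "hom_ext \<phi> = induced (\<lambda>w. prod_list (map \<phi> w))"

lemma
  assumes "\<And>v. \<phi> v \<in> homog (odd_ix v)"
  shows linear_hom_ext: "linear (hom_ext \<phi>)"
    and hom_ext_mon: "hom_ext \<phi> (mon w) = prod_list (map \<phi> w)"
proof -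
  have "koszul_sym (\<lambda>w. prod_list (map \<phi> w))"
  proof (rule koszul_symI)
    fix us vs and v w :: 'a
    have "prod_list (map \<phi> (us @ v # w # vs)) = prod_list (map \<phi> us) * (\<phi> v * \<phi> w) * prod_list (map \<phi> vs)"
      by (simp add: mult.assoc)
    also have "\<phi> v * \<phi> w = sg (odd_ix v \<and> odd_ix w) *\<^sub>R (\<phi> w * \<phi> v)"
      by (rule supercommute[OF assms assms])
    finally show "prod_list (map \<phi> (us @ v # w # vs)) =
        sg (odd_ix v \<and> odd_ix w) *\<^sub>R prod_list (map \<phi> (us @ w # v # vs))"
      by (simp add: mult.assoc)
  qed
  then show "linear (hom_ext \<phi>)" "hom_ext \<phi> (mon w) = prod_list (map \<phi> w)"
    unfolding hom_ext_def by (auto intro: linear_induced simp: induced_mon)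
qed

lemma linear_hom_ext_comp [linear_intros]:
  "(\<And>v. \<phi> v \<in> homog (odd_ix v)) \<Longrightarrow> linear F \<Longrightarrow> linear (\<lambda>f. hom_ext \<phi> (F f))"
  by (rule linear_fun_comp[OF linear_hom_ext])

lemma hom_ext_mult:
  assumes "\<And>v. \<phi> v \<in> homog (odd_ix v)"
  shows "hom_ext \<phi> (f * g) = hom_ext \<phi> f * hom_ext \<phi> g"
proof (rule linear_eq_mon[where f=f])
  fix u
  show "hom_ext \<phi> (mon u * g) = hom_ext \<phi> (mon u) * hom_ext \<phi> g"
  proof (rule linear_eq_mon[where f=g])
    fix w
    show "hom_ext \<phi> (mon u * mon w) = hom_ext \<phi> (mon u) * hom_ext \<phi> (mon w)"
      by (simp add: hom_ext_mon[OF assms] flip: mon_append)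
  qed (intro linear_intros linear_hom_ext_comp assms; assumption?)+
qed (intro linear_intros linear_hom_ext_comp assms; assumption?)+

lemma hom_ext_gen: "(\<And>v. \<phi> v \<in> homog (odd_ix v)) \<Longrightarrow> hom_ext \<phi> (mon [v]) = \<phi> v"
  by (simp add: hom_ext_mon)

lemma hom_ext_one: "(\<And>v. \<phi> v \<in> homog (odd_ix v)) \<Longrightarrow> hom_ext \<phi> 1 = 1"
  using hom_ext_mon[of \<phi> "[]"] by simp

subsection \<open>Constant coefficient operators\<close>

definition pd :: "'v::super_index \<Rightarrow> 'v spoly \<Rightarrow> 'v spoly" where
  "pd i = deriv_ext (odd_ix i) (\<lambda>v. if v = i then 1 else 0)"

lemma super_vf_pd: "super_vf (odd_ix i) (\<lambda>v. if v = i then 1 else 0)"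
  using homog_one by (auto simp: super_vf_def)

lemma linear_pd: "linear (pd i)"
  unfolding pd_def by (rule linear_deriv[OF super_vf_pd])

lemma linear_pd_comp [linear_intros]: "linear F \<Longrightarrow> linear (\<lambda>f. pd i (F f))"
  by (rule linear_fun_comp[OF linear_pd])

lemma pd_simps [simp]:
  "pd i 0 = 0" "pd i (f + g) = pd i f + pd i g" "pd i (f - g) = pd i f - pd i g"
  "pd i (c *\<^sub>R f) = c *\<^sub>R pd i f" "pd i (- f) = - pd i f"
  "pd i (sum F A) = (\<Sum>a\<in>A. pd i (F a))"
  by (simp_all add: linear_0[OF linear_pd] linear_add[OF linear_pd] linear_diff[OF linear_pd]
      linear_scale[OF linear_pd] linear_neg[OF linear_pd] linear_sum[OF linear_pd])

lemma pd_one [simp]: "pd i 1 = 0"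
  unfolding pd_def by (rule deriv_one[OF super_vf_pd])

lemma pd_gen [simp]: "pd i (mon [j]) = (if j = i then 1 else 0)"
  unfolding pd_def by (rule deriv_gen[OF super_vf_pd])

lemma pd_mult_gen: "pd i (mon [j] * f) =
    (if j = i then f else 0) + sg (odd_ix i \<and> odd_ix j) *\<^sub>R (mon [j] * pd i f)"
  unfolding pd_def by (simp add: deriv_mult_gen[OF super_vf_pd])

lemma pd_mult: "f \<in> homog q \<Longrightarrow> pd i (f * g) = pd i f * g + sg (odd_ix i \<and> q) *\<^sub>R (f * pd i g)"
  unfolding pd_def by (rule deriv_mult[OF super_vf_pd])

lemma pd_homog: "f \<in> homog q \<Longrightarrow> pd i f \<in> homog (odd_ix i \<noteq> q)"
  unfolding pd_def by (rule deriv_homog[OF super_vf_pd])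

lemma self_eq_neg: "x = - x \<Longrightarrow> x = 0" for x :: "'a::real_vector"
  by (metis add.right_inverse scaleR_2 scaleR_eq_0_iff zero_neq_numeral)

lemma pd_commute: "pd i (pd j f) = sg (odd_ix i \<and> odd_ix j) *\<^sub>R pd j (pd i f)"
proof (rule linear_eq_gen[where f=f])
  fix k and f :: "'a spoly"
  assume "pd i (pd j f) = sg (odd_ix i \<and> odd_ix j) *\<^sub>R pd j (pd i f)"
  then show "pd i (pd j (mon [k] * f)) = sg (odd_ix i \<and> odd_ix j) *\<^sub>R pd j (pd i (mon [k] * f))"
  proof (cases "i = j \<and> odd_ix i")
    case True
    then have ij: "j = i" "odd_ix i" by auto
    \<comment> \<open>For an odd coordinate the claim says that \<open>pd i\<close> squares to zero,
      while the induction hypothesis only says that the square is its own negative.\<close>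
    have "pd i (pd i f) = - pd i (pd i f)"
      using \<open>pd i (pd j f) = _\<close> unfolding ij(1) by (simp only: ij(2) sg_def if_True simp_thms scaleR_minus1_left)
    then have "pd i (pd i f) = 0" by (rule self_eq_neg)
    then show ?thesis using ij(2) unfolding ij(1)
      by (cases "k = i"; cases "odd_ix k") (simp_all add: pd_mult_gen)
  qed (cases "odd_ix i"; cases "odd_ix j"; cases "odd_ix k"; cases "k = i"; cases "k = j";
      simp add: pd_mult_gen algebra_simps)
qed (intro linear_intros | simp)+

section \<open>Degree and support of polynomials\<close>

lemma sym_part_linear:
  assumes "f \<in> sym_part J N" "linear F" "subspace S"
    "\<And>w. set w \<subseteq> J \<Longrightarrow> length w \<in> N \<Longrightarrow> F (mon w) \<in> S"
  shows "F f \<in> S"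
  using assms(1) unfolding sym_part_def
proof (induction rule: span_induct_alt)
  case base
  then show ?case using assms by (simp add: linear_0 subspace_0)
next
  case (step c x y)
  then show ?case using assms by (auto simp: linear_add linear_scale intro!: subspace_add subspace_scale)
qed

lemma subspace_sym_part [simp]: "subspace (sym_part J N)"
  by (simp add: sym_part_def)

lemma sym_part_mon: "set w \<subseteq> J \<Longrightarrow> length w \<in> N \<Longrightarrow> mon w \<in> sym_part J N"
  unfolding sym_part_def by (rule span_base) blast

lemma sym_part_linear_eq:
  assumes "f \<in> sym_part J N" "linear F" "linear G"
    "\<And>w. set w \<subseteq> J \<Longrightarrow> length w \<in> N \<Longrightarrow> F (mon w) = G (mon w)"
  shows "F f = G f"
  using sym_part_linear[OF assms(1) linear_diff_compose[OF assms(2,3)], of "{0}"] assms(4) by auto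

lemma sym_part_mono: "J \<subseteq> J' \<Longrightarrow> N \<subseteq> N' \<Longrightarrow> sym_part J N \<subseteq> sym_part J' N'"
  unfolding sym_part_def by (intro span_mono) auto

lemma sym_part_UNIV [simp]: "f \<in> sym_part UNIV UNIV"
proof (induction f rule: spoly_induct)
  case (add c w f)
  have "mon w \<in> sym_part UNIV UNIV" by (rule sym_part_mon) auto
  with add show ?case by (intro subspace_add[OF subspace_sym_part] subspace_scale[OF subspace_sym_part])
qed (simp add: subspace_0)

lemma sym_part_mult:
  assumes "f \<in> sym_part J N" "g \<in> sym_part J N'"
    and "\<And>a b. a \<in> N \<Longrightarrow> b \<in> N' \<Longrightarrow> a + b \<in> N''"
  shows "f * g \<in> sym_part J N''"
  using assms(1)
proof (rule sym_part_linear)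
  fix w assume w: "set w \<subseteq> J" "length w \<in> N"
  show "mon w * g \<in> sym_part J N''"
    using assms(2)
    by (rule sym_part_linear)
      (use w assms(3) in \<open>auto intro!: linear_intros sym_part_mon simp flip: mon_append\<close>)
qed (auto intro!: linear_intros)

text \<open>The set \<open>{n. Suc n = length w}\<close> stands for degree
  \<open>length w - 1\<close> without truncated subtraction: it is empty for the empty word, whose
  derivative is 0.\<close>

lemma pd_word_part:
  assumes "set w \<subseteq> J"
  shows "pd i (mon w) \<in> sym_part J {n. Suc n = length w}"
  using assms
proof (induction w)
  case (Cons v w)
  have "mon w \<in> sym_part J {n. Suc n = length (v # w)}" using Cons by (intro sym_part_mon) auto
  moreover have "mon [v] * pd i (mon w) \<in> sym_part J {n. Suc n = length (v # w)}"
    by (rule sym_part_mult[OF _ Cons.IH, of _ "{1}"]) (use Cons.prems in \<open>auto intro!: sym_part_mon\<close>)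
  ultimately show ?case
    unfolding mon_Cons[of v w] pd_mult_gen
    by (auto intro!: subspace_add subspace_scale subspace_0)
qed (simp add: subspace_0)

lemma pd_sym_part:
  assumes "f \<in> sym_part J N" "\<And>n. Suc n \<in> N \<Longrightarrow> n \<in> N'"
  shows "pd i f \<in> sym_part J N'"
  using assms(1) linear_pd
proof (rule sym_part_linear)
  fix w assume w: "set w \<subseteq> J" "length w \<in> N"
  have "{n. Suc n = length w} \<subseteq> N'" using w(2) assms(2) by auto
  then show "pd i (mon w) \<in> sym_part J N'"
    using pd_word_part[OF w(1), of i] sym_part_mono[of J J "{n. Suc n = length w}" N'] by auto
qed simp

lemma pd_sym_part_0:
  assumes "f \<in> sym_part J N" "i \<notin> J"
  shows "pd i f = 0"
proof (rule sym_part_linear_eq[OF assms(1) linear_pd linear_zero])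
  fix w assume "set w \<subseteq> J"
  then show "pd i (mon w) = 0"
  proof (induction w)
    case (Cons v w)
    then show ?case unfolding mon_Cons[of v w] pd_mult_gen using assms(2) by auto
  qed simp
qed

text \<open>In contrast to \<open>linear_eq_gen\<close>, the induction hypothesis covers every
  polynomial of no larger degree. Wick recursions need this, since they express the value at
  \<open>mon [i] * f\<close> through derivatives of \<open>f\<close> and not through
  \<open>f\<close> itself.\<close>

lemma linear_eq_deg:
  fixes A :: "'a::super_index spoly \<Rightarrow> 'b::real_vector"
  assumes "linear A" "linear B" "A 1 = B 1"
    and step: "\<And>i f n. f \<in> sym_part UNIV {..n} \<Longrightarrow>
      (\<And>g. g \<in> sym_part UNIV {..n} \<Longrightarrow> A g = B g) \<Longrightarrow> A (mon [i] * f) = B (mon [i] * f)"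
  shows "A f = B f"
proof -
  have *: "\<forall>g\<in>sym_part UNIV {..n}. A g = B g" for n
  proof (induction n)
    case 0
    show ?case
    proof
      fix g assume "g \<in> sym_part (UNIV :: 'a set) {..0}"
      then show "A g = B g"
        by (rule sym_part_linear_eq[OF _ assms(1,2)]) (simp add: assms(3))
    qed
  next
    case (Suc n)
    show ?case
    proof
      fix g assume "g \<in> sym_part (UNIV :: 'a set) {..Suc n}"
      then show "A g = B g"
      proof (rule sym_part_linear_eq[OF _ assms(1,2)])
        fix w :: "'a list" assume w: "length w \<in> {..Suc n}"
        show "A (mon w) = B (mon w)"
        proof (cases w)
          case (Cons v u)
          then show ?thesis
            unfolding Cons mon_Cons[of v u] using step[of "mon u" n v] Suc w Cons sym_part_mon[of u UNIV "{..n}"] by auto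
        qed (simp add: assms(3))
      qed
    qed
  qed
  show ?thesis
    by (rule linear_eq_mon[OF assms(1,2)]) (use * in \<open>auto intro: sym_part_mon\<close>)
qed

section \<open>Linear vector fields and second order operators with constant coefficients\<close>

locale fin_ix =
  fixes I :: "'v::super_index set"
  assumes finI [simp]: "finite I"
begin

definition mat :: "bool \<Rightarrow> ('v \<Rightarrow> 'v \<Rightarrow> real) \<Rightarrow> bool" where
  "mat p M \<longleftrightarrow> (\<forall>i j. M i j \<noteq> 0 \<longrightarrow> i \<in> I \<and> j \<in> I \<and> (odd_ix i \<noteq> odd_ix j) = p)"

definition msym :: "('v \<Rightarrow> 'v \<Rightarrow> real) \<Rightarrow> bool" where
  "msym M \<longleftrightarrow> (\<forall>i j. M j i = sg (odd_ix i \<and> odd_ix j) * M i j)"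

definition lvf :: "('v \<Rightarrow> 'v \<Rightarrow> real) \<Rightarrow> 'v \<Rightarrow> 'v spoly" where
  "lvf D k = (\<Sum>l\<in>I. D k l *\<^sub>R mon [l])"

lemma lvf_homog:
  assumes "mat p D"
  shows "lvf D k \<in> homog (p \<noteq> odd_ix k)"
  unfolding lvf_def
proof (rule homog_sum)
  fix l
  show "D k l *\<^sub>R mon [l] \<in> homog (p \<noteq> odd_ix k)"
  proof (cases "D k l = 0")
    case False
    with assms have "(odd_ix k \<noteq> odd_ix l) = p" unfolding mat_def by blast
    then have "odd_ix l = (p \<noteq> odd_ix k)" by auto
    then show ?thesis using homog_mon1[of l] by simp
  qed simp
qed

lemma super_vf_lvf: "mat p D \<Longrightarrow> super_vf p (lvf D)"
  unfolding super_vf_def using lvf_homog by blast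

lemma pd_lvf: "mat p D \<Longrightarrow> pd j (lvf D k) = D k j *\<^sub>R 1"
proof -
  assume m: "mat p D"
  have "pd j (lvf D k) = (\<Sum>l\<in>I. if l = j then D k l *\<^sub>R 1 else 0)"
    unfolding lvf_def pd_simps by (rule sum.cong) auto
  also have "\<dots> = D k j *\<^sub>R 1" using m by (auto simp: mat_def sum.delta)
  finally show ?thesis .
qed

text \<open>The supercommutator of a constant vector field with a linear one is again constant, with
  coefficients the column \<open>j\<close> of the matrix.\<close>

lemma pd_lderiv:
  assumes m: "mat p D"
  shows "pd j (deriv_ext p (lvf D) f) =
    sg (p \<and> odd_ix j) *\<^sub>R deriv_ext p (lvf D) (pd j f) + (\<Sum>k\<in>I. D k j *\<^sub>R pd k f)"
proof (rule linear_eq_gen[where f=f])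
  note v = super_vf_lvf[OF m]
  show "linear (\<lambda>a. pd j (deriv_ext p (lvf D) a))"
    "linear (\<lambda>a. sg (p \<and> odd_ix j) *\<^sub>R deriv_ext p (lvf D) (pd j a) + (\<Sum>k\<in>I. D k j *\<^sub>R pd k a))"
    by (intro linear_intros v)+
  show "pd j (deriv_ext p (lvf D) 1) =
    sg (p \<and> odd_ix j) *\<^sub>R deriv_ext p (lvf D) (pd j 1) + (\<Sum>k\<in>I. D k j *\<^sub>R pd k 1)"
    using linear_deriv[OF v] by (simp add: v linear_0)
  fix i and f :: "'v spoly"
  assume IH: "pd j (deriv_ext p (lvf D) f) =
    sg (p \<and> odd_ix j) *\<^sub>R deriv_ext p (lvf D) (pd j f) + (\<Sum>k\<in>I. D k j *\<^sub>R pd k f)"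
  have 1: "(\<Sum>k\<in>I. D k j *\<^sub>R (if i = k then f else 0)) = D i j *\<^sub>R f"
    using m by (auto simp: mat_def if_distrib cong: if_cong)
  have 2: "(\<Sum>k\<in>I. (D k j * sg (odd_ix k \<and> odd_ix i)) *\<^sub>R (mon [i] * pd k f)) =
     (sg (p \<and> odd_ix i) * sg (odd_ix j \<and> odd_ix i)) *\<^sub>R (mon [i] * (\<Sum>k\<in>I. D k j *\<^sub>R pd k f))"
    unfolding sum_distrib_left scaleR_sum_right
  proof (rule sum.cong[OF refl])
    fix k
    show "(D k j * sg (odd_ix k \<and> odd_ix i)) *\<^sub>R (mon [i] * pd k f) =
       (sg (p \<and> odd_ix i) * sg (odd_ix j \<and> odd_ix i)) *\<^sub>R (mon [i] * D k j *\<^sub>R pd k f)"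
    \<comment> \<open>A nonzero entry forces the parity of \<open>k\<close> to be that of
      \<open>j\<close> shifted by \<open>p\<close>, so the sign no longer depends on
      \<open>k\<close> and leaves the sum.\<close>
    proof (cases "D k j = 0")
      case False
      with m have "p = (odd_ix k \<noteq> odd_ix j)" unfolding mat_def by blast
      then show ?thesis by (auto simp: sg_def)
    qed simp
  qed
  have 3: "(\<Sum>k\<in>I. D k j *\<^sub>R pd k (mon [i] * f)) = D i j *\<^sub>R f +
     (sg (p \<and> odd_ix i) * sg (odd_ix j \<and> odd_ix i)) *\<^sub>R (mon [i] * (\<Sum>k\<in>I. D k j *\<^sub>R pd k f))"
    by (simp only: pd_mult_gen scaleR_add_right sum.distrib scaleR_scaleR 1 2)
  have 5: "pd j (lvf D i * f) = D i j *\<^sub>R f + sg (odd_ix j \<and> (p \<noteq> odd_ix i)) *\<^sub>R (lvf D i * pd j f)"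
    using pd_mult[OF lvf_homog[OF m], of j i f] by (simp add: pd_lvf[OF m])
  have lin: "deriv_ext p (lvf D) (x + y) = deriv_ext p (lvf D) x + deriv_ext p (lvf D) y"
    "deriv_ext p (lvf D) (c *\<^sub>R x) = c *\<^sub>R deriv_ext p (lvf D) x" "deriv_ext p (lvf D) 0 = 0" for x y c
    using linear_deriv[OF v] by (auto simp: linear_add linear_scale linear_0)
  have 6: "deriv_ext p (lvf D) (if i = j then f else 0) = (if i = j then deriv_ext p (lvf D) f else 0)"
    by (simp add: lin(3))
  show "pd j (deriv_ext p (lvf D) (mon [i] * f)) = sg (p \<and> odd_ix j) *\<^sub>R deriv_ext p (lvf D) (pd j (mon [i] * f)) +
      (\<Sum>k\<in>I. D k j *\<^sub>R pd k (mon [i] * f))"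
    unfolding 3 deriv_mult_gen[OF v]
    by (simp only: pd_simps 5 pd_mult_gen lin(1,2) 6 IH deriv_mult_gen[OF v])
      (cases "i = j"; cases "odd_ix i"; cases "odd_ix j"; cases p; simp add: algebra_simps lin)
qed

text \<open>The sum runs over ordered pairs without a factor 1/2. For supersymmetric
  \<open>M\<close> every pair is thus counted twice, and this is where the halves in front of
  \<open>T\<close> come from later.\<close>

definition T :: "('v \<Rightarrow> 'v \<Rightarrow> real) \<Rightarrow> 'v spoly \<Rightarrow> 'v spoly" where
  "T M f = (\<Sum>i\<in>I. \<Sum>j\<in>I. M i j *\<^sub>R pd j (pd i f))"

lemma linear_T: "linear (T M)"
  unfolding T_def by (intro linear_intros)

lemma linear_T_comp [linear_intros]: "linear F \<Longrightarrow> linear (\<lambda>f. T M (F f))"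
  by (rule linear_fun_comp[OF linear_T])

lemma T_simps [simp]:
  "T M 0 = 0" "T M (f + g) = T M f + T M g" "T M (f - g) = T M f - T M g"
  "T M (c *\<^sub>R f) = c *\<^sub>R T M f" "T M (- f) = - T M f" "T M (sum F A) = (\<Sum>a\<in>A. T M (F a))"
  by (simp_all add: linear_0[OF linear_T] linear_add[OF linear_T] linear_diff[OF linear_T]
      linear_scale[OF linear_T] linear_neg[OF linear_T] linear_sum[OF linear_T])

lemma T_one [simp]: "T M 1 = 0"
  by (simp add: T_def)

lemma pd_T:
  assumes "mat m M"
  shows "pd l (T M f) = sg (m \<and> odd_ix l) *\<^sub>R T M (pd l f)"
  unfolding T_def pd_simps scaleR_sum_right
proof (intro sum.cong refl)
  fix i j
  show "M i j *\<^sub>R pd l (pd j (pd i f)) = sg (m \<and> odd_ix l) *\<^sub>R M i j *\<^sub>R pd j (pd i (pd l f))"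
  proof (cases "M i j = 0")
    case False
    with assms have m: "m = (odd_ix i \<noteq> odd_ix j)" unfolding mat_def by blast
    show ?thesis
      unfolding pd_commute[of l j] pd_commute[of l i] m by (auto simp: sg_def)
  qed simp
qed

lemma T_T:
  assumes "mat m M" "mat n N"
  shows "T M (T N f) = sg (m \<and> n) *\<^sub>R T N (T M f)"
proof -
  have "T M (T N f) = (\<Sum>i\<in>I. \<Sum>j\<in>I. M i j *\<^sub>R (sg (n \<and> odd_ix i) * sg (n \<and> odd_ix j)) *\<^sub>R T N (pd j (pd i f)))"
    by (simp add: T_def[of M] pd_T[OF assms(2)])
  also have "\<dots> = (\<Sum>i\<in>I. \<Sum>j\<in>I. sg (m \<and> n) *\<^sub>R M i j *\<^sub>R T N (pd j (pd i f)))"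
  proof (intro sum.cong refl)
    fix i j
    show "M i j *\<^sub>R (sg (n \<and> odd_ix i) * sg (n \<and> odd_ix j)) *\<^sub>R T N (pd j (pd i f)) =
      sg (m \<and> n) *\<^sub>R M i j *\<^sub>R T N (pd j (pd i f))"
    proof (cases "M i j = 0")
      case False
      with assms(1) have m: "m = (odd_ix i \<noteq> odd_ix j)" unfolding mat_def by blast
      show ?thesis unfolding m by (auto simp: sg_def)
    qed simp
  qed
  also have "\<dots> = sg (m \<and> n) *\<^sub>R T N (T M f)"
    by (simp add: T_def[of M] scaleR_sum_right)
  finally show ?thesis .
qed

text \<open>Either of the two derivatives may hit the new coordinate; by supersymmetry of
  \<open>M\<close> both contributions agree, hence the factor 2.\<close>

lemma T_mult_gen:
  assumes "mat m M" "msym M"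
  shows "T M (mon [i] * f) = 2 *\<^sub>R (\<Sum>l\<in>I. M i l *\<^sub>R pd l f) + sg (m \<and> odd_ix i) *\<^sub>R (mon [i] * T M f)"
proof -
  have *: "M k l *\<^sub>R pd l (pd k (mon [i] * f)) =
      (if i = k then M k l *\<^sub>R pd l f else 0) + (if i = l then M l k *\<^sub>R pd k f else 0) +
      sg (m \<and> odd_ix i) *\<^sub>R (mon [i] * M k l *\<^sub>R pd l (pd k f))" for k l
  proof (cases "M k l = 0")
    case True
    moreover have "M l k = 0" using assms(2) True by (metis mult_zero_right msym_def)
    ultimately show ?thesis by (cases "l = k") auto
  next
    case False
    with assms(1) have m: "m = (odd_ix k \<noteq> odd_ix l)" unfolding mat_def by blast
    have s: "M l k = sg (odd_ix k \<and> odd_ix l) * M k l" using assms(2) unfolding msym_def by blast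
    show ?thesis unfolding m s
      by (cases "i = k"; cases "i = l"; cases "odd_ix i"; cases "odd_ix k"; cases "odd_ix l")
        (simp_all add: pd_mult_gen algebra_simps)
  qed
  have i: "M i l = 0" if "i \<notin> I" for l using assms(1) that by (auto simp: mat_def)
  have 1: "(\<Sum>k\<in>I. \<Sum>l\<in>I. if i = k then M k l *\<^sub>R pd l f else 0) = (\<Sum>l\<in>I. M i l *\<^sub>R pd l f)"
  proof -
    have "(\<Sum>k\<in>I. \<Sum>l\<in>I. if i = k then M k l *\<^sub>R pd l f else 0) =
        (\<Sum>k\<in>I. if i = k then \<Sum>l\<in>I. M k l *\<^sub>R pd l f else 0)"
      by (rule sum.cong) auto
    then show ?thesis using i by (auto simp: sum.delta)
  qed
  have 2: "(\<Sum>k\<in>I. \<Sum>l\<in>I. if i = l then M l k *\<^sub>R pd k f else 0) = (\<Sum>l\<in>I. M i l *\<^sub>R pd l f)"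
  proof -
    have "(\<Sum>k\<in>I. \<Sum>l\<in>I. if i = l then M l k *\<^sub>R pd k f else 0) =
        (\<Sum>k\<in>I. if i \<in> I then M i k *\<^sub>R pd k f else 0)"
      by (intro sum.cong) (auto simp: sum.delta)
    then show ?thesis using i by (cases "i \<in> I") auto
  qed
  have "T M (mon [i] * f) = (\<Sum>k\<in>I. \<Sum>l\<in>I. M k l *\<^sub>R pd l (pd k (mon [i] * f)))"
    by (rule T_def)
  then show ?thesis
    unfolding * sum.distrib 1 2
    by (simp only: T_def[of M f] scaleR_sum_right sum_distrib_left scaleR_2 sum.distrib)
qed

text \<open>The infinitesimal action of the linear field \<open>D\<close> on the two slots of the
  tensor \<open>M\<close>; by \<open>T_lderiv\<close> it is the matrix of the supercommutator of
  \<open>T M\<close> with that field.\<close>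

definition Rm :: "bool \<Rightarrow> ('v \<Rightarrow> 'v \<Rightarrow> real) \<Rightarrow> ('v \<Rightarrow> 'v \<Rightarrow> real) \<Rightarrow> 'v \<Rightarrow> 'v \<Rightarrow> real" where
  "Rm p D M k l = (\<Sum>i\<in>I. D k i * M i l + sg (p \<and> odd_ix k) * M k i * D l i)"

lemma swap3: "(\<Sum>i\<in>A. \<Sum>j\<in>B. \<Sum>k\<in>C. g i j k) = (\<Sum>k\<in>C. \<Sum>j\<in>B. \<Sum>i\<in>A. g i j k)"
  for g :: "'i \<Rightarrow> 'j \<Rightarrow> 'k \<Rightarrow> 'b::comm_monoid_add"
proof -
  have "(\<Sum>i\<in>A. \<Sum>j\<in>B. \<Sum>k\<in>C. g i j k) = (\<Sum>i\<in>A. \<Sum>k\<in>C. \<Sum>j\<in>B. g i j k)"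
    by (intro sum.cong refl sum.swap)
  also have "\<dots> = (\<Sum>k\<in>C. \<Sum>i\<in>A. \<Sum>j\<in>B. g i j k)" by (rule sum.swap)
  also have "\<dots> = (\<Sum>k\<in>C. \<Sum>j\<in>B. \<Sum>i\<in>A. g i j k)" by (intro sum.cong refl sum.swap)
  finally show ?thesis .
qed

text \<open>Passing the field through the two derivatives in \<open>T M\<close> one after the other
  gives one correction each by \<open>pd_lderiv\<close>; after renaming indices these are the two
  summands of \<open>Rm\<close>.\<close>

lemma T_lderiv:
  assumes D: "mat p D" and M: "mat m M"
  shows "T M (deriv_ext p (lvf D) f) = sg (p \<and> m) *\<^sub>R deriv_ext p (lvf D) (T M f) + T (Rm p D M) f"
proof -
  let ?D = "deriv_ext p (lvf D)"
  note L = linear_deriv[OF super_vf_lvf[OF D]]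
  have lin: "?D (x + y) = ?D x + ?D y" "?D (c *\<^sub>R x) = c *\<^sub>R ?D x" "?D (sum F A) = (\<Sum>a\<in>A. ?D (F a))"
    for x y c and F :: "'v \<Rightarrow> 'v spoly" and A
    using L by (auto simp: linear_add linear_scale linear_sum)
  have *: "M i j *\<^sub>R pd j (pd i (?D f)) = sg (p \<and> m) *\<^sub>R M i j *\<^sub>R ?D (pd j (pd i f)) +
     (\<Sum>k\<in>I. (sg (p \<and> odd_ix i) * M i j * D k j) *\<^sub>R pd k (pd i f)) +
     (\<Sum>k\<in>I. (D k i * M i j) *\<^sub>R pd j (pd k f))" for i j
  proof (cases "M i j = 0")
    case False
    with M have m: "m = (odd_ix i \<noteq> odd_ix j)" unfolding mat_def by blast
    show ?thesis
      unfolding pd_lderiv[OF D, of i] pd_simps pd_lderiv[OF D, of j] m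
      by (cases "odd_ix i"; cases "odd_ix j"; cases p)
        (simp_all add: scaleR_sum_right scaleR_add_right scaleR_diff_right mult.commute sum_negf)
  qed simp
  have "T M (?D f) = sg (p \<and> m) *\<^sub>R ?D (T M f) +
     (\<Sum>i\<in>I. \<Sum>j\<in>I. \<Sum>k\<in>I. (sg (p \<and> odd_ix i) * M i j * D k j) *\<^sub>R pd k (pd i f)) +
     (\<Sum>i\<in>I. \<Sum>j\<in>I. \<Sum>k\<in>I. (D k i * M i j) *\<^sub>R pd j (pd k f))"
    unfolding T_def[of M] * by (simp add: sum.distrib lin scaleR_sum_right)
  also have "(\<Sum>i\<in>I. \<Sum>j\<in>I. \<Sum>k\<in>I. (sg (p \<and> odd_ix i) * M i j * D k j) *\<^sub>R pd k (pd i f)) =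
     (\<Sum>k\<in>I. \<Sum>l\<in>I. \<Sum>i\<in>I. (sg (p \<and> odd_ix k) * M k i * D l i) *\<^sub>R pd l (pd k f))"
    by (intro sum.cong refl sum.swap)
  also have "(\<Sum>i\<in>I. \<Sum>j\<in>I. \<Sum>k\<in>I. (D k i * M i j) *\<^sub>R pd j (pd k f)) =
     (\<Sum>k\<in>I. \<Sum>l\<in>I. \<Sum>i\<in>I. (D k i * M i l) *\<^sub>R pd l (pd k f))"
    by (rule swap3)
  also have "sg (p \<and> m) *\<^sub>R ?D (T M f) +
     (\<Sum>k\<in>I. \<Sum>l\<in>I. \<Sum>i\<in>I. (sg (p \<and> odd_ix k) * M k i * D l i) *\<^sub>R pd l (pd k f)) +
     (\<Sum>k\<in>I. \<Sum>l\<in>I. \<Sum>i\<in>I. (D k i * M i l) *\<^sub>R pd l (pd k f)) =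
     sg (p \<and> m) *\<^sub>R ?D (T M f) + T (Rm p D M) f"
    unfolding T_def[of "Rm p D M"] Rm_def
    by (simp add: scaleR_add_left sum.distrib scaleR_sum_left add_ac)
  finally show ?thesis .
qed

subsection \<open>Wick functionals\<close>

text \<open>Integration by parts against a normalised Gaussian with covariance \<open>K\<close>,
  taken as the definition so that a degenerate \<open>K\<close> is allowed.\<close>

definition is_wick :: "('v \<Rightarrow> 'v \<Rightarrow> real) \<Rightarrow> ('v spoly \<Rightarrow> real) \<Rightarrow> bool" where
  "is_wick K E \<longleftrightarrow> linear E \<and> E 1 = 1 \<and> (\<forall>i f. E (mon [i] * f) = (\<Sum>j\<in>I. K i j * E (pd j f)))"

lemma is_wickD:
  assumes "is_wick K E"
  shows "linear E" "E 1 = 1" "E (mon [i] * f) = (\<Sum>j\<in>I. K i j * E (pd j f))"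
  using assms unfolding is_wick_def by auto

lemma wick_simps:
  assumes "is_wick K E"
  shows "E 0 = 0" "E (f + g) = E f + E g" "E (f - g) = E f - E g"
  "E (c *\<^sub>R f) = c * E f" "E (- f) = - E f" "E (sum F A) = (\<Sum>a\<in>A. E (F a))"
  using is_wickD(1)[OF assms]
  by (simp_all add: linear_0 linear_add linear_diff linear_scale linear_neg linear_sum)

text \<open>Every application of the recursion lowers the degree, so only the value at 1 is free.
  \<open>A\<close> may take values in any real vector space, because the functional to be identified
  is a complex integral.\<close>

lemma wick_unique:
  assumes E: "is_wick K E" and A: "linear A"
    and rec: "\<And>i f. A (mon [i] * f) = (\<Sum>j\<in>I. K i j *\<^sub>R A (pd j f))"
  shows "A f = E f *\<^sub>R A 1"
proof (rule linear_eq_deg[where f=f, OF A])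
  show "linear (\<lambda>f. E f *\<^sub>R A 1)"
    by (rule linearI) (simp_all add: wick_simps[OF E] scaleR_add_left)
  fix i n and f :: "'v spoly"
  assume f: "f \<in> sym_part UNIV {..n}" and IH: "\<And>g. g \<in> sym_part UNIV {..n} \<Longrightarrow> A g = E g *\<^sub>R A 1"
  have "pd j f \<in> sym_part UNIV {..n}" for j by (rule pd_sym_part[OF f]) auto
  then show "A (mon [i] * f) = E (mon [i] * f) *\<^sub>R A 1"
    by (simp add: rec is_wickD(3)[OF E] IH scaleR_sum_left)
qed (simp add: is_wickD(2)[OF E])

text \<open>A linear change of variables turns a Gaussian into one with transformed covariance.
  Infinitesimally the covariance moves by \<open>Rm p D K\<close>, and a change K' of the covariance
  changes the functional by \<open>T\<close> of K' over 2. The proof compares the recursions of both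
  sides.\<close>

lemma wick_lderiv:
  assumes E: "is_wick K E" and K: "mat False K" and D: "mat p D" and R: "msym (Rm p D K)" "mat p (Rm p D K)"
  shows "E (deriv_ext p (lvf D) f) = E (T (Rm p D K) f) / 2"
proof (rule linear_eq_deg[where f=f])
  let ?D = "deriv_ext p (lvf D)" and ?T = "T (Rm p D K)"
  note v = super_vf_lvf[OF D] and L = is_wickD(1)[OF E]
  show "linear (\<lambda>f. E (?D f))" by (intro linear_fun_comp[OF L] linear_intros v)
  show "linear (\<lambda>f. E (?T f) / 2)"
    using linear_real_mult[OF linear_fun_comp[OF L linear_T[of "Rm p D K"]], of "1/2"] by simp
  show "E (?D 1) = E (?T 1) / 2" by (simp add: v wick_simps[OF E])
  fix i n and f :: "'v spoly"
  assume f: "f \<in> sym_part UNIV {..n}" and IH: "\<And>g. g \<in> sym_part UNIV {..n} \<Longrightarrow> E (?D g) = E (?T g) / 2"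
  have IH': "E (?D (pd j f)) = E (?T (pd j f)) / 2" for j
    by (intro IH pd_sym_part[OF f]) auto
  have "E (?D (mon [i] * f)) = E (lvf D i * f) + sg (p \<and> odd_ix i) * E (mon [i] * ?D f)"
    by (simp add: deriv_mult_gen[OF v] wick_simps[OF E])
  also have "E (lvf D i * f) = (\<Sum>l\<in>I. \<Sum>k\<in>I. D i k * K k l * E (pd l f))"
    by (simp add: lvf_def sum_distrib_right wick_simps[OF E] is_wickD(3)[OF E] sum_distrib_left mult.assoc)
       (rule sum.swap)
  also have "sg (p \<and> odd_ix i) * E (mon [i] * ?D f) = (\<Sum>j\<in>I. K i j * E (?T (pd j f)) / 2) +
     (\<Sum>j\<in>I. \<Sum>k\<in>I. sg (p \<and> odd_ix i) * K i j * D k j * E (pd k f))"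
  proof -
    have *: "sg (p \<and> odd_ix i) * (K i j * E (pd j (?D f))) = K i j * E (?T (pd j f)) / 2 +
        (\<Sum>k\<in>I. sg (p \<and> odd_ix i) * K i j * D k j * E (pd k f))" for j
    proof (cases "K i j = 0")
      case False
      with K have "odd_ix i = odd_ix j" unfolding mat_def by blast
      then show ?thesis
        by (simp add: pd_lderiv[OF D] wick_simps[OF E] IH' algebra_simps sum_distrib_left)
    qed simp
    show ?thesis
      unfolding is_wickD(3)[OF E] sum_distrib_left * sum.distrib by (simp add: sum_distrib_left)
  qed
  also have "(\<Sum>j\<in>I. \<Sum>k\<in>I. sg (p \<and> odd_ix i) * K i j * D k j * E (pd k f)) =
     (\<Sum>l\<in>I. \<Sum>k\<in>I. sg (p \<and> odd_ix i) * K i k * D l k * E (pd l f))"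
    by (rule sum.swap)
  finally have "E (?D (mon [i] * f)) = (\<Sum>l\<in>I. Rm p D K i l * E (pd l f)) + (\<Sum>j\<in>I. K i j * E (?T (pd j f)) / 2)"
    by (simp add: Rm_def[of p D K i] sum.distrib sum_distrib_right distrib_right)
  moreover have "E (?T (mon [i] * f)) = 2 * (\<Sum>l\<in>I. Rm p D K i l * E (pd l f)) + (\<Sum>j\<in>I. K i j * E (?T (pd j f)))"
  proof -
    have "sg (p \<and> odd_ix i) * (K i j * E (pd j (?T f))) = K i j * E (?T (pd j f))" for j
    proof (cases "K i j = 0")
      case False
      with K have "odd_ix i = odd_ix j" unfolding mat_def by blast
      then show ?thesis by (simp add: pd_T[OF R(2)] wick_simps[OF E])
    qed simp
    then have "(\<Sum>j\<in>I. sg (p \<and> odd_ix i) * (K i j * E (pd j (?T f)))) = (\<Sum>j\<in>I. K i j * E (?T (pd j f)))"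
      by (intro sum.cong refl)
    then show ?thesis
      by (simp add: T_mult_gen[OF R(2,1)] wick_simps[OF E] is_wickD(3)[OF E] sum_distrib_left)
  qed
  ultimately show "E (?D (mon [i] * f)) = E (?T (mon [i] * f)) / 2"
    by (simp flip: sum_divide_distrib)
qed

definition ev0 :: "'v spoly \<Rightarrow> real" where
  "ev0 = induced (\<lambda>w. if w = [] then 1 else 0)"

lemma koszul_sym_ev0: "koszul_sym (\<lambda>w. if w = [] then 1 else (0::real))"
  by (rule koszul_symI) simp

lemma linear_ev0: "linear ev0"
  unfolding ev0_def by (rule linear_induced[OF koszul_sym_ev0])

lemma ev0_one [simp]: "ev0 1 = 1"
  using induced_mon[OF koszul_sym_ev0, of "[]"] by (simp add: ev0_def)

lemma ev0_gen_mult [simp]: "ev0 (mon [i] * f) = 0"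
proof (rule linear_eq_mon[where f=f])
  show "ev0 (mon [i] * mon w) = 0" for w
    using induced_mon[OF koszul_sym_ev0, of "i # w"] by (simp add: ev0_def mon_Cons[of i w])
  show "linear (\<lambda>f. ev0 (mon [i] * f))" by (intro linear_fun_comp[OF linear_ev0] linear_intros)
qed (rule linear_zero)

text \<open>The degree \<open>2 n\<close> part of \<open>exp (T K / 2)\<close>, evaluated at the origin.\<close>
definition expT :: "('v \<Rightarrow> 'v \<Rightarrow> real) \<Rightarrow> nat \<Rightarrow> 'v spoly \<Rightarrow> real" where
  "expT K n f = ev0 ((T K ^^ n) f) / (2 ^ n * fact n)"

lemma linear_T_pow: "linear (T K ^^ n)"
  by (induction n) (auto intro: linear_T_comp simp: linear_ident' id_def)

lemma linear_expT: "linear (expT K n)"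
  unfolding expT_def divide_inverse
  by (rule linearI) (simp_all add: linear_add[OF linear_T_pow] linear_scale[OF linear_T_pow]
      linear_add[OF linear_ev0] linear_scale[OF linear_ev0] algebra_simps)

text \<open>The commutator of \<open>T M\<close> with multiplication by a coordinate is a first
  order operator commuting with \<open>T M\<close>, so a power behaves as under differentiation and
  produces the factor \<open>Suc n\<close>.\<close>

lemma T_pow_gen:
  assumes "mat False M" "msym M"
  shows "(T M ^^ Suc n) (mon [i] * f) =
     (2 * real (Suc n)) *\<^sub>R (\<Sum>l\<in>I. M i l *\<^sub>R (T M ^^ n) (pd l f)) + mon [i] * (T M ^^ Suc n) f"
proof (induction n)
  case 0
  then show ?case by (simp add: T_mult_gen[OF assms])
next
  case (Suc n)
  have c: "pd l ((T M ^^ k) g) = (T M ^^ k) (pd l g)" for l k g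
    by (induction k) (simp_all add: pd_T[OF assms(1)])
  have "(T M ^^ Suc (Suc n)) (mon [i] * f) = T M ((T M ^^ Suc n) (mon [i] * f))" by simp
  also have "\<dots> = (2 * real (Suc n)) *\<^sub>R (\<Sum>l\<in>I. M i l *\<^sub>R (T M ^^ Suc n) (pd l f)) +
     T M (mon [i] * (T M ^^ Suc n) f)"
    unfolding Suc.IH T_simps by simp
  also have "T M (mon [i] * (T M ^^ Suc n) f) =
     2 *\<^sub>R (\<Sum>l\<in>I. M i l *\<^sub>R (T M ^^ Suc n) (pd l f)) + mon [i] * (T M ^^ Suc (Suc n)) f"
    unfolding T_mult_gen[OF assms] c by simp
  finally show ?case by (simp add: algebra_simps flip: scaleR_add_left)
qed

text \<open>At the origin the term that still carries the coordinate vanishes, and the factor 2 (n +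
  1) reduces the denominator for n + 1 to the one for n.\<close>

lemma expT_gen:
  assumes "mat False K" "msym K"
  shows "expT K (Suc n) (mon [i] * f) = (\<Sum>l\<in>I. K i l * expT K n (pd l f))"
proof -
  have "ev0 ((T K ^^ Suc n) (mon [i] * f)) = 2 * real (Suc n) * (\<Sum>l\<in>I. K i l * ev0 ((T K ^^ n) (pd l f)))"
    unfolding T_pow_gen[OF assms]
    by (simp add: linear_add[OF linear_ev0] linear_scale[OF linear_ev0] linear_sum[OF linear_ev0] del: funpow.simps)
  moreover have "(2 * real (Suc n) * x) / (2 ^ Suc n * fact (Suc n)) = x / (2 ^ n * fact n)" for x
    unfolding fact_Suc by (simp add: field_simps del: of_nat_Suc)
  ultimately show ?thesis
    by (simp add: expT_def sum_divide_distrib del: funpow.simps of_nat_Suc fact_Suc power_Suc)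
qed

text \<open>\<open>T K\<close> lowers the degree by two and the evaluation sees only constants, so
  on a word a single term of the exponential series survives; it is selected by length and no
  infinite series occurs.\<close>

definition wick :: "('v \<Rightarrow> 'v \<Rightarrow> real) \<Rightarrow> 'v spoly \<Rightarrow> real" where
  "wick K = induced (\<lambda>w. if even (length w) then expT K (length w div 2) (mon w) else 0)"

lemma is_wick_wick:
  assumes "mat False K" "msym K"
  shows "is_wick K (wick K)"
proof -
  have ks: "koszul_sym (\<lambda>w. if even (length w) then expT K (length w div 2) (mon w) else 0)"
    unfolding koszul_sym_def
  proof (intro allI)
    fix us vs and v w :: 'v
    have "mon (us @ [v, w] @ vs) = sg (odd_ix v \<and> odd_ix w) *\<^sub>R mon (us @ [w, v] @ vs)"
      using koszul_sym_mon unfolding koszul_sym_def by blast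
    then show "(if even (length (us @ [v, w] @ vs)) then expT K (length (us @ [v, w] @ vs) div 2) (mon (us @ [v, w] @ vs)) else 0) =
      sg (odd_ix v \<and> odd_ix w) *\<^sub>R (if even (length (us @ [w, v] @ vs)) then expT K (length (us @ [w, v] @ vs) div 2) (mon (us @ [w, v] @ vs)) else 0)"
      by (simp add: linear_scale[OF linear_expT])
  qed
  note L = linear_induced[OF ks, folded wick_def] and W = induced_mon[OF ks, folded wick_def]
  have part: "wick K f = (if even n then expT K (n div 2) f else 0)" if "f \<in> sym_part UNIV {n}" for n f
    using that L
  proof (rule sym_part_linear_eq)
    show "linear (\<lambda>f. if even n then expT K (n div 2) f else 0)"
      by (cases "even n") (auto intro: linear_expT linear_zero)
  qed (auto simp: W)
  have *: "wick K (mon [i] * f) = (\<Sum>j\<in>I. K i j * wick K (pd j f))" for i f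
  proof (rule linear_eq_mon[where f=f])
    fix w
    have iw: "mon [i] * mon w = mon (i # w)" by (simp add: mon_Cons[of i w])
    show "wick K (mon [i] * mon w) = (\<Sum>j\<in>I. K i j * wick K (pd j (mon w)))"
    proof (cases w)
      case Nil
      then show ?thesis by (simp add: W linear_0[OF L])
    next
      case (Cons v u)
      have p: "pd j (mon w) \<in> sym_part UNIV {length u}" for j
        using pd_sym_part[OF sym_part_mon[of w UNIV "{length w}"], of "{length u}" j] Cons by auto
      show ?thesis
      proof (cases "even (length u)")
        case True
        then obtain n where n: "length u = 2 * n" by (elim evenE)
        then have n': "length w = Suc (2 * n)" using Cons by simp
        show ?thesis
          unfolding iw W part[OF p] using True n n' expT_gen[OF assms, of n i "mon w"]
          by (simp add: iw)
      next
        case False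
        then show ?thesis unfolding iw W part[OF p] by (simp add: Cons)
      qed
    qed
  qed (intro linear_fun_comp[OF L] linear_intros)+
  have "wick K 1 = 1" using W[of "[]"] by (simp add: expT_def)
  with L * show ?thesis by (simp add: is_wick_def)
qed

text \<open>Formally the derivative of exp (T (K + t K') / 2). It is obtained by differentiating the
  recursion, whose right-hand side involves the derivatives of the polynomial; hence the induction
  treats all polynomials of bounded degree and all t at once.\<close>

lemma wick_has_derivative:
  assumes E: "\<And>t. is_wick (\<lambda>i j. K i j + t * K' i j) (E t)"
    and K: "\<And>t. mat False (\<lambda>i j. K i j + t * K' i j)" and K': "mat False K'" "msym K'"
  shows "((\<lambda>t. E t f) has_real_derivative E t (T K' f) / 2) (at t)"
proof -
  have *: "\<forall>f\<in>sym_part UNIV {..n}. \<forall>t. ((\<lambda>t. E t f) has_real_derivative E t (T K' f) / 2) (at t)" for n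
  proof (induction n)
    case 0
    show ?case
    proof
      fix f assume "f \<in> sym_part (UNIV :: 'v set) {..0}"
      then show "\<forall>t. ((\<lambda>t. E t f) has_real_derivative E t (T K' f) / 2) (at t)"
        unfolding sym_part_def
      proof (induction rule: span_induct_alt)
        case (step c x y)
        then show ?case
          by (auto simp: wick_simps[OF E] is_wickD(2)[OF E] intro!: derivative_eq_intros)
      qed (simp add: wick_simps[OF E])
    qed
  next
    case (Suc n)
    show ?case
    proof
      fix f assume "f \<in> sym_part (UNIV :: 'v set) {..Suc n}"
      then show "\<forall>t. ((\<lambda>t. E t f) has_real_derivative E t (T K' f) / 2) (at t)"
        unfolding sym_part_def
      proof (induction rule: span_induct_alt)
        case base
        then show ?case by (simp add: wick_simps[OF E])
      next
        case (step c x y)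
        then obtain w where w: "x = mon w" "length w \<le> Suc n" by auto
        have "((\<lambda>t. E t (mon w)) has_real_derivative E t (T K' (mon w)) / 2) (at t)" for t
        proof (cases w)
          case Nil
          then show ?thesis by (simp add: wick_simps[OF E] is_wickD(2)[OF E])
        next
          case (Cons i u)
          have u: "mon u \<in> sym_part UNIV {..n}" using w Cons by (intro sym_part_mon) auto
          have d: "((\<lambda>t. E t (pd j (mon u))) has_real_derivative E t (T K' (pd j (mon u))) / 2) (at t)" for j
            by (intro Suc[rule_format] pd_sym_part[OF u]) auto
          have "((\<lambda>t. \<Sum>j\<in>I. (K i j + t * K' i j) * E t (pd j (mon u))) has_real_derivative
             (\<Sum>j\<in>I. K' i j * E t (pd j (mon u)) + (E t (T K' (pd j (mon u))) / 2) * (K i j + t * K' i j))) (at t)"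
            by (auto intro!: derivative_eq_intros d)
          also have "(\<Sum>j\<in>I. K' i j * E t (pd j (mon u)) + (E t (T K' (pd j (mon u))) / 2) * (K i j + t * K' i j)) =
             E t (T K' (mon [i] * mon u)) / 2"
            unfolding T_mult_gen[OF K'] wick_simps[OF E] is_wickD(3)[OF E]
            by (simp add: sum.distrib pd_T[OF K'(1)] sum_divide_distrib sum_distrib_left add_divide_distrib algebra_simps)
          finally show ?thesis
            unfolding Cons mon_Cons[of i u] is_wickD(3)[OF E] .
        qed
        with step w show ?case
          by (auto simp: wick_simps[OF E] intro!: derivative_eq_intros)
      qed
    qed
  qed
  have "f \<in> sym_part UNIV UNIV" by simp
  then have "\<forall>t. ((\<lambda>t. E t f) has_real_derivative E t (T K' f) / 2) (at t)"
    unfolding sym_part_def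
  proof (induction rule: span_induct_alt)
    case base
    then show ?case by (simp add: wick_simps[OF E])
  next
    case (step c x y)
    then obtain w where w: "x = mon w" by auto
    have "\<forall>t. ((\<lambda>t. E t (mon w)) has_real_derivative E t (T K' (mon w)) / 2) (at t)"
      using *[of "length w"] sym_part_mon[of w UNIV "{..length w}"] by simp
    with step w show ?case
      by (auto simp: wick_simps[OF E] intro!: derivative_eq_intros)
  qed
  then show ?thesis by blast
qed

end

subsection \<open>Gaussian moments and Wick rotation\<close>

definition gmom :: "nat \<Rightarrow> real" where
  "gmom e = (LINT x|lborel. x ^ e * exp (- (1/2) * x\<^sup>2))"

lemma gmom_integral:
  "has_bochner_integral lborel (\<lambda>x. x ^ e * exp (- (1/2) * x\<^sup>2))
     (if even e then sqrt (2 * pi) * (fact e / (2 ^ (e div 2) * fact (e div 2))) else 0)"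
proof -
  have s: "has_bochner_integral lborel (\<lambda>x. sqrt (2 * pi) * (std_normal_density x * x ^ e')) (sqrt (2 * pi) * r)"
    if "has_bochner_integral lborel (\<lambda>x. std_normal_density x * x ^ e') r" for r e'
    using that by (rule has_bochner_integral_mult_right)
  have f: "(\<lambda>x::real. x ^ e * exp (- (1/2) * x\<^sup>2)) = (\<lambda>x. sqrt (2 * pi) * (std_normal_density x * x ^ e))"
    by (simp add: std_normal_density_def fun_eq_iff)
  show ?thesis
  proof (cases "even e")
    case True
    then obtain j where "e = 2 * j" by (elim evenE)
    then show ?thesis unfolding f using s[OF std_normal_moment_even[of j]] by simp
  next
    case False
    then obtain j where "e = 2 * j + 1" by (elim oddE)
    then show ?thesis unfolding f using s[OF std_normal_moment_odd[of j]] by simp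
  qed
qed

lemma gmom_eq: "gmom e = (if even e then sqrt (2 * pi) * (fact e / (2 ^ (e div 2) * fact (e div 2))) else 0)"
  unfolding gmom_def using gmom_integral by (rule has_bochner_integral_integral_eq)

lemma gmom_0: "gmom 0 \<noteq> 0"
  by (simp add: gmom_eq)

text \<open>Integration by parts in one variable, read off from the explicit moments. For
  \<open>e = 0\<close> the truncated \<open>e - 1\<close> is harmless because of the factor
  0.\<close>

lemma gmom_rec: "gmom (Suc e) = real e * gmom (e - 1)"
proof (cases e)
  case (Suc j)
  show ?thesis
  proof (cases "even j")
    case True
    then obtain i where i: "j = 2 * i" by (elim evenE)
    have "(fact (Suc (Suc (2 * i))) :: real) = (2 * real (Suc i)) * (real (Suc (2 * i)) * fact (2 * i))"
      by (simp add: algebra_simps)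
    moreover have "(fact (Suc i) :: real) = real (Suc i) * fact i" by simp
    ultimately show ?thesis unfolding Suc i
      by (simp add: gmom_eq field_simps del: of_nat_Suc fact_Suc)
  qed (simp add: Suc gmom_eq)
qed (simp add: gmom_eq)

lemma gauss_scaled:
  assumes "t > 0"
  shows "has_bochner_integral lborel (\<lambda>x. x ^ e * exp (- (1/2) * (t * x)\<^sup>2)) (gmom e / t ^ Suc e)"
proof -
  have "has_bochner_integral lborel (\<lambda>x. x ^ e * exp (- (1/2) * x\<^sup>2)) (gmom e)"
    using gmom_integral[of e] by (simp add: gmom_eq)
  then have "has_bochner_integral lborel (\<lambda>x. (0 + t * x) ^ e * exp (- (1/2) * (0 + t * x)\<^sup>2)) (gmom e /\<^sub>R \<bar>t\<bar>)"
    using assms by (subst (asm) lborel_has_bochner_integral_real_affine_iff[where c=t and t=0]) auto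
  then have "has_bochner_integral lborel (\<lambda>x. (1 / t ^ e) * ((0 + t * x) ^ e * exp (- (1/2) * (0 + t * x)\<^sup>2)))
     ((1 / t ^ e) * (gmom e /\<^sub>R \<bar>t\<bar>))"
    by (rule has_bochner_integral_mult_right)
  then show ?thesis
    using assms by (simp add: power_mult_distrib field_simps)
qed

lemma gauss_monomial:
  fixes e :: "nat \<Rightarrow> nat"
  assumes "t > 0" "k \<le> N"
  defines "f \<equiv> \<lambda>x. (\<Prod>i<N. x i ^ e i) * exp (- (1/2) * ((\<Sum>i<k. (x i)\<^sup>2) + (\<Sum>i\<in>{k..<N}. (t * x i)\<^sup>2)))"
  shows "integrable (PiM {..<N} (\<lambda>_. lborel)) f"
    "integral\<^sup>L (PiM {..<N} (\<lambda>_. lborel)) f = (\<Prod>i<N. gmom (e i) / (if i < k then 1 else t ^ Suc (e i)))"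
proof -
  interpret product_sigma_finite "\<lambda>_::nat. lborel :: real measure" by standard
  let ?g = "\<lambda>i x. x ^ e i * exp (- (1/2) * ((if i < k then 1 else t) * x)\<^sup>2)"
  have g: "has_bochner_integral lborel (?g i) (gmom (e i) / (if i < k then 1 else t ^ Suc (e i)))" for i
    using gauss_scaled[of "if i < k then 1 else t" "e i"] assms(1) by (auto split: if_splits)
  have u: "{..<N} = {..<k} \<union> {k..<N}" using assms(2) by auto
  have "(\<Sum>i<N. ((if i < k then 1 else t) * x i)\<^sup>2) = (\<Sum>i<k. (x i)\<^sup>2) + (\<Sum>i\<in>{k..<N}. (t * x i)\<^sup>2)" for x
    unfolding u by (subst sum.union_disjoint) auto
  then have "f x = (\<Prod>i<N. ?g i (x i))" for x
    unfolding f_def prod.distrib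
    by (simp only: exp_sum[symmetric] sum_distrib_left[symmetric] finite_lessThan)
  then have f: "f = (\<lambda>x. \<Prod>i<N. ?g i (x i))" by (rule ext)
  show "integrable (PiM {..<N} (\<lambda>_. lborel)) f"
    unfolding f by (rule product_integrable_prod) (use g in \<open>auto simp: has_bochner_integral_iff\<close>)
  show "integral\<^sup>L (PiM {..<N} (\<lambda>_. lborel)) f = (\<Prod>i<N. gmom (e i) / (if i < k then 1 else t ^ Suc (e i)))"
    unfolding f by (subst product_integral_prod) (use g in \<open>auto simp: has_bochner_integral_iff intro!: prod.cong\<close>)
qed

text \<open>Two continuations agree on the positive reals, which accumulate at 1 inside the
  connected punctured plane, so the identity theorem makes the choice in
  \<open>wick_integral\<close> irrelevant.\<close>

lemma wick_integral_eqI: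
  assumes "G holomorphic_on (- {0})" "\<And>t. t > 0 \<Longrightarrow> G (of_real t) = of_real (gauss_integral N k F t)"
  shows "wick_integral N k F = G \<i>"
proof -
  let ?P = "\<lambda>G. G holomorphic_on (- {0}) \<and> (\<forall>t>0. G (of_real t) = of_real (gauss_integral N k F t))"
  define G' where "G' = (SOME G. ?P G)"
  have "?P G'" unfolding G'_def by (rule someI[of ?P G]) (use assms in auto)
  then have G': "G' holomorphic_on (- {0})" "\<And>t. t > 0 \<Longrightarrow> G' (of_real t) = of_real (gauss_integral N k F t)"
    by auto
  have "G' \<i> - G \<i> = 0"
  proof (rule analytic_continuation[of "\<lambda>z. G' z - G z" "- {0}" "of_real ` {0<..}" 1])
    show "(\<lambda>z. G' z - G z) holomorphic_on - {0}" by (intro holomorphic_intros G' assms)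
    show "connected (- {0 :: complex})" by (rule connected_punctured_universe) simp
    show "(1 :: complex) islimpt of_real ` {0<..}"
      unfolding islimpt_approachable
    proof (intro allI impI)
      fix e :: real assume "e > 0"
      then have "(of_real (1 + e / 2) :: complex) \<in> of_real ` {0<..}"
        by (intro imageI) auto
      moreover have "of_real (1 + e / 2) \<noteq> (1::complex)" "dist (of_real (1 + e / 2)) (1::complex) < e"
        using \<open>e > 0\<close> by (auto simp: dist_norm)
      ultimately show "\<exists>x'\<in>of_real ` {0<..}. x' \<noteq> (1::complex) \<and> dist x' 1 < e" by blast
    qed
  qed (use G' assms in auto)
  then show ?thesis unfolding wick_integral_def G'_def by simp
qed

subsection \<open>The Berezin integral\<close>

definition inv_sgn :: "nat list \<Rightarrow> real" where
  "inv_sgn js = (-1) ^ card {(r, s). r < s \<and> s < length js \<and> js ! s < js ! r}"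

text \<open>Inversions are sorted by whether they involve the first position; those that do are
  counted by the smaller entries of the tail.\<close>

lemma inv_sgn_Cons: "inv_sgn (a # l) = (-1) ^ length (filter (\<lambda>b. b < a) l) * inv_sgn l"
proof -
  let ?S = "{(r, s). r < s \<and> s < length (a # l) \<and> (a # l) ! s < (a # l) ! r}"
  let ?A = "(\<lambda>i. (0::nat, Suc i)) ` {i. i < length l \<and> l ! i < a}"
  let ?B = "map_prod Suc Suc ` {(r, s). r < s \<and> s < length l \<and> l ! s < l ! r}"
  have fin: "finite {(r, s). r < s \<and> s < length l \<and> l ! s < l ! r}"
    by (rule finite_subset[of _ "{..<length l} \<times> {..<length l}"]) auto
  have "?S = ?A \<union> ?B"
  proof (rule set_eqI, safe)
    fix r s assume h: "r < s" "s < length (a # l)" "(a # l) ! s < (a # l) ! r" "(r, s) \<notin> ?B"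
    then obtain s' where s': "s = Suc s'" by (cases s) auto
    show "(r, s) \<in> ?A"
    proof (cases r)
      case 0
      then show ?thesis using h s' by auto
    next
      case (Suc r')
      then have "(r, s) = map_prod Suc Suc (r', s')" using s' by simp
      then show ?thesis using h s' Suc by auto
    qed
  qed auto
  moreover have "card (?A \<union> ?B) = card ?A + card ?B"
    by (rule card_Un_disjoint) (use fin in auto)
  moreover have "card ?A = length (filter (\<lambda>b. b < a) l)"
    by (subst card_image) (auto simp: inj_on_def length_filter_conv_card)
  moreover have "card ?B = card {(r, s). r < s \<and> s < length l \<and> l ! s < l ! r}"
    by (rule card_image) (auto simp: inj_on_def)
  ultimately have "card ?S = length (filter (\<lambda>b. b < a) l) + card {(r, s). r < s \<and> s < length l \<and> l ! s < l ! r}"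
    by simp
  then show ?thesis by (simp only: inv_sgn_def power_add)
qed

lemma inv_sgn_swap: "a \<noteq> b \<Longrightarrow> inv_sgn (xs @ a # b # ys) = - inv_sgn (xs @ b # a # ys)"
  by (induction xs) (auto simp: inv_sgn_Cons)

definition ods_of :: "cix list \<Rightarrow> nat list" where
  "ods_of w = [j. Od j \<leftarrow> w]"

lemma ods_of_simps [simp]: "ods_of [] = []" "ods_of (Ev i # w) = ods_of w" "ods_of (Od j # w) = j # ods_of w"
  "ods_of (u @ w) = ods_of u @ ods_of w"
  by (simp_all add: ods_of_def)

lemma set_ods_of [simp]: "j \<in> set (ods_of w) \<longleftrightarrow> Od j \<in> set w"
  by (induction w rule: list.induct) (auto simp: ods_of_def split: cix.splits)

definition bsgn :: "nat \<Rightarrow> cix list \<Rightarrow> real" where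
  "bsgn M w = (if distinct (ods_of w) \<and> set (ods_of w) = {..<M} then inv_sgn (ods_of w) else 0)"

abbreviation cnt :: "cix list \<Rightarrow> nat \<Rightarrow> nat" where
  "cnt w i \<equiv> count_list w (Ev i)"

lemma prod_evs:
  fixes x :: "nat \<Rightarrow> real"
  assumes "set w \<subseteq> evs N \<union> ods M"
  shows "prod_list [x i. Ev i \<leftarrow> w] = (\<Prod>i<N. x i ^ cnt w i)"
  using assms
proof (induction w)
  case (Cons v w)
  show ?case
  proof (cases v)
    case (Ev i)
    have i: "i < N" using Cons.prems Ev by auto
    have "(\<Prod>i'<N. x i' ^ cnt (v # w) i') = (\<Prod>i'<N. (if i' = i then x i' else 1) * x i' ^ cnt w i')"
      by (rule prod.cong) (auto simp: Ev)
    also have "\<dots> = x i * (\<Prod>i'<N. x i' ^ cnt w i')"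
      using i by (simp add: prod.distrib prod.delta)
    finally show ?thesis using Cons Ev by simp
  qed (use Cons in auto)
qed simp

lemma bsgn_swap:
  assumes "odd_ix v \<and> odd_ix w \<Longrightarrow> F = -1" "\<not> (odd_ix v \<and> odd_ix w) \<Longrightarrow> F = (1::real)"
  shows "bsgn M (us @ v # w # vs) = F * bsgn M (us @ w # v # vs)"
proof (cases "odd_ix v \<and> odd_ix w")
  case True
  then obtain a b where ab: "v = Od a" "w = Od b" by (cases v; cases w) auto
  show ?thesis
  proof (cases "a = b")
    case False
    then show ?thesis using True assms(1)
      by (auto simp: ab bsgn_def inv_sgn_swap[of a b])
  qed (simp add: ab bsgn_def)
next
  case False
  then show ?thesis using assms(2)
    by (cases v; cases w) (auto simp: bsgn_def)
qed

lemma berezin_def': "berezin M f x = induced (\<lambda>w. bsgn M w * prod_list [x i. Ev i \<leftarrow> w]) f"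
  unfolding berezin_def bsgn_def inv_sgn_def ods_of_def Let_def
  by (rule arg_cong[where f="\<lambda>F. induced F f"]) (auto simp: fun_eq_iff)

lemma koszul_sym_berezin: "koszul_sym (\<lambda>w. bsgn M w * prod_list [x i. Ev i \<leftarrow> w])"
proof (rule koszul_symI)
  fix us vs :: "cix list" and v w
  have "prod_list [x i. Ev i \<leftarrow> us @ v # w # vs] = prod_list [x i. Ev i \<leftarrow> us @ w # v # vs]"
    by (cases v; cases w) auto
  then show "bsgn M (us @ v # w # vs) * prod_list [x i. Ev i \<leftarrow> us @ v # w # vs] =
     sg (odd_ix v \<and> odd_ix w) *\<^sub>R (bsgn M (us @ w # v # vs) * prod_list [x i. Ev i \<leftarrow> us @ w # v # vs])"
    using bsgn_swap[of v w "sg (odd_ix v \<and> odd_ix w)" M us vs] by (simp add: sg_def)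
qed

lemma berezin_mon: "berezin M (mon w) x = bsgn M w * prod_list [x i. Ev i \<leftarrow> w]"
  unfolding berezin_def' by (rule induced_mon[OF koszul_sym_berezin])

lemma linear_berezin: "linear (\<lambda>f. berezin M f x)"
  unfolding berezin_def' by (rule linear_induced[OF koszul_sym_berezin])

locale wick_rotation =
  fixes N M k :: nat
  assumes kN: "k \<le> N"
begin

text \<open>On a monomial of degree \<open>e\<close> in one variable, scaling that variable by \<open>t\<close> yields a factor
  \<open>t ^ - Suc e\<close>, and Wick rotation puts \<open>t = \<i>\<close>.\<close>
definition mu :: "nat \<Rightarrow> nat \<Rightarrow> complex" where
  "mu i e = of_real (gmom e) / (if i < k then 1 else \<i> ^ Suc e)"

definition Jw :: "cix list \<Rightarrow> complex" where
  "Jw w = of_real (bsgn M w) * (\<Prod>i<N. mu i (cnt w i))"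

definition J :: "cix spoly \<Rightarrow> complex" where
  "J = induced Jw"

lemma koszul_sym_Jw: "koszul_sym Jw"
proof (rule koszul_symI)
  fix us vs :: "cix list" and v w
  have "cnt (us @ v # w # vs) i = cnt (us @ w # v # vs) i" for i by auto
  then show "Jw (us @ v # w # vs) = sg (odd_ix v \<and> odd_ix w) *\<^sub>R Jw (us @ w # v # vs)"
    using bsgn_swap[of v w "sg (odd_ix v \<and> odd_ix w)" M us vs]
    by (simp add: Jw_def sg_def scaleR_conv_of_real)
qed

lemma linear_J: "linear J"
  unfolding J_def by (rule linear_induced[OF koszul_sym_Jw])

lemma J_mon: "J (mon w) = Jw w"
  unfolding J_def by (rule induced_mon[OF koszul_sym_Jw])

lemmas J_simps = linear_0[OF linear_J] linear_add[OF linear_J] linear_scale[OF linear_J]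
  linear_diff[OF linear_J] linear_neg[OF linear_J]

abbreviation "gauss t x \<equiv> exp (- (1/2) * ((\<Sum>i<k. (x i)\<^sup>2) + (\<Sum>i\<in>{k..<N}. (t * x i)\<^sup>2)))"

text \<open>A continuation picked by choice is not visibly linear in the integrand. Therefore an
  explicit continuation is built along the span of monomials, together with the integrability needed
  to split the integral.\<close>

lemma wick_berezin:
  assumes "F \<in> sym_part (evs N \<union> ods M) UNIV"
  shows "wick_integral N k (berezin M F) = J F"
proof -
  have "\<exists>G. G holomorphic_on (- {0}) \<and> G \<i> = J F \<and>
     (\<forall>t>0. integrable (PiM {..<N} (\<lambda>_. lborel)) (\<lambda>x. berezin M F x * gauss t x) \<and>
       G (of_real t) = of_real (gauss_integral N k (berezin M F) t))"
    using assms unfolding sym_part_def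
  proof (induction rule: span_induct_alt)
    case base
    show ?case
      by (intro exI[of _ "\<lambda>_. 0"]) (simp add: J_simps gauss_integral_def linear_0[OF linear_berezin])
  next
    case (step c m F)
    then obtain w where w: "m = mon w" "set w \<subseteq> evs N \<union> ods M" by auto
    from step obtain G where G: "G holomorphic_on (- {0})" "G \<i> = J F"
      "\<And>t. t > 0 \<Longrightarrow> integrable (PiM {..<N} (\<lambda>_. lborel)) (\<lambda>x. berezin M F x * gauss t x)"
      "\<And>t. t > 0 \<Longrightarrow> G (of_real t) = of_real (gauss_integral N k (berezin M F) t)" by blast
    \<comment> \<open>The continuation for one monomial: its Gaussian integral factorises, and each
      rotated variable contributes a moment divided by a power of the parameter, holomorphic away
      from 0.\<close>
    define H where "H = (\<lambda>z. \<Prod>i<N. of_real (gmom (cnt w i)) / (if i < k then 1 else z ^ Suc (cnt w i)) :: complex)"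
    have Hh: "H holomorphic_on - {0}" unfolding H_def
    proof (intro holomorphic_on_prod)
      fix i
      show "(\<lambda>z. of_real (gmom (cnt w i)) / (if i < k then 1 else z ^ Suc (cnt w i))) holomorphic_on - {0 :: complex}"
        by (cases "i < k") (auto intro!: holomorphic_intros)
    qed
    have bw: "berezin M m x * gauss t x = bsgn M w * ((\<Prod>i<N. x i ^ cnt w i) * gauss t x)" for x t
      unfolding w(1) berezin_mon prod_evs[OF w(2)] by simp
    have mi: "integrable (PiM {..<N} (\<lambda>_. lborel)) (\<lambda>x. berezin M m x * gauss t x)"
      and mv: "gauss_integral N k (berezin M m) t =
         bsgn M w * (\<Prod>i<N. gmom (cnt w i) / (if i < k then 1 else t ^ Suc (cnt w i)))" if "t > 0" for t
      unfolding gauss_integral_def bw using gauss_monomial[OF that kN, of "cnt w"] by auto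
    have b: "berezin M (c *\<^sub>R m + F) x * gauss t x = c * (berezin M m x * gauss t x) + berezin M F x * gauss t x" for x t
      by (simp add: linear_add[OF linear_berezin] linear_scale[OF linear_berezin] algebra_simps)
    show ?case
    proof (intro exI[of _ "\<lambda>z. of_real c * (of_real (bsgn M w) * H z) + G z"] conjI allI impI)
      show "(\<lambda>z. of_real c * (of_real (bsgn M w) * H z) + G z) holomorphic_on - {0}"
        by (intro holomorphic_intros Hh G)
      show "of_real c * (of_real (bsgn M w) * H \<i>) + G \<i> = J (c *\<^sub>R m + F)"
        by (simp add: J_simps G w(1) J_mon Jw_def H_def mu_def scaleR_conv_of_real[where 'a=complex])
      fix t :: real assume t: "t > 0"
      show "integrable (PiM {..<N} (\<lambda>_. lborel)) (\<lambda>x. berezin M (c *\<^sub>R m + F) x * gauss t x)"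
        unfolding b using mi[OF t] G(3)[OF t] by auto
      have "gauss_integral N k (berezin M (c *\<^sub>R m + F)) t =
         c * gauss_integral N k (berezin M m) t + gauss_integral N k (berezin M F) t"
        unfolding gauss_integral_def b using mi[OF t] G(3)[OF t]
        by (subst Bochner_Integration.integral_add) auto
      then show "of_real c * (of_real (bsgn M w) * H (of_real t)) + G (of_real t) =
         of_real (gauss_integral N k (berezin M (c *\<^sub>R m + F)) t)"
        using t G(4)[OF t] by (simp add: mv H_def if_distrib cong: if_cong)
    qed
  qed
  then obtain G where "G holomorphic_on (- {0})" "G \<i> = J F"
     "\<And>t. t > 0 \<Longrightarrow> G (of_real t) = of_real (gauss_integral N k (berezin M F) t)" by blast
  then show ?thesis using wick_integral_eqI[of G] by simp
qed

lemma mon_front: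
  assumes "v \<in> set w"
  shows "\<exists>u c. mon w = c *\<^sub>R mon (v # u) \<and> mset w = add_mset v (mset u)"
  using assms
proof (induction w)
  case (Cons x w)
  show ?case
  proof (cases "x = v")
    case True
    then show ?thesis by (intro exI[of _ w] exI[of _ 1]) simp
  next
    case False
    then obtain u c where u: "mon w = c *\<^sub>R mon (v # u)" "mset w = add_mset v (mset u)" using Cons by auto
    have "mon (x # w) = (c * sg (odd_ix x \<and> odd_ix v)) *\<^sub>R mon (v # x # u)"
      using koszul_sym_mon[unfolded koszul_sym_def, rule_format, of "[]" x v u] u(1)
      by (simp add: mon_Cons[of x w] mon_Cons[of x "v # u"])
    then show ?thesis using u(2) by (metis add_mset_commute mset.simps(2))
  qed
qed simp

lemma mon_odd_sq: "odd_ix v \<Longrightarrow> mon [v] * mon [v] = (0 :: 'a::super_index spoly)"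
  using mon_swap[of v v] by (intro self_eq_neg) (simp add: mon_Cons[of v "[v]"])

text \<open>A monomial with a repeated odd letter is zero, and one containing \<open>Od j\<close>
  once loses it under the derivative; the Berezin integral needs every odd coordinate.\<close>

lemma J_pd_Od:
  assumes "j < M"
  shows "J (pd (Od j) F) = 0"
proof (rule linear_eq_mon[where f=F])
  show "linear (\<lambda>F. J (pd (Od j) F))" by (intro linear_fun_comp[OF linear_J] linear_intros)
  show "linear (\<lambda>F. 0 :: complex)" by (rule linear_zero)
  fix w
  have nz: "pd (Od j) (mon u) = 0" if "Od j \<notin> set u" for u
    using pd_sym_part_0[OF sym_part_mon[of u "set u" UNIV]] that by simp
  show "J (pd (Od j) (mon w)) = 0"
  proof (cases "Od j \<in> set w")
    case True
    then obtain u c where u: "mon w = c *\<^sub>R mon (Od j # u)" by (meson mon_front)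
    show ?thesis
    proof (cases "Od j \<in> set u")
      case True
      then obtain u' c' where u': "mon u = c' *\<^sub>R mon (Od j # u')" by (meson mon_front)
      have "mon w = (c * c') *\<^sub>R (mon [Od j] * mon [Od j] * mon u')"
        by (simp add: u u' mon_Cons[of "Od j" u] mon_Cons[of "Od j" u'] mult.assoc)
      then have "mon w = 0" using mon_odd_sq[of "Od j"] by simp
      then show ?thesis by (simp add: J_simps)
    next
      case False
      have "pd (Od j) (mon w) = c *\<^sub>R mon u"
        unfolding u mon_Cons[of "Od j" u] pd_simps pd_mult_gen nz[OF False] by simp
      moreover have "bsgn M u = 0"
        using False assms unfolding bsgn_def by (metis lessThan_iff set_ods_of)
      ultimately show ?thesis by (simp add: J_simps J_mon Jw_def)
    qed
  qed (simp add: nz J_simps)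
qed

text \<open>The prefix \<open>u\<close> collects the letters already passed by the Leibniz rule.
  Where the subtraction of 1 truncates, the factor \<open>cnt w i\<close> is 0.\<close>

lemma J_pd_Ev_word:
  "J (mon u * pd (Ev i) (mon w)) =
     of_nat (cnt w i) * (of_real (bsgn M (u @ w)) * (\<Prod>i'<N. mu i' (cnt (u @ w) i' - (if i' = i then 1 else 0))))"
proof (induction w arbitrary: u)
  case (Cons v w)
  have 1: "mon u * (mon [v] * pd (Ev i) (mon w)) = mon (u @ [v]) * pd (Ev i) (mon w)"
    by (simp add: mon_append mult.assoc)
  show ?case
  proof (cases "v = Ev i")
    case True
    have 2: "J (mon u * mon w) =
      of_real (bsgn M (u @ v # w)) * (\<Prod>i'<N. mu i' (cnt (u @ v # w) i' - (if i' = i then 1 else 0)))"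
    proof -
      have "cnt (u @ w) i' = cnt (u @ v # w) i' - (if i' = i then 1 else 0)" for i'
        using True by auto
      moreover have "bsgn M (u @ v # w) = bsgn M (u @ w)" using True by (simp add: bsgn_def)
      ultimately show ?thesis unfolding mon_append[symmetric] J_mon Jw_def by presburger
    qed
    show ?thesis
      unfolding mon_Cons[of v w] pd_mult_gen distrib_left
      using True Cons.IH[of "u @ [v]"] by (simp add: 1[unfolded True] J_simps 2[unfolded True] algebra_simps)
  next
    case False
    then show ?thesis
      unfolding mon_Cons[of v w] pd_mult_gen distrib_left
      using Cons.IH[of "u @ [v]"] by (simp add: 1 J_simps)
  qed
qed (simp add: J_simps)

definition lam :: "nat \<Rightarrow> real" where "lam i = (if i < k then 1 else -1)"

text \<open>For a rotated variable the two denominators differ by the square of the imaginary unit,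
  and this -1 is the sign of the variable in the quadratic form.\<close>

lemma mu_rec: "of_nat e * mu i (e - 1) = of_real (lam i) * mu i (Suc e)"
proof (cases e)
  case 0
  then show ?thesis by (simp add: mu_def gmom_rec)
next
  case (Suc j)
  have "gmom (Suc e) = real e * gmom (e - 1)" by (rule gmom_rec)
  then show ?thesis by (simp add: mu_def lam_def Suc field_simps)
qed

lemma J_pd_Ev:
  assumes i: "i < N"
  shows "J (pd (Ev i) F) = of_real (lam i) * J (mon [Ev i] * F)"
proof (rule linear_eq_mon[where f=F])
  show "linear (\<lambda>F. J (pd (Ev i) F))" by (intro linear_fun_comp[OF linear_J] linear_intros)
  show "linear (\<lambda>F. of_real (lam i) * J (mon [Ev i] * F))"
    unfolding scaleR_conv_of_real[symmetric]
    by (intro linear_scaleR_compose linear_fun_comp[OF linear_J] linear_intros)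
  fix w
  let ?R = "\<Prod>i'\<in>{..<N} - {i}. mu i' (cnt w i')"
  have "J (pd (Ev i) (mon w)) = of_nat (cnt w i) *
      (of_real (bsgn M w) * (\<Prod>i'<N. mu i' (cnt w i' - (if i' = i then 1 else 0))))"
    using J_pd_Ev_word[of "[]" i w] by simp
  also have "(\<Prod>i'<N. mu i' (cnt w i' - (if i' = i then 1 else 0))) = mu i (cnt w i - 1) * ?R"
    using i by (subst prod.remove[of _ i]) (auto intro!: prod.cong)
  also have "of_nat (cnt w i) * (of_real (bsgn M w) * (mu i (cnt w i - 1) * ?R)) =
      of_real (bsgn M w) * ((of_nat (cnt w i) * mu i (cnt w i - 1)) * ?R)" by simp
  also have "\<dots> = of_real (lam i) * (of_real (bsgn M (Ev i # w)) * (mu i (Suc (cnt w i)) * ?R))"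
    unfolding mu_rec by (simp add: bsgn_def)
  also have "mu i (Suc (cnt w i)) * ?R = (\<Prod>i'<N. mu i' (cnt (Ev i # w) i'))"
    using i by (subst prod.remove[of "{..<N}" i]) (auto intro!: prod.cong)
  finally show "J (pd (Ev i) (mon w)) = of_real (lam i) * J (mon [Ev i] * mon w)"
    by (simp add: J_mon Jw_def flip: mon_Cons)
qed

text \<open>Pigeonhole: more than \<open>M\<close> letters out of \<open>M\<close> odd ones contain
  a repetition, and moving the two equal letters together exhibits an odd square.\<close>

lemma ods_part_0:
  assumes "F \<in> sym_part (ods M) K" "\<And>n. n \<in> K \<Longrightarrow> M < n"
  shows "F = 0"
  using assms(1) linear_ident' linear_zero
proof (rule sym_part_linear_eq)
  fix w assume w: "set w \<subseteq> ods M" "length w \<in> K"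
  have "\<not> distinct w"
  proof
    assume "distinct w"
    then have "length w = card (set w)" by (simp add: distinct_card)
    also have "\<dots> \<le> card (ods M)" using w by (intro card_mono) auto
    also have "\<dots> \<le> M" using card_image_le[of "{..<M}" Od] by simp
    finally show False using assms(2)[OF w(2)] by simp
  qed
  then obtain xs ys zs y where d: "w = xs @ [y] @ ys @ [y] @ zs" by (blast dest: not_distinct_decomp)
  have "y \<in> ods M" using w d by auto
  then have "odd_ix y" by auto
  obtain u c where u: "mon (ys @ [y]) = c *\<^sub>R mon (y # u)" using mon_front[of y "ys @ [y]"] by auto
  have "mon w = mon xs * mon [y] * mon (ys @ [y]) * mon zs"
    by (simp only: d mon_append mult.assoc)
  also have "\<dots> = c *\<^sub>R (mon xs * (mon [y] * mon [y]) * mon u * mon zs)"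
    unfolding u mon_Cons[of y u] by (simp add: mult.assoc)
  finally have "mon w = c *\<^sub>R (mon xs * (mon [y] * mon [y]) * mon u * mon zs)" .
  then show "mon w = 0" using mon_odd_sq[OF \<open>odd_ix y\<close>] by simp
qed

end

section \<open>Schwinger-Dyson equations for the superintegral\<close>

locale gauss_coords = wick_rotation +
  fixes q :: "cix \<Rightarrow> cix \<Rightarrow> real" and so :: "cix spoly"
  assumes q_sym: "\<And>c c'. c \<in> evs N \<union> ods M \<Longrightarrow> c' \<in> evs N \<union> ods M \<Longrightarrow> q c' c = sg (odd_ix c \<and> odd_ix c') * q c c'"
    and q_even: "\<And>c c'. c \<in> evs N \<union> ods M \<Longrightarrow> c' \<in> evs N \<union> ods M \<Longrightarrow> odd_ix c \<noteq> odd_ix c' \<Longrightarrow> q c c' = 0"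
    and so: "so = (1/2) *\<^sub>R (\<Sum>c\<in>ods M. \<Sum>c'\<in>ods M. q c c' *\<^sub>R mon [c, c'])"
    and q_ev: "\<And>i. i < N \<Longrightarrow> (\<Sum>c\<in>evs N. q (Ev i) c *\<^sub>R mon [c]) = lam i *\<^sub>R mon [Ev i]"
begin

abbreviation "CC \<equiv> evs N \<union> ods M"

definition expo :: "cix spoly" where
  "expo = (\<Sum>r\<le>M. (1 / fact r) *\<^sub>R (- so) ^ r)"

definition II :: "cix spoly \<Rightarrow> complex" where
  "II f = J (f * expo)"

lemma linear_II: "linear II"
  unfolding II_def by (intro linear_fun_comp[OF linear_J] linear_intros)

lemma so_homog: "so \<in> homog False"
  unfolding so by (intro homog_simps homog_sum homog_mon) auto

lemma so_part: "so \<in> sym_part (ods M) {2}"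
  unfolding so by (intro subspace_scale subspace_sum sym_part_mon subspace_sym_part) auto

lemma so_pow_part: "(- so) ^ r \<in> sym_part (ods M) {2 * r}"
proof (induction r)
  case 0
  show ?case using sym_part_mon[of "[]" "ods M" "{0}"] by simp
next
  case (Suc r)
  have "- so \<in> sym_part (ods M) {2}" by (intro subspace_neg subspace_sym_part so_part)
  then show ?case using sym_part_mult[OF _ Suc, of "- so" "{2}" "{2 * Suc r}"] by simp
qed

lemma expo_part: "expo \<in> sym_part (ods M) UNIV"
  unfolding expo_def
  using so_pow_part sym_part_mono[of "ods M" "ods M" _ UNIV]
  by (intro subspace_sum subspace_scale subspace_sym_part) blast

definition dso :: "nat \<Rightarrow> cix spoly" where
  "dso j = (\<Sum>c\<in>ods M. q (Od j) c *\<^sub>R mon [c])"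

lemma dso_homog: "dso j \<in> homog True"
  unfolding dso_def
proof (intro homog_sum homog_simps)
  fix c assume "c \<in> ods M"
  then have "odd_ix c" by auto
  then show "mon [c] \<in> homog True" using homog_cong[OF homog_mon1[of c], of True] by simp
qed

text \<open>On odd coordinates \<open>q\<close> is antisymmetric and odd letters anticommute, so
  both slots contribute equally and cancel the factor 1/2.\<close>

lemma pd_so:
  assumes "j < M"
  shows "pd (Od j) so = dso j"
proof -
  have p: "pd (Od j) (mon [c, c']) = (if c = Od j then mon [c'] else 0) - (if c' = Od j then mon [c] else 0)"
    if "c \<in> ods M" for c c'
    using that unfolding mon_Cons[of c "[c']"] pd_mult_gen by auto
  have "pd (Od j) so = (1/2) *\<^sub>R (\<Sum>c\<in>ods M. \<Sum>c'\<in>ods M. q c c' *\<^sub>R pd (Od j) (mon [c, c']))"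
    unfolding so by simp
  also have "\<dots> = (1/2) *\<^sub>R (\<Sum>c\<in>ods M. \<Sum>c'\<in>ods M. (if c = Od j then q c c' *\<^sub>R mon [c'] else 0)
     - (if c' = Od j then q c c' *\<^sub>R mon [c] else 0))"
    by (intro arg_cong[where f="\<lambda>x. (1/2) *\<^sub>R x"] sum.cong refl) (simp add: p)
  also have "\<dots> = (1/2) *\<^sub>R ((\<Sum>c'\<in>ods M. q (Od j) c' *\<^sub>R mon [c']) - (\<Sum>c\<in>ods M. q c (Od j) *\<^sub>R mon [c]))"
  proof -
    have "(\<Sum>c\<in>ods M. \<Sum>c'\<in>ods M. if c = Od j then q c c' *\<^sub>R mon [c'] else 0) =
        (\<Sum>c\<in>ods M. if c = Od j then \<Sum>c'\<in>ods M. q c c' *\<^sub>R mon [c'] else 0)"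
      by (rule sum.cong) auto
    then show ?thesis using assms by (simp add: sum_subtractf)
  qed
  also have "(\<Sum>c\<in>ods M. q c (Od j) *\<^sub>R mon [c]) = - dso j"
    unfolding dso_def sum_negf[symmetric]
  proof (intro sum.cong refl)
    fix c assume "c \<in> ods M"
    then show "q c (Od j) *\<^sub>R mon [c] = - (q (Od j) c *\<^sub>R mon [c])"
      using q_sym[of "Od j" c] assms by auto
  qed
  finally show ?thesis by (simp add: dso_def flip: scaleR_2)
qed

lemma pd_so_pow:
  assumes "j < M"
  shows "pd (Od j) ((- so) ^ Suc r) = - (real (Suc r) *\<^sub>R (dso j * (- so) ^ r))"
proof (induction r)
  case 0
  then show ?case by (simp add: pd_so[OF assms])
next
  case (Suc r)
  have c: "so * dso j = dso j * so" using supercommute[OF so_homog dso_homog] by simp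
  have "pd (Od j) ((- so) ^ Suc (Suc r)) = pd (Od j) (- so) * (- so) ^ Suc r + (- so) * pd (Od j) ((- so) ^ Suc r)"
    using pd_mult[of "- so" False "Od j" "(- so) ^ Suc r"] so_homog by simp
  also have "\<dots> = - (dso j * (- so) ^ Suc r) - real (Suc r) *\<^sub>R (dso j * (- so) ^ Suc r)"
    unfolding Suc.IH by (simp add: pd_so[OF assms] mult.assoc[symmetric] c)
  finally show ?case by (simp add: algebra_simps scaleR_2)
qed

lemma pd_expo_Od:
  assumes "j < M"
  shows "pd (Od j) expo = - (dso j * expo)"
proof -
  \<comment> \<open>Differentiating the truncated exponential lowers its order by one; the missing
    top term has degree 2 M + 1 in \<open>M\<close> odd coordinates and is zero.\<close>
  have "dso j * (- so) ^ M \<in> sym_part (ods M) {2 * M + 1}"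
    by (rule sym_part_mult[OF _ so_pow_part, of _ "{1}"])
      (auto simp: dso_def intro!: subspace_sum subspace_scale sym_part_mon)
  then have z: "dso j * (- so) ^ M = 0" by (rule ods_part_0) auto
  obtain M' where M': "M = Suc M'" using assms by (cases M) auto
  have "pd (Od j) expo = (\<Sum>r\<le>M. (1 / fact r) *\<^sub>R pd (Od j) ((- so) ^ r))"
    by (simp add: expo_def)
  also have "\<dots> = (\<Sum>r\<le>M'. (1 / fact (Suc r)) *\<^sub>R pd (Od j) ((- so) ^ Suc r))"
    unfolding M' by (subst sum.atMost_Suc_shift) simp
  also have "\<dots> = (\<Sum>r\<le>M'. - (dso j * ((1 / fact r) *\<^sub>R (- so) ^ r)))"
    unfolding pd_so_pow[OF assms] fact_Suc by (simp add: field_simps del: of_nat_Suc)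
  also have "\<dots> = (\<Sum>r\<le>M. - (dso j * ((1 / fact r) *\<^sub>R (- so) ^ r)))"
    using z by (simp add: M')
  finally show ?thesis by (simp add: expo_def sum_distrib_left sum_negf)
qed

lemma pd_expo_Ev: "pd (Ev i) expo = 0"
  by (rule pd_sym_part_0[OF expo_part]) auto

text \<open>The integral of a total derivative vanishes. For even coordinates the weight is hidden
  in the moments, so this is \<open>J_pd_Ev\<close>; for odd ones the derivative of
  \<open>expo\<close> supplies the linear factor.\<close>

lemma schwinger_dyson:
  assumes "c \<in> CC"
  shows "II (pd c f) = II ((\<Sum>c'\<in>CC. q c c' *\<^sub>R mon [c']) * f)"
proof (rule linear_eq_mon[where f=f])
  show "linear (\<lambda>f. II (pd c f))" "linear (\<lambda>f. II ((\<Sum>c'\<in>CC. q c c' *\<^sub>R mon [c']) * f))"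
    by (intro linear_fun_comp[OF linear_II] linear_intros)+
  fix w
  have dis: "evs N \<inter> ods M = {}" by auto
  show "II (pd c (mon w)) = II ((\<Sum>c'\<in>CC. q c c' *\<^sub>R mon [c']) * mon w)"
  proof (cases c)
    case (Ev i)
    then have i: "i < N" using assms by auto
    have "q c c' = 0" if "c' \<in> ods M" for c' using q_even[OF assms, of c'] that Ev by auto
    then have s: "(\<Sum>c'\<in>CC. q c c' *\<^sub>R mon [c']) = lam i *\<^sub>R mon [Ev i]"
      using q_ev[OF i] Ev by (simp add: sum.union_disjoint dis)
    have "J (pd (Ev i) (mon w * expo)) = J (pd (Ev i) (mon w) * expo)"
      using pd_mult[of "mon w" "odd_word w" "Ev i" expo] by (simp add: homog_mon pd_expo_Ev)
    then show ?thesis using J_pd_Ev[OF i, of "mon w * expo"]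
      by (simp add: II_def s[unfolded Ev] Ev mult.assoc J_simps scaleR_conv_of_real[where 'a=complex])
  next
    case (Od j)
    then have j: "j < M" using assms by auto
    have "q c c' = 0" if "c' \<in> evs N" for c' using q_even[OF assms, of c'] that Od by auto
    then have s: "(\<Sum>c'\<in>CC. q c c' *\<^sub>R mon [c']) = dso j"
      using Od by (simp add: sum.union_disjoint dis dso_def)
    have c: "mon w * dso j = sg (odd_word w) *\<^sub>R (dso j * mon w)"
      using supercommute[OF homog_mon[of w "odd_word w"] dso_homog] by simp
    have "0 = J (pd (Od j) (mon w * expo))" by (simp add: J_pd_Od[OF j])
    also have "pd (Od j) (mon w * expo) = pd (Od j) (mon w) * expo - dso j * mon w * expo"
      using pd_mult[of "mon w" "odd_word w" "Od j" expo]
      by (simp add: homog_mon pd_expo_Od[OF j] mult.assoc[symmetric] c)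
    finally show ?thesis by (simp add: II_def s[unfolded Od] Od J_simps)
  qed
qed

text \<open>The product of all odd coordinates annihilates every term of the exponential except 1
  and leaves a product of Gaussian normalisations. Testing on it instead of on 1 avoids the Pfaffian
  of the odd form.\<close>

lemma II_nonzero: "\<exists>w. set w \<subseteq> CC \<and> II (mon w) \<noteq> 0"
proof (intro exI conjI)
  let ?w = "map Od [0..<M]"
  show "set ?w \<subseteq> CC" by auto
  have "mon ?w * expo = (\<Sum>r\<le>M. (1 / fact r) *\<^sub>R (mon ?w * (- so) ^ r))"
    by (simp add: expo_def sum_distrib_left)
  also have "\<dots> = (\<Sum>r\<le>M. if r = 0 then mon ?w else 0)"
  proof (rule sum.cong[OF refl])
    fix r
    have "mon ?w * (- so) ^ r \<in> sym_part (ods M) {M + 2 * r}"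
      by (rule sym_part_mult[OF sym_part_mon[of _ _ "{M}"] so_pow_part]) auto
    then show "(1 / fact r) *\<^sub>R (mon ?w * (- so) ^ r) = (if r = 0 then mon ?w else 0)"
      using ods_part_0[of _ "{M + 2 * r}"] by auto
  qed
  finally have "II (mon ?w) = Jw ?w" by (simp add: II_def J_mon)
  moreover have "ods_of (map Od l) = l" for l by (induction l) auto
  then have "bsgn M ?w \<noteq> 0" by (auto simp: bsgn_def inv_sgn_def)
  moreover have "mu i (cnt ?w i) \<noteq> 0" for i
  proof -
    have "cnt (map Od l) i = 0" for l by (induction l) auto
    then show ?thesis by (simp add: mu_def gmom_0)
  qed
  ultimately show "II (mon ?w) \<noteq> 0" by (simp add: Jw_def)
qed

lemma wick_II:
  assumes "f \<in> sym_part CC UNIV"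
  shows "wick_integral N k (berezin M (f * expo)) = II f"
  unfolding II_def
proof (rule wick_berezin)
  have "expo \<in> sym_part CC UNIV"
    using expo_part sym_part_mono[of "ods M" CC UNIV UNIV] by auto
  then show "f * expo \<in> sym_part CC UNIV" by (rule sym_part_mult[OF assms]) auto
qed

end

subsection \<open>Odd Frobenius algebras\<close>

text \<open>Elements of A are pairs of an even and an odd part, but quantifiers over A are meant to
  stay unsplit.\<close>

declare split_paired_All [simp del] split_paired_Ex [simp del]

text \<open>The duality fact behind the construction of dual bases below.\<close>

lemma functional_in_span:
  fixes \<phi> :: "'i \<Rightarrow> 'a::real_vector \<Rightarrow> real"
  assumes "finite S" "\<And>i. i \<in> S \<Longrightarrow> linear (\<phi> i)" "linear \<psi>"
    "\<And>x. (\<And>i. i \<in> S \<Longrightarrow> \<phi> i x = 0) \<Longrightarrow> \<psi> x = 0"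
  shows "\<exists>c. \<forall>x. \<psi> x = (\<Sum>i\<in>S. c i * \<phi> i x)"
  using assms
proof (induction S arbitrary: \<psi> rule: finite_induct)
  case empty
  then show ?case by auto
next
  case (insert j S)
  show ?case
  proof (cases "\<forall>x. (\<forall>i\<in>S. \<phi> i x = 0) \<longrightarrow> \<phi> j x = 0")
    case True
    then obtain c where c: "\<forall>x. \<psi> x = (\<Sum>i\<in>S. c i * \<phi> i x)"
      using insert.IH[of \<psi>] insert.prems by fastforce
    have "(\<Sum>i\<in>insert j S. (c(j := 0)) i * \<phi> i x) = (\<Sum>i\<in>S. c i * \<phi> i x)" for x
      using insert.hyps by (simp, intro sum.cong) auto
    with c show ?thesis by metis
  next
    case False
    then obtain x1 where x1: "\<forall>i\<in>S. \<phi> i x1 = 0" "\<phi> j x1 \<noteq> 0" by blast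
    define x0 where "x0 = (1 / \<phi> j x1) *\<^sub>R x1"
    have x0: "\<forall>i\<in>S. \<phi> i x0 = 0" "\<phi> j x0 = 1"
      using x1 insert.prems(1) by (auto simp: x0_def linear_scale)
    \<comment> \<open>\<open>x0\<close> is dual to the functional with index \<open>j\<close> and
      killed by the others, so this difference vanishes on the common kernel of \<open>S\<close>
      alone.\<close>
    let ?\<psi> = "\<lambda>x. \<psi> x - \<psi> x0 * \<phi> j x"
    have "linear ?\<psi>"
      by (intro linear_diff_compose linear_real_mult insert.prems) auto
    moreover have "?\<psi> x = 0" if h: "\<And>i. i \<in> S \<Longrightarrow> \<phi> i x = 0" for x
    proof -
      have "\<psi> (x - \<phi> j x *\<^sub>R x0) = 0"
        by (rule insert.prems(3))
          (use h x0 insert.prems(1) insert.hyps in \<open>auto simp: linear_diff linear_scale\<close>)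
      then show ?thesis using insert.prems(2) by (simp add: linear_diff linear_scale)
    qed
    ultimately obtain c where c: "\<forall>x. ?\<psi> x = (\<Sum>i\<in>S. c i * \<phi> i x)"
      using insert.IH[of ?\<psi>] insert.prems(1) by auto
    have "\<psi> x = (\<Sum>i\<in>insert j S. (c(j := \<psi> x0)) i * \<phi> i x)" for x
    proof -
      have "(\<Sum>i\<in>S. (c(j := \<psi> x0)) i * \<phi> i x) = (\<Sum>i\<in>S. c i * \<phi> i x)"
        using insert.hyps by (intro sum.cong) auto
      then show ?thesis using insert.hyps spec[OF c, of x] by simp
    qed
    then show ?thesis by blast
  qed
qed

text \<open>An odd nondegenerate form pairs even with odd vectors, so A has dimension r|r, and a
  basis indexed by \<open>idx r\<close> can be chosen with \<open>Ev i\<close> dual to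
  \<open>Od i\<close>.\<close>

fun cdual :: "cix \<Rightarrow> cix" where
  "cdual (Ev i) = Od i"
| "cdual (Od i) = Ev i"

lemma cdual_cdual [simp]: "cdual (cdual a) = a"
  by (cases a) auto

lemma odd_cdual [simp]: "odd_ix (cdual a) = (\<not> odd_ix a)"
  by (cases a) auto

definition idx :: "nat \<Rightarrow> cix set" where "idx r = evs r \<union> ods r"

lemma finite_idx [simp]: "finite (idx r)"
  by (simp add: idx_def)

lemma cdual_idx [simp]: "cdual a \<in> idx r \<longleftrightarrow> a \<in> idx r"
  by (cases a) (auto simp: idx_def)

lemma sum_cdual: "(\<Sum>a\<in>idx r. F (cdual a)) = (\<Sum>a\<in>idx r. F a)"
  by (rule sum.reindex_bij_witness[of _ cdual cdual]) auto

lemma graded_part_subspace [simp]: "subspace (graded_part p)"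
  unfolding subspace_def graded_part_def by auto

lemma graded_simps [simp]: "0 \<in> graded_part p"
  "a \<in> graded_part p \<Longrightarrow> b \<in> graded_part p \<Longrightarrow> a + b \<in> graded_part p"
  "a \<in> graded_part p \<Longrightarrow> b \<in> graded_part p \<Longrightarrow> a - b \<in> graded_part p"
  "a \<in> graded_part p \<Longrightarrow> c *\<^sub>R a \<in> graded_part p"
  "(x, 0) \<in> graded_part False" "(0, y) \<in> graded_part True"
  by (auto simp: graded_part_def)

lemma graded_sum: "(\<And>i. i \<in> S \<Longrightarrow> F i \<in> graded_part p) \<Longrightarrow> sum F S \<in> graded_part p"
  by (rule subspace_sum[OF graded_part_subspace])

lemma twist_graded: "a \<in> graded_part p \<Longrightarrow> twist q a = sg (q \<and> p) *\<^sub>R a"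
  by (cases p; cases q) (auto simp: graded_part_def twist_def prod_eq_iff)

lemma twist_False [simp]: "twist False a = a"
  by (simp add: twist_def)

lemma linear_twist: "linear (twist p)"
  by (rule linearI) (auto simp: twist_def scaleR_add_right)

lemma linear_eq_graded:
  assumes "linear F" "linear G" "\<And>p a. a \<in> graded_part p \<Longrightarrow> F a = G a"
  shows "F a = G a"
proof -
  have "F ((fst a, 0) + (0, snd a)) = G ((fst a, 0) + (0, snd a))"
    using assms(3)[of "(fst a, 0)" False] assms(3)[of "(0, snd a)" True]
    unfolding linear_add[OF assms(1)] linear_add[OF assms(2)] by simp
  then show ?thesis by simp
qed

locale odd_frobenius = contractible_odd_frobenius mul d form
  for mul :: "'e::real_vector \<times> 'o::real_vector \<Rightarrow> 'e \<times> 'o \<Rightarrow> 'e \<times> 'o"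
    and d :: "'e \<times> 'o \<Rightarrow> 'e \<times> 'o" and form :: "'e \<times> 'o \<Rightarrow> 'e \<times> 'o \<Rightarrow> real"
begin

lemma form_linear: "linear (form a)" "linear (\<lambda>a. form a b)"
  using form_bilinear unfolding bilinear_def by blast+

lemma form_simps [simp]:
  "form 0 b = 0" "form a 0 = 0" "form (a + a') b = form a b + form a' b" "form a (b + b') = form a b + form a b'"
  "form (a - a') b = form a b - form a' b" "form a (b - b') = form a b - form a b'"
  "form (c *\<^sub>R a) b = c * form a b" "form a (c *\<^sub>R b) = c * form a b"
  "form (- a) b = - form a b" "form a (- b) = - form a b"
  "form (sum F' S) b = (\<Sum>i\<in>S. form (F' i) b)" "form a (sum F S) = (\<Sum>i\<in>S. form a (F i))"
  using linear_0[OF form_linear(1)] linear_0[OF form_linear(2)]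
    linear_add[OF form_linear(1)] linear_add[OF form_linear(2)]
    linear_diff[OF form_linear(1)] linear_diff[OF form_linear(2)]
    linear_scale[OF form_linear(1)] linear_scale[OF form_linear(2)]
    linear_neg[OF form_linear(1)] linear_neg[OF form_linear(2)]
    linear_sum[OF form_linear(2), of F' S] linear_sum[OF form_linear(1), of _ F S]
  by (simp_all del: split_paired_All)

lemma mul_simps [simp]:
  "mul 0 b = 0" "mul a 0 = 0" "mul (a + a') b = mul a b + mul a' b" "mul a (b + b') = mul a b + mul a b'"
  "mul (c *\<^sub>R a) b = c *\<^sub>R mul a b" "mul a (c *\<^sub>R b) = c *\<^sub>R mul a b"
  using bilinear_lzero[OF mul_bilinear] bilinear_rzero[OF mul_bilinear] bilinear_ladd[OF mul_bilinear]
    bilinear_radd[OF mul_bilinear] bilinear_lmul[OF mul_bilinear] bilinear_rmul[OF mul_bilinear]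
  by auto

lemmas d_simps [simp] = linear_0[OF d_linear] linear_add[OF d_linear] linear_diff[OF d_linear]
  linear_scale[OF d_linear] linear_neg[OF d_linear] linear_sum[OF d_linear]

text \<open>Graded symmetry has a sign only between two odd arguments, and there the odd form
  vanishes; so it is plain symmetry.\<close>

lemma form_commute: "form a b = form b a"
proof -
  have 1: "form a b = form b a" if "a \<in> graded_part p" "b \<in> graded_part q" for a b p q
  proof (cases "p = q")
    case True
    then show ?thesis using form_odd[of a p b] form_odd[of b p a] that by simp
  next
    case False
    then have "(p \<and> q) = False" by auto
    then show ?thesis using form_sym[OF that] by (simp only: sg_simps mult_1)
  qed
  have "form a ((fst b, 0) + (0, snd b)) = form ((fst b, 0) + (0, snd b)) a" for a b
  proof -
    have "form ((fst a, 0) + (0, snd a)) ((fst b, 0) + (0, snd b)) =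
      form ((fst b, 0) + (0, snd b)) ((fst a, 0) + (0, snd a))"
      using 1[of "(fst a, 0)" False "(fst b, 0)" False] 1[of "(fst a, 0)" False "(0, snd b)" True]
        1[of "(0, snd a)" True "(fst b, 0)" False] 1[of "(0, snd a)" True "(0, snd b)" True]
      unfolding form_simps by simp
    then show ?thesis by simp
  qed
  then show ?thesis by simp
qed

text \<open>A basis of the even part is chosen freely; nondegeneracy provides odd vectors dual to it
  and shows that together they span.\<close>

lemma dual_basis_exists:
  "\<exists>r e. (\<forall>a\<in>idx r. e a \<in> graded_part (odd_ix a)) \<and>
     (\<forall>a\<in>idx r. \<forall>b\<in>idx r. form (e a) (e b) = (if b = cdual a then 1 else 0)) \<and>
     (\<forall>x. x = (\<Sum>a\<in>idx r. form x (e (cdual a)) *\<^sub>R e a))"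
proof -
  obtain B where B: "finite B" "span B = (UNIV :: ('e \<times> 'o) set)" using fin_dim by blast
  have "span (fst ` B) = fst ` span B"
    using linear_span_image[OF linear_fst, of B] by simp
  then have sp: "span (fst ` B) = (UNIV :: 'e set)" by (simp add: B)
  obtain B0 where B0: "B0 \<subseteq> fst ` B" "independent B0" "fst ` B \<subseteq> span B0"
    by (rule maximal_independent_subset)
  have fB0: "finite B0" using B0 B finite_subset by blast
  have "span B0 = UNIV" using span_minimal[OF B0(3) subspace_span] sp by auto
  obtain e0 where e0: "bij_betw e0 {0..<card B0} B0" using ex_bij_betw_nat_finite[OF fB0] by blast
  define r where "r = card B0"
  have e0': "bij_betw e0 {..<r} B0" using e0 by (simp add: r_def atLeast0LessThan)
  have indep: "c j = 0" if "(\<Sum>i<r. c i *\<^sub>R e0 i) = 0" "j < r" for c j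
  proof -
    have "(\<Sum>v\<in>B0. c (the_inv_into {..<r} e0 v) *\<^sub>R v) = (\<Sum>i<r. c i *\<^sub>R e0 i)"
      using e0' by (subst sum.reindex_bij_betw[OF e0', symmetric])
        (auto simp: the_inv_into_f_f bij_betw_def intro!: sum.cong)
    then have "c (the_inv_into {..<r} e0 (e0 j)) = 0"
      using independentD[OF B0(2) fB0 subset_refl, of "\<lambda>v. c (the_inv_into {..<r} e0 v)" "e0 j"] that
        e0' by (auto simp: bij_betw_def)
    then show ?thesis using e0' that by (simp add: bij_betw_def the_inv_into_f_f)
  qed
  \<comment> \<open>Otherwise pairing with \<open>e0 j\<close> would be a combination of the
    pairings with the other basis vectors, and the corresponding combination of vectors would lie in
    the radical, against independence.\<close>
  have "\<exists>y. \<forall>i<r. form (e0 i, 0) (0, y) = (if i = j then 1 else 0)" if j: "j < r" for j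
  proof (rule ccontr)
    assume no: "\<not> ?thesis"
    have lin: "linear (\<lambda>y. form (e0 i, 0) (0, y))" for i
      using form_simps(4)[of "(e0 i, 0)" "(0, _)" "(0, _)"] form_simps(8)[of "(e0 i, 0)" _ "(0, _)"]
      by (intro linearI) (simp_all del: form_simps)
    have "form (e0 j, 0) (0, y) = 0" if h: "\<And>i. i \<in> {..<r} - {j} \<Longrightarrow> form (e0 i, 0) (0, y) = 0" for y
    proof (rule ccontr)
      assume nz: "form (e0 j, 0) (0, y) \<noteq> 0"
      let ?y = "(1 / form (e0 j, 0) (0, y)) *\<^sub>R y"
      have "\<forall>i<r. form (e0 i, 0) (0, ?y) = (if i = j then 1 else 0)"
        using h nz by (auto simp: linear_scale[OF lin])
      with no show False by blast
    qed
    then obtain c where c: "\<forall>y. form (e0 j, 0) (0, y) = (\<Sum>i\<in>{..<r} - {j}. c i * form (e0 i, 0) (0, y))"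
      using functional_in_span[of "{..<r} - {j}" "\<lambda>i y. form (e0 i, 0) (0, y)" "\<lambda>y. form (e0 j, 0) (0, y)"] lin
      by auto
    let ?x = "(e0 j, 0) - (\<Sum>i\<in>{..<r} - {j}. c i *\<^sub>R (e0 i, 0)) :: 'e \<times> 'o"
    have xg: "?x \<in> graded_part False" by (intro graded_simps graded_sum)
    have "form ?x ((fst b, 0) + (0, snd b)) = 0" for b
      unfolding form_simps(4) using form_odd[OF xg, of "(fst b, 0)"] c
      by (simp del: scaleR_Pair)
    then have "?x = 0" by (intro form_nondeg) simp
    then have "fst ?x = 0" by simp
    then have "e0 j - (\<Sum>i\<in>{..<r} - {j}. c i *\<^sub>R e0 i) = 0" by (simp add: fst_sum)
    moreover have "(\<Sum>i<r. (if i = j then 1 else - c i) *\<^sub>R e0 i) =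
      e0 j - (\<Sum>i\<in>{..<r} - {j}. c i *\<^sub>R e0 i)"
      using j by (subst sum.remove[of _ j]) (auto simp: sum_negf[symmetric] intro!: sum.cong)
    ultimately show False using indep[of "\<lambda>i. if i = j then 1 else - c i" j] j by simp
  qed
  then obtain f0 where f0: "\<And>i j. i < r \<Longrightarrow> j < r \<Longrightarrow> form (e0 i, 0) (0, f0 j) = (if i = j then 1 else 0)"
    by metis
  define e where "e = (\<lambda>a. case a of Ev i \<Rightarrow> (e0 i, 0 :: 'o) | Od j \<Rightarrow> (0, f0 j))"
  have g: "e a \<in> graded_part (odd_ix a)" for a by (cases a) (auto simp: e_def)
  have f: "form (e a) (e b) = (if b = cdual a then 1 else 0)" if "a \<in> idx r" "b \<in> idx r" for a b
  proof (cases "odd_ix a = odd_ix b")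
    case True
    then show ?thesis using form_odd[OF g[of a], of "e b"] g[of b] by auto
  next
    case False
    then show ?thesis
      using that f0 form_commute[of "(0, f0 _)" "(e0 _, 0)"]
      by (cases a; cases b) (auto simp: e_def idx_def)
  qed
  have "x - (\<Sum>a\<in>idx r. form x (e (cdual a)) *\<^sub>R e a) = 0" (is "?y = 0") for x
  proof (rule form_nondeg)
    fix b
    have yb: "form ?y (e b) = 0" if "b \<in> idx r" for b
    proof -
      have "form (\<Sum>a\<in>idx r. form x (e (cdual a)) *\<^sub>R e a) (e b) =
          (\<Sum>a\<in>idx r. if a = cdual b then form x (e b) else 0)"
        unfolding form_simps by (intro sum.cong refl) (auto simp: f that)
      then show ?thesis using that by (simp add: sum.delta)
    qed
    have sp': "z \<in> span (e ` evs r)" if "z \<in> graded_part False" for z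
    proof -
      have "fst z \<in> span B0" using \<open>span B0 = UNIV\<close> by simp
      also have "B0 = e0 ` {..<r}" using e0' by (simp add: bij_betw_def)
      finally have "fst z \<in> span (e0 ` {..<r})" .
      then have "(fst z, 0 :: 'o) \<in> span ((\<lambda>x. (x, 0)) ` (e0 ` {..<r}))"
        by (subst linear_span_image) (auto intro!: linearI)
      also have "(\<lambda>x. (x, 0)) ` (e0 ` {..<r}) = e ` evs r" by (auto simp: e_def image_image)
      finally have "(fst z, 0) \<in> span (e ` evs r)" .
      moreover have "(fst z, 0) = z" using that by (simp add: graded_part_def prod_eq_iff)
      ultimately show ?thesis by simp
    qed
    have orth0: "form ?y z = 0" if "z \<in> graded_part False" for z
      using sp'[OF that]
    proof (induction rule: span_induct_alt)
      case (step c x y)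
      then show ?case using yb by (auto simp: idx_def)
    qed simp
    have odd0: "w = 0" if w: "w \<in> graded_part True" "\<And>z. z \<in> graded_part False \<Longrightarrow> form w z = 0" for w
    proof (rule form_nondeg)
      fix b
      have "form w ((fst b, 0) + (0, snd b)) = 0"
        unfolding form_simps(4) using w(2)[of "(fst b, 0)"] form_odd[OF w(1), of "(0, snd b)"] by simp
      then show "form w b = 0" by simp
    qed
    have "(0 :: 'e, snd ?y) = 0"
    proof (rule odd0)
      fix z :: "'e \<times> 'o" assume z: "z \<in> graded_part False"
      have "form ((fst ?y, 0) + (0, snd ?y)) z = 0"
        using orth0[OF z] by (simp only: add_Pair add_0_left add_0_right prod.collapse)
      then show "form (0, snd ?y) z = 0"
        unfolding form_simps(3) using form_odd[of "(fst ?y, 0)" False z] z by simp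
    qed simp
    then have ye: "?y \<in> graded_part False" by (simp add: graded_part_def prod_eq_iff)
    have orth1: "form ?y (e (Od j)) = 0" if "j < r" for j using yb[of "Od j"] that by (simp add: idx_def)
    have "?y \<in> span (e ` evs r)" by (rule sp'[OF ye])
    then obtain c where c: "?y = (\<Sum>i<r. c i *\<^sub>R e (Ev i))"
    proof -
      have "\<exists>c. z = (\<Sum>i<r. c i *\<^sub>R e (Ev i))" if "z \<in> span (e ` evs r)" for z
        using that
      proof (induction rule: span_induct_alt)
        case base
        show ?case by (intro exI[of _ "\<lambda>_. 0"]) simp
      next
        case (step t x y)
        then obtain i c where i: "x = e (Ev i)" "i < r" "y = (\<Sum>i<r. c i *\<^sub>R e (Ev i))" by auto
        have "t *\<^sub>R x = (\<Sum>i'<r. (if i' = i then t else 0) *\<^sub>R e (Ev i'))"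
          using i(1,2) by (simp add: if_distrib[of "\<lambda>c. c *\<^sub>R _"] sum.delta cong: if_cong)
        then show ?case using i
          by (intro exI[of _ "\<lambda>i'. (if i' = i then t else 0) + c i'"]) (simp add: scaleR_add_left sum.distrib)
      qed
      then show thesis using \<open>?y \<in> span (e ` evs r)\<close> that by blast
    qed
    have "c j = 0" if "j < r" for j
    proof -
      have "form ?y (e (Od j)) = (\<Sum>i<r. if i = j then c i else 0)"
        unfolding c form_simps using that by (intro sum.cong refl) (auto simp: f idx_def)
      then show ?thesis using orth1[OF that] that by simp
    qed
    then have "?y = 0" unfolding c by simp
    then show "form ?y b = 0" by (simp only: form_simps)
  qed
  then have "\<forall>x. x = (\<Sum>a\<in>idx r. form x (e (cdual a)) *\<^sub>R e a)" by simp
  then show ?thesis using g f by blast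
qed

section \<open>The contracting homotopy of an isotropic complement\<close>

definition hty :: "('e \<times> 'o) set \<Rightarrow> 'e \<times> 'o \<Rightarrow> 'e \<times> 'o" where
  "hty L a = (THE l. l \<in> L \<and> a - d l \<in> L)"

text \<open>Existence and uniqueness come from A = L + d(L), a direct decomposition into L and the
  image of L; \<open>hty L\<close> inverts d on the second summand and kills the first. Grading
  follows from L being graded, adjointness from L being isotropic.\<close>

lemma hty_props:
  assumes "isotropic_complement d form L"
  shows hty_eqI: "\<And>a l. l \<in> L \<Longrightarrow> a - d l \<in> L \<Longrightarrow> hty L a = l"
    and hty_in: "\<And>a. hty L a \<in> L" "\<And>a. a - d (hty L a) \<in> L"
    and linear_hty: "linear (hty L)"
    and d_hty: "\<And>a. d (hty L a) + hty L (d a) = a"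
    and hty_graded: "\<And>a p. a \<in> graded_part p \<Longrightarrow> hty L a \<in> graded_part (\<not> p)"
    and hty_adjoint: "\<And>a b p. a \<in> graded_part p \<Longrightarrow> form (hty L a) b = sg p * form a (hty L b)"
proof -
  have L: "graded_subspace L" "\<And>a b. a \<in> L \<Longrightarrow> b \<in> L \<Longrightarrow> form a b = 0" "L \<inter> range d = {0}"
    "{l + d a | l a. l \<in> L} = UNIV"
    using assms by (auto simp: isotropic_complement_def max_isotropic_def isotropic_def)
  have sub: "subspace L" and gr: "\<And>a. a \<in> L \<Longrightarrow> (fst a, 0) \<in> L" "\<And>a. a \<in> L \<Longrightarrow> (0, snd a) \<in> L"
    using L(1) by (auto simp: graded_subspace_def)
  have uniq: "l = l'" if "l \<in> L" "l' \<in> L" "a - d l \<in> L" "a - d l' \<in> L" for a l l'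
  proof -
    have "(a - d l') - (a - d l) \<in> L" by (intro subspace_diff sub that)
    moreover have "(a - d l') - (a - d l) = d (l - l')" by simp
    ultimately have "d (l - l') \<in> L \<inter> range d" by (metis IntI rangeI)
    then have "d (l - l') = 0" unfolding L(3) by blast
    then have "l - l' \<in> L \<inter> range d" using contractible subspace_diff[OF sub that(1,2)] by blast
    then show ?thesis using L(3) by auto
  qed
  \<comment> \<open>The decomposition A = L + d(A) is applied twice; as d squares to zero, only the
    part in L of the preimage matters.\<close>
  have ex: "\<exists>l. l \<in> L \<and> a - d l \<in> L" for a
  proof -
    obtain l x where a: "a = l + d x" "l \<in> L" using L(4) by blast
    obtain l' y where x: "x = l' + d y" "l' \<in> L" using L(4) by blast
    have "a - d l' = l" using a x by (simp add: d_square)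
    then have "l' \<in> L \<and> a - d l' \<in> L" using a x by simp
    then show ?thesis by blast
  qed
  show eqI: "hty L a = l" if "l \<in> L" "a - d l \<in> L" for a l
    unfolding hty_def by (rule the_equality) (use that uniq in blast)+
  show inL: "hty L a \<in> L" and inL': "a - d (hty L a) \<in> L" for a
    using ex[of a] eqI by metis+
  show "linear (hty L)"
  proof (rule linearI; rule eqI)
    fix a b and c :: real
    show "hty L a + hty L b \<in> L" "c *\<^sub>R hty L a \<in> L" by (intro subspace_add subspace_scale sub inL)+
    have "(a - d (hty L a)) + (b - d (hty L b)) \<in> L" "c *\<^sub>R (a - d (hty L a)) \<in> L"
      by (intro subspace_add subspace_scale sub inL')+
    then show "a + b - d (hty L a + hty L b) \<in> L" "c *\<^sub>R a - d (c *\<^sub>R hty L a) \<in> L"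
      by (simp_all add: algebra_simps)
  qed
  show dh: "d (hty L a) + hty L (d a) = a" for a
  proof -
    have "d a - d (a - d (hty L a)) \<in> L" by (simp add: d_square subspace_0[OF sub])
    then have "hty L (d a) = a - d (hty L a)" by (intro eqI inL')
    then show ?thesis by simp
  qed
  show hg: "hty L a \<in> graded_part (\<not> p)" if a: "a \<in> graded_part p" for a p
  proof (cases p)
    case True
    \<comment> \<open>Discarding the component of the wrong parity gives another element satisfying
      the defining condition, so it equals the original by uniqueness.\<close>
    let ?l = "(fst (hty L a), 0) :: 'e \<times> 'o"
    have 1: "d (fst (hty L a), 0) \<in> graded_part True" "d (0, snd (hty L a)) \<in> graded_part False"
      using d_odd[of "(fst (hty L a), 0)" False] d_odd[of "(0, snd (hty L a))" True] by auto
    have "d (hty L a) = d (fst (hty L a), 0) + d (0, snd (hty L a))" by (simp flip: d_simps(2))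
    then have "a - d ?l = (0, snd (a - d (hty L a)))"
      using a True 1 by (auto simp: graded_part_def prod_eq_iff)
    then have "a - d ?l \<in> L" using gr(2)[OF inL'[of a]] by simp
    then have "hty L a = ?l" by (intro eqI gr inL)
    then show ?thesis using True by (metis graded_simps(5))
  next
    case False
    let ?l = "(0, snd (hty L a)) :: 'e \<times> 'o"
    have 1: "d (fst (hty L a), 0) \<in> graded_part True" "d (0, snd (hty L a)) \<in> graded_part False"
      using d_odd[of "(fst (hty L a), 0)" False] d_odd[of "(0, snd (hty L a))" True] by auto
    have "d (hty L a) = d (fst (hty L a), 0) + d (0, snd (hty L a))" by (simp flip: d_simps(2))
    then have "a - d ?l = (fst (a - d (hty L a)), 0)"
      using a False 1 by (auto simp: graded_part_def prod_eq_iff)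
    then have "a - d ?l \<in> L" using gr(1)[OF inL'[of a]] by simp
    then have "hty L a = ?l" by (intro eqI gr inL)
    then show ?thesis using False by (metis graded_simps(6))
  qed
  show "form (hty L a) b = sg p * form a (hty L b)" if a: "a \<in> graded_part p" for a b p
  proof -
    \<comment> \<open>The argument b is split as d s b + s d b; the second part lies in L and pairs
      to zero with s a. The same is then done on the other side.\<close>
    have "form (hty L a) b = form (hty L a) (d (hty L b)) + form (hty L a) (hty L (d b))"
      using dh[of b] by (simp flip: form_simps(4))
    also have "form (hty L a) (hty L (d b)) = 0" by (intro L(2) inL)
    also have "form (hty L a) (d (hty L b)) = sg p * form (d (hty L a)) (hty L b)"
      using form_d[OF hg[OF a], of "hty L b"] by (cases p) auto
    also have "form (d (hty L a)) (hty L b) = form a (hty L b) - form (hty L (d a)) (hty L b)"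
    proof -
      have "d (hty L a) = a - hty L (d a)" using dh[of a] by (simp add: eq_diff_eq)
      then show ?thesis by simp
    qed
    also have "form (hty L (d a)) (hty L b) = 0" by (intro L(2) inL)
    finally show ?thesis by simp
  qed
qed

end

subsection \<open>Adjoining a unit and a trace\<close>

text \<open>Elements of \<open>R + A + R \<tau>\<close>. With the product \<open>a b + \<langle>a, b\<rangle> \<tau>\<close> on \<open>A\<close> and the trace reading
  off the coefficient of \<open>\<tau>\<close>, the tensor \<open>m\<close> of the Frobenius algebra is the trace of an iterated product.\<close>
definition hmk :: "real \<Rightarrow> 'e \<times> 'o \<Rightarrow> real \<Rightarrow> (real \<times> 'e) \<times> ('o \<times> real)" where
  "hmk s a t = ((s, fst a), (snd a, t))"
definition hsc :: "(real \<times> 'e) \<times> ('o \<times> real) \<Rightarrow> real" where "hsc z = fst (fst z)"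
definition hA :: "(real \<times> 'e) \<times> ('o \<times> real) \<Rightarrow> 'e \<times> 'o" where "hA z = (snd (fst z), fst (snd z))"
definition htr :: "(real \<times> 'e) \<times> ('o \<times> real) \<Rightarrow> real" where "htr z = snd (snd z)"

lemma hmk_simps [simp]: "hsc (hmk s a t) = s" "hA (hmk s a t) = a" "htr (hmk s a t) = t"
  by (simp_all add: hmk_def hsc_def hA_def htr_def)

lemma hat_eqI: "hsc z = hsc z' \<Longrightarrow> hA z = hA z' \<Longrightarrow> htr z = htr z' \<Longrightarrow> z = z'"
  by (simp add: hsc_def hA_def htr_def prod_eq_iff)

lemma hat_linear_simps [simp]:
  "hsc (z + z') = hsc z + hsc z'" "hA (z + z') = hA z + hA z'" "htr (z + z') = htr z + htr z'"
  "hsc (z - z') = hsc z - hsc z'" "hA (z - z') = hA z - hA z'" "htr (z - z') = htr z - htr z'"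
  "hsc (c *\<^sub>R z) = c * hsc z" "hA (c *\<^sub>R z) = c *\<^sub>R hA z" "htr (c *\<^sub>R z) = c * htr z"
  "hsc 0 = 0" "hA 0 = 0" "htr 0 = 0" "hsc (- z) = - hsc z" "hA (- z) = - hA z" "htr (- z) = - htr z"
  by (simp_all add: hsc_def hA_def htr_def prod_eq_iff)

lemma hat_sum_simps [simp]:
  fixes F :: "'i \<Rightarrow> (real \<times> 'e::real_vector) \<times> ('o::real_vector \<times> real)"
  shows "hsc (sum F S) = (\<Sum>i\<in>S. hsc (F i))" "hA (sum F S) = (\<Sum>i\<in>S. hA (F i))"
    "htr (sum F S) = (\<Sum>i\<in>S. htr (F i))"
proof -
  have l: "linear (hsc :: (real \<times> 'e) \<times> ('o \<times> real) \<Rightarrow> _)" "linear (hA :: (real \<times> 'e) \<times> ('o \<times> real) \<Rightarrow> _)"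
    "linear (htr :: (real \<times> 'e) \<times> ('o \<times> real) \<Rightarrow> _)" by (rule linearI; simp)+
  show "hsc (sum F S) = (\<Sum>i\<in>S. hsc (F i))" "hA (sum F S) = (\<Sum>i\<in>S. hA (F i))"
    "htr (sum F S) = (\<Sum>i\<in>S. htr (F i))"
    by (rule linear_sum[OF l(1)], rule linear_sum[OF l(2)], rule linear_sum[OF l(3)])
qed

lemma hat_graded: "z \<in> graded_part p \<longleftrightarrow>
    hA z \<in> graded_part p \<and> (if p then hsc z = 0 else htr z = 0)"
  by (cases p) (auto simp: graded_part_def hsc_def hA_def htr_def prod_eq_iff)

context odd_frobenius
begin

definition hmul where
  "hmul z z' = hmk (hsc z * hsc z') (hsc z *\<^sub>R hA z' + hsc z' *\<^sub>R hA z + mul (hA z) (hA z'))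
     (hsc z * htr z' + hsc z' * htr z + form (hA z) (hA z'))"

definition dhat where "dhat z = hmk 0 (d (hA z)) 0"

definition hone :: "(real \<times> 'e) \<times> ('o \<times> real)" where "hone = hmk 1 0 0"

lemma hmul_linear [simp]: "hmul (z + z') y = hmul z y + hmul z' y" "hmul y (z + z') = hmul y z + hmul y z'"
  "hmul (c *\<^sub>R z) y = c *\<^sub>R hmul z y" "hmul y (c *\<^sub>R z) = c *\<^sub>R hmul y z" "hmul 0 y = 0" "hmul y 0 = 0"
  by (rule hat_eqI; simp add: hmul_def algebra_simps)+

lemma hmul_one [simp]: "hmul hone z = z" "hmul z hone = z"
  by (rule hat_eqI; simp add: hmul_def hone_def)+

text \<open>In the coefficient of tau, associativity is the invariance of the scalar
  product.\<close>

lemma hmul_assoc: "hmul (hmul x y) z = hmul x (hmul y z)"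
  by (rule hat_eqI) (simp_all add: hmul_def algebra_simps mul_assoc form_mul)

lemma hmul_graded: "x \<in> graded_part p \<Longrightarrow> y \<in> graded_part q \<Longrightarrow> hmul x y \<in> graded_part (p \<noteq> q)"
proof -
  assume h: "x \<in> graded_part p" "y \<in> graded_part q"
  have "mul (hA x) (hA y) \<in> graded_part (p \<noteq> q)" "p = q \<Longrightarrow> form (hA x) (hA y) = 0"
    using h mul_parity[of "hA x" p "hA y" q] form_odd[of "hA x" p "hA y"] by (simp_all add: hat_graded)
  then show ?thesis
    using h by (cases p; cases q) (auto simp: hat_graded hmul_def)
qed

lemma hmul_commute:
  assumes "x \<in> graded_part p" "y \<in> graded_part q"
  shows "hmul x y = sg (p \<and> q) *\<^sub>R hmul y x"
proof -
  have "mul (hA x) (hA y) = sg (p \<and> q) *\<^sub>R mul (hA y) (hA x)"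
    "form (hA x) (hA y) = sg (p \<and> q) * form (hA y) (hA x)"
    using assms mul_comm[of "hA x" p "hA y" q] form_sym[of "hA x" p "hA y" q] by (simp_all add: hat_graded)
  then show ?thesis using assms
    by (intro hat_eqI; cases p; cases q) (simp_all add: hmul_def hat_graded)
qed

lemma dhat_simps [simp]: "dhat (z + z') = dhat z + dhat z'" "dhat (c *\<^sub>R z) = c *\<^sub>R dhat z" "dhat 0 = 0" "htr (dhat z) = 0"
  "dhat hone = 0"
proof -
  show "dhat (z + z') = dhat z + dhat z'" "dhat (c *\<^sub>R z) = c *\<^sub>R dhat z" "dhat 0 = 0"
    by (rule hat_eqI; simp add: dhat_def)+
  show "htr (dhat z) = 0" by (simp add: dhat_def)
  show "dhat hone = 0" by (rule hat_eqI; simp add: dhat_def hone_def)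
qed

lemma dhat_graded: "z \<in> graded_part p \<Longrightarrow> dhat z \<in> graded_part (\<not> p)"
  using d_odd[of "hA z" p] by (simp add: hat_graded dhat_def)

text \<open>In the coefficient of tau, the Leibniz rule is \<open>form_d\<close>: the trace vanishes
  on boundaries.\<close>

lemma dhat_mul:
  assumes "z \<in> graded_part p"
  shows "dhat (hmul z z') = hmul (dhat z) z' + sg p *\<^sub>R hmul z (dhat z')"
  using assms d_mul[of "hA z" p "hA z'"] form_d[of "hA z" p "hA z'"]
  by (intro hat_eqI; cases p) (simp_all add: hmul_def dhat_def hat_graded algebra_simps)

end

section \<open>Coordinates on A tensor V and the symplectic duality of V\<close>

instantiation prod :: (super_index, super_index) super_index
begin
definition odd_ix_prod :: "'a \<times> 'b \<Rightarrow> bool" where "odd_ix_prod x = (odd_ix (fst x) \<noteq> odd_ix (snd x))"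
instance ..
end

lemma odd_ix_pair [simp]: "odd_ix (a, b) = (odd_ix a \<noteq> odd_ix b)"
  by (simp add: odd_ix_prod_def)

fun vhat :: "vix \<Rightarrow> vix" where
  "vhat (P i) = Q i"
| "vhat (Q i) = P i"
| "vhat (X i) = X i"

text \<open>The signs for which the symplectic form is half the sum of \<open>veta v\<close> times
  dv d(\<open>vhat v\<close>).\<close>

fun veta :: "vix \<Rightarrow> real" where
  "veta (P i) = 1"
| "veta (Q i) = -1"
| "veta (X i) = 1"

lemma vhat_simps [simp]: "vhat (vhat v) = v" "odd_ix (vhat v) = odd_ix v"
  "vhat v \<in> coordsV n m \<longleftrightarrow> v \<in> coordsV n m"
  by (cases v; auto simp: coordsV_def)+

lemma vhat_eq_iff: "vhat v = w \<longleftrightarrow> v = vhat w"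
  by (metis vhat_simps(1))

lemma veta_vhat: "veta (vhat v) = - sg (odd_ix v) * veta v"
  by (cases v) auto

lemma veta_sq [simp]: "veta v * veta v = 1" "veta v * (veta v * x) = x"
  by (cases v; simp)+

lemma finite_coordsV [simp]: "finite (coordsV n m)"
  by (simp add: coordsV_def)

lemma sum_vhat: "(\<Sum>v\<in>coordsV n m. F (vhat v)) = (\<Sum>v\<in>coordsV n m. F v)"
  by (rule sum.reindex_bij_witness[of _ vhat vhat]) auto

subsection \<open>Superfields\<close>

locale superfield = odd_frobenius mul d form
  for mul :: "'e::real_vector \<times> 'o::real_vector \<Rightarrow> 'e \<times> 'o \<Rightarrow> 'e \<times> 'o"
    and d :: "'e \<times> 'o \<Rightarrow> 'e \<times> 'o" and form :: "'e \<times> 'o \<Rightarrow> 'e \<times> 'o \<Rightarrow> real" +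
  fixes r :: nat and e :: "cix \<Rightarrow> 'e \<times> 'o" and n m :: nat
  assumes e_graded: "a \<in> idx r \<Longrightarrow> e a \<in> graded_part (odd_ix a)"
    and e_dual: "\<lbrakk>a \<in> idx r; b \<in> idx r\<rbrakk> \<Longrightarrow> form (e a) (e b) = (if b = cdual a then 1 else 0)"
    and e_complete: "x = (\<Sum>a\<in>idx r. form x (e (cdual a)) *\<^sub>R e a)"
begin

abbreviation "VV \<equiv> coordsV n m"
abbreviation "WW \<equiv> idx r \<times> coordsV n m"

sublocale V: fin_ix VV by standard simp
sublocale W: fin_ix WW by standard simp

definition Eb where "Eb a = hmk 0 (e a) 0"

lemma Eb_graded [simp]: "a \<in> idx r \<Longrightarrow> Eb a \<in> graded_part (odd_ix a)"
  using e_graded[of a] by (simp add: hat_graded Eb_def)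

text \<open>The trace of \<open>z v\<^sub>1 \<dots> v\<^sub>k\<close> with each \<open>v\<^sub>i\<close> replaced by the generic element
  \<open>\<Sum>a. y\<^sub>a\<^sub>,\<^sub>v e\<^sub>a\<close> of \<open>A\<close>.\<close>
fun G :: "(real \<times> 'e) \<times> ('o \<times> real) \<Rightarrow> vix list \<Rightarrow> (cix \<times> vix) spoly" where
  "G z [] = htr z *\<^sub>R 1"
| "G z (v # w) = sg (odd_ix v) *\<^sub>R (\<Sum>a\<in>idx r. mon [(a, v)] * G (twist (odd_ix v) (hmul z (Eb a))) w)"

lemma twist_linear [simp]: "twist q (a + b) = twist q a + twist q b" "twist q (c *\<^sub>R a) = c *\<^sub>R twist q a"
  by (rule linear_add[OF linear_twist], rule linear_scale[OF linear_twist])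

lemma linear_G: "linear (\<lambda>z. G z w)"
proof (induction w)
  case Nil
  show ?case by (rule linearI) (simp_all add: scaleR_add_left)
next
  case (Cons v w)
  show ?case
    by (rule linearI) (simp_all add: linear_add[OF Cons] linear_scale[OF Cons] distrib_left sum.distrib
        scaleR_add_right scaleR_sum_right mult.commute)
qed

text \<open>Reshuffling twists all later factors by the parity of \<open>v\<close>. Since the twist
  is multiplicative, it can be put on the product read so far, which gives the second sign, and on
  the odd trace, which gives the first.\<close>

abbreviation cf :: "bool \<Rightarrow> bool \<Rightarrow> bool \<Rightarrow> real" where
  "cf p v a \<equiv> sg v * sg (v \<and> (p \<noteq> a))"

lemma G_Cons:
  assumes "z \<in> graded_part p"
  shows "G z (v # w) = (\<Sum>a\<in>idx r. cf p (odd_ix v) (odd_ix a) *\<^sub>R (mon [(a, v)] * G (hmul z (Eb a)) w))"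
  unfolding G.simps scaleR_sum_right
proof (rule sum.cong[OF refl])
  fix a assume a: "a \<in> idx r"
  have "twist (odd_ix v) (hmul z (Eb a)) = sg (odd_ix v \<and> (p \<noteq> odd_ix a)) *\<^sub>R hmul z (Eb a)"
    by (rule twist_graded[OF hmul_graded[OF assms Eb_graded[OF a]]])
  then show "sg (odd_ix v) *\<^sub>R (mon [(a, v)] * G (twist (odd_ix v) (hmul z (Eb a))) w) =
     cf p (odd_ix v) (odd_ix a) *\<^sub>R (mon [(a, v)] * G (hmul z (Eb a)) w)"
    by (simp add: linear_scale[OF linear_G])
qed

lemma hmul_Eb_commute:
  assumes "a \<in> idx r" "b \<in> idx r"
  shows "hmul (hmul z (Eb a)) (Eb b) = sg (odd_ix a \<and> odd_ix b) *\<^sub>R hmul (hmul z (Eb b)) (Eb a)"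
  using hmul_commute[OF Eb_graded[OF assms(1)] Eb_graded[OF assms(2)]] by (simp add: hmul_assoc)

lemma mon1_swap: "mon [i] * (mon [j] * f) = sg (odd_ix i \<and> odd_ix j) *\<^sub>R (mon [j] * (mon [i] * f))"
  using mon_swap[of i j] by (simp add: mon_Cons[of i "[j]"] mon_Cons[of j "[i]"] flip: mult.assoc)

text \<open>Exchanging two letters exchanges two coordinates and two basis elements inside the
  trace. Both pairs supercommute, and what remains of the signs after relabelling the double sum is
  the Koszul sign of the letters in V.\<close>

lemma koszul_sym_G: "koszul_sym (G z)"
proof (rule koszul_symI)
  fix us vs v w
  have base: "G z (v # w # vs) = sg (odd_ix v \<and> odd_ix w) *\<^sub>R G z (w # v # vs)"
    if z: "z \<in> graded_part p" for z p
  proof -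
    have ex: "G z (v # w # vs) = (\<Sum>a\<in>idx r. \<Sum>b\<in>idx r.
       (cf p (odd_ix v) (odd_ix a) * cf (p \<noteq> odd_ix a) (odd_ix w) (odd_ix b)) *\<^sub>R
         (mon [(a, v)] * (mon [(b, w)] * G (hmul (hmul z (Eb a)) (Eb b)) vs)))" for v w
      unfolding G_Cons[OF z]
      by (intro sum.cong refl)
        (simp only: G_Cons[OF hmul_graded[OF z Eb_graded]] sum_distrib_left scaleR_sum_right
          mult_scaleR_right scaleR_scaleR)
    have "G z (w # v # vs) = (\<Sum>a\<in>idx r. \<Sum>b\<in>idx r.
       (cf p (odd_ix w) (odd_ix b) * cf (p \<noteq> odd_ix b) (odd_ix v) (odd_ix a)) *\<^sub>R
         (mon [(b, w)] * (mon [(a, v)] * G (hmul (hmul z (Eb b)) (Eb a)) vs)))"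
      unfolding ex by (rule sum.swap)
    then show ?thesis
      unfolding ex[of v w] scaleR_sum_right
    proof (simp only: scaleR_sum_right, intro sum.cong refl)
      fix a b assume ab: "a \<in> idx r" "b \<in> idx r"
      show "(cf p (odd_ix v) (odd_ix a) * cf (p \<noteq> odd_ix a) (odd_ix w) (odd_ix b)) *\<^sub>R
         (mon [(a, v)] * (mon [(b, w)] * G (hmul (hmul z (Eb a)) (Eb b)) vs)) =
         sg (odd_ix v \<and> odd_ix w) *\<^sub>R (cf p (odd_ix w) (odd_ix b) * cf (p \<noteq> odd_ix b) (odd_ix v) (odd_ix a)) *\<^sub>R
         (mon [(b, w)] * (mon [(a, v)] * G (hmul (hmul z (Eb b)) (Eb a)) vs))"
        unfolding hmul_Eb_commute[OF ab, of z] mon1_swap[of "(a, v)" "(b, w)"] linear_scale[OF linear_G]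
        by (simp only: mult_scaleR_right scaleR_scaleR, rule arg_cong[where f="\<lambda>c. c *\<^sub>R _"])
          (cases "odd_ix a"; cases "odd_ix b"; cases "odd_ix v"; cases "odd_ix w"; cases p; simp)
    qed
  qed
  have gr: "G z (us @ v # w # vs) = sg (odd_ix v \<and> odd_ix w) *\<^sub>R G z (us @ w # v # vs)"
    if "z \<in> graded_part p" for z p
    using that
  proof (induction us arbitrary: z p)
    case (Cons u us)
    have IH: "G (hmul z (Eb a)) (us @ v # w # vs) =
        sg (odd_ix v \<and> odd_ix w) *\<^sub>R G (hmul z (Eb a)) (us @ w # v # vs)" if "a \<in> idx r" for a
      by (rule Cons.IH[OF hmul_graded[OF Cons.prems Eb_graded[OF that]]])
    show ?case
      unfolding append_Cons G_Cons[OF Cons.prems] scaleR_sum_right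
      by (intro sum.cong refl) (simp add: IH mult.commute)
  qed (simp add: base del: G.simps)
  show "G z (us @ v # w # vs) = sg (odd_ix v \<and> odd_ix w) *\<^sub>R G z (us @ w # v # vs)"
    by (rule linear_eq_graded[OF linear_G linear_scaleR_compose[OF linear_G] gr])
qed

definition GG :: "(real \<times> 'e) \<times> ('o \<times> real) \<Rightarrow> vix spoly \<Rightarrow> (cix \<times> vix) spoly" where
  "GG z = induced (G z)"

lemma linear_GG: "linear (GG z)"
  unfolding GG_def by (rule linear_induced[OF koszul_sym_G])

lemma linear_GG_comp [linear_intros]: "linear F \<Longrightarrow> linear (\<lambda>f. GG z (F f))"
  by (rule linear_fun_comp[OF linear_GG])

lemma GG_mon: "GG z (mon w) = G z w"
  unfolding GG_def by (rule induced_mon[OF koszul_sym_G])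

lemmas GG_simps [simp] = linear_0[OF linear_GG] linear_add[OF linear_GG] linear_scale[OF linear_GG]
  linear_diff[OF linear_GG] linear_neg[OF linear_GG] linear_sum[OF linear_GG]

lemma GG_one [simp]: "GG z 1 = htr z *\<^sub>R 1"
  using GG_mon[of z "[]"] by simp

lemma GG_lin_z [simp]: "GG (z + z') f = GG z f + GG z' f" "GG (c *\<^sub>R z) f = c *\<^sub>R GG z f"
proof -
  show "GG (z + z') f = GG z f + GG z' f"
    by (rule linear_eq_mon[where f=f], (intro linear_intros)+)
      (simp only: GG_mon linear_add[OF linear_G])
  show "GG (c *\<^sub>R z) f = c *\<^sub>R GG z f"
    by (rule linear_eq_mon[where f=f], (intro linear_intros)+)
      (simp only: GG_mon linear_scale[OF linear_G])
qed

lemma linear_GG_z: "linear (\<lambda>z. GG z f)"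
  by (rule linearI) auto

lemma GG_gen:
  assumes "z \<in> graded_part p"
  shows "GG z (mon [v] * f) =
    (\<Sum>a\<in>idx r. cf p (odd_ix v) (odd_ix a) *\<^sub>R (mon [(a, v)] * GG (hmul z (Eb a)) f))"
proof (rule linear_eq_mon[where f=f])
  fix w
  show "GG z (mon [v] * mon w) =
    (\<Sum>a\<in>idx r. cf p (odd_ix v) (odd_ix a) *\<^sub>R (mon [(a, v)] * GG (hmul z (Eb a)) (mon w)))"
    using G_Cons[OF assms, of v w] by (simp only: GG_mon flip: mon_Cons)
qed (intro linear_intros)+

text \<open>The trace is odd, so the parity is opposite to the sum of \<open>p\<close> and
  \<open>q\<close>.\<close>

lemma GG_homog:
  assumes "z \<in> graded_part p" "f \<in> homog q"
  shows "GG z f \<in> homog (p = q)"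
proof -
  have w: "G z w \<in> homog (p = odd_word w)" if "z \<in> graded_part p" for z p w
    using that
  proof (induction w arbitrary: z p)
    case Nil
    then show ?case using homog_simps(4)[OF homog_one] by (cases p) (auto simp: hat_graded)
  next
    case (Cons v w)
    show ?case
      unfolding G_Cons[OF Cons.prems]
    proof (intro homog_sum homog_simps)
      fix a assume a: "a \<in> idx r"
      show "mon [(a, v)] * G (hmul z (Eb a)) w \<in> homog (p = odd_word (v # w))"
        by (rule homog_cong[OF homog_mult[OF homog_mon1 Cons.IH[OF hmul_graded[OF Cons.prems Eb_graded[OF a]]]]])
          auto
    qed
  qed
  show ?thesis
    using assms(2)
  proof (induction rule: homog_induct)
    case (add c u g)
    then show ?case using w[OF assms(1), of u] by (simp add: GG_mon)
  qed simp
qed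

lemma GG_part:
  assumes "f \<in> sym_part VV K"
  shows "GG z f \<in> sym_part WW UNIV"
  using assms linear_GG
proof (rule sym_part_linear)
  fix w assume w: "set w \<subseteq> VV"
  have one: "(1 :: (cix \<times> vix) spoly) \<in> sym_part WW UNIV"
    using sym_part_mon[of "[]" WW UNIV] by simp
  show "GG z (mon w) \<in> sym_part WW UNIV"
    unfolding GG_mon using w
  proof (induction w arbitrary: z)
    case Nil
    show ?case unfolding G.simps by (intro subspace_scale[OF subspace_sym_part] one)
  next
    case (Cons v w)
    then have "set w \<subseteq> VV" by simp
    then have IH: "G z w \<in> sym_part WW UNIV" for z by (rule Cons.IH)
    show ?case unfolding G.simps
    proof (intro subspace_scale[OF subspace_sym_part] subspace_sum[OF subspace_sym_part])
      fix a assume "a \<in> idx r"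
      then show "mon [(a, v)] * G (twist (odd_ix v) (hmul z (Eb a))) w \<in> sym_part WW UNIV"
        using Cons.prems by (intro sym_part_mult[OF sym_part_mon[of _ _ UNIV] IH]) auto
    qed
  qed
qed simp

text \<open>Differentiation removes one letter \<open>v\<close> and leaves the basis element with
  index \<open>a\<close> in its place; supercommutativity moves that element to the front, where it
  is absorbed into \<open>z\<close>.\<close>

lemma pd_GG:
  assumes "z \<in> graded_part p" "a \<in> idx r"
  shows "pd (a, v) (GG z f) =
    sg (odd_ix v \<and> (p = odd_ix a)) *\<^sub>R GG (hmul z (Eb a)) (pd v f)"
proof (rule linear_eq_mon[where f=f])
  fix w
  show "pd (a, v) (GG z (mon w)) =
    sg (odd_ix v \<and> (p = odd_ix a)) *\<^sub>R GG (hmul z (Eb a)) (pd v (mon w))"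
    using assms(1)
  proof (induction w arbitrary: z p)
    case (Cons u w)
    note za = hmul_graded[OF Cons.prems Eb_graded]
    have "pd (a, v) (GG z (mon (u # w))) =
      (\<Sum>b\<in>idx r. (if b = a \<and> u = v then cf p (odd_ix u) (odd_ix b) *\<^sub>R GG (hmul z (Eb b)) (mon w) else 0) +
        (cf p (odd_ix u) (odd_ix b) * sg ((odd_ix a \<noteq> odd_ix v) \<and> (odd_ix b \<noteq> odd_ix u)) *
          sg (odd_ix v \<and> ((p \<noteq> odd_ix b) = odd_ix a)) * sg (odd_ix b \<and> odd_ix a)) *\<^sub>R
         (mon [(b, u)] * GG (hmul (hmul z (Eb a)) (Eb b)) (pd v (mon w))))"
      unfolding mon_Cons[of u w] GG_gen[OF Cons.prems] pd_simps
    proof (intro sum.cong refl)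
      fix b assume b: "b \<in> idx r"
      show "cf p (odd_ix u) (odd_ix b) *\<^sub>R pd (a, v) (mon [(b, u)] * GG (hmul z (Eb b)) (mon w)) =
        (if b = a \<and> u = v then cf p (odd_ix u) (odd_ix b) *\<^sub>R GG (hmul z (Eb b)) (mon w) else 0) +
        (cf p (odd_ix u) (odd_ix b) * sg ((odd_ix a \<noteq> odd_ix v) \<and> (odd_ix b \<noteq> odd_ix u)) *
          sg (odd_ix v \<and> ((p \<noteq> odd_ix b) = odd_ix a)) * sg (odd_ix b \<and> odd_ix a)) *\<^sub>R
         (mon [(b, u)] * GG (hmul (hmul z (Eb a)) (Eb b)) (pd v (mon w)))"
        unfolding pd_mult_gen Cons.IH[OF za[OF b]] hmul_Eb_commute[OF b assms(2), of z]
        by (simp add: mult_scaleR_right scaleR_add_right mult.assoc)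
    qed
    also have "\<dots> = (if u = v then cf p (odd_ix u) (odd_ix a) *\<^sub>R GG (hmul z (Eb a)) (mon w) else 0) +
       sg (odd_ix v \<and> (p = odd_ix a)) *\<^sub>R sg (odd_ix v \<and> odd_ix u) *\<^sub>R GG (hmul z (Eb a)) (mon [u] * pd v (mon w))"
    proof -
      have 1: "(\<Sum>b\<in>idx r. if b = a \<and> u = v then cf p (odd_ix u) (odd_ix b) *\<^sub>R GG (hmul z (Eb b)) (mon w) else 0) =
        (if u = v then cf p (odd_ix u) (odd_ix a) *\<^sub>R GG (hmul z (Eb a)) (mon w) else 0)"
        using assms(2) by (simp add: sum.delta)
      have 2: "cf p (odd_ix u) (odd_ix b) * sg ((odd_ix a \<noteq> odd_ix v) \<and> (odd_ix b \<noteq> odd_ix u)) *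
          sg (odd_ix v \<and> ((p \<noteq> odd_ix b) = odd_ix a)) * sg (odd_ix b \<and> odd_ix a) =
          sg (odd_ix v \<and> (p = odd_ix a)) * (sg (odd_ix v \<and> odd_ix u) * cf (p \<noteq> odd_ix a) (odd_ix u) (odd_ix b))" for b
        by (cases "odd_ix u"; cases "odd_ix v"; cases "odd_ix a"; cases "odd_ix b"; cases p) simp_all
      show ?thesis
        unfolding sum.distrib 1 2 GG_gen[OF za[OF assms(2)]] scaleR_sum_right scaleR_scaleR by simp
    qed
    also have "\<dots> = sg (odd_ix v \<and> (p = odd_ix a)) *\<^sub>R GG (hmul z (Eb a)) (pd v (mon (u # w)))"
      unfolding mon_Cons[of u w] pd_mult_gen GG_simps scaleR_add_right
      by (cases "u = v"; cases "odd_ix u"; cases p; cases "odd_ix a") simp_all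
    finally show ?case .
  qed simp
qed (intro linear_intros)+

text \<open>Completeness of the dual basis, phrased with traces: without a unit component, only a
  multiple of tau is invisible to them.\<close>

lemma hat_aug0:
  assumes "hsc z = 0"
  shows "z = (\<Sum>a\<in>idx r. htr (hmul z (Eb (cdual a))) *\<^sub>R Eb a) + hmk 0 0 (htr z)"
  by (rule hat_eqI) (use assms e_complete[of "hA z"] in \<open>simp_all add: hmul_def Eb_def\<close>)

text \<open>tau annihilates A, so a trace starting with it cannot read a further letter.\<close>

lemma GG_top: "f \<in> sym_part UNIV {1..} \<Longrightarrow> GG (hmk 0 0 t) f = 0"
proof (rule sym_part_linear_eq[OF _ linear_GG linear_zero])
  fix w :: "vix list" assume "length w \<in> {1..}"
  then obtain v u where w: "w = v # u" by (cases w) auto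
  have "hmul (hmk 0 0 t) (Eb a) = 0" for a by (rule hat_eqI) (simp_all add: hmul_def Eb_def)
  then show "GG (hmk 0 0 t) (mon w) = 0"
    by (simp add: w GG_mon linear_0[OF linear_G] linear_0[OF linear_twist])
qed

text \<open>Gluing means that the trace of a product is recovered by inserting dual basis elements
  into the two traces and summing. This is the step that prepends a letter to the left factor; the
  inserted element has to be moved past the one that belongs to that letter.\<close>

lemma casimir_step:
  assumes z: "z \<in> graded_part p"
    and IH: "\<And>b. b \<in> idx r \<Longrightarrow> GG (hmul z (Eb b)) (x * y) =
      (\<Sum>c\<in>idx r. sg (odd_ix c \<and> ((p \<noteq> odd_ix b) \<noteq> q)) *\<^sub>R
        (GG (hmul (hmul z (Eb b)) (Eb c)) x * GG (Eb (cdual c)) y))"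
  shows "GG z (mon [u] * x * y) = (\<Sum>c\<in>idx r. sg (odd_ix c \<and> (p \<noteq> (odd_ix u \<noteq> q))) *\<^sub>R
        (GG (hmul z (Eb c)) (mon [u] * x) * GG (Eb (cdual c)) y))"
proof -
  have "GG z (mon [u] * x * y) = (\<Sum>b\<in>idx r. \<Sum>c\<in>idx r.
      (cf p (odd_ix u) (odd_ix b) * sg (odd_ix c \<and> ((p \<noteq> odd_ix b) \<noteq> q)) * sg (odd_ix b \<and> odd_ix c)) *\<^sub>R
      (mon [(b, u)] * (GG (hmul (hmul z (Eb c)) (Eb b)) x * GG (Eb (cdual c)) y)))"
    unfolding mult.assoc[of "mon [u]" x y] GG_gen[OF z]
  proof (intro sum.cong refl)
    fix b assume b: "b \<in> idx r"
    show "cf p (odd_ix u) (odd_ix b) *\<^sub>R (mon [(b, u)] * GG (hmul z (Eb b)) (x * y)) = (\<Sum>c\<in>idx r.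
      (cf p (odd_ix u) (odd_ix b) * sg (odd_ix c \<and> ((p \<noteq> odd_ix b) \<noteq> q)) * sg (odd_ix b \<and> odd_ix c)) *\<^sub>R
      (mon [(b, u)] * (GG (hmul (hmul z (Eb c)) (Eb b)) x * GG (Eb (cdual c)) y)))"
      by (simp only: IH[OF b] sum_distrib_left scaleR_sum_right, intro sum.cong refl,
          simp only: hmul_Eb_commute[OF b, of _ z] GG_lin_z mult_scaleR_left mult_scaleR_right
            scaleR_scaleR mult.assoc)
  qed
  also have "\<dots> = (\<Sum>c\<in>idx r. \<Sum>b\<in>idx r.
      (sg (odd_ix c \<and> (p \<noteq> (odd_ix u \<noteq> q))) * cf (p \<noteq> odd_ix c) (odd_ix u) (odd_ix b)) *\<^sub>R
      (mon [(b, u)] * (GG (hmul (hmul z (Eb c)) (Eb b)) x * GG (Eb (cdual c)) y)))"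
  proof (subst sum.swap, intro sum.cong refl)
    fix b c :: cix
    have "cf p (odd_ix u) (odd_ix b) * sg (odd_ix c \<and> ((p \<noteq> odd_ix b) \<noteq> q)) * sg (odd_ix b \<and> odd_ix c) =
      sg (odd_ix c \<and> (p \<noteq> (odd_ix u \<noteq> q))) * cf (p \<noteq> odd_ix c) (odd_ix u) (odd_ix b)"
      by (cases "odd_ix u"; cases "odd_ix b"; cases "odd_ix c"; cases p; cases q) simp_all
    then show "(cf p (odd_ix u) (odd_ix b) * sg (odd_ix c \<and> ((p \<noteq> odd_ix b) \<noteq> q)) * sg (odd_ix b \<and> odd_ix c)) *\<^sub>R
      (mon [(b, u)] * (GG (hmul (hmul z (Eb c)) (Eb b)) x * GG (Eb (cdual c)) y)) =
      (sg (odd_ix c \<and> (p \<noteq> (odd_ix u \<noteq> q))) * cf (p \<noteq> odd_ix c) (odd_ix u) (odd_ix b)) *\<^sub>R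
      (mon [(b, u)] * (GG (hmul (hmul z (Eb c)) (Eb b)) x * GG (Eb (cdual c)) y))" by simp
  qed
  also have "\<dots> = (\<Sum>c\<in>idx r. sg (odd_ix c \<and> (p \<noteq> (odd_ix u \<noteq> q))) *\<^sub>R
        (GG (hmul z (Eb c)) (mon [u] * x) * GG (Eb (cdual c)) y))"
    by (intro sum.cong refl)
      (simp only: GG_gen[OF hmul_graded[OF z Eb_graded]] sum_distrib_right scaleR_sum_right
        mult_scaleR_left scaleR_scaleR mult.assoc)
  finally show ?thesis .
qed

lemma casimir_aug0:
  assumes "z \<in> graded_part p" "hsc z = 0" "y \<in> sym_part UNIV {1..}"
  shows "GG z (mon w * y) = (\<Sum>c\<in>idx r. sg (odd_ix c \<and> (p \<noteq> odd_word w)) *\<^sub>R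
        (GG (hmul z (Eb c)) (mon w) * GG (Eb (cdual c)) y))"
  using assms(1,2)
proof (induction w arbitrary: z p)
  case Nil
  \<comment> \<open>With no letters left on the left, gluing is the expansion of \<open>z\<close> in
    the basis. The multiple of tau drops out since \<open>y\<close> has no constant term.\<close>
  have "GG z y = (\<Sum>a\<in>idx r. htr (hmul z (Eb (cdual a))) *\<^sub>R GG (Eb a) y)"
    by (subst hat_aug0[OF Nil(2)]) (simp add: GG_top[OF assms(3)] linear_sum[OF linear_GG_z])
  also have "\<dots> = (\<Sum>c\<in>idx r. htr (hmul z (Eb c)) *\<^sub>R GG (Eb (cdual c)) y)"
    by (subst sum_cdual[symmetric]) simp
  also have "\<dots> = (\<Sum>c\<in>idx r. sg (odd_ix c \<and> p) *\<^sub>R htr (hmul z (Eb c)) *\<^sub>R GG (Eb (cdual c)) y)"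
  proof (intro sum.cong refl)
    fix c assume "c \<in> idx r"
    then have "hmul z (Eb c) \<in> graded_part (p \<noteq> odd_ix c)" by (intro hmul_graded Nil Eb_graded)
    then show "htr (hmul z (Eb c)) *\<^sub>R GG (Eb (cdual c)) y =
      sg (odd_ix c \<and> p) *\<^sub>R htr (hmul z (Eb c)) *\<^sub>R GG (Eb (cdual c)) y"
      by (cases p; cases "odd_ix c") (auto simp: hat_graded)
  qed
  finally show ?case by simp
next
  case (Cons u w)
  have "GG (hmul z (Eb b)) (mon w * y) = (\<Sum>c\<in>idx r. sg (odd_ix c \<and> ((p \<noteq> odd_ix b) \<noteq> odd_word w)) *\<^sub>R
        (GG (hmul (hmul z (Eb b)) (Eb c)) (mon w) * GG (Eb (cdual c)) y))" if "b \<in> idx r" for b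
    using Cons.IH[OF hmul_graded[OF Cons.prems(1) Eb_graded[OF that]]] Cons.prems(2) by (simp add: hmul_def)
  from casimir_step[OF Cons.prems(1) this, of u]
  show ?case unfolding mon_Cons[of u w] by simp
qed

definition psi :: "vix spoly \<Rightarrow> (cix \<times> vix) spoly" where
  "psi = GG hone"

lemma hone_graded [simp]: "hone \<in> graded_part False"
  by (simp add: hat_graded hone_def)

text \<open>A superfield starts from the unit, to which the basis expansion does not apply. As
  \<open>x\<close> has no constant term, its first letter is read beforehand, after which the unit
  component is gone.\<close>

lemma casimir:
  assumes x: "x \<in> sym_part UNIV {1..}" "x \<in> homog q" and y: "y \<in> sym_part UNIV {1..}"
  shows "psi (x * y) = (\<Sum>c\<in>idx r. sg (odd_ix c \<and> q) *\<^sub>R (GG (Eb c) x * GG (Eb (cdual c)) y))"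
proof -
  \<comment> \<open>The sign depends on the parity of \<open>x\<close>; splitting into components
    makes the right-hand side linear, so that it can be checked on words.\<close>
  have "psi (x * y) = (\<Sum>p\<in>UNIV. \<Sum>c\<in>idx r. sg (odd_ix c \<and> p) *\<^sub>R (GG (Eb c) (component p x) * GG (Eb (cdual c)) y))"
    using x(1)
  proof (rule sym_part_linear_eq)
    show "linear (\<lambda>x. psi (x * y))" unfolding psi_def by (intro linear_intros)
    show "linear (\<lambda>x. \<Sum>p\<in>UNIV. \<Sum>c\<in>idx r. sg (odd_ix c \<and> p) *\<^sub>R (GG (Eb c) (component p x) * GG (Eb (cdual c)) y))"
      by (intro linear_intros linear_fun_comp[OF linear_GG linear_component])
    fix w :: "vix list" assume "length w \<in> {1..}"
    then obtain u w' where w: "w = u # w'" by (cases w) auto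
    have "GG (hmul hone (Eb b)) (mon w' * y) = (\<Sum>c\<in>idx r. sg (odd_ix c \<and> ((False \<noteq> odd_ix b) \<noteq> odd_word w')) *\<^sub>R
        (GG (hmul (hmul hone (Eb b)) (Eb c)) (mon w') * GG (Eb (cdual c)) y))" if "b \<in> idx r" for b
      using casimir_aug0[OF Eb_graded[OF that] _ y, of w'] by (simp add: Eb_def)
    from casimir_step[OF hone_graded this, of u]
    have *: "psi (mon w * y) = (\<Sum>c\<in>idx r. sg (odd_ix c \<and> odd_word w) *\<^sub>R (GG (Eb c) (mon w) * GG (Eb (cdual c)) y))"
      unfolding psi_def w mon_Cons[of u w'] by simp
    have c: "component p (mon w) = (if p = odd_word w then mon w else 0)" for p
      by (rule component_homog[OF homog_mon]) simp
    show "psi (mon w * y) = (\<Sum>p\<in>UNIV. \<Sum>c\<in>idx r. sg (odd_ix c \<and> p) *\<^sub>R (GG (Eb c) (component p (mon w)) * GG (Eb (cdual c)) y))"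
      unfolding * c UNIV_bool by (cases "odd_word w") simp_all
  qed
  then show ?thesis unfolding component_homog[OF x(2)] UNIV_bool by (cases q) simp_all
qed

end

section \<open>The bracket generated by an odd second order operator\<close>

context fin_ix
begin

lemma deriv_chain:
  assumes "super_vf p \<phi>" "g \<in> sym_part I K"
  shows "deriv_ext p \<phi> g = (\<Sum>i\<in>I. \<phi> i * pd i g)"
  using assms(2) linear_deriv[OF assms(1)]
proof (rule sym_part_linear_eq)
  show "linear (\<lambda>g. \<Sum>i\<in>I. \<phi> i * pd i g)" by (intro linear_intros)
  fix w assume "set w \<subseteq> I"
  then show "deriv_ext p \<phi> (mon w) = (\<Sum>i\<in>I. \<phi> i * pd i (mon w))"
  proof (induction w)
    case (Cons v w)
    have "\<phi> i * (mon [v] * pd i (mon w)) =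
        sg (odd_ix v \<and> (p \<noteq> odd_ix i)) *\<^sub>R (mon [v] * (\<phi> i * pd i (mon w)))" for i
      using supercommute[of "\<phi> i" "p \<noteq> odd_ix i" "mon [v]" "odd_ix v"] assms(1)
      by (simp add: super_vf_def conj_commute flip: mult.assoc)
    then have *: "sg (odd_ix i \<and> odd_ix v) *\<^sub>R (\<phi> i * (mon [v] * pd i (mon w))) =
        sg (p \<and> odd_ix v) *\<^sub>R (mon [v] * (\<phi> i * pd i (mon w)))" for i
      by (cases "odd_ix i"; cases "odd_ix v"; cases p) simp_all
    have "(\<Sum>i\<in>I. \<phi> i * (if v = i then mon w else 0)) = (\<Sum>i\<in>I. if i = v then \<phi> v * mon w else 0)"
      by (intro sum.cong) auto
    then show ?case
      using Cons unfolding mon_Cons[of v w] deriv_mult_gen[OF assms(1)] pd_mult_gen distrib_left sum.distrib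
        mult_scaleR_right *
      by (simp add: sum_distrib_left scaleR_sum_right)
  qed (simp add: assms(1))
qed

text \<open>The Hamiltonian vector field of \<open>F\<close> for the odd bracket whose constant
  tensor is \<open>B\<close>.\<close>

definition brk :: "('v \<Rightarrow> 'v \<Rightarrow> real) \<Rightarrow> bool \<Rightarrow> 'v spoly \<Rightarrow> 'v \<Rightarrow> 'v spoly" where
  "brk B p F i = (\<Sum>l\<in>I. (sg (p \<and> odd_ix i) * B i l) *\<^sub>R pd l F)"

lemma super_vf_brk:
  assumes "mat True B" "F \<in> homog p"
  shows "super_vf (\<not> p) (brk B p F)"
  unfolding super_vf_def brk_def
proof (intro allI homog_sum)
  fix i l
  show "(sg (p \<and> odd_ix i) * B i l) *\<^sub>R pd l F \<in> homog ((\<not> p) \<noteq> odd_ix i)"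
  proof (cases "B i l = 0")
    case False
    then have "odd_ix l = (\<not> odd_ix i)" using assms(1) by (auto simp: mat_def)
    then show ?thesis
      using homog_cong[OF pd_homog[OF assms(2), of l], of "(\<not> p) \<noteq> odd_ix i"] by auto
  qed simp
qed

text \<open>The Batalin-Vilkovisky identity: a second order operator fails to be a derivation by a
  bracket, which is a derivation in the second argument. The factor 2 is again the double counting
  in \<open>T\<close>.\<close>

lemma T_product:
  assumes B: "mat True B" "msym B" and F: "F \<in> homog p"
  shows "T B (F * g) = T B F * g + sg p *\<^sub>R (F * T B g) + 2 *\<^sub>R deriv_ext (\<not> p) (brk B p F) g"
proof (rule linear_eq_gen[where f=g])
  note v = super_vf_brk[OF B(1) F]
  show "linear (\<lambda>g. T B (F * g))" by (intro linear_intros)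
  show "linear (\<lambda>g. T B F * g + sg p *\<^sub>R (F * T B g) + 2 *\<^sub>R deriv_ext (\<not> p) (brk B p F) g)"
    by (intro linear_intros v)
  fix i and g :: "'v spoly"
  assume IH: "T B (F * g) = T B F * g + sg p *\<^sub>R (F * T B g) + 2 *\<^sub>R deriv_ext (\<not> p) (brk B p F) g"
  have TF: "T B F \<in> homog (\<not> p)"
    unfolding T_def
  proof (intro homog_sum)
    fix i j
    show "B i j *\<^sub>R pd j (pd i F) \<in> homog (\<not> p)"
    proof (cases "B i j = 0")
      case False
      then have "odd_ix j = (\<not> odd_ix i)" using B(1) by (auto simp: mat_def)
      then show ?thesis
        using homog_cong[OF pd_homog[OF pd_homog[OF F, of i], of j], of "\<not> p"] by auto
    qed simp
  qed
  have c1: "F * (mon [i] * h) = sg (p \<and> odd_ix i) *\<^sub>R (mon [i] * (F * h))" for h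
    using supercommute[OF F homog_mon1[of i]] by (simp flip: mult.assoc)
  have c2: "mon [i] * (T B F * h) = sg (odd_ix i \<and> \<not> p) *\<^sub>R (T B F * (mon [i] * h))" for h
    using supercommute[OF homog_mon1[of i] TF] by (simp flip: mult.assoc)
  have s: "(\<Sum>l\<in>I. B i l *\<^sub>R pd l (F * g)) =
     sg (p \<and> odd_ix i) *\<^sub>R (brk B p F i * g) + sg (p \<and> \<not> odd_ix i) *\<^sub>R (F * (\<Sum>l\<in>I. B i l *\<^sub>R pd l g))"
  proof -
    have "B i l *\<^sub>R pd l (F * g) = B i l *\<^sub>R (pd l F * g) + sg (p \<and> \<not> odd_ix i) *\<^sub>R (F * B i l *\<^sub>R pd l g)" for l
    proof (cases "B i l = 0")
      case False
      then have "odd_ix l = (\<not> odd_ix i)" using B(1) by (auto simp: mat_def)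
      then show ?thesis unfolding pd_mult[OF F] by (simp add: scaleR_add_right conj_commute)
    qed simp
    then show ?thesis
      by (simp add: brk_def sum.distrib scaleR_sum_right sum_distrib_left sum_distrib_right)
  qed
  have "T B (F * (mon [i] * g)) = sg (p \<and> odd_ix i) *\<^sub>R T B (mon [i] * (F * g))"
    by (simp add: c1)
  also have "\<dots> = T B F * (mon [i] * g) + sg p *\<^sub>R (F * T B (mon [i] * g)) +
      2 *\<^sub>R deriv_ext (\<not> p) (brk B p F) (mon [i] * g)"
    unfolding T_mult_gen[OF B] s IH deriv_mult_gen[OF v]
    by (cases p; cases "odd_ix i")
      (simp_all add: distrib_left right_diff_distrib scaleR_add_right scaleR_diff_right
        mult_scaleR_right mult_scaleR_left c1 c2 algebra_simps)
  finally show "T B (F * (mon [i] * g)) = T B F * (mon [i] * g) + sg p *\<^sub>R (F * T B (mon [i] * g)) +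
      2 *\<^sub>R deriv_ext (\<not> p) (brk B p F) (mon [i] * g)" .
qed (simp add: super_vf_brk[OF B(1) F])

end

section \<open>Tensors and linear vector fields on A tensor V\<close>

context superfield
begin

text \<open>The tensor of \<open>N\<close> and the inverse symplectic form. As the scalar product of \<open>A\<close> is odd, \<open>t\<close> is opposite
  to the parity of \<open>N\<close>.\<close>
definition tens :: "bool \<Rightarrow> ('e \<times> 'o \<Rightarrow> 'e \<times> 'o) \<Rightarrow> cix \<times> vix \<Rightarrow> cix \<times> vix \<Rightarrow> real" where
  "tens t N i j = (if i \<in> WW \<and> j \<in> WW \<and> snd j = vhat (snd i)
     then veta (snd i) * sg ((odd_ix (fst i) \<noteq> t) \<and> (odd_ix (snd i) \<noteq> t)) *
       form (N (e (cdual (fst i)))) (e (cdual (fst j))) else 0)"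

lemma form_parity: "x \<in> graded_part p \<Longrightarrow> y \<in> graded_part q \<Longrightarrow> form x y \<noteq> 0 \<Longrightarrow> q = (\<not> p)"
  using form_odd[of x p y] by (cases "p = q") auto

lemma mat_tens:
  assumes "\<And>x p. x \<in> graded_part p \<Longrightarrow> N x \<in> graded_part (p \<noteq> (\<not> t))"
  shows "W.mat t (tens t N)"
  unfolding W.mat_def
proof (intro allI impI)
  fix i j assume nz: "tens t N i j \<noteq> 0"
  then have ij: "i \<in> WW" "j \<in> WW" "snd j = vhat (snd i)" and
    f: "form (N (e (cdual (fst i)))) (e (cdual (fst j))) \<noteq> 0"
    by (auto simp: tens_def split: if_splits)
  have "e (cdual (fst i)) \<in> graded_part (\<not> odd_ix (fst i))" "e (cdual (fst j)) \<in> graded_part (\<not> odd_ix (fst j))"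
    using e_graded[of "cdual (fst i)"] e_graded[of "cdual (fst j)"] ij by (auto simp: mem_Times_iff)
  from form_parity[OF assms[OF this(1)] this(2) f]
  show "i \<in> WW \<and> j \<in> WW \<and> (odd_ix i \<noteq> odd_ix j) = t"
    using ij by (auto simp: odd_ix_prod_def)
qed

text \<open>The graded self-adjointness of \<open>N\<close> and the symmetry of the inverse
  symplectic form, encoded in \<open>veta_vhat\<close>, combine to supersymmetry of the
  product.\<close>

lemma msym_tens:
  assumes N: "\<And>x p. x \<in> graded_part p \<Longrightarrow> N x \<in> graded_part (p \<noteq> (\<not> t))"
    and adj: "\<And>x y p. x \<in> graded_part p \<Longrightarrow> form (N x) y = sg (p \<and> \<not> t) * form x (N y)"
  shows "W.msym (tens t N)"
  unfolding W.msym_def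
proof (intro allI)
  fix i j
  show "tens t N j i = sg (odd_ix i \<and> odd_ix j) * tens t N i j"
  proof (cases "i \<in> WW \<and> j \<in> WW \<and> snd j = vhat (snd i)")
    case True
    then obtain a v b where ij: "i = (a, v)" "j = (b, vhat v)" "a \<in> idx r" "b \<in> idx r" "v \<in> VV"
      by (cases i; cases j) auto
    have g: "e (cdual a) \<in> graded_part (\<not> odd_ix a)" "e (cdual b) \<in> graded_part (\<not> odd_ix b)"
      using e_graded[of "cdual a"] e_graded[of "cdual b"] ij by auto
    have "form (N (e (cdual b))) (e (cdual a)) = sg (\<not> odd_ix b \<and> \<not> t) * form (N (e (cdual a))) (e (cdual b))"
      unfolding adj[OF g(2)] by (simp add: form_commute)
    moreover have "form (N (e (cdual a))) (e (cdual b)) = 0 \<or> odd_ix b = (odd_ix a \<noteq> t)"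
      using form_parity[OF N[OF g(1)] g(2)] by auto
    ultimately show ?thesis
      using ij by (simp add: tens_def veta_vhat)
        (cases "odd_ix a"; cases "odd_ix b"; cases "odd_ix v"; cases t; auto)
  next
    case False
    then have "tens t N i j = 0" "tens t N j i = 0"
      by (auto simp: tens_def)
    then show ?thesis by simp
  qed
qed

lemma tens_linear:
  "tens t (\<lambda>x. N x + c *\<^sub>R N' x) i j = tens t N i j + c * tens t N' i j"
  "tens t (\<lambda>x. N x - N' x) i j = tens t N i j - tens t N' i j"
  by (simp_all add: tens_def algebra_simps)

text \<open>By \<open>form_d\<close> the coefficients are those of minus the coordinate composed
  with d on the A factor.\<close>

definition Qm :: "cix \<times> vix \<Rightarrow> cix \<times> vix \<Rightarrow> real" where
  "Qm i j = (if i \<in> WW \<and> j \<in> WW \<and> snd j = snd i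
     then - sg (odd_ix (fst i)) * form (d (e (cdual (fst i)))) (e (fst j)) else 0)"

lemma mat_Qm: "W.mat True Qm"
  unfolding W.mat_def
proof (intro allI impI)
  fix i j assume nz: "Qm i j \<noteq> 0"
  then have ij: "i \<in> WW" "j \<in> WW" "snd j = snd i" and
    f: "form (d (e (cdual (fst i)))) (e (fst j)) \<noteq> 0"
    by (auto simp: Qm_def split: if_splits)
  have "e (cdual (fst i)) \<in> graded_part (\<not> odd_ix (fst i))" "e (fst j) \<in> graded_part (odd_ix (fst j))"
    using e_graded[of "cdual (fst i)"] e_graded[of "fst j"] ij by (auto simp: mem_Times_iff)
  from form_parity[OF d_odd[OF this(1)] this(2) f]
  show "i \<in> WW \<and> j \<in> WW \<and> (odd_ix i \<noteq> odd_ix j) = True"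
    using ij by (auto simp: odd_ix_prod_def)
qed

text \<open>The linear field \<open>U\<close> on V, extended by the identity of A; the sign arises
  from moving a field of parity \<open>p\<close> past the A index.\<close>

definition Um :: "(vix \<Rightarrow> vix \<Rightarrow> real) \<Rightarrow> bool \<Rightarrow> cix \<times> vix \<Rightarrow> cix \<times> vix \<Rightarrow> real" where
  "Um U p i j = (if i \<in> WW \<and> j \<in> WW \<and> fst j = fst i
     then sg (p \<and> odd_ix (fst i)) * U (snd i) (snd j) else 0)"

lemma mat_Um: "V.mat p U \<Longrightarrow> W.mat p (Um U p)"
  unfolding W.mat_def V.mat_def Um_def odd_ix_prod_def by auto

lemma form_d_adj: "x \<in> graded_part p \<Longrightarrow> form x (d y) = - sg p * form (d x) y"
  using form_d[of x p y] by (cases p) auto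

lemma e_expand: "(\<Sum>c\<in>idx r. form x (e c) * form (e (cdual c)) y) = form x y"
  "(\<Sum>c\<in>idx r. form x (e (cdual c)) * form (e c) y) = form x y"
proof -
  have "form x y = form (\<Sum>c\<in>idx r. form x (e (cdual c)) *\<^sub>R e c) y"
    by (subst e_complete[of x]) simp
  then show "(\<Sum>c\<in>idx r. form x (e (cdual c)) * form (e c) y) = form x y" by simp
  then show "(\<Sum>c\<in>idx r. form x (e c) * form (e (cdual c)) y) = form x y"
    using sum_cdual[of "\<lambda>c. form x (e (cdual c)) * form (e c) y" r] by simp
qed

lemma e_complete': "(\<Sum>c\<in>idx r. form x (e c) *\<^sub>R e (cdual c)) = x"
  using e_complete[of x] sum_cdual[of "\<lambda>c. form x (e (cdual c)) *\<^sub>R e c" r] by simp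

lemma sum_WW_fst:
  "(\<Sum>i\<in>WW. if snd i = v then F i else 0) = (if v \<in> VV then \<Sum>c\<in>idx r. F (c, v) else (0::'z::comm_monoid_add))"
  by (simp add: sum.cartesian_product[symmetric, of _ VV "idx r", simplified split_def] sum.delta
      sum.cartesian_product' cong: if_cong)

lemma sum_WW_snd:
  "(\<Sum>i\<in>WW. if fst i = a then F i else 0) = (if a \<in> idx r then \<Sum>v\<in>VV. F (a, v) else (0::'z::comm_monoid_add))"
proof -
  have "(\<Sum>i\<in>WW. if fst i = a then F i else 0) = (\<Sum>c\<in>idx r. \<Sum>v\<in>VV. if c = a then F (c, v) else 0)"
    by (simp add: sum.cartesian_product')
  also have "\<dots> = (\<Sum>c\<in>idx r. if c = a then \<Sum>v\<in>VV. F (c, v) else 0)"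
    by (intro sum.cong) auto
  finally show ?thesis by (simp add: sum.delta)
qed

text \<open>The field of d acts on the tensor of \<open>N\<close> through the supercommutator of d
  and \<open>N\<close>, whose parity is opposite to \<open>t\<close>. For a homotopy this is d s + s
  d, for a product of two homotopies it is d N - N d.\<close>

lemma Rm_Qm_tens:
  assumes N: "linear N" "\<And>x p. x \<in> graded_part p \<Longrightarrow> N x \<in> graded_part (p \<noteq> (\<not> t))"
  shows "W.Rm True Qm (tens t N) = tens (\<not> t) (\<lambda>x. d (N x) + (if t then -1 else 1) *\<^sub>R N (d x))"
proof (intro ext)
  fix i j
  show "W.Rm True Qm (tens t N) i j = tens (\<not> t) (\<lambda>x. d (N x) + (if t then -1 else 1) *\<^sub>R N (d x)) i j"
  proof (cases "i \<in> WW \<and> j \<in> WW \<and> snd j = vhat (snd i)")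
    case False
    have "Qm i k * tens t N k j + sg (True \<and> odd_ix i) * tens t N i k * Qm j k = 0" for k
      using False by (auto simp: Qm_def tens_def)
    then have "W.Rm True Qm (tens t N) i j = 0"
      unfolding W.Rm_def by (intro sum.neutral ballI)
    moreover have "tens (\<not> t) (\<lambda>x. d (N x) + (if t then -1 else 1) *\<^sub>R N (d x)) i j = 0"
      unfolding tens_def using False by (intro if_not_P) blast
    ultimately show ?thesis by simp
  next
    case True
    then obtain a v b where ij: "i = (a, v)" "j = (b, vhat v)" "a \<in> idx r" "b \<in> idx r" "v \<in> VV"
      by (cases i; cases j) auto
    have g: "e (cdual a) \<in> graded_part (\<not> odd_ix a)" "e (cdual b) \<in> graded_part (\<not> odd_ix b)"
      using e_graded[of "cdual a"] e_graded[of "cdual b"] ij by auto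
    let ?x = "e (cdual a)" and ?y = "e (cdual b)"
    have dx: "d ?x \<in> graded_part (odd_ix a)" using d_odd[OF g(1)] by simp
    have 1: "(\<Sum>k\<in>WW. Qm i k * tens t N k j) =
      - sg (odd_ix a) * veta v * sg ((odd_ix a = t) \<and> (odd_ix v \<noteq> t)) * form (N (d ?x)) ?y"
    proof -
      have "(\<Sum>k\<in>WW. Qm i k * tens t N k j) =
        (\<Sum>k\<in>WW. if snd k = v then - sg (odd_ix a) * form (d ?x) (e (fst k)) *
           (veta v * sg ((odd_ix (fst k) \<noteq> t) \<and> (odd_ix v \<noteq> t)) * form (N (e (cdual (fst k)))) ?y) else 0)"
        using ij by (intro sum.cong refl) (auto simp: Qm_def tens_def)
      also have "\<dots> = (\<Sum>c\<in>idx r. - sg (odd_ix a) * form (d ?x) (e c) *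
           (veta v * sg ((odd_ix c \<noteq> t) \<and> (odd_ix v \<noteq> t)) * form (N (e (cdual c))) ?y))"
        using ij by (subst sum_WW_fst) simp
      also have "\<dots> = (\<Sum>c\<in>idx r. - sg (odd_ix a) * veta v * sg ((odd_ix a = t) \<and> (odd_ix v \<noteq> t)) *
           (form (d ?x) (e c) * form (N (e (cdual c))) ?y))"
      proof (intro sum.cong refl)
        fix c assume c: "c \<in> idx r"
        have "form (d ?x) (e c) = 0 \<or> odd_ix c = (\<not> odd_ix a)"
          using form_parity[OF dx e_graded[OF c]] by auto
        then show "- sg (odd_ix a) * form (d ?x) (e c) *
           (veta v * sg ((odd_ix c \<noteq> t) \<and> (odd_ix v \<noteq> t)) * form (N (e (cdual c))) ?y) =
           - sg (odd_ix a) * veta v * sg ((odd_ix a = t) \<and> (odd_ix v \<noteq> t)) *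
           (form (d ?x) (e c) * form (N (e (cdual c))) ?y)"
          by (elim disjE) simp_all
      qed
      also have "\<dots> = - sg (odd_ix a) * veta v * sg ((odd_ix a = t) \<and> (odd_ix v \<noteq> t)) *
           form (N (\<Sum>c\<in>idx r. form (d ?x) (e c) *\<^sub>R e (cdual c))) ?y"
        by (simp add: sum_distrib_left linear_sum[OF N(1)] linear_scale[OF N(1)])
      finally show ?thesis unfolding e_complete' .
    qed
    have Nx: "N ?x \<in> graded_part ((\<not> odd_ix a) \<noteq> (\<not> t))" by (rule N(2)[OF g(1)])
    have 2: "(\<Sum>k\<in>WW. tens t N i k * Qm j k) =
      veta v * sg ((odd_ix a \<noteq> t) \<and> (odd_ix v \<noteq> t)) * (- sg (odd_ix b)) * form (N ?x) (d ?y)"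
    proof -
      have "(\<Sum>k\<in>WW. tens t N i k * Qm j k) =
        (\<Sum>k\<in>WW. if snd k = vhat v then veta v * sg ((odd_ix a \<noteq> t) \<and> (odd_ix v \<noteq> t)) * form (N ?x) (e (cdual (fst k))) *
           (- sg (odd_ix b) * form (d ?y) (e (fst k))) else 0)"
        using ij by (intro sum.cong refl) (auto simp: Qm_def tens_def)
      also have "\<dots> = (\<Sum>c\<in>idx r. veta v * sg ((odd_ix a \<noteq> t) \<and> (odd_ix v \<noteq> t)) * (- sg (odd_ix b)) *
           (form (N ?x) (e (cdual c)) * form (e c) (d ?y)))"
        using ij by (subst sum_WW_fst) (simp add: form_commute[of "d ?y"] mult_ac)
      finally show ?thesis by (simp only: e_expand sum_distrib_left[symmetric])
    qed
    have 3: "form (N ?x) (d ?y) = - sg (odd_ix a \<noteq> t) * form (d (N ?x)) ?y"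
      using form_d_adj[OF Nx, of ?y] by (cases "odd_ix a"; cases t) simp_all
    have 4: "form (d (N ?x)) ?y = 0 \<or> odd_ix b = (odd_ix a = t)"
      using form_parity[OF d_odd[OF Nx] g(2)] by auto
    have "W.Rm True Qm (tens t N) i j = (\<Sum>k\<in>WW. Qm i k * tens t N k j) + sg (odd_ix i) * (\<Sum>k\<in>WW. tens t N i k * Qm j k)"
      by (simp add: W.Rm_def sum.distrib sum_distrib_left mult.assoc)
    also have "\<dots> = tens (\<not> t) (\<lambda>x. d (N x) + (if t then -1 else 1) *\<^sub>R N (d x)) i j"
      unfolding 1 2 3 using 4 ij
      by (cases "odd_ix a"; cases "odd_ix v"; cases t; cases "odd_ix b") (auto simp: tens_def algebra_simps)
    finally show ?thesis .
  qed
qed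

text \<open>The hypothesis \<open>sym\<close> says that \<open>U\<close> preserves the inverse
  symplectic form. As \<open>U\<close> does not touch the A factor, it preserves the tensor of every
  \<open>N\<close>.\<close>

lemma Rm_Um_tens:
  assumes U: "V.mat p U" and sym: "\<And>v w. v \<in> VV \<Longrightarrow> w \<in> VV \<Longrightarrow>
      U v (vhat w) * veta (vhat w) + sg (p \<and> odd_ix v) * veta v * U w (vhat v) = 0"
    and N: "\<And>x p. x \<in> graded_part p \<Longrightarrow> N x \<in> graded_part (p \<noteq> (\<not> t))"
  shows "W.Rm p (Um U p) (tens t N) = (\<lambda>i j. 0)"
proof (intro ext)
  fix i j
  show "W.Rm p (Um U p) (tens t N) i j = 0"
  proof (cases "i \<in> WW \<and> j \<in> WW")
    case False
    have "Um U p i k * tens t N k j + sg (p \<and> odd_ix i) * tens t N i k * Um U p j k = 0" for k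
      using False by (auto simp: Um_def tens_def)
    then show ?thesis by (simp add: W.Rm_def)
  next
    case True
    then obtain a v b w where ij: "i = (a, v)" "j = (b, w)" "a \<in> idx r" "b \<in> idx r" "v \<in> VV" "w \<in> VV"
      by (cases i; cases j) auto
    have g: "e (cdual a) \<in> graded_part (\<not> odd_ix a)" "e (cdual b) \<in> graded_part (\<not> odd_ix b)"
      using e_graded[of "cdual a"] e_graded[of "cdual b"] ij by auto
    let ?f = "form (N (e (cdual a))) (e (cdual b))"
    have 1: "(\<Sum>k\<in>WW. Um U p i k * tens t N k j) =
      sg (p \<and> odd_ix a) * U v (vhat w) * (veta (vhat w) * sg ((odd_ix a \<noteq> t) \<and> (odd_ix w \<noteq> t)) * ?f)"
    proof -
      have "(\<Sum>k\<in>WW. Um U p i k * tens t N k j) = (\<Sum>k\<in>WW. if fst k = a then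
         (if snd k = vhat w then sg (p \<and> odd_ix a) * U v (snd k) * (veta (snd k) * sg ((odd_ix a \<noteq> t) \<and> (odd_ix w \<noteq> t)) * ?f) else 0) else 0)"
        using ij by (intro sum.cong refl) (auto simp: Um_def tens_def vhat_eq_iff)
      then show ?thesis using ij by (simp add: sum_WW_snd sum.delta)
    qed
    have 2: "(\<Sum>k\<in>WW. tens t N i k * Um U p j k) =
      veta v * sg ((odd_ix a \<noteq> t) \<and> (odd_ix v \<noteq> t)) * ?f * (sg (p \<and> odd_ix b) * U w (vhat v))"
    proof -
      have "(\<Sum>k\<in>WW. tens t N i k * Um U p j k) = (\<Sum>k\<in>WW. if fst k = b then
         (if snd k = vhat v then veta v * sg ((odd_ix a \<noteq> t) \<and> (odd_ix v \<noteq> t)) * ?f * (sg (p \<and> odd_ix b) * U w (snd k)) else 0) else 0)"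
        using ij by (intro sum.cong refl) (auto simp: Um_def tens_def vhat_eq_iff)
      then show ?thesis using ij by (simp add: sum_WW_snd sum.delta)
    qed
    have 3: "?f = 0 \<or> odd_ix b = (odd_ix a \<noteq> t)"
      using form_parity[OF N[OF g(1)] g(2)] by auto
    have 4: "U v (vhat w) = 0 \<and> U w (vhat v) = 0 \<or> odd_ix w = (odd_ix v \<noteq> p)"
      using U by (auto simp: V.mat_def)
    have "W.Rm p (Um U p) (tens t N) i j = (\<Sum>k\<in>WW. Um U p i k * tens t N k j) + sg (p \<and> odd_ix i) * (\<Sum>k\<in>WW. tens t N i k * Um U p j k)"
      by (simp add: W.Rm_def sum.distrib sum_distrib_left mult.assoc)
    also have "\<dots> = sg (p \<and> odd_ix a) * sg ((odd_ix a \<noteq> t) \<and> (odd_ix w \<noteq> t)) * ?f *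
        (U v (vhat w) * veta (vhat w) + sg (p \<and> odd_ix v) * veta v * U w (vhat v))"
      unfolding 1 2 using 3 4 ij
      by (elim disjE; cases "odd_ix a"; cases "odd_ix v"; cases t; cases p; simp add: algebra_simps)
    finally show ?thesis using sym[OF ij(5,6)] by simp
  qed
qed

text \<open>The trace of a boundary is zero, so differentiating the generic elements amounts, up to
  sign, to differentiating \<open>z\<close>. For \<open>z = hone\<close> nothing is left, which is
  why superfields are closed.\<close>

lemma Q_GG:
  assumes "z \<in> graded_part p" "f \<in> sym_part VV K"
  shows "deriv_ext True (W.lvf Qm) (GG z f) = sg p *\<^sub>R GG (dhat z) f"
  using assms(2)
proof (rule sym_part_linear_eq)
  note vq = W.super_vf_lvf[OF mat_Qm]
  show "linear (\<lambda>f. deriv_ext True (W.lvf Qm) (GG z f))" "linear (\<lambda>f. sg p *\<^sub>R GG (dhat z) f)"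
    by (intro linear_intros vq)+
  fix w :: "vix list" assume w: "set w \<subseteq> VV"
  have lin: "deriv_ext True (W.lvf Qm) (c *\<^sub>R x) = c *\<^sub>R deriv_ext True (W.lvf Qm) x"
    "deriv_ext True (W.lvf Qm) (sum F A) = (\<Sum>a\<in>A. deriv_ext True (W.lvf Qm) (F a))" for c x A and F :: "cix \<Rightarrow> _"
    using linear_deriv[OF vq] by (auto simp: linear_scale linear_sum)
  show "deriv_ext True (W.lvf Qm) (GG z (mon w)) = sg p *\<^sub>R GG (dhat z) (mon w)"
    using assms(1) w
  proof (induction w arbitrary: z p)
    case Nil
    then show ?case by (simp add: lin vq)
  next
    case (Cons u w)
    have u: "u \<in> VV" using Cons.prems by simp
    note za = hmul_graded[OF Cons.prems(1) Eb_graded]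
    have IH: "deriv_ext True (W.lvf Qm) (GG (hmul z (Eb a)) (mon w)) =
        sg (p \<noteq> odd_ix a) *\<^sub>R GG (dhat (hmul z (Eb a))) (mon w)" if "a \<in> idx r" for a
      using Cons.IH[OF za[OF that]] Cons.prems by simp
    have "deriv_ext True (W.lvf Qm) (GG z (mon (u # w))) =
      (\<Sum>a\<in>idx r. cf p (odd_ix u) (odd_ix a) *\<^sub>R (W.lvf Qm (a, u) * GG (hmul z (Eb a)) (mon w))) +
      (\<Sum>a\<in>idx r. (sg p * cf (\<not> p) (odd_ix u) (odd_ix a)) *\<^sub>R (mon [(a, u)] * GG (hmul (dhat z) (Eb a)) (mon w))) +
      (\<Sum>a\<in>idx r. sg (odd_ix u \<and> (p \<noteq> odd_ix a)) *\<^sub>R (mon [(a, u)] * GG (hmul z (dhat (Eb a))) (mon w)))"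
      unfolding mon_Cons[of u w] GG_gen[OF Cons.prems(1)] lin sum.distrib[symmetric]
    proof (intro sum.cong refl)
      fix a assume a: "a \<in> idx r"
      show "cf p (odd_ix u) (odd_ix a) *\<^sub>R deriv_ext True (W.lvf Qm) (mon [(a, u)] * GG (hmul z (Eb a)) (mon w)) =
        cf p (odd_ix u) (odd_ix a) *\<^sub>R (W.lvf Qm (a, u) * GG (hmul z (Eb a)) (mon w)) +
        (sg p * cf (\<not> p) (odd_ix u) (odd_ix a)) *\<^sub>R (mon [(a, u)] * GG (hmul (dhat z) (Eb a)) (mon w)) +
        sg (odd_ix u \<and> (p \<noteq> odd_ix a)) *\<^sub>R (mon [(a, u)] * GG (hmul z (dhat (Eb a))) (mon w))"
        unfolding deriv_mult_gen[OF vq] IH[OF a] dhat_mul[OF Cons.prems(1)] GG_lin_z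
        by (cases "odd_ix u"; cases "odd_ix a"; cases p) (simp_all add: algebra_simps)
    qed
    \<comment> \<open>The field replaces the generic element by minus its differential, and this
      cancels the Leibniz term in which the differential falls on the inserted basis
      element.\<close>
    also have "(\<Sum>a\<in>idx r. cf p (odd_ix u) (odd_ix a) *\<^sub>R (W.lvf Qm (a, u) * GG (hmul z (Eb a)) (mon w))) =
      - (\<Sum>a\<in>idx r. sg (odd_ix u \<and> (p \<noteq> odd_ix a)) *\<^sub>R (mon [(a, u)] * GG (hmul z (dhat (Eb a))) (mon w)))"
    proof -
      have dE: "(\<Sum>a\<in>idx r. form (d (e c)) (e (cdual a)) *\<^sub>R Eb a) = dhat (Eb c)" for c
        by (rule hat_eqI) (simp_all add: dhat_def Eb_def e_complete[of "d (e c)", symmetric])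
      have l: "W.lvf Qm (a, u) = (\<Sum>c\<in>idx r. (- sg (odd_ix a) * form (d (e (cdual a))) (e c)) *\<^sub>R mon [(c, u)])"
        if "a \<in> idx r" for a
      proof -
        have "W.lvf Qm (a, u) = (\<Sum>i\<in>WW. if snd i = u then (- sg (odd_ix a) * form (d (e (cdual a))) (e (fst i))) *\<^sub>R mon [i] else 0)"
          unfolding W.lvf_def using that u by (intro sum.cong refl) (auto simp: Qm_def)
        then show ?thesis using u by (simp add: sum_WW_fst)
      qed
      have "(\<Sum>a\<in>idx r. cf p (odd_ix u) (odd_ix a) *\<^sub>R (W.lvf Qm (a, u) * GG (hmul z (Eb a)) (mon w))) =
        (\<Sum>a\<in>idx r. \<Sum>c\<in>idx r. (cf p (odd_ix u) (odd_ix a) * (- sg (odd_ix a) * form (d (e (cdual a))) (e c))) *\<^sub>R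
           (mon [(c, u)] * GG (hmul z (Eb a)) (mon w)))"
        by (intro sum.cong refl) (simp add: l sum_distrib_right scaleR_sum_right)
      also have "\<dots> = (\<Sum>a\<in>idx r. \<Sum>c\<in>idx r. (- sg (odd_ix u \<and> (p \<noteq> odd_ix c))) *\<^sub>R
           (mon [(c, u)] * GG (hmul z (form (d (e c)) (e (cdual a)) *\<^sub>R Eb a)) (mon w)))"
      proof (intro sum.cong refl)
        fix a c assume ac: "a \<in> idx r" "c \<in> idx r"
        have g: "e (cdual a) \<in> graded_part (\<not> odd_ix a)" using e_graded[of "cdual a"] ac by simp
        have f: "form (d (e (cdual a))) (e c) = sg (odd_ix a) * form (d (e c)) (e (cdual a))"
          using form_d_adj[OF g, of "e c"] by (simp add: form_commute[of "d (e c)"])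
        have "form (d (e c)) (e (cdual a)) = 0 \<or> odd_ix c = (\<not> odd_ix a)"
          using form_parity[OF d_odd[OF e_graded[OF ac(2)]] g] by auto
        then show "(cf p (odd_ix u) (odd_ix a) * (- sg (odd_ix a) * form (d (e (cdual a))) (e c))) *\<^sub>R
           (mon [(c, u)] * GG (hmul z (Eb a)) (mon w)) =
           (- sg (odd_ix u \<and> (p \<noteq> odd_ix c))) *\<^sub>R
           (mon [(c, u)] * GG (hmul z (form (d (e c)) (e (cdual a)) *\<^sub>R Eb a)) (mon w))"
          unfolding f by (elim disjE; cases "odd_ix u"; cases "odd_ix a"; cases p; simp add: linear_0[OF linear_GG_z])
      qed
      also have "\<dots> = (\<Sum>c\<in>idx r. (- sg (odd_ix u \<and> (p \<noteq> odd_ix c))) *\<^sub>R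
           (mon [(c, u)] * GG (hmul z (\<Sum>a\<in>idx r. form (d (e c)) (e (cdual a)) *\<^sub>R Eb a)) (mon w)))"
      proof (subst sum.swap, intro sum.cong refl)
        fix c
        have "linear (\<lambda>x. (- sg (odd_ix u \<and> (p \<noteq> odd_ix c))) *\<^sub>R (mon [(c, u)] * GG (hmul z x) (mon w)))"
          by (rule linearI) (simp_all add: scaleR_add_right distrib_left mult.commute)
        from linear_sum[OF this, of "\<lambda>a. form (d (e c)) (e (cdual a)) *\<^sub>R Eb a" "idx r"]
        show "(\<Sum>a\<in>idx r. (- sg (odd_ix u \<and> (p \<noteq> odd_ix c))) *\<^sub>R
           (mon [(c, u)] * GG (hmul z (form (d (e c)) (e (cdual a)) *\<^sub>R Eb a)) (mon w))) =
           (- sg (odd_ix u \<and> (p \<noteq> odd_ix c))) *\<^sub>R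
           (mon [(c, u)] * GG (hmul z (\<Sum>a\<in>idx r. form (d (e c)) (e (cdual a)) *\<^sub>R Eb a)) (mon w))" by simp
      qed
      finally show ?thesis unfolding dE by (simp add: sum_negf)
    qed
    also have "- (\<Sum>a\<in>idx r. sg (odd_ix u \<and> (p \<noteq> odd_ix a)) *\<^sub>R (mon [(a, u)] * GG (hmul z (dhat (Eb a))) (mon w))) +
      (\<Sum>a\<in>idx r. (sg p * cf (\<not> p) (odd_ix u) (odd_ix a)) *\<^sub>R (mon [(a, u)] * GG (hmul (dhat z) (Eb a)) (mon w))) +
      (\<Sum>a\<in>idx r. sg (odd_ix u \<and> (p \<noteq> odd_ix a)) *\<^sub>R (mon [(a, u)] * GG (hmul z (dhat (Eb a))) (mon w))) =
      sg p *\<^sub>R GG (dhat z) (mon (u # w))"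
      unfolding mon_Cons[of u w] GG_gen[OF dhat_graded[OF Cons.prems(1)]] scaleR_sum_right scaleR_scaleR by simp
    finally show ?case .
  qed
qed

text \<open>The field acts only on the letters in V and passes through the trace; the sign records
  that \<open>GG z\<close> has parity opposite to \<open>p\<close>.\<close>

lemma rho_GG:
  assumes "z \<in> graded_part p" and U: "V.mat q U"
  shows "deriv_ext q (W.lvf (Um U q)) (GG z f) = sg (q \<and> \<not> p) *\<^sub>R GG z (deriv_ext q (V.lvf U) f)"
proof (rule linear_eq_mon[where f=f])
  note vq = W.super_vf_lvf[OF mat_Um[OF U]] and vu = V.super_vf_lvf[OF U]
  show "linear (\<lambda>f. deriv_ext q (W.lvf (Um U q)) (GG z f))"
    "linear (\<lambda>f. sg (q \<and> \<not> p) *\<^sub>R GG z (deriv_ext q (V.lvf U) f))"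
    by (intro linear_intros vq vu)+
  let ?D = "deriv_ext q (W.lvf (Um U q))"
  have lin: "?D (c *\<^sub>R x) = c *\<^sub>R ?D x" "?D (sum F A) = (\<Sum>a\<in>A. ?D (F a))" for c x A and F :: "cix \<Rightarrow> _"
    using linear_deriv[OF vq] by (auto simp: linear_scale linear_sum)
  fix w :: "vix list"
  show "?D (GG z (mon w)) = sg (q \<and> \<not> p) *\<^sub>R GG z (deriv_ext q (V.lvf U) (mon w))"
    using assms(1)
  proof (induction w arbitrary: z p)
    case Nil
    then show ?case by (simp add: lin vq vu)
  next
    case (Cons u w)
    note za = hmul_graded[OF Cons.prems Eb_graded]
    have l: "W.lvf (Um U q) (a, u) = sg (q \<and> odd_ix a) *\<^sub>R (\<Sum>v\<in>VV. U u v *\<^sub>R mon [(a, v)])" if a: "a \<in> idx r" for a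
    proof (cases "u \<in> VV")
      case True
      have "W.lvf (Um U q) (a, u) = (\<Sum>i\<in>WW. if fst i = a then (sg (q \<and> odd_ix a) * U u (snd i)) *\<^sub>R mon [i] else 0)"
        unfolding W.lvf_def using a True by (intro sum.cong refl) (auto simp: Um_def)
      then show ?thesis using a by (simp add: sum_WW_snd scaleR_sum_right)
    next
      case False
      then have "U u v = 0" for v using U by (auto simp: V.mat_def)
      then show ?thesis using False by (simp add: W.lvf_def Um_def)
    qed
    have "?D (GG z (mon (u # w))) =
      (\<Sum>a\<in>idx r. cf p (odd_ix u) (odd_ix a) *\<^sub>R (W.lvf (Um U q) (a, u) * GG (hmul z (Eb a)) (mon w))) +
      (\<Sum>a\<in>idx r. (sg (q \<and> \<not> p) * sg (q \<and> odd_ix u) * cf p (odd_ix u) (odd_ix a)) *\<^sub>R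
        (mon [(a, u)] * GG (hmul z (Eb a)) (deriv_ext q (V.lvf U) (mon w))))"
      unfolding mon_Cons[of u w] GG_gen[OF Cons.prems] lin sum.distrib[symmetric]
    proof (intro sum.cong refl)
      fix a assume a: "a \<in> idx r"
      show "cf p (odd_ix u) (odd_ix a) *\<^sub>R ?D (mon [(a, u)] * GG (hmul z (Eb a)) (mon w)) =
        cf p (odd_ix u) (odd_ix a) *\<^sub>R (W.lvf (Um U q) (a, u) * GG (hmul z (Eb a)) (mon w)) +
        (sg (q \<and> \<not> p) * sg (q \<and> odd_ix u) * cf p (odd_ix u) (odd_ix a)) *\<^sub>R
        (mon [(a, u)] * GG (hmul z (Eb a)) (deriv_ext q (V.lvf U) (mon w)))"
        unfolding deriv_mult_gen[OF vq] Cons.IH[OF za[OF a]]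
        by (cases "odd_ix u"; cases "odd_ix a"; cases p; cases q) (simp_all add: algebra_simps)
    qed
    also have "(\<Sum>a\<in>idx r. cf p (odd_ix u) (odd_ix a) *\<^sub>R (W.lvf (Um U q) (a, u) * GG (hmul z (Eb a)) (mon w))) =
      sg (q \<and> \<not> p) *\<^sub>R GG z (V.lvf U u * mon w)"
    proof -
      have "cf p (odd_ix u) (odd_ix a) *\<^sub>R (W.lvf (Um U q) (a, u) * GG (hmul z (Eb a)) (mon w)) =
        sg (q \<and> \<not> p) *\<^sub>R (\<Sum>v\<in>VV. U u v *\<^sub>R (cf p (odd_ix v) (odd_ix a) *\<^sub>R (mon [(a, v)] * GG (hmul z (Eb a)) (mon w))))"
        if a: "a \<in> idx r" for a
        unfolding l[OF a] scaleR_sum_right sum_distrib_right mult_scaleR_left scaleR_scaleR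
      proof (intro sum.cong refl arg_cong[where f="\<lambda>c. c *\<^sub>R _"])
        fix v
        have "U u v = 0 \<or> odd_ix v = (odd_ix u \<noteq> q)" using U by (auto simp: V.mat_def)
        then show "cf p (odd_ix u) (odd_ix a) * (sg (q \<and> odd_ix a) * U u v) =
          sg (q \<and> \<not> p) * (U u v * cf p (odd_ix v) (odd_ix a))"
          by (elim disjE; cases "odd_ix u"; cases "odd_ix a"; cases p; cases q; simp)
      qed
      then have "(\<Sum>a\<in>idx r. cf p (odd_ix u) (odd_ix a) *\<^sub>R (W.lvf (Um U q) (a, u) * GG (hmul z (Eb a)) (mon w))) =
        (\<Sum>a\<in>idx r. sg (q \<and> \<not> p) *\<^sub>R (\<Sum>v\<in>VV. U u v *\<^sub>R (cf p (odd_ix v) (odd_ix a) *\<^sub>R (mon [(a, v)] * GG (hmul z (Eb a)) (mon w)))))"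
        by (intro sum.cong refl)
      also have "\<dots> = sg (q \<and> \<not> p) *\<^sub>R (\<Sum>v\<in>VV. U u v *\<^sub>R GG z (mon [v] * mon w))"
        unfolding GG_gen[OF Cons.prems] scaleR_sum_right by (rule sum.swap)
      also have "\<dots> = sg (q \<and> \<not> p) *\<^sub>R GG z (V.lvf U u * mon w)"
        by (simp add: V.lvf_def sum_distrib_right)
      finally show ?thesis .
    qed
    also have "(\<Sum>a\<in>idx r. (sg (q \<and> \<not> p) * sg (q \<and> odd_ix u) * cf p (odd_ix u) (odd_ix a)) *\<^sub>R
        (mon [(a, u)] * GG (hmul z (Eb a)) (deriv_ext q (V.lvf U) (mon w)))) =
        (sg (q \<and> \<not> p) * sg (q \<and> odd_ix u)) *\<^sub>R GG z (mon [u] * deriv_ext q (V.lvf U) (mon w))"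
      unfolding GG_gen[OF Cons.prems] scaleR_sum_right scaleR_scaleR by simp
    finally show ?case
      unfolding mon_Cons[of u w] deriv_mult_gen[OF vu] by (simp add: scaleR_add_right)
  qed
qed

end

subsection \<open>The Poisson bracket\<close>

lemma prod_list_Fn: "prod_list (map (\<lambda>v. mon [Fn v]) w) = mon (map Fn w)"
  by (induction w) (simp_all flip: mon_Cons)

lemma fn_incl_eq: "fn_incl = hom_ext (\<lambda>v. mon [Fn v])"
  by (simp add: fn_incl_def hom_ext_def fun_eq_iff prod_list_Fn)

lemma Fn_homog: "mon [Fn v] \<in> homog (odd_ix v)"
  using homog_mon1[of "Fn v"] by simp

lemmas fn_incl_simps = linear_hom_ext[of "\<lambda>v. mon [Fn v]", OF Fn_homog, folded fn_incl_eq]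
  hom_ext_mult[of "\<lambda>v. mon [Fn v]", OF Fn_homog, folded fn_incl_eq]
  hom_ext_gen[of "\<lambda>v. mon [Fn v]", OF Fn_homog, folded fn_incl_eq]
  hom_ext_one[of "\<lambda>v. mon [Fn v]", OF Fn_homog, folded fn_incl_eq]

lemma hom_ext_homog:
  assumes "\<And>v. \<phi> v \<in> homog (odd_ix v)" "f \<in> homog p"
  shows "hom_ext \<phi> f \<in> homog p"
  using assms(2)
proof (induction rule: homog_induct)
  case zero
  show ?case using linear_hom_ext[OF assms(1)] by (simp add: linear_0)
next
  case (add c w g)
  have "prod_list (map \<phi> w) \<in> homog (odd_word w)" for w
    by (induction w) (auto intro: homog_one homog_cong[OF homog_mult[OF assms(1)]])
  from this[of w] have "prod_list (map \<phi> w) \<in> homog p" using add by simp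
  then show ?case using add linear_hom_ext[OF assms(1)]
    by (simp add: linear_add linear_scale hom_ext_mon[OF assms(1)])
qed

lemma fn_incl_homog: "f \<in> homog p \<Longrightarrow> fn_incl f \<in> homog p"
  unfolding fn_incl_eq by (rule hom_ext_homog[OF Fn_homog])

lemma fn_incl_part: "fn_incl f \<in> sym_part (range Fn) UNIV"
proof -
  have "f \<in> sym_part UNIV UNIV" by simp
  then show ?thesis using fn_incl_simps(1)
  proof (rule sym_part_linear)
    fix w :: "'a list"
    have "fn_incl (mon w) = mon (map Fn w)"
      by (simp add: fn_incl_eq hom_ext_mon[OF Fn_homog] prod_list_Fn)
    moreover have "mon (map Fn w) \<in> sym_part (range Fn) UNIV" by (rule sym_part_mon) auto
    ultimately show "fn_incl (mon w) \<in> sym_part (range Fn) UNIV" by simp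
  qed simp
qed

text \<open>Setting all differentials to zero: a left inverse of \<open>fn_incl\<close>, which makes
  the latter injective for the uniqueness of Hamiltonian fields.\<close>

definition fn_proj :: "'v::super_index form_ix spoly \<Rightarrow> 'v spoly" where
  "fn_proj = hom_ext (\<lambda>u. case u of Fn v \<Rightarrow> mon [v] | Df v \<Rightarrow> 0)"

lemma fn_proj_incl: "fn_proj (fn_incl f) = f"
proof -
  have h: "(case u of Fn v \<Rightarrow> mon [v] | Df v \<Rightarrow> 0) \<in> homog (odd_ix u)" for u :: "'a form_ix"
    by (cases u) auto
  show ?thesis
    by (rule linear_eq_gen[where f=f])
      (auto simp: fn_proj_def fn_incl_simps hom_ext_mult[OF h] hom_ext_gen[OF h] hom_ext_one[OF h]
        intro!: linear_fun_comp[OF linear_hom_ext[OF h] fn_incl_simps(1)] linear_ident')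
qed

lemma linear_fn_incl_comp [linear_intros]: "linear F \<Longrightarrow> linear (\<lambda>f. fn_incl (F f))"
  by (rule linear_fun_comp[OF fn_incl_simps(1)])

lemma omega_part: "sym_part (coordsV n m) N \<subseteq> sym_part UNIV N"
  by (rule sym_part_mono) auto

locale sympl =
  fixes n m :: nat
begin

sublocale V: fin_ix "coordsV n m" by standard simp

definition hamvf :: "bool \<Rightarrow> vix spoly \<Rightarrow> vix \<Rightarrow> vix spoly" where
  "hamvf p f v = (if v \<in> coordsV n m then (veta v * sg (\<not> odd_ix v \<and> p)) *\<^sub>R pd (vhat v) f else 0)"

definition pois :: "bool \<Rightarrow> vix spoly \<Rightarrow> vix spoly \<Rightarrow> vix spoly" where
  "pois p f g = (\<Sum>v\<in>coordsV n m. (veta v * sg (odd_ix v \<and> p)) *\<^sub>R (pd (vhat v) f * pd v g))"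

lemma sum_VV: "(\<Sum>v\<in>coordsV n m. F v) = (\<Sum>i<n. F (P i)) + (\<Sum>i<n. F (Q i)) + (\<Sum>i<m. F (X i))"
  for F :: "vix \<Rightarrow> 'z::comm_monoid_add"
proof -
  have i: "inj_on P {..<n}" "inj_on Q {..<n}" "inj_on X {..<m}" by (auto simp: inj_on_def)
  show ?thesis
    unfolding coordsV_def
    by (subst sum.union_disjoint; (subst sum.union_disjoint)?)
      (auto simp: sum.reindex[OF i(1)] sum.reindex[OF i(2)] sum.reindex[OF i(3)])
qed

lemma super_vf_contraction:
  assumes "vfieldV n m p \<phi>"
  shows "super_vf (\<not> p) (\<lambda>u. case u of Fn v \<Rightarrow> 0 | Df v \<Rightarrow> fn_incl (\<phi> v))"
  unfolding super_vf_def
proof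
  fix u :: "vix form_ix"
  show "(case u of Fn v \<Rightarrow> 0 | Df v \<Rightarrow> fn_incl (\<phi> v)) \<in> homog ((\<not> p) \<noteq> odd_ix u)"
  proof (cases u)
    case (Df v)
    have "\<phi> v \<in> homog (p \<noteq> odd_ix v)"
      using assms unfolding vfieldV_def by (cases "v \<in> coordsV n m") auto
    from homog_cong[OF fn_incl_homog[OF this], of "(\<not> p) \<noteq> odd_ix u"] show ?thesis using Df by auto
  qed simp
qed

lemma contraction_omega:
  assumes "vfieldV n m p \<phi>"
  shows "contraction p \<phi> (omega n m) = (\<Sum>v\<in>coordsV n m. veta v *\<^sub>R (fn_incl (\<phi> v) * mon [Df (vhat v)]))"
proof -
  note s = super_vf_contraction[OF assms]
  note L = linear_deriv[OF s, folded contraction_def]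
  have h: "fn_incl (\<phi> v) \<in> homog (p \<noteq> odd_ix v)" for v
    using assms unfolding vfieldV_def by (cases "v \<in> coordsV n m") (auto intro: fn_incl_homog)
  have c: "contraction p \<phi> (mon [Df y, Df z]) = fn_incl (\<phi> y) * mon [Df z] +
      (sg (\<not> p \<and> \<not> odd_ix y) * sg (\<not> odd_ix y \<and> (p \<noteq> odd_ix z))) *\<^sub>R (fn_incl (\<phi> z) * mon [Df y])" for y z
    using deriv_mult_gen[OF s, of "Df y" "mon [Df z]"] supercommute[OF homog_mon1[of "Df y"] h[of z]]
    by (simp add: contraction_def s mon_Cons[of "Df y" "[Df z]"])
  have PQ: "contraction p \<phi> (mon [Df (P i), Df (Q i)]) =
      fn_incl (\<phi> (P i)) * mon [Df (Q i)] - fn_incl (\<phi> (Q i)) * mon [Df (P i)]" for i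
    unfolding c by (cases p) simp_all
  have XX: "contraction p \<phi> (mon [Df (X i), Df (X i)]) = 2 *\<^sub>R (fn_incl (\<phi> (X i)) * mon [Df (X i)])" for i
    unfolding c by (simp add: scaleR_2)
  show ?thesis
    by (simp add: omega_def linear_add[OF L] linear_scale[OF L] linear_sum[OF L] PQ XX sum_VV sum_subtractf
        sum_negf scaleR_sum_right)
qed

lemma super_vf_ext_d: "super_vf True (\<lambda>u. case u of Fn v \<Rightarrow> mon [Df v] | Df v \<Rightarrow> 0)"
  unfolding super_vf_def
proof
  fix u :: "'a form_ix"
  show "(case u of Fn v \<Rightarrow> mon [Df v] | Df v \<Rightarrow> 0) \<in> homog (True \<noteq> odd_ix u)"
    using homog_mon1[of "Df (case u of Fn v \<Rightarrow> v | Df v \<Rightarrow> v)"] by (cases u) auto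
qed

lemma ext_d_fn_incl:
  assumes "f \<in> sym_part (coordsV n m) K" "f \<in> homog p"
  shows "ext_d (fn_incl f) = (\<Sum>v\<in>coordsV n m. sg (\<not> odd_ix v \<and> p) *\<^sub>R (fn_incl (pd v f) * mon [Df v]))"
proof -
  note s = super_vf_ext_d
  have "ext_d (fn_incl f) = (\<Sum>v\<in>coordsV n m. mon [Df v] * fn_incl (pd v f))"
    using assms(1)
  proof (rule sym_part_linear_eq)
    show "linear (\<lambda>f. ext_d (fn_incl f))" unfolding ext_d_def by (intro linear_intros s)
    show "linear (\<lambda>f. \<Sum>v\<in>coordsV n m. mon [Df v] * fn_incl (pd v f))" by (intro linear_intros)
    fix w assume "set w \<subseteq> (coordsV n m)"
    then show "ext_d (fn_incl (mon w)) = (\<Sum>v\<in>coordsV n m. mon [Df v] * fn_incl (pd v (mon w)))"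
    proof (induction w)
      case Nil
      show ?case by (simp add: fn_incl_simps ext_d_def s linear_0[OF fn_incl_simps(1)])
    next
      case (Cons u w)
      have *: "mon [Df v] * fn_incl (pd v (mon [u] * mon w)) =
        (if v = u then mon [Df v] * fn_incl (mon w) else 0) +
        sg (odd_ix u) *\<^sub>R (mon [Fn u] * (mon [Df v] * fn_incl (pd v (mon w))))" for v
      proof -
        have "mon [Df v] * mon [Fn u] = sg (\<not> odd_ix v \<and> odd_ix u) *\<^sub>R (mon [Fn u] * mon [Df v])"
          using supercommute[OF homog_mon1[of "Df v"] homog_mon1[of "Fn u"]] by simp
        then have c: "mon [Df v] * (mon [Fn u] * x) = sg (\<not> odd_ix v \<and> odd_ix u) *\<^sub>R (mon [Fn u] * (mon [Df v] * x))" for x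
          by (simp flip: mult.assoc)
        show ?thesis
          unfolding pd_mult_gen linear_add[OF fn_incl_simps(1)] linear_scale[OF fn_incl_simps(1)] fn_incl_simps(2,3)
            distrib_left mult_scaleR_right c
          by (cases "odd_ix u"; cases "odd_ix v") (auto simp: linear_0[OF fn_incl_simps(1)])
      qed
      have "ext_d (fn_incl (mon [u] * mon w)) = mon [Df u] * fn_incl (mon w) + sg (odd_ix u) *\<^sub>R (mon [Fn u] * ext_d (fn_incl (mon w)))"
        by (simp add: fn_incl_simps ext_d_def deriv_mult_gen[OF s])
      also have "\<dots> = (\<Sum>v\<in>coordsV n m. mon [Df v] * fn_incl (pd v (mon [u] * mon w)))"
        unfolding * sum.distrib using Cons by (simp add: sum_distrib_left scaleR_sum_right sum.delta)
      finally show ?case unfolding mon_Cons[of u w] .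
    qed
  qed
  also have "\<dots> = (\<Sum>v\<in>coordsV n m. sg (\<not> odd_ix v \<and> p) *\<^sub>R (fn_incl (pd v f) * mon [Df v]))"
  proof (intro sum.cong refl)
    fix v
    show "mon [Df v] * fn_incl (pd v f) = sg (\<not> odd_ix v \<and> p) *\<^sub>R (fn_incl (pd v f) * mon [Df v])"
      using supercommute[OF homog_mon1[of "Df v"] fn_incl_homog[OF pd_homog[OF assms(2), of v]]]
      by (cases "odd_ix v"; cases p) simp_all
  qed
  finally show ?thesis .
qed

lemma vfieldV_hamvf:
  assumes "f \<in> sym_part (coordsV n m) K" "f \<in> homog p"
  shows "vfieldV n m p (hamvf p f)"
  unfolding vfieldV_def
proof (intro conjI ballI allI impI)
  fix v assume v: "v \<in> coordsV n m"
  have "pd (vhat v) f \<in> sym_part (coordsV n m) UNIV" by (rule pd_sym_part[OF assms(1)]) auto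
  moreover have "pd (vhat v) f \<in> homog (p \<noteq> odd_ix v)"
    by (rule homog_cong[OF pd_homog[OF assms(2), of "vhat v"]]) auto
  ultimately show "hamvf p f v \<in> sym_part (coordsV n m) UNIV \<inter> homog (p \<noteq> odd_ix v)"
    using v by (auto simp: hamvf_def intro: subspace_scale)
qed (simp add: hamvf_def)

text \<open>The explicit field solves the defining equation coefficientwise; since a definite
  description is used, uniqueness has to be proved as well.\<close>

lemma ham_vfield_eq:
  assumes "f \<in> sym_part (coordsV n m) K" "f \<in> homog p"
  shows "ham_vfield n m p f = hamvf p f"
  unfolding ham_vfield_def
proof (rule the_equality)
  have "ext_d (fn_incl f) = (\<Sum>v\<in>coordsV n m. sg (\<not> odd_ix v \<and> p) *\<^sub>R (fn_incl (pd (vhat v) f) * mon [Df (vhat v)]))"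
    unfolding ext_d_fn_incl[OF assms] by (subst sum_vhat[symmetric]) simp
  also have "\<dots> = contraction p (hamvf p f) (omega n m)"
    unfolding contraction_omega[OF vfieldV_hamvf[OF assms]]
    by (intro sum.cong refl) (simp add: hamvf_def linear_scale[OF fn_incl_simps(1)])
  finally show ham: "vfieldV n m p (hamvf p f) \<and> contraction p (hamvf p f) (omega n m) = ext_d (fn_incl f)"
    using vfieldV_hamvf[OF assms] by simp
  fix \<phi> assume phi: "vfieldV n m p \<phi> \<and> contraction p \<phi> (omega n m) = ext_d (fn_incl f)"
  \<comment> \<open>Differentiating with respect to one symbol dy isolates a single component of the
    field, because the coefficients are functions only.\<close>
  have ex: "pd (Df (vhat w)) (contraction p \<psi> (omega n m)) =
      (veta w * sg (\<not> odd_ix w \<and> (p \<noteq> odd_ix w))) *\<^sub>R fn_incl (\<psi> w)"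
    if psi: "vfieldV n m p \<psi>" and w: "w \<in> coordsV n m" for \<psi> w
  proof -
    have h: "fn_incl (\<psi> v) \<in> homog (p \<noteq> odd_ix v)" for v
      using psi unfolding vfieldV_def by (cases "v \<in> coordsV n m") (auto intro: fn_incl_homog)
    have z: "pd (Df (vhat w)) (fn_incl (\<psi> v)) = 0" for v
      by (rule pd_sym_part_0[OF fn_incl_part]) auto
    have "pd (Df (vhat w)) (fn_incl (\<psi> v) * mon [Df (vhat v)]) =
       (if v = w then sg (\<not> odd_ix w \<and> (p \<noteq> odd_ix w)) *\<^sub>R fn_incl (\<psi> w) else 0)" for v
      using pd_mult[OF h[of v], of "Df (vhat w)" "mon [Df (vhat v)]"] z[of v]
      by (auto simp: vhat_eq_iff)
    then show ?thesis
      unfolding contraction_omega[OF psi] pd_simps using w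
      by (simp add: if_distrib[of "\<lambda>x. _ *\<^sub>R x"] sum.delta' cong: if_cong)
  qed
  show "\<phi> = hamvf p f"
  proof
    fix v
    show "\<phi> v = hamvf p f v"
    proof (cases "v \<in> coordsV n m")
      case True
      have nz: "veta v * sg (\<not> odd_ix v \<and> (p \<noteq> odd_ix v)) \<noteq> 0" by (cases v; auto simp: sg_def)
      have "(veta v * sg (\<not> odd_ix v \<and> (p \<noteq> odd_ix v))) *\<^sub>R fn_incl (\<phi> v) =
          (veta v * sg (\<not> odd_ix v \<and> (p \<noteq> odd_ix v))) *\<^sub>R fn_incl (hamvf p f v)"
        using ex[OF _ True, of \<phi>] ex[OF _ True, of "hamvf p f"] ham phi by simp
      then have "fn_incl (\<phi> v) = fn_incl (hamvf p f v)" using nz by (metis scaleR_cancel_left)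
      then show ?thesis by (metis fn_proj_incl)
    next
      case False
      then show ?thesis using phi by (auto simp: vfieldV_def hamvf_def)
    qed
  qed
qed

lemma super_vf_hamvf:
  assumes "f \<in> homog p"
  shows "super_vf p (hamvf p f)"
  unfolding super_vf_def hamvf_def
proof
  fix v
  have "pd (vhat v) f \<in> homog (p \<noteq> odd_ix v)"
    by (rule homog_cong[OF pd_homog[OF assms]]) auto
  then show "(if v \<in> coordsV n m then (veta v * sg (\<not> odd_ix v \<and> p)) *\<^sub>R pd (vhat v) f else 0) \<in> homog (p \<noteq> odd_ix v)"
    by simp
qed

lemma poisson_deriv:
  assumes "f \<in> sym_part (coordsV n m) K" "f \<in> homog p"
  shows "poisson n m f g = sg p *\<^sub>R deriv_ext p (hamvf p f) g"
proof -
  have z: "(0 :: vix spoly) \<in> sym_part (coordsV n m) K" by (simp add: subspace_0)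
  \<comment> \<open>\<open>poisson\<close> sums over both parities; the component of the other
    parity is 0, and its field must be seen to vanish.\<close>
  have h0: "hamvf q 0 = (\<lambda>v. 0)" for q by (auto simp: hamvf_def)
  have d0: "deriv_ext q (\<lambda>v. 0) g = 0" for q
    by (rule linear_eq_gen[where f=g])
      (auto simp: super_vf_def deriv_mult_gen intro!: linear_deriv linear_zero)
  have "ham_vfield n m q (component q f) = (if q = p then hamvf p f else (\<lambda>v. 0))" for q
    using ham_vfield_eq[OF assms] ham_vfield_eq[OF z, of q] ham_vfield_eq[OF z, of "\<not> p"]
    by (simp add: component_homog[OF assms(2)] h0)
  then show ?thesis
    unfolding poisson_def UNIV_bool by (cases p) (simp_all add: d0)
qed

lemma poisson_eq:
  assumes "f \<in> sym_part (coordsV n m) K" "f \<in> homog p" "g \<in> sym_part (coordsV n m) K'"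
  shows "poisson n m f g = pois p f g"
  unfolding poisson_deriv[OF assms(1,2)] V.deriv_chain[OF super_vf_hamvf[OF assms(2)] assms(3)] pois_def scaleR_sum_right
proof (intro sum.cong refl)
  fix v assume "v \<in> coordsV n m"
  then show "sg p *\<^sub>R (hamvf p f v * pd v g) = (veta v * sg (odd_ix v \<and> p)) *\<^sub>R (pd (vhat v) f * pd v g)"
    by (cases p; cases "odd_ix v") (simp_all add: hamvf_def)
qed

lemma pois_homog:
  assumes "f \<in> homog p" "g \<in> homog q"
  shows "pois p f g \<in> homog (p \<noteq> q)"
  unfolding pois_def
proof (intro homog_sum homog_simps)
  fix v
  show "pd (vhat v) f * pd v g \<in> homog (p \<noteq> q)"
    by (rule homog_cong[OF homog_mult[OF pd_homog[OF assms(1)] pd_homog[OF assms(2)]]]) auto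
qed

end

subsection \<open>Bracket and Laplacian on superfields\<close>

sublocale superfield \<subseteq> sympl n m .

context superfield
begin

text \<open>Half of \<open>T Bm\<close> is the odd Laplacian: the dual-basis tensor of the odd
  scalar product combined with the inverse symplectic form.\<close>

abbreviation "Bm \<equiv> tens True (\<lambda>x. x)"

lemma mat_Bm: "W.mat True Bm"
  by (rule mat_tens) simp

lemma msym_Bm: "W.msym Bm"
  by (rule msym_tens) simp_all

lemma sum_Bm:
  fixes F :: "cix \<times> vix \<Rightarrow> 'z::real_vector"
  assumes "a \<in> idx r" "v \<in> VV"
  shows "(\<Sum>j\<in>WW. (c * Bm (a, v) j) *\<^sub>R F j) =
    (c * (veta v * sg (\<not> odd_ix a \<and> \<not> odd_ix v))) *\<^sub>R F (cdual a, vhat v)"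
proof -
  have "(\<Sum>j\<in>WW. (c * Bm (a, v) j) *\<^sub>R F j) = (\<Sum>j\<in>WW. if j = (cdual a, vhat v) then
      (c * (veta v * sg (\<not> odd_ix a \<and> \<not> odd_ix v))) *\<^sub>R F j else 0)"
  proof (intro sum.cong refl)
    fix j assume j: "j \<in> WW"
    obtain b w where bw: "j = (b, w)" by (cases j)
    have "form (e (cdual a)) (e (cdual b)) = (if b = cdual a then 1 else 0)"
      using assms j bw by (auto simp: e_dual)
    then show "(c * Bm (a, v) j) *\<^sub>R F j = (if j = (cdual a, vhat v) then
      (c * (veta v * sg (\<not> odd_ix a \<and> \<not> odd_ix v))) *\<^sub>R F j else 0)"
      using assms j bw by (auto simp: tens_def)
  qed
  then show ?thesis using assms by (simp add: sum.delta)
qed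

lemma sum_WW: "(\<Sum>i\<in>WW. F i) = (\<Sum>v\<in>VV. \<Sum>a\<in>idx r. F (a, v))"
  by (subst sum.swap) (simp add: sum.cartesian_product')

lemma linear_psi: "linear psi"
  unfolding psi_def by (rule linear_GG)

lemmas psi_simps = linear_0[OF linear_psi] linear_add[OF linear_psi] linear_scale[OF linear_psi]
  linear_diff[OF linear_psi] linear_sum[OF linear_psi]

lemma pd_psi: "a \<in> idx r \<Longrightarrow> pd (a, v) (psi f) = sg (odd_ix v \<and> \<not> odd_ix a) *\<^sub>R GG (Eb a) (pd v f)"
  using pd_GG[OF hone_graded, of a v f] by (simp add: psi_def)

lemma psi_homog: "f \<in> homog p \<Longrightarrow> psi f \<in> homog (\<not> p)"
  using GG_homog[OF hone_graded, of f p] by (simp add: psi_def)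

text \<open>Both derivatives insert a basis element, giving the product of an element with its dual.
  One of the two is even, so this product is symmetric under \<open>cdual\<close>, while its sign
  changes; hence the sum equals its own negative.\<close>

lemma T_psi: "W.T Bm (psi f) = 0"
proof -
  have Tsum: "W.T Bm (psi f) = (\<Sum>v\<in>VV. \<Sum>a\<in>idx r. \<Sum>j\<in>WW. Bm (a, v) j *\<^sub>R pd j (pd (a, v) (psi f)))"
    unfolding W.T_def by (rule sum_WW)
  have "W.T Bm (psi f) = (\<Sum>v\<in>VV. \<Sum>a\<in>idx r. (veta v * sg (\<not> odd_ix a)) *\<^sub>R
      GG (hmul (Eb a) (Eb (cdual a))) (pd (vhat v) (pd v f)))"
    unfolding Tsum
  proof (rule sum.cong[OF refl], rule sum.cong[OF refl])
    fix v a assume va: "v \<in> VV" "a \<in> idx r"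
    have "(\<Sum>j\<in>WW. Bm (a, v) j *\<^sub>R pd j (pd (a, v) (psi f))) =
       (veta v * sg (\<not> odd_ix a \<and> \<not> odd_ix v)) *\<^sub>R pd (cdual a, vhat v) (pd (a, v) (psi f))"
      using sum_Bm[OF va(2,1), of 1 "\<lambda>j. pd j (pd (a, v) (psi f))"] by simp
    then show "(\<Sum>j\<in>WW. Bm (a, v) j *\<^sub>R pd j (pd (a, v) (psi f))) =
       (veta v * sg (\<not> odd_ix a)) *\<^sub>R GG (hmul (Eb a) (Eb (cdual a))) (pd (vhat v) (pd v f))"
      using va pd_GG[OF Eb_graded[OF va(2)], of "cdual a" "vhat v" "pd v f"]
      by (cases "odd_ix a"; cases "odd_ix v") (simp_all add: pd_psi)
  qed
  also have "\<dots> = 0"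
  proof (rule sum.neutral, rule ballI, rule self_eq_neg)
    fix v
    have "(\<Sum>a\<in>idx r. (veta v * sg (\<not> odd_ix a)) *\<^sub>R GG (hmul (Eb a) (Eb (cdual a))) (pd (vhat v) (pd v f))) =
      (\<Sum>a\<in>idx r. (veta v * sg (odd_ix a)) *\<^sub>R GG (hmul (Eb (cdual a)) (Eb a)) (pd (vhat v) (pd v f)))"
      by (subst sum_cdual[symmetric]) simp
    also have "\<dots> = (\<Sum>a\<in>idx r. - ((veta v * sg (\<not> odd_ix a)) *\<^sub>R GG (hmul (Eb a) (Eb (cdual a))) (pd (vhat v) (pd v f))))"
    proof (intro sum.cong refl)
      fix a assume a: "a \<in> idx r"
      have "hmul (Eb (cdual a)) (Eb a) = hmul (Eb a) (Eb (cdual a))"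
        using hmul_commute[OF Eb_graded[of "cdual a"] Eb_graded[of a]] a by simp
      then show "(veta v * sg (odd_ix a)) *\<^sub>R GG (hmul (Eb (cdual a)) (Eb a)) (pd (vhat v) (pd v f)) =
        - ((veta v * sg (\<not> odd_ix a)) *\<^sub>R GG (hmul (Eb a) (Eb (cdual a))) (pd (vhat v) (pd v f)))"
        by simp
    qed
    finally show "(\<Sum>a\<in>idx r. (veta v * sg (\<not> odd_ix a)) *\<^sub>R GG (hmul (Eb a) (Eb (cdual a))) (pd (vhat v) (pd v f))) =
      - (\<Sum>a\<in>idx r. (veta v * sg (\<not> odd_ix a)) *\<^sub>R GG (hmul (Eb a) (Eb (cdual a))) (pd (vhat v) (pd v f)))"
      by (simp add: sum_negf)
  qed
  finally show ?thesis .
qed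

text \<open>The bracket differentiates each superfield once and sums over dual indices, which is the
  shape that \<open>casimir\<close> glues into one trace. Degree at least 2 keeps the derivatives
  free of constant terms.\<close>

lemma brk_psi:
  assumes f: "f \<in> sym_part VV {2..}" "f \<in> homog p" and g: "g \<in> sym_part VV {2..}"
  shows "deriv_ext p (W.brk Bm (\<not> p) (psi f)) (psi g) = - (sg p *\<^sub>R psi (pois p f g))"
proof -
  have v: "super_vf p (W.brk Bm (\<not> p) (psi f))"
    using W.super_vf_brk[OF mat_Bm psi_homog[OF f(2)]] by simp
  have part: "psi g \<in> sym_part WW UNIV" unfolding psi_def by (rule GG_part[OF g])
  have up: "h \<in> sym_part UNIV {1..}" if "h \<in> sym_part VV {1..}" for h :: "vix spoly"
    using that omega_part by blast
  have pf: "pd v f \<in> sym_part UNIV {1..}" "pd v g \<in> sym_part UNIV {1..}" for v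
    by (rule up, rule pd_sym_part[OF f(1)], simp) (rule up, rule pd_sym_part[OF g], simp)
  have "deriv_ext p (W.brk Bm (\<not> p) (psi f)) (psi g) = (\<Sum>v\<in>VV. \<Sum>a\<in>idx r.
      (- (sg p * veta v * sg (odd_ix v \<and> p) * sg (\<not> odd_ix a \<and> (odd_ix v \<noteq> p)))) *\<^sub>R
      (GG (Eb (cdual a)) (pd (vhat v) f) * GG (Eb a) (pd v g)))"
    unfolding W.deriv_chain[OF v part] sum_WW
  proof (intro sum.cong refl)
    fix v a assume va: "v \<in> VV" "a \<in> idx r"
    have b: "W.brk Bm (\<not> p) (psi f) (a, v) = (sg (\<not> p \<and> (odd_ix a \<noteq> odd_ix v)) *
        (veta v * sg (\<not> odd_ix a \<and> \<not> odd_ix v))) *\<^sub>R pd (cdual a, vhat v) (psi f)"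
      unfolding W.brk_def using sum_Bm[OF va(2,1)] by simp
    have c: "sg (\<not> p \<and> (odd_ix a \<noteq> odd_ix v)) * (veta v * sg (\<not> odd_ix a \<and> \<not> odd_ix v)) *
        sg (odd_ix v \<and> odd_ix a) * sg (odd_ix v \<and> \<not> odd_ix a) =
        - (sg p * veta v * sg (odd_ix v \<and> p) * sg (\<not> odd_ix a \<and> (odd_ix v \<noteq> p)))"
      by (cases "odd_ix a"; cases "odd_ix v"; cases p) simp_all
    have "W.brk Bm (\<not> p) (psi f) (a, v) * pd (a, v) (psi g) =
      (sg (\<not> p \<and> (odd_ix a \<noteq> odd_ix v)) * (veta v * sg (\<not> odd_ix a \<and> \<not> odd_ix v)) *
        sg (odd_ix v \<and> odd_ix a) * sg (odd_ix v \<and> \<not> odd_ix a)) *\<^sub>R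
      (GG (Eb (cdual a)) (pd (vhat v) f) * GG (Eb a) (pd v g))"
      unfolding b using va by (simp add: pd_psi)
    then show "W.brk Bm (\<not> p) (psi f) (a, v) * pd (a, v) (psi g) =
      (- (sg p * veta v * sg (odd_ix v \<and> p) * sg (\<not> odd_ix a \<and> (odd_ix v \<noteq> p)))) *\<^sub>R
      (GG (Eb (cdual a)) (pd (vhat v) f) * GG (Eb a) (pd v g))"
      unfolding c .
  qed
  also have "\<dots> = (\<Sum>v\<in>VV. (- (sg p * veta v * sg (odd_ix v \<and> p))) *\<^sub>R psi (pd (vhat v) f * pd v g))"
  proof (intro sum.cong refl)
    fix v
    have h: "pd (vhat v) f \<in> homog (odd_ix v \<noteq> p)" using pd_homog[OF f(2), of "vhat v"] by simp
    have "psi (pd (vhat v) f * pd v g) = (\<Sum>a\<in>idx r. sg (\<not> odd_ix a \<and> (odd_ix v \<noteq> p)) *\<^sub>R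
      (GG (Eb (cdual a)) (pd (vhat v) f) * GG (Eb a) (pd v g)))"
      unfolding casimir[OF pf(1) h pf(2)] by (subst sum_cdual[symmetric]) simp
    then show "(\<Sum>a\<in>idx r. (- (sg p * veta v * sg (odd_ix v \<and> p) * sg (\<not> odd_ix a \<and> (odd_ix v \<noteq> p)))) *\<^sub>R
      (GG (Eb (cdual a)) (pd (vhat v) f) * GG (Eb a) (pd v g))) =
      (- (sg p * veta v * sg (odd_ix v \<and> p))) *\<^sub>R psi (pd (vhat v) f * pd v g)"
      by (simp add: scaleR_sum_right)
  qed
  also have "\<dots> = - (sg p *\<^sub>R psi (pois p f g))"
    unfolding pois_def psi_simps scaleR_sum_right sum_negf[symmetric] by (intro sum.cong refl) simp
  finally show ?thesis .
qed

subsection \<open>The Chevalley-Eilenberg complex\<close>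

definition psis :: "bool \<Rightarrow> vix spoly \<Rightarrow> (cix \<times> vix) spoly" where
  "psis b h = sg (parity h \<and> b) *\<^sub>R psi h"

text \<open>The Koszul sign \<open>p(h)\<close> distributed over the factors.\<close>
fun PP :: "vix spoly list \<Rightarrow> (cix \<times> vix) spoly" where
  "PP [] = 1"
| "PP (h # hs) = psis (odd (length hs)) h * PP hs"

text \<open>The signs in \<open>PP\<close> depend on the number of later factors, so an initial
  segment has to know how many follow it, here \<open>k\<close>.\<close>

fun PPo :: "nat \<Rightarrow> vix spoly list \<Rightarrow> (cix \<times> vix) spoly" where
  "PPo k [] = 1"
| "PPo k (h # hs) = psis (odd (length hs + k)) h * PPo k hs"

lemma PP_append: "PP (us @ vs) = PPo (length vs) us * PP vs"
  by (induction us) (simp_all add: mult.assoc)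

lemma psis_eq: "h \<in> homog p \<Longrightarrow> psis b h = sg (p \<and> b) *\<^sub>R psi h"
  by (cases "h = 0") (simp_all add: psis_def psi_simps parity_homog)

lemma psi_commute: "g \<in> homog p \<Longrightarrow> h \<in> homog q \<Longrightarrow> psi g * psi h = sg (\<not> p \<and> \<not> q) *\<^sub>R (psi h * psi g)"
  by (rule supercommute[OF psi_homog psi_homog])

lemma gtilde_homD:
  assumes "g \<in> gtilde_hom n m"
  shows "g \<in> homog (parity g)" "g \<in> sym_part VV {3..}" "g \<in> sym_part VV {2..}"
proof -
  obtain p where "g \<in> homog p" using assms by (auto simp: gtilde_hom_def)
  then show "g \<in> homog (parity g)"
    by (cases "g = 0") (simp_all add: parity_homog)
  show g: "g \<in> sym_part VV {3..}" using assms by (simp add: gtilde_hom_def gtilde_def)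
  show "g \<in> sym_part VV {2..}" using sym_part_mono[of VV VV "{3..}" "{2..}"] g by auto
qed

text \<open>A functional on polynomials on A tensor V, pulled back to chains along the product of
  superfields.\<close>

abbreviation HP :: "((cix \<times> vix) spoly \<Rightarrow> real) \<Rightarrow> chain \<Rightarrow> real" where
  "HP H \<equiv> lin_ext (\<lambda>gs. H (PP gs))"

lemma HP_simps: "HP H (word gs) = H (PP gs)" "HP H (x + y) = HP H x + HP H y" "HP H (x - y) = HP H x - HP H y"
  "HP H (c *\<^sub>R x) = c * HP H x" "HP H (sum F A) = (\<Sum>a\<in>A. HP H (F a))" "HP H 0 = 0" "HP H (- x) = - HP H x"
  by (simp_all add: linear_add[OF linear_lin_ext] linear_diff[OF linear_lin_ext] linear_scale[OF linear_lin_ext]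
      linear_sum[OF linear_lin_ext] linear_0[OF linear_lin_ext] linear_neg[OF linear_lin_ext])

text \<open>A derivation of the polynomials that acts on superfields through \<open>B\<close>
  realises the adjoint action on products. The final sign is that of \<open>D\<close>, of parity
  \<open>p\<close>, passing the odd maps \<open>psi\<close>.\<close>

lemma adjoint_sum:
  assumes D: "\<And>g F. g \<in> set gs \<Longrightarrow> D (psi g * F) = (sg p *\<^sub>R psi (B g)) * F + sg (p \<and> \<not> parity g) *\<^sub>R (psi g * D F)"
      "D 1 = 0" "linear D"
    and B: "\<And>g. g \<in> set gs \<Longrightarrow> B g \<in> homog (p \<noteq> parity g)"
    and g: "\<And>g. g \<in> set gs \<Longrightarrow> g \<in> homog (parity g)"
  shows "(\<Sum>i<length gs. sg (p \<and> odd (\<Sum>r<i. of_bool (parity (gs ! r)) :: nat)) *\<^sub>R PP (gs[i := B (gs ! i)])) =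
     sg (p \<and> odd (length gs)) *\<^sub>R D (PP gs)"
  using assms
proof (induction gs)
  case Nil
  then show ?case by simp
next
  case (Cons h hs)
  have s: "sg (p \<and> odd (\<Sum>r<Suc i. of_bool (parity ((h # hs) ! r)) :: nat)) =
      sg (p \<and> parity h) * sg (p \<and> odd (\<Sum>r<i. of_bool (parity (hs ! r)) :: nat))" for i
    unfolding sum.lessThan_Suc_shift by (cases "parity h"; cases p) (auto simp: sg_def)
  have "(\<Sum>i<length (h # hs). sg (p \<and> odd (\<Sum>r<i. of_bool (parity ((h # hs) ! r)) :: nat)) *\<^sub>R
      PP ((h # hs)[i := B ((h # hs) ! i)])) =
      psis (odd (length hs)) (B h) * PP hs + sg (p \<and> parity h) *\<^sub>R (psis (odd (length hs)) h *
        (\<Sum>i<length hs. sg (p \<and> odd (\<Sum>r<i. of_bool (parity (hs ! r)) :: nat)) *\<^sub>R PP (hs[i := B (hs ! i)])))"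
    unfolding length_Cons sum.lessThan_Suc_shift[of _ "length hs"] s
    by (simp add: sum_distrib_left scaleR_sum_right mult_scaleR_right)
  also have "(\<Sum>i<length hs. sg (p \<and> odd (\<Sum>r<i. of_bool (parity (hs ! r)) :: nat)) *\<^sub>R PP (hs[i := B (hs ! i)])) =
      sg (p \<and> odd (length hs)) *\<^sub>R D (PP hs)"
    by (rule Cons.IH) (use Cons.prems in auto)
  also have "psis (odd (length hs)) (B h) * PP hs + sg (p \<and> parity h) *\<^sub>R (psis (odd (length hs)) h *
        sg (p \<and> odd (length hs)) *\<^sub>R D (PP hs)) = sg (p \<and> odd (length (h # hs))) *\<^sub>R D (PP (h # hs))"
  proof -
    have DPP: "D (PP (h # hs)) = sg (parity h \<and> odd (length hs)) *\<^sub>R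
      ((sg p *\<^sub>R psi (B h)) * PP hs + sg (p \<and> \<not> parity h) *\<^sub>R (psi h * D (PP hs)))"
      using Cons.prems(1)[of h "PP hs"] linear_scale[OF Cons.prems(3)] by (simp add: psis_def)
    have psB: "psis (odd (length hs)) (B h) = sg ((p \<noteq> parity h) \<and> odd (length hs)) *\<^sub>R psi (B h)"
      by (rule psis_eq) (use Cons.prems in auto)
    show ?thesis
      unfolding DPP psB by (cases p; cases "parity h"; cases "odd (length hs)") (simp_all add: psis_def algebra_simps)
  qed
  finally show ?case .
qed

text \<open>Linearity yields the first two families of relations, the parity shift of superfields
  the exterior one, and \<open>inv\<close>, invariance under linear symplectic fields, the passage
  to coinvariants.\<close>

lemma cochain_HP:
  assumes H: "linear H"
    and inv: "\<And>p U f. V.mat p U \<Longrightarrow>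
      (\<And>v w. v \<in> VV \<Longrightarrow> w \<in> VV \<Longrightarrow> U v (vhat w) * veta (vhat w) + sg (p \<and> odd_ix v) * veta v * U w (vhat v) = 0) \<Longrightarrow>
      H (deriv_ext p (W.lvf (Um U p)) f) = 0"
  shows "ce_cochain n m (HP H)"
  unfolding ce_cochain_def
proof (intro conjI ballI)
  show "linear (HP H)" by (rule linear_lin_ext)
  note Hs = linear_add[OF H] linear_diff[OF H] linear_scale[OF H] linear_0[OF H]
  fix c assume "c \<in> rel_relations n m"
  then show "HP H c = 0"
    unfolding rel_relations_def
  proof (induction rule: span_induct_alt)
    case base
    show ?case by (simp add: HP_simps)
  next
    case (step a x y)
    have "HP H x = 0"
      using step(1)
    proof (elim UnE)
      assume "x \<in> {word (us @ [g + h] @ vs) - word (us @ [g] @ vs) - word (us @ [h] @ vs) | us g h vs p.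
         set (us @ vs) \<subseteq> gtilde_hom n m \<and> {g, h} \<subseteq> gtilde n m \<inter> homog p}"
      then obtain us g h vs p where x: "x = word (us @ [g + h] @ vs) - word (us @ [g] @ vs) - word (us @ [h] @ vs)"
        and gh: "g \<in> homog p" "h \<in> homog p" by blast
      have "PP (us @ [g + h] @ vs) = PP (us @ [g] @ vs) + PP (us @ [h] @ vs)"
        using gh by (simp add: PP_append psis_eq[of _ p] psi_simps algebra_simps)
      then show ?thesis by (simp add: x HP_simps Hs)
    next
      assume "x \<in> {word (us @ [c *\<^sub>R g] @ vs) - c *\<^sub>R word (us @ [g] @ vs) | us c g vs.
         set (us @ [g] @ vs) \<subseteq> gtilde_hom n m}"
      then obtain us c g vs where x: "x = word (us @ [c *\<^sub>R g] @ vs) - c *\<^sub>R word (us @ [g] @ vs)"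
        and g: "g \<in> gtilde_hom n m" by auto
      note gp = gtilde_homD(1)[OF g]
      have "PP (us @ [c *\<^sub>R g] @ vs) = c *\<^sub>R PP (us @ [g] @ vs)"
        using gp psis_eq[of "c *\<^sub>R g" "parity g"] by (simp add: PP_append psis_eq[OF gp] psi_simps)
      then show ?thesis by (simp add: x HP_simps Hs)
    next
      assume "x \<in> {word (us @ [g, h] @ vs) + sg (parity g \<and> parity h) *\<^sub>R word (us @ [h, g] @ vs) | us g h vs.
         set (us @ [g, h] @ vs) \<subseteq> gtilde_hom n m}"
      then obtain us g h vs where x: "x = word (us @ [g, h] @ vs) + sg (parity g \<and> parity h) *\<^sub>R word (us @ [h, g] @ vs)"
        and g: "g \<in> gtilde_hom n m" "h \<in> gtilde_hom n m" by auto
      \<comment> \<open>Superfields have shifted parity. Exchanging adjacent positions also alters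
        their \<open>psis\<close> signs, and together this is the sign of the wedge product.\<close>
      have "psi g * (psi h * F) = sg (\<not> parity g \<and> \<not> parity h) *\<^sub>R (psi h * (psi g * F))" for F
        using psi_commute[OF gtilde_homD(1)[OF g(1)] gtilde_homD(1)[OF g(2)]] by (simp flip: mult.assoc)
      then have "PP (us @ [g, h] @ vs) = - (sg (parity g \<and> parity h) *\<^sub>R PP (us @ [h, g] @ vs))"
        by (cases "parity g"; cases "parity h"; cases "odd (length vs)") (simp_all add: PP_append psis_def)
      then show ?thesis by (simp add: x HP_simps Hs linear_neg[OF H])
    next
      assume "x \<in> {adjoint n m u gs | u gs p. u \<in> osp n m \<inter> homog p \<and> set gs \<subseteq> gtilde_hom n m}"
      then obtain u gs p where x: "x = adjoint n m u gs" and u0: "u \<in> osp n m" "u \<in> homog p"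
        and gs: "set gs \<subseteq> gtilde_hom n m" by blast
      have u: "u \<in> homog (parity u)" "u \<in> sym_part VV {2}"
        using u0 by (cases "u = 0"; simp add: parity_homog osp_def)+
      let ?p = "parity u"
      \<comment> \<open>The matrix of the linear Hamiltonian field of the quadratic
        \<open>u\<close>, read off from its second derivatives at the origin.\<close>
      define U where "U v w = (if v \<in> VV \<and> w \<in> VV then veta v * sg (\<not> odd_ix v \<and> ?p) * V.ev0 (pd w (pd (vhat v) u)) else 0)" for v w
      have ev: "V.ev0 h = 0" if "h \<in> homog True" for h
        using that
      proof (induction rule: homog_induct)
        case (add c w g)
        then have "w \<noteq> []" by auto
        then obtain v w' where "w = v # w'" by (cases w) auto
        then show ?case using add by (simp add: linear_add[OF V.linear_ev0] linear_scale[OF V.linear_ev0] mon_Cons[of v w'])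
      qed (simp add: linear_0[OF V.linear_ev0])
      have par: "odd_ix w = (odd_ix v \<noteq> ?p)" if "V.ev0 (pd w (pd (vhat v) u)) \<noteq> 0" for v w
        using ev[of "pd w (pd (vhat v) u)"] pd_homog[OF pd_homog[OF u(1), of "vhat v"], of w] that
        by (cases "odd_ix w \<noteq> (odd_ix v \<noteq> ?p)") auto
      have matU: "V.mat ?p U"
        unfolding V.mat_def U_def using par by auto
      \<comment> \<open>Graded symmetry of second derivatives is the condition that the linear field
        is symplectic.\<close>
      have symU: "U v (vhat w) * veta (vhat w) + sg (?p \<and> odd_ix v) * veta v * U w (vhat v) = 0"
        if "v \<in> VV" "w \<in> VV" for v w
      proof -
        let ?S = "V.ev0 (pd (vhat w) (pd (vhat v) u))"
        have e1: "U v (vhat w) = veta v * sg (\<not> odd_ix v \<and> ?p) * ?S" using that by (simp add: U_def)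
        have "V.ev0 (pd (vhat v) (pd (vhat w) u)) = sg (odd_ix v \<and> odd_ix w) * ?S"
          using pd_commute[of "vhat v" "vhat w" u] by (simp add: linear_scale[OF V.linear_ev0])
        then have e2: "U w (vhat v) = veta w * sg (\<not> odd_ix w \<and> ?p) * (sg (odd_ix v \<and> odd_ix w) * ?S)"
          using that by (simp add: U_def)
        have "?S = 0 \<or> odd_ix w = (odd_ix v \<noteq> ?p)" using par[of "vhat w" v] by auto
        then show ?thesis unfolding e1 e2 veta_vhat
          by (elim disjE; cases "odd_ix v"; cases ?p; simp)
      qed
      have lin1: "h = (\<Sum>w\<in>VV. V.ev0 (pd w h) *\<^sub>R mon [w])" if "h \<in> sym_part VV {1}" for h
        using that linear_ident'
      proof (rule sym_part_linear_eq)
        show "linear (\<lambda>h. \<Sum>w\<in>VV. V.ev0 (pd w h) *\<^sub>R mon [w])"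
          by (rule linearI) (simp_all add: linear_add[OF V.linear_ev0] linear_scale[OF V.linear_ev0]
              scaleR_add_left sum.distrib scaleR_sum_right)
        fix w :: "vix list" assume w: "set w \<subseteq> VV" "length w \<in> {1}"
        then obtain v where v: "w = [v]" by (cases w) auto
        have "(\<Sum>w\<in>VV. V.ev0 (pd w (mon [v])) *\<^sub>R mon [w]) = (\<Sum>w\<in>VV. if w = v then mon [v] else 0)"
          by (intro sum.cong) (auto simp: linear_0[OF V.linear_ev0])
        then show "mon w = (\<Sum>v\<in>VV. V.ev0 (pd v (mon w)) *\<^sub>R mon [v])" using v w by simp
      qed
      have lvfU: "V.lvf U = (\<lambda>v. hamvf ?p u v)"
      proof
        fix v
        show "V.lvf U v = hamvf ?p u v"
        proof (cases "v \<in> VV")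
          case True
          have "pd (vhat v) u \<in> sym_part VV {1}" by (rule pd_sym_part[OF u(2)]) auto
          from arg_cong[OF lin1[OF this], of "\<lambda>h. (veta v * sg (\<not> odd_ix v \<and> ?p)) *\<^sub>R h"] show ?thesis
            using True unfolding V.lvf_def hamvf_def U_def by (simp add: scaleR_sum_right)
        qed (simp add: V.lvf_def hamvf_def U_def)
      qed
      define D where "D = (\<lambda>F. sg ?p *\<^sub>R deriv_ext ?p (W.lvf (Um U ?p)) F)"
      note vD = W.super_vf_lvf[OF mat_Um[OF matU]]
      have Dpsi: "D (psi g) = sg ?p *\<^sub>R psi (poisson n m u g)" if "g \<in> gtilde_hom n m" for g
        unfolding D_def psi_def rho_GG[OF hone_graded matU] lvfU poisson_deriv[OF u(2,1)] by simp
      have HD: "H (D F) = 0" for F unfolding D_def by (simp add: Hs inv[OF matU symU])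
      have "HP H x = H (\<Sum>i<length gs. sg (?p \<and> odd (\<Sum>r<i. of_bool (parity (gs ! r)) :: nat)) *\<^sub>R
          PP (gs[i := poisson n m u (gs ! i)]))"
        by (simp add: x adjoint_def HP_simps linear_sum[OF H] Hs)
      also have "\<dots> = H (sg (?p \<and> odd (length gs)) *\<^sub>R D (PP gs))"
      proof (rule arg_cong[where f=H], rule adjoint_sum)
        fix g F assume "g \<in> set gs"
        then have g: "g \<in> gtilde_hom n m" using gs by auto
        show "D (psi g * F) = (sg ?p *\<^sub>R psi (poisson n m u g)) * F + sg (?p \<and> \<not> parity g) *\<^sub>R (psi g * D F)"
          using deriv_mult[OF vD psi_homog[OF gtilde_homD(1)[OF g]], of F] Dpsi[OF g]
          unfolding D_def by (cases ?p) simp_all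
        show "poisson n m u g \<in> homog (?p \<noteq> parity g)"
          unfolding poisson_eq[OF u(2,1) gtilde_homD(2)[OF g]] by (rule pois_homog[OF u(1) gtilde_homD(1)[OF g]])
        show "g \<in> homog (parity g)" by (rule gtilde_homD(1)[OF g])
      qed (auto simp: D_def vD intro!: linear_intros)
      finally show ?thesis by (simp add: Hs HD)
    qed
    with step show ?case by (simp add: HP_simps)
  qed
qed

end

section \<open>The Chevalley-Eilenberg differential on products of superfields\<close>

context superfield
begin

lemma nths_drop_Suc: "nths (g # gs) (- {0, Suc j}) = nths gs (- {j})"
  "nths (g # gs) (- {Suc i, Suc j}) = g # nths gs (- {i, j})"
  by (auto simp: nths_Cons intro!: arg_cong[where f="nths gs"])

lemma length_nths_drop:
  "j < length gs \<Longrightarrow> Suc (length (nths gs (- {j}))) = length gs"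
  "i < j \<Longrightarrow> j < length gs \<Longrightarrow> Suc (Suc (length (nths gs (- {i, j})))) = length gs"
proof -
  have 1: "{i. i < length gs \<and> i \<in> - {j}} = {..<length gs} - {j}" for j by auto
  have 2: "{k. k < length gs \<and> k \<in> - {i, j}} = {..<length gs} - {i, j}" for i j by auto
  show "j < length gs \<Longrightarrow> Suc (length (nths gs (- {j}))) = length gs"
    unfolding length_nths 1 by simp
  show "i < j \<Longrightarrow> j < length gs \<Longrightarrow> Suc (Suc (length (nths gs (- {i, j})))) = length gs"
    unfolding length_nths 2 by (subst card_Diff_subset) auto
qed

text \<open>The position-dependent signs of \<open>PP\<close> turn supercommutation in shifted
  parity into the exterior relation.\<close>

lemma PP_swap:
  assumes "x \<in> homog p" "g \<in> homog (parity g)"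
  shows "PP (x # g # R) = - (sg (p \<and> parity g) *\<^sub>R PP (g # x # R))"
proof -
  have "psi x * (psi g * F) = sg (\<not> p \<and> \<not> parity g) *\<^sub>R (psi g * (psi x * F))" for F
    using psi_commute[OF assms] by (simp flip: mult.assoc)
  then show ?thesis
    by (cases p; cases "parity g"; cases "odd (length R)") (simp_all add: psis_eq[OF assms(1)] psis_eq[OF assms(2)])
qed

lemma neg_one_power: "(-1 :: real) ^ k = sg (odd k)"
  by (simp add: sg_def)

text \<open>The same derivation as in \<open>adjoint_sum\<close>, but each bracket is moved to the
  front, as the differential demands; \<open>PP_swap\<close> accounts for the entries it
  passes.\<close>

lemma front_sum:
  assumes D: "\<And>g F. g \<in> set gs \<Longrightarrow> D (psi g * F) = (sg p *\<^sub>R psi (B g)) * F + sg (p \<and> \<not> parity g) *\<^sub>R (psi g * D F)"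
      "D 1 = 0" "linear D"
    and B: "\<And>g. g \<in> set gs \<Longrightarrow> B g \<in> homog (p \<noteq> parity g)"
    and g: "\<And>g. g \<in> set gs \<Longrightarrow> g \<in> homog (parity g)"
  shows "(\<Sum>j<length gs. sg (odd (of_bool (parity (gs ! j)) * (\<Sum>r<j. of_bool (parity (gs ! r))) + j :: nat)) *\<^sub>R
      PP (B (gs ! j) # nths gs (- {j}))) = sg (p \<and> odd (length gs)) *\<^sub>R D (PP gs)"
  using assms
proof (induction gs)
  case Nil
  then show ?case by simp
next
  case (Cons h hs)
  let ?c = "\<lambda>hs j. sg (odd (of_bool (parity (hs ! j)) * (\<Sum>r<j. of_bool (parity (hs ! r))) + j :: nat))"
  have n0: "nths (h # hs) (- {0}) = hs" by (simp add: nths_Cons nths_all)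
  have nS: "nths (h # hs) (- {Suc j}) = h # nths hs (- {j})" for j
    by (auto simp: nths_Cons intro!: arg_cong[where f="nths hs"])
  have "(\<Sum>j<length (h # hs). ?c (h # hs) j *\<^sub>R PP (B ((h # hs) ! j) # nths (h # hs) (- {j}))) =
      PP (B h # hs) + (\<Sum>j<length hs. ?c (h # hs) (Suc j) *\<^sub>R PP (B (hs ! j) # h # nths hs (- {j})))"
    unfolding length_Cons sum.lessThan_Suc_shift[of _ "length hs"] nS by (simp add: n0)
  also have "(\<Sum>j<length hs. ?c (h # hs) (Suc j) *\<^sub>R PP (B (hs ! j) # h # nths hs (- {j}))) =
      sg (p \<and> parity h) *\<^sub>R (psis (odd (length hs)) h * (\<Sum>j<length hs. ?c hs j *\<^sub>R PP (B (hs ! j) # nths hs (- {j}))))"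
    unfolding sum_distrib_left[of "psis (odd (length hs)) h"] scaleR_sum_right
  proof (intro sum.cong refl)
    fix j assume j: "j \<in> {..<length hs}"
    have m: "hs ! j \<in> set hs" using j by simp
    have "B (hs ! j) \<in> homog (p \<noteq> parity (hs ! j))" using Cons.prems(4) m by simp
    then have sw: "PP (B (hs ! j) # h # nths hs (- {j})) =
      - (sg ((p \<noteq> parity (hs ! j)) \<and> parity h) *\<^sub>R PP (h # B (hs ! j) # nths hs (- {j})))"
      using Cons.prems(5) by (intro PP_swap) auto
    have l: "length (B (hs ! j) # nths hs (- {j})) = length hs" using length_nths_drop(1)[of j hs] j by simp
    have c: "?c (h # hs) (Suc j) = - (sg (parity (hs ! j) \<and> parity h) * ?c hs j)"
      unfolding sum.lessThan_Suc_shift by (cases "parity h"; cases "parity (hs ! j)") (auto simp: sg_def)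
    show "?c (h # hs) (Suc j) *\<^sub>R PP (B (hs ! j) # h # nths hs (- {j})) =
      sg (p \<and> parity h) *\<^sub>R (psis (odd (length hs)) h * ?c hs j *\<^sub>R PP (B (hs ! j) # nths hs (- {j})))"
      unfolding sw c PP.simps(2)[of h "B (hs ! j) # nths hs (- {j})"] l
      by (cases p; cases "parity h"; cases "parity (hs ! j)") (simp_all add: mult_scaleR_right)
  qed
  also have "(\<Sum>j<length hs. ?c hs j *\<^sub>R PP (B (hs ! j) # nths hs (- {j}))) = sg (p \<and> odd (length hs)) *\<^sub>R D (PP hs)"
    by (rule Cons.IH) (use Cons.prems in auto)
  also have "PP (B h # hs) + sg (p \<and> parity h) *\<^sub>R (psis (odd (length hs)) h *
        sg (p \<and> odd (length hs)) *\<^sub>R D (PP hs)) = sg (p \<and> odd (length (h # hs))) *\<^sub>R D (PP (h # hs))"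
  proof -
    have DPP: "D (PP (h # hs)) = sg (parity h \<and> odd (length hs)) *\<^sub>R
      ((sg p *\<^sub>R psi (B h)) * PP hs + sg (p \<and> \<not> parity h) *\<^sub>R (psi h * D (PP hs)))"
      using Cons.prems(1)[of h "PP hs"] linear_scale[OF Cons.prems(3)] by (simp add: psis_def)
    have psB: "psis (odd (length hs)) (B h) = sg ((p \<noteq> parity h) \<and> odd (length hs)) *\<^sub>R psi (B h)"
      by (rule psis_eq) (use Cons.prems in auto)
    show ?thesis
      unfolding DPP PP.simps(2)[of "B h"] psB by (cases p; cases "parity h"; cases "odd (length hs)") (simp_all add: psis_def algebra_simps)
  qed
  finally show ?case .
qed

abbreviation ceq :: "vix spoly list \<Rightarrow> nat \<Rightarrow> nat \<Rightarrow> nat" where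
  "ceq gs i j \<equiv> of_bool (parity (gs ! i)) * (\<Sum>r<i. of_bool (parity (gs ! r))) +
    of_bool (parity (gs ! j)) * (\<Sum>r<j. of_bool (parity (gs ! r))) +
    of_bool (parity (gs ! i)) * of_bool (parity (gs ! j)) + i + j + 1"

text \<open>Both sides obey the same recursion in the first entry: the differential separates the
  brackets with that entry from the rest, and \<open>W.T_product\<close> separates the bracket term
  of the Laplacian from its action on the remaining product.\<close>

lemma delta_sum:
  assumes "set gs \<subseteq> gtilde_hom n m"
  shows "(\<Sum>j<length gs. \<Sum>i<j. sg (odd (ceq gs i j)) *\<^sub>R
     PP (poisson n m (gs ! i) (gs ! j) # nths gs (- {i, j}))) = - ((1/2) *\<^sub>R W.T Bm (PP gs))"
  using assms
proof (induction gs)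
  case Nil
  then show ?case by simp
next
  case (Cons g gs)
  have g: "g \<in> gtilde_hom n m" and gs: "set gs \<subseteq> gtilde_hom n m" using Cons.prems by auto
  note gp = gtilde_homD[OF g]
  let ?B = "poisson n m"
  have pb: "?B x y \<in> homog (parity x \<noteq> parity y)" if "x \<in> gtilde_hom n m" "y \<in> gtilde_hom n m" for x y
    unfolding poisson_eq[OF gtilde_homD(2,1)[OF that(1)] gtilde_homD(2)[OF that(2)]]
    by (rule pois_homog[OF gtilde_homD(1)[OF that(1)] gtilde_homD(1)[OF that(2)]])
  have 0: "(\<Sum>j<length (g # gs). \<Sum>i<j. sg (odd (ceq (g # gs) i j)) *\<^sub>R
       PP (?B ((g # gs) ! i) ((g # gs) ! j) # nths (g # gs) (- {i, j}))) =
     (\<Sum>j<length gs. sg (odd (of_bool (parity (gs ! j)) * (\<Sum>r<j. of_bool (parity (gs ! r))) + j :: nat)) *\<^sub>R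
        PP (?B g (gs ! j) # nths gs (- {j}))) +
     (\<Sum>j<length gs. \<Sum>i<j. (sg (odd (ceq gs i j)) * sg (parity g \<and> (parity (gs ! i) \<noteq> parity (gs ! j)))) *\<^sub>R
        PP (?B (gs ! i) (gs ! j) # g # nths gs (- {i, j})))"
  proof -
    have a: "sg (odd (ceq (g # gs) 0 (Suc j))) =
       sg (odd (of_bool (parity (gs ! j)) * (\<Sum>r<j. of_bool (parity (gs ! r))) + j :: nat))" for j
      unfolding sum.lessThan_Suc_shift by (cases "parity g"; cases "parity (gs ! j)") (auto simp: sg_def)
    have b: "sg (odd (ceq (g # gs) (Suc i) (Suc j))) =
       sg (odd (ceq gs i j)) * sg (parity g \<and> (parity (gs ! i) \<noteq> parity (gs ! j)))" for i j
      unfolding sum.lessThan_Suc_shift by (cases "parity g"; cases "parity (gs ! i)"; cases "parity (gs ! j)") (auto simp: sg_def)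
    show ?thesis
      unfolding length_Cons sum.lessThan_Suc_shift[of "\<lambda>j. \<Sum>i<j. F i j" "length gs" for F]
        sum.lessThan_Suc_shift[of "\<lambda>i. sg (odd (ceq (g # gs) i (Suc j))) *\<^sub>R _ i" j for j]
        a b nths_drop_Suc
      by (simp add: sum.distrib)
  qed
  \<comment> \<open>The minus sign matches the one in \<open>brk_psi\<close>, so that
    \<open>D\<close> acts on superfields in the way \<open>front_sum\<close> expects.\<close>
  define D where "D = (\<lambda>F. - deriv_ext (parity g) (W.brk Bm (\<not> parity g) (psi g)) F)"
  have v: "super_vf (parity g) (W.brk Bm (\<not> parity g) (psi g))"
    using W.super_vf_brk[OF mat_Bm psi_homog[OF gp(1)]] by simp
  have 1: "(\<Sum>j<length gs. sg (odd (of_bool (parity (gs ! j)) * (\<Sum>r<j. of_bool (parity (gs ! r))) + j :: nat)) *\<^sub>R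
        PP (?B g (gs ! j) # nths gs (- {j}))) = sg (parity g \<and> odd (length gs)) *\<^sub>R D (PP gs)"
  proof (rule front_sum)
    fix h F assume "h \<in> set gs"
    then have h: "h \<in> gtilde_hom n m" using gs by auto
    note hp = gtilde_homD[OF h]
    have "D (psi h) = sg (parity g) *\<^sub>R psi (?B g h)"
      unfolding D_def brk_psi[OF gp(3,1) hp(3)] poisson_eq[OF gp(2,1) hp(2)] by simp
    moreover have "D (psi h * F) = D (psi h) * F + sg (parity g \<and> \<not> parity h) *\<^sub>R (psi h * D F)"
      using deriv_mult[OF v psi_homog[OF hp(1)], of F] by (simp add: D_def)
    ultimately show "D (psi h * F) = (sg (parity g) *\<^sub>R psi (?B g h)) * F + sg (parity g \<and> \<not> parity h) *\<^sub>R (psi h * D F)"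
      by simp
    show "?B g h \<in> homog (parity g \<noteq> parity h)" by (rule pb[OF g h])
    show "h \<in> homog (parity h)" by (rule hp(1))
  next
    show "linear D" unfolding D_def
      using linear_scaleR_compose[OF linear_deriv[OF v], of "-1"] by simp
  qed (simp_all add: D_def v)
  have 2: "(\<Sum>j<length gs. \<Sum>i<j. (sg (odd (ceq gs i j)) * sg (parity g \<and> (parity (gs ! i) \<noteq> parity (gs ! j)))) *\<^sub>R
        PP (?B (gs ! i) (gs ! j) # g # nths gs (- {i, j}))) =
     (- sg (parity g \<and> even (length gs))) *\<^sub>R (psi g * (\<Sum>j<length gs. \<Sum>i<j. sg (odd (ceq gs i j)) *\<^sub>R
        PP (?B (gs ! i) (gs ! j) # nths gs (- {i, j}))))"
    unfolding sum_distrib_left[of "psi g"] scaleR_sum_right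
  proof (rule sum.cong[OF refl], rule sum.cong[OF refl])
    fix j i assume ij: "j \<in> {..<length gs}" "i \<in> {..<j}"
    then have m: "gs ! i \<in> gtilde_hom n m" "gs ! j \<in> gtilde_hom n m" using gs by (auto simp: subset_iff)
    note sw = PP_swap[OF pb[OF m] gp(1), of "nths gs (- {i, j})"]
    have l: "odd (length (?B (gs ! i) (gs ! j) # nths gs (- {i, j}))) = even (length gs)"
      using length_nths_drop(2)[of i j gs] ij by (metis even_Suc length_Cons lessThan_iff)
    show "(sg (odd (ceq gs i j)) * sg (parity g \<and> (parity (gs ! i) \<noteq> parity (gs ! j)))) *\<^sub>R
        PP (?B (gs ! i) (gs ! j) # g # nths gs (- {i, j})) =
      (- sg (parity g \<and> even (length gs))) *\<^sub>R (psi g * sg (odd (ceq gs i j)) *\<^sub>R PP (?B (gs ! i) (gs ! j) # nths gs (- {i, j})))"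
      unfolding sw PP.simps(2)[of g "?B (gs ! i) (gs ! j) # nths gs (- {i, j})"] l psis_def
      by (cases "parity g"; cases "parity (gs ! i)"; cases "parity (gs ! j)"; cases "even (length gs)") simp_all
  qed
  have 3: "W.T Bm (psi g * PP gs) = sg (\<not> parity g) *\<^sub>R (psi g * W.T Bm (PP gs)) - 2 *\<^sub>R D (PP gs)"
    using W.T_product[OF mat_Bm msym_Bm psi_homog[OF gp(1)], of "PP gs"] by (simp add: T_psi D_def)
  show ?case
    unfolding 0 1 2 Cons.IH[OF gs]
    unfolding PP.simps(2)[of g gs] psis_def mult_scaleR_left W.T_simps 3
    by (cases "parity g"; cases "even (length gs)") (simp_all add: algebra_simps mult_scaleR_right)
qed

lemma HP_delta:
  assumes H: "linear H" and c: "c \<in> rel_words n m"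
  shows "HP H (ce_delta n m c) = HP (\<lambda>F. - (H (W.T Bm F) / 2)) c"
  using c unfolding rel_words_def
proof (induction rule: span_induct_alt)
  case base
  show ?case by (simp add: ce_delta_def linear_0[OF linear_lin_ext])
next
  case (step a x y)
  then obtain gs where x: "x = word gs" "set gs \<subseteq> gtilde_hom n m" by blast
  have "HP H (ce_delta n m x) = H (\<Sum>j<length gs. \<Sum>i<j. sg (odd (ceq gs i j)) *\<^sub>R
     PP (poisson n m (gs ! i) (gs ! j) # nths gs (- {i, j})))"
    by (simp only: x ce_delta_def lin_ext_single scaleR_one Let_def HP_simps neg_one_power
        linear_sum[OF H] linear_scale[OF H] real_scaleR_def mult_1)
  also have "\<dots> = - (H (W.T Bm (PP gs)) / 2)"
    unfolding delta_sum[OF x(2)] by (simp add: linear_neg[OF H] linear_scale[OF H])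
  finally have "HP H (ce_delta n m x) = HP (\<lambda>F. - (H (W.T Bm F) / 2)) x" by (simp add: x HP_simps)
  moreover have l: "linear (ce_delta n m)" unfolding ce_delta_def by (rule linear_lin_ext)
  ultimately show ?case using step(2)
    by (simp add: linear_add[OF l] linear_scale[OF l] HP_simps linear_add[OF linear_lin_ext] linear_scale[OF linear_lin_ext])
qed

lemma HP_cong:
  assumes "\<And>gs. set gs \<subseteq> gtilde_hom n m \<Longrightarrow> H (PP gs) = H' (PP gs)" "c \<in> rel_words n m"
  shows "HP H c = HP H' c"
  using assms(2) unfolding rel_words_def
proof (induction rule: span_induct_alt)
  case base
  show ?case by (simp add: HP_simps)
next
  case (step a x y)
  then show ?case using assms(1) by (auto simp: HP_simps)
qed

subsection \<open>Cocycle property and independence of the homotopy\<close>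

abbreviation "Qd \<equiv> deriv_ext True (W.lvf Qm)"

lemma Q_PP: "set gs \<subseteq> gtilde_hom n m \<Longrightarrow> Qd (PP gs) = 0"
proof (induction gs)
  case Nil
  then show ?case by (simp add: W.super_vf_lvf[OF mat_Qm])
next
  case (Cons g gs)
  have v: "super_vf True (W.lvf Qm)" by (rule W.super_vf_lvf[OF mat_Qm])
  have g: "g \<in> gtilde_hom n m" using Cons by simp
  have "Qd (psi g) = 0"
    unfolding psi_def Q_GG[OF hone_graded gtilde_homD(2)[OF g]] by (simp add: linear_0[OF linear_GG_z])
  then have "Qd (psi g * PP gs) = 0"
    using deriv_mult[OF v psi_homog[OF gtilde_homD(1)[OF g]], of "PP gs"] Cons by simp
  then show ?case by (simp add: psis_def linear_scale[OF linear_deriv[OF v]])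
qed

text \<open>All conditions are linear or affine in \<open>s\<close>, so they persist along the
  segment joining two homotopies, whose inner points need not come from a subspace L.\<close>

definition homotopy :: "('e \<times> 'o \<Rightarrow> 'e \<times> 'o) \<Rightarrow> bool" where
  "homotopy s \<longleftrightarrow> linear s \<and> (\<forall>a. d (s a) + s (d a) = a) \<and>
     (\<forall>p a. a \<in> graded_part p \<longrightarrow> s a \<in> graded_part (\<not> p)) \<and>
     (\<forall>p a b. a \<in> graded_part p \<longrightarrow> form (s a) b = sg p * form a (s b))"

lemma homotopyD:
  assumes "homotopy s"
  shows "linear s" "d (s a) + s (d a) = a" "a \<in> graded_part p \<Longrightarrow> s a \<in> graded_part (\<not> p)"
    "a \<in> graded_part p \<Longrightarrow> form (s a) b = sg p * form a (s b)"
  using assms unfolding homotopy_def by blast+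

lemma homotopy_hty: "isotropic_complement d form L \<Longrightarrow> homotopy (hty L)"
  unfolding homotopy_def using linear_hty d_hty hty_graded hty_adjoint by blast

lemma homotopy_comb:
  assumes "homotopy s" "homotopy s'"
  shows "homotopy (\<lambda>x. s x + t *\<^sub>R (s' x - s x))"
  unfolding homotopy_def
proof (intro conjI allI impI)
  show "linear (\<lambda>x. s x + t *\<^sub>R (s' x - s x))"
    by (intro linear_add_compose linear_scaleR_compose linear_diff_compose homotopyD[OF assms(1)] homotopyD[OF assms(2)])
  fix a :: "'e \<times> 'o"
  have "d (s a + t *\<^sub>R (s' a - s a)) + (s (d a) + t *\<^sub>R (s' (d a) - s (d a))) =
      (d (s a) + s (d a)) + t *\<^sub>R ((d (s' a) + s' (d a)) - (d (s a) + s (d a)))"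
    by (simp add: algebra_simps)
  then show "d (s a + t *\<^sub>R (s' a - s a)) + (s (d a) + t *\<^sub>R (s' (d a) - s (d a))) = a"
    by (simp only: homotopyD(2)[OF assms(1)] homotopyD(2)[OF assms(2)]) simp
next
  fix p and a b :: "'e \<times> 'o" assume a: "a \<in> graded_part p"
  show "s a + t *\<^sub>R (s' a - s a) \<in> graded_part (\<not> p)"
    using homotopyD(3)[OF assms(1) a] homotopyD(3)[OF assms(2) a] by simp
  show "form (s a + t *\<^sub>R (s' a - s a)) b = sg p * form a (s b + t *\<^sub>R (s' b - s b))"
    using homotopyD(4)[OF assms(1) a, of b] homotopyD(4)[OF assms(2) a, of b] by (simp add: algebra_simps)
qed

abbreviation "Km s \<equiv> tens False s"

lemma mat_Km: "homotopy s \<Longrightarrow> W.mat False (Km s)"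
  by (rule mat_tens) (simp add: homotopyD)

lemma msym_Km: "homotopy s \<Longrightarrow> W.msym (Km s)"
  by (rule msym_tens) (auto simp: homotopyD)

lemma is_wick_Km: "homotopy s \<Longrightarrow> W.is_wick (Km s) (W.wick (Km s))"
  by (rule W.is_wick_wick[OF mat_Km msym_Km])

text \<open>By \<open>Rm_Qm_tens\<close> the field of d moves the propagator by the tensor of d s +
  s d = 1, which is \<open>Bm\<close>.\<close>

lemma wick_Q:
  assumes "homotopy s"
  shows "W.wick (Km s) (Qd f) = W.wick (Km s) (W.T Bm f) / 2"
proof -
  have "W.Rm True Qm (Km s) = Bm"
    using Rm_Qm_tens[of s False] homotopyD[OF assms] by simp
  then show ?thesis
    using W.wick_lderiv[OF is_wick_Km[OF assms] mat_Km[OF assms] mat_Qm, of f] mat_Bm msym_Bm by simp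
qed

lemma wick_rho:
  assumes "homotopy s" "V.mat p U"
    and "\<And>v w. v \<in> VV \<Longrightarrow> w \<in> VV \<Longrightarrow> U v (vhat w) * veta (vhat w) + sg (p \<and> odd_ix v) * veta v * U w (vhat v) = 0"
  shows "W.wick (Km s) (deriv_ext p (W.lvf (Um U p)) f) = 0"
proof -
  have "W.Rm p (Um U p) (Km s) = (\<lambda>i j. 0)"
    by (rule Rm_Um_tens[OF assms(2,3)]) (simp_all add: homotopyD[OF assms(1)])
  then show ?thesis
    using W.wick_lderiv[OF is_wick_Km[OF assms(1)] mat_Km[OF assms(1)] mat_Um[OF assms(2)], of f]
    by (simp add: W.msym_def W.mat_def W.T_def W.wick_simps[OF is_wick_Km[OF assms(1)]])
qed

lemma wick_cocycle:
  assumes "homotopy s"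
  shows "ce_cocycle n m (HP (W.wick (Km s)))"
  unfolding ce_cocycle_def
proof (intro conjI ballI)
  note E = is_wick_Km[OF assms]
  show "ce_cochain n m (HP (W.wick (Km s)))"
    by (rule cochain_HP[OF W.is_wickD(1)[OF E] wick_rho[OF assms]])
  fix c assume c: "c \<in> rel_words n m"
  have "HP (W.wick (Km s)) (ce_delta n m c) = HP (\<lambda>F. - (W.wick (Km s) (W.T Bm F) / 2)) c"
    by (rule HP_delta[OF W.is_wickD(1)[OF E] c])
  also have "\<dots> = HP (\<lambda>F. 0) c"
    by (rule HP_cong[OF _ c]) (simp add: wick_Q[OF assms, symmetric] Q_PP W.wick_simps[OF E])
  also have "\<dots> = 0" by (simp add: lin_ext_def)
  finally show "HP (W.wick (Km s)) (ce_delta n m c) = 0" .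
qed

lemma wick_coboundary:
  assumes s: "homotopy s" and s': "homotopy s'"
  shows "ce_coboundary n m (\<lambda>c. HP (W.wick (Km s')) c - HP (W.wick (Km s)) c)"
proof -
  let ?N = "\<lambda>x. s (s' x)"
  define M where "M = tens True ?N"
  define st where "st t = (\<lambda>x. s x + t *\<^sub>R (s' x - s x))" for t
  have hs: "homotopy (st t)" for t unfolding st_def by (rule homotopy_comb[OF s s'])
  define E where "E t = W.wick (Km (st t))" for t
  have E: "W.is_wick (Km (st t)) (E t)" for t unfolding E_def by (rule is_wick_Km[OF hs])
  define K' where "K' = tens False (\<lambda>x. s' x - s x)"
  have Kt: "Km (st t) = (\<lambda>i j. Km s i j + t * K' i j)" for t
    unfolding st_def K'_def by (intro ext) (rule tens_linear(1))
  have Nlin: "linear ?N" by (rule linear_fun_comp[OF homotopyD(1)[OF s] homotopyD(1)[OF s']])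
  have Npar: "?N x \<in> graded_part (p \<noteq> (\<not> True))" if "x \<in> graded_part p" for x p
    using homotopyD(3)[OF s homotopyD(3)[OF s' that]] by simp
  have matM: "W.mat True M" unfolding M_def by (rule mat_tens[OF Npar])
  \<comment> \<open>From d s + s d = 1 and d s' + s' d = 1 one gets d s s' = s' - s d s' and s s' d
    = s - s d s'; the middle terms cancel.\<close>
  have N': "d (?N x) - ?N (d x) = s' x - s x" for x
  proof -
    have "d (s (s' x)) = s' x - s (d (s' x))" using homotopyD(2)[OF s, of "s' x"] by (simp add: eq_diff_eq)
    moreover have "s' (d x) = x - d (s' x)" using homotopyD(2)[OF s', of x] by (simp add: eq_diff_eq add.commute)
    ultimately show ?thesis by (simp add: linear_diff[OF homotopyD(1)[OF s]])
  qed
  have RM: "W.Rm True Qm M = K'"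
    unfolding M_def using Rm_Qm_tens[OF Nlin Npar] N' by (simp add: K'_def)
  have TK: "W.T K' f = W.T M (Qd f) + Qd (W.T M f)" for f
    using W.T_lderiv[OF mat_Qm matM, of f] by (simp add: RM)
  have matK': "W.mat False K'" unfolding K'_def
    by (rule mat_tens) (simp add: homotopyD(3)[OF s] homotopyD(3)[OF s'])
  have symK': "W.msym K'" unfolding K'_def
    by (rule msym_tens) (auto simp: homotopyD(3)[OF s] homotopyD(3)[OF s'] homotopyD(4)[OF s] homotopyD(4)[OF s'] algebra_simps)
  have deriv: "((\<lambda>t. E t f) has_real_derivative E t (W.T K' f) / 2) (at t)" for t f
    by (rule W.wick_has_derivative[OF _ _ matK' symK']) (use E mat_Km[OF hs] in \<open>simp_all add: Kt\<close>)
  have cont: "continuous_on {0..1} (\<lambda>t. E t f)" for f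
    using deriv by (intro DERIV_continuous_on[where D="\<lambda>t. E t (W.T K' f) / 2"]) (auto intro: has_field_derivative_at_within)
  have intg: "(\<lambda>t. E t f) integrable_on {0..1}" for f
    by (rule integrable_continuous_real[OF cont])
  \<comment> \<open>The primitive averages over the segment. Its factor 1/2 is the one in the
    derivative of a Wick functional; the other half comes from \<open>wick_Q\<close> and is matched
    by \<open>HP_delta\<close>.\<close>
  define H where "H F = integral {0..1} (\<lambda>t. E t (W.T M F)) / 2" for F
  have Hlin: "linear H"
    unfolding H_def
  proof (rule linearI)
    fix x y c
    show "integral {0..1} (\<lambda>t. E t (W.T M (x + y))) / 2 =
      integral {0..1} (\<lambda>t. E t (W.T M x)) / 2 + integral {0..1} (\<lambda>t. E t (W.T M y)) / 2"
      by (simp add: W.wick_simps[OF E] integral_add[OF intg intg] add_divide_distrib)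
    show "integral {0..1} (\<lambda>t. E t (W.T M (c *\<^sub>R x))) / 2 = c *\<^sub>R (integral {0..1} (\<lambda>t. E t (W.T M x)) / 2)"
      by (simp add: W.wick_simps[OF E])
  qed
  have coch: "ce_cochain n m (HP H)"
  proof (rule cochain_HP[OF Hlin])
    fix p U f
    assume U: "V.mat p U" "\<And>v w. v \<in> VV \<Longrightarrow> w \<in> VV \<Longrightarrow>
      U v (vhat w) * veta (vhat w) + sg (p \<and> odd_ix v) * veta v * U w (vhat v) = 0"
    have "W.Rm p (Um U p) M = (\<lambda>i j. 0)"
      unfolding M_def by (rule Rm_Um_tens[OF U Npar])
    then have "W.T M (deriv_ext p (W.lvf (Um U p)) f) = sg p *\<^sub>R deriv_ext p (W.lvf (Um U p)) (W.T M f)"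
      using W.T_lderiv[OF mat_Um[OF U(1)] matM, of f] by (simp add: W.T_def)
    then have "E t (W.T M (deriv_ext p (W.lvf (Um U p)) f)) = 0" for t
      using wick_rho[OF hs U, of t, folded E_def] by (simp add: W.wick_simps[OF E])
    then show "H (deriv_ext p (W.lvf (Um U p)) f) = 0" by (simp add: H_def)
  qed
  have main: "W.wick (Km s') (PP gs) - W.wick (Km s) (PP gs) = - (H (W.T Bm (PP gs)) / 2)"
    if gs: "set gs \<subseteq> gtilde_hom n m" for gs
  proof -
    \<comment> \<open>As the field of d kills \<open>PP gs\<close>, one term of the commutator
      survives. \<open>wick_Q\<close> turns it into half the operator \<open>W.T Bm\<close> applied
      after \<open>W.T M\<close>, and these two odd operators anticommute.\<close>
    have der: "E t (W.T K' (PP gs)) / 2 = - (E t (W.T M (W.T Bm (PP gs))) / 4)" for t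
      using wick_Q[OF hs, of t "W.T M (PP gs)"] W.T_T[OF mat_Bm matM, of "PP gs"]
      unfolding TK Q_PP[OF gs] by (simp add: W.wick_simps[OF E] E_def[symmetric])
    have "((\<lambda>t. E t (W.T K' (PP gs)) / 2) has_integral E 1 (PP gs) - E 0 (PP gs)) {0..1}"
      by (rule fundamental_theorem_of_calculus)
        (use deriv in \<open>auto simp: has_real_derivative_iff_has_vector_derivative[symmetric] intro: has_field_derivative_at_within\<close>)
    then have "E 1 (PP gs) - E 0 (PP gs) = integral {0..1} (\<lambda>t. - (E t (W.T M (W.T Bm (PP gs))) / 4))"
      unfolding der by (rule integral_unique[symmetric])
    also have "\<dots> = - (H (W.T Bm (PP gs)) / 2)" by (simp add: H_def)
    finally show ?thesis by (simp add: E_def st_def)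
  qed
  show ?thesis
    unfolding ce_coboundary_def
  proof (intro exI[of _ "HP H"] conjI ballI coch)
    fix c assume c: "c \<in> rel_words n m"
    have "HP (W.wick (Km s')) c - HP (W.wick (Km s)) c = HP (\<lambda>F. W.wick (Km s') F - W.wick (Km s) F) c"
      by (simp add: lin_ext_def sum_subtractf algebra_simps)
    also have "\<dots> = HP (\<lambda>F. - (H (W.T Bm F) / 2)) c"
    proof (rule HP_cong[OF _ c])
      fix gs assume "set gs \<subseteq> gtilde_hom n m"
      then show "W.wick (Km s') (PP gs) - W.wick (Km s) (PP gs) = - (H (W.T Bm (PP gs)) / 2)" by (rule main)
    qed
    also have "\<dots> = HP H (ce_delta n m c)" by (rule HP_delta[OF Hlin c, symmetric])
    finally show "HP (W.wick (Km s')) c - HP (W.wick (Km s)) c = HP H (ce_delta n m c)" .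
  qed
qed

end

subsection \<open>Diagonalisation of symmetric bilinear forms\<close>

lemma orthonormal_independent:
  fixes B :: "'a::real_vector \<Rightarrow> 'a \<Rightarrow> real"
  assumes lin: "\<And>x. linear (B x)" "\<And>y. linear (\<lambda>x. B x y)"
    and orth: "\<And>u v. u \<in> U \<Longrightarrow> v \<in> U \<Longrightarrow> u \<noteq> v \<Longrightarrow> B u v = 0" "\<And>u. u \<in> U \<Longrightarrow> B u u \<noteq> 0"
  shows "independent U"
  unfolding dependent_explicit
proof safe
  fix T c v assume h: "finite T" "T \<subseteq> U" "(\<Sum>v\<in>T. c v *\<^sub>R v) = 0" "v \<in> T" "c v \<noteq> 0"
  have "0 = B (\<Sum>v\<in>T. c v *\<^sub>R v) v" using h(3) linear_0[OF lin(2)[of v]] by simp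
  also have "\<dots> = (\<Sum>w\<in>T. c w * B w v)" by (simp add: linear_sum[OF lin(2)] linear_scale[OF lin(2)])
  also have "\<dots> = (\<Sum>w\<in>T. if w = v then c v * B v v else 0)"
    using h(2,4) orth(1) by (intro sum.cong) auto
  also have "\<dots> = c v * B v v" using h(1,4) by simp
  finally show False using h orth(2)[of v] by auto
qed

text \<open>An orthonormal set of maximal size spans: otherwise the orthogonal complement contains a
  vector of nonzero square, which could be normalised and added. Symmetry and nondegeneracy are
  asked on \<open>S\<close> only, as the form is not symmetric on the odd part.\<close>

lemma orthonormal_basis_exists:
  fixes B :: "'a::real_vector \<Rightarrow> 'a \<Rightarrow> real"
  assumes lin: "\<And>x. linear (B x)" "\<And>y. linear (\<lambda>x. B x y)"
    and S: "subspace S" "S \<subseteq> span F" "finite F"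
    and sym: "\<And>x y. x \<in> S \<Longrightarrow> y \<in> S \<Longrightarrow> B x y = B y x"
    and nondeg: "\<And>x. x \<in> S \<Longrightarrow> (\<And>y. y \<in> S \<Longrightarrow> B x y = 0) \<Longrightarrow> x = 0"
  obtains U where "finite U" "span U = S" "independent U"
    "\<And>u v. u \<in> U \<Longrightarrow> v \<in> U \<Longrightarrow> u \<noteq> v \<Longrightarrow> B u v = 0" "\<And>u. u \<in> U \<Longrightarrow> B u u = 1 \<or> B u u = -1"
proof -
  define good where "good U \<longleftrightarrow> U \<subseteq> S \<and> (\<forall>u\<in>U. \<forall>v\<in>U. u \<noteq> v \<longrightarrow> B u v = 0) \<and> (\<forall>u\<in>U. B u u = 1 \<or> B u u = -1)" for U
  have ind: "independent U" if "good U" for U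
    by (rule orthonormal_independent[OF lin]) (use that in \<open>auto simp: good_def\<close>)
  have bnd: "finite U \<and> card U \<le> card F" if "good U" for U
    using independent_span_bound[OF S(3) ind[OF that]] that S(2) by (auto simp: good_def)
  have "good {}" by (simp add: good_def)
  then obtain U where U: "good U" "\<And>U'. good U' \<Longrightarrow> card U' \<le> card U"
    using ex_has_greatest_nat[of good "{}" card "Suc (card F)"] bnd le_imp_less_Suc by blast
  note fU = bnd[OF U(1), THEN conjunct1]
  have Bs: "B x (y + z) = B x y + B x z" "B (y + z) x = B y x + B z x"
    "B x (y - z) = B x y - B x z" "B (y - z) x = B y x - B z x"
    "B x (c *\<^sub>R y) = c * B x y" "B (c *\<^sub>R y) x = c * B y x" for x y z c
    using linear_add[OF lin(1)] linear_add[OF lin(2)] linear_diff[OF lin(1)] linear_diff[OF lin(2)]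
      linear_scale[OF lin(1)] linear_scale[OF lin(2)] by auto
  \<comment> \<open>The orthogonal projection away from \<open>U\<close>; squares are 1 or -1, so
    multiplying by \<open>B u u\<close> is the same as dividing.\<close>
  define pr where "pr y = y - (\<Sum>u\<in>U. (B u u * B y u) *\<^sub>R u)" for y
  have US: "U \<subseteq> S" using U(1) by (simp add: good_def)
  have prS: "pr y \<in> S" if "y \<in> S" for y
    unfolding pr_def using that US by (intro subspace_diff subspace_sum subspace_scale S(1)) auto
  have pr0: "B (pr y) u = 0" if "y \<in> S" "u \<in> U" for y u
  proof -
    have "B (\<Sum>u\<in>U. (B u u * B y u) *\<^sub>R u) u = (\<Sum>v\<in>U. (B v v * B y v) * B v u)"
      by (simp add: linear_sum[OF lin(2)] Bs)
    also have "\<dots> = (\<Sum>v\<in>U. if v = u then (B u u * B u u) * B y u else 0)"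
      using that U(1) by (intro sum.cong) (auto simp: good_def)
    also have "\<dots> = B y u" using that U(1) fU by (auto simp: good_def)
    finally show ?thesis by (simp add: pr_def Bs)
  qed
  have "S \<subseteq> span U"
  proof
    fix x assume x: "x \<in> S"
    show "x \<in> span U"
    proof (rule ccontr)
      assume nx: "x \<notin> span U"
      have "pr x \<noteq> 0"
      proof
        assume "pr x = 0"
        then have "x = (\<Sum>u\<in>U. (B u u * B x u) *\<^sub>R u)" by (simp add: pr_def)
        also have "\<dots> \<in> span U" by (intro span_sum span_scale span_base)
        finally show False using nx by simp
      qed
      then obtain y where y: "y \<in> S" "B (pr x) y \<noteq> 0" using nondeg[OF prS[OF x]] by blast
      have "B (pr x) (pr y) = B (pr x) y"
        using pr0[OF x] by (simp add: pr_def[of y] Bs linear_sum[OF lin(1)])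
      then have xy: "B (pr x) (pr y) \<noteq> 0" using y by simp
      \<comment> \<open>Polarisation: if two vectors have nonzero product, one of them or their sum
        has nonzero square.\<close>
      have "\<exists>z\<in>{pr x, pr y, pr x + pr y}. B z z \<noteq> 0"
        using xy sym[OF prS[OF x] prS[OF y(1)]] by (auto simp: Bs)
      then obtain z where z: "z \<in> {pr x, pr y, pr x + pr y}" "B z z \<noteq> 0" by blast
      have zS: "z \<in> S" using z(1) prS[OF x] prS[OF y(1)] subspace_add[OF S(1)] by auto
      have z0: "B z u = 0" if "u \<in> U" for u using z(1) pr0[OF x that] pr0[OF y(1) that] by (auto simp: Bs)
      define w where "w = (1 / sqrt \<bar>B z z\<bar>) *\<^sub>R z"
      have wS: "w \<in> S" unfolding w_def by (intro subspace_scale S(1) zS)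
      have w0: "B w u = 0" "B u w = 0" if "u \<in> U" for u
        using z0[OF that] sym[of u w] wS that US by (auto simp: w_def Bs)
      have ww: "B w w = 1 \<or> B w w = -1"
        using z(2) by (cases "B z z > 0") (auto simp: w_def Bs field_simps real_sqrt_mult[symmetric] abs_if)
      have "w \<notin> U" using w0(1)[of w] ww by auto
      moreover have "good (insert w U)" using U(1) wS w0 ww by (auto simp: good_def)
      ultimately show False using U(2)[of "insert w U"] fU by simp
    qed
  qed
  then have "span U = S" using span_minimal[OF US S(1)] by auto
  then show thesis using that[of U] fU ind[OF U(1)] U(1) by (auto simp: good_def)
qed

lemma independent_Un:
  assumes "independent S" "independent T" "span S \<inter> span T = {0}"
  shows "independent (S \<union> T)"
  unfolding dependent_explicit
proof safe
  fix W c v assume h: "finite W" "W \<subseteq> S \<union> T" "(\<Sum>v\<in>W. c v *\<^sub>R v) = 0" "v \<in> W" "c v \<noteq> 0"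
  let ?a = "\<Sum>v\<in>W \<inter> S. c v *\<^sub>R v" and ?b = "\<Sum>v\<in>W - S. c v *\<^sub>R v"
  have s: "?a + ?b = 0" using h(3) sum.Int_Diff[OF h(1), of "\<lambda>v. c v *\<^sub>R v" S] by simp
  have a: "?a \<in> span S" by (intro span_sum span_scale span_base) auto
  have b: "?b \<in> span T" using h(2) by (intro span_sum span_scale span_base) auto
  have "?a = - ?b" using s by (simp add: eq_neg_iff_add_eq_0)
  then have "?a \<in> span S \<inter> span T" using a b span_neg[OF b] by auto
  then have a0: "?a = 0" and b0: "?b = 0" using assms(3) s by auto
  show False
  proof (cases "v \<in> S")
    case True
    then show ?thesis using independentD[OF assms(1), of "W \<inter> S" c v] a0 h by auto
  next
    case False
    then show ?thesis using independentD[OF assms(2), of "W - S" c v] b0 h by auto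
  qed
qed

subsection \<open>Adapted coordinates\<close>

lemma restr_two:
  assumes "finite C"
  shows "restr C b 2 (\<lambda>us. F (us ! 0) (us ! 1)) = (\<Sum>c\<in>C. \<Sum>c'\<in>C. F (b c) (b c') *\<^sub>R mon [c, c'])"
proof -
  have "(\<Sum>c\<in>C. \<Sum>c'\<in>C. F (b c) (b c') *\<^sub>R mon [c, c']) = (\<Sum>(c, c')\<in>C \<times> C. F (b c) (b c') *\<^sub>R mon [c, c'])"
    by (rule sum.cartesian_product)
  also have "\<dots> = (\<Sum>cs | length cs = 2 \<and> set cs \<subseteq> C. F (b (cs ! 0)) (b (cs ! 1)) *\<^sub>R mon cs)"
    by (rule sum.reindex_bij_witness[of _ "\<lambda>cs. (cs ! 0, cs ! 1)" "\<lambda>(c, c'). [c, c']"])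
      (auto simp: length_Suc_conv numeral_2_eq_2)
  also have "\<dots> = restr C b 2 (\<lambda>us. F (us ! 0) (us ! 1))"
    unfolding restr_def by (rule sum.cong) auto
  finally show ?thesis by simp
qed

lemma koszul_sym_upsilon: "koszul_sym (\<lambda>u. case u of
       [Df y, Df z] \<Rightarrow> sg (odd_ix y) *
         (of_bool (y = v \<and> z = v') - sg (odd_ix y \<and> odd_ix z) * of_bool (z = v \<and> y = v'))
     | _ \<Rightarrow> (0::real))" (is "koszul_sym ?F")
proof (rule koszul_symI)
  fix us vs :: "'a form_ix list" and a b
  show "?F (us @ a # b # vs) = sg (odd_ix a \<and> odd_ix b) *\<^sub>R ?F (us @ b # a # vs)"
  proof (cases "us = [] \<and> vs = []")
    case True
    then show ?thesis
    proof (cases a; cases b)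
      fix y z assume ab: "a = Df y" "b = Df z"
      have "of_bool (y = v \<and> z = v') = (0::real) \<or> y = v \<and> z = v'"
        "of_bool (z = v \<and> y = v') = (0::real) \<or> z = v \<and> y = v'" by auto
      then show ?thesis
        using True ab by (cases "odd_ix y"; cases "odd_ix z") auto
    qed (use True in simp_all)
  next
    case False
    have z: "?F w = 0" if "length w \<noteq> 2" for w
    proof (cases w)
      case (Cons x l)
      then show ?thesis
      proof (cases x; cases l)
        fix y x' l' assume l: "x = Df y" "l = x' # l'"
        then have "l' \<noteq> []" using that Cons by auto
        then show ?thesis using Cons l by (cases x'; cases l') simp_all
      qed (simp_all add: Cons)
    qed simp
    have "length us + length vs \<noteq> 0" using False by auto
    then show ?thesis using z[of "us @ a # b # vs"] z[of "us @ b # a # vs"] by simp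
  qed
qed

lemma formV_eq:
  assumes "v \<in> coordsV n m"
  shows "formV n m v v' = (if v' = vhat v then sg (odd_ix v) * veta v else 0)"
proof -
  have lin: "linear (\<lambda>\<theta>. upsilon \<theta> v v')" unfolding upsilon_def by (rule linear_induced[OF koszul_sym_upsilon])
  have m: "upsilon (mon [Df y, Df z]) v v' = sg (odd_ix y) *
         (of_bool (y = v \<and> z = v') - sg (odd_ix y \<and> odd_ix z) * of_bool (z = v \<and> y = v'))" for y z
    unfolding upsilon_def by (subst induced_mon[OF koszul_sym_upsilon]) simp
  have "formV n m v v' = (\<Sum>i<n. of_bool (P i = v \<and> Q i = v') - of_bool (Q i = v \<and> P i = v')) +
     (\<Sum>i<m. - of_bool (X i = v \<and> X i = v'))"
    by (simp add: formV_def omega_def linear_add[OF lin] linear_scale[OF lin] linear_sum[OF lin] m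
        sum_distrib_left)
  also have "\<dots> = (if v' = vhat v then sg (odd_ix v) * veta v else 0)"
  proof (cases v)
    case (P j)
    have "(\<Sum>i<n. of_bool (P i = v \<and> Q i = v') - of_bool (Q i = v \<and> P i = v') :: real) =
       (\<Sum>i<n. if i = j then of_bool (v' = Q j) else 0)" by (rule sum.cong) (auto simp: P)
    then show ?thesis using assms P by (auto simp: coordsV_def)
  next
    case (Q j)
    have "(\<Sum>i<n. of_bool (P i = v \<and> Q i = v') - of_bool (Q i = v \<and> P i = v') :: real) =
       (\<Sum>i<n. if i = j then - of_bool (v' = P j) else 0)" by (rule sum.cong) (auto simp: Q)
    then show ?thesis using assms Q by (auto simp: coordsV_def)
  next
    case (X j)
    have "(\<Sum>i<m. - of_bool (X i = v \<and> X i = v') :: real) =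
       (\<Sum>i<m. if i = j then - of_bool (v' = X j) else 0)" by (rule sum.cong) (auto simp: X)
    then show ?thesis using assms X by (auto simp: coordsV_def)
  qed
  finally show ?thesis .
qed

lemma linear_lookup: "linear (\<lambda>u. Poly_Mapping.lookup u v)"
  by (rule linearI) (simp_all add: lookup_add scaleR_poly_mapping.rep_eq)

section \<open>The even symmetric form on A tensor V\<close>

context superfield
begin

abbreviation lk :: "(vix \<Rightarrow>\<^sub>0 'e \<times> 'o) \<Rightarrow> vix \<Rightarrow> 'e \<times> 'o" where "lk \<equiv> Poly_Mapping.lookup"
abbreviation "ft \<equiv> form_tilde d form n m"

lemmas lk_simps = linear_add[OF linear_lookup] linear_scale[OF linear_lookup] linear_0[OF linear_lookup]
  linear_sum[OF linear_lookup]

lemma ft_eq: "ft u u' = (\<Sum>v\<in>VV. sg (odd_ix v) * veta v *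
    form (twist True (lk u v)) (d (twist (odd_ix v) (lk u' (vhat v)))))"
  unfolding form_tilde_def form_d_def
proof (rule sum.cong[OF refl])
  fix v assume v: "v \<in> VV"
  have "(\<Sum>v'\<in>VV. form (twist True (lk u v)) (d (twist (odd_ix v) (lk u' v'))) * formV n m v v') =
    (\<Sum>v'\<in>VV. if v' = vhat v then sg (odd_ix v) * veta v * form (twist True (lk u v)) (d (twist (odd_ix v) (lk u' v'))) else 0)"
    by (intro sum.cong refl) (simp add: formV_eq[OF v])
  then show "(\<Sum>v'\<in>VV. form (twist True (lk u v)) (d (twist (odd_ix v) (lk u' v'))) * formV n m v v') =
    sg (odd_ix v) * veta v * form (twist True (lk u v)) (d (twist (odd_ix v) (lk u' (vhat v))))"
    using v by simp
qed

lemma ft_linear: "linear (ft u)" "linear (\<lambda>u. ft u u')"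
  unfolding ft_eq
  by (rule linearI; simp add: lk_simps algebra_simps sum.distrib sum_distrib_left)+

lemma tens_partD: "u \<in> tens_part p \<Longrightarrow> lk u v \<in> graded_part (p \<noteq> odd_ix v)"
  by (simp add: tens_part_def)

lemma ft_homog:
  assumes "u \<in> tens_part p" "u' \<in> tens_part p'"
  shows "ft u u' = (\<Sum>v\<in>VV. sg (odd_ix v) * veta v * sg (p \<noteq> odd_ix v) * sg (odd_ix v \<and> \<not> p') *
    form (lk u v) (d (lk u' (vhat v))))"
  unfolding ft_eq
proof (rule sum.cong[OF refl])
  fix v
  have "lk u v \<in> graded_part (p \<noteq> odd_ix v)" "lk u' (vhat v) \<in> graded_part (p' \<noteq> odd_ix v)"
    using tens_partD[OF assms(1), of v] tens_partD[OF assms(2), of "vhat v"] by simp_all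
  then show "sg (odd_ix v) * veta v * form (twist True (lk u v)) (d (twist (odd_ix v) (lk u' (vhat v)))) =
    sg (odd_ix v) * veta v * sg (p \<noteq> odd_ix v) * sg (odd_ix v \<and> \<not> p') * form (lk u v) (d (lk u' (vhat v)))"
    by (simp add: twist_graded) (cases "odd_ix v"; cases p'; simp)
qed

lemma ft_parity:
  assumes "u \<in> tens_part p" "u' \<in> tens_part p'" "p \<noteq> p'"
  shows "ft u u' = 0"
  unfolding ft_homog[OF assms(1,2)]
proof (intro sum.neutral ballI)
  fix v
  have "form (lk u v) (d (lk u' (vhat v))) = 0"
    using form_parity[OF tens_partD[OF assms(1), of v] d_odd[OF tens_partD[OF assms(2), of "vhat v"]]] assms(3) by auto
  then show "sg (odd_ix v) * veta v * sg (p \<noteq> odd_ix v) * sg (odd_ix v \<and> \<not> p') *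
    form (lk u v) (d (lk u' (vhat v))) = 0" by simp
qed

text \<open>Exchanging the arguments moves d across the scalar product and replaces
  \<open>veta v\<close> by \<open>veta (vhat v)\<close>; together the two signs give graded
  symmetry.\<close>

lemma ft_sym:
  assumes "u \<in> tens_part p" "u' \<in> tens_part p"
  shows "ft u' u = sg p * ft u u'"
proof -
  have "ft u' u = (\<Sum>v\<in>VV. sg (odd_ix v) * veta (vhat v) * sg (p \<noteq> odd_ix v) * sg (odd_ix v \<and> \<not> p) *
    form (lk u' (vhat v)) (d (lk u v)))"
    unfolding ft_homog[OF assms(2,1)] by (subst sum_vhat[symmetric]) simp
  also have "\<dots> = sg p * ft u u'"
    unfolding ft_homog[OF assms] sum_distrib_left
  proof (intro sum.cong refl)
    fix v
    have "form (lk u' (vhat v)) (d (lk u v)) = - sg (p \<noteq> odd_ix v) * form (lk u v) (d (lk u' (vhat v)))"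
      using form_d_adj[OF tens_partD[OF assms(2), of "vhat v"], of "lk u v"] by (simp add: form_commute)
    then show "sg (odd_ix v) * veta (vhat v) * sg (p \<noteq> odd_ix v) * sg (odd_ix v \<and> \<not> p) * form (lk u' (vhat v)) (d (lk u v)) =
      sg p * (sg (odd_ix v) * veta v * sg (p \<noteq> odd_ix v) * sg (odd_ix v \<and> \<not> p) * form (lk u v) (d (lk u' (vhat v))))"
      unfolding veta_vhat by (cases "odd_ix v"; cases p; simp)
  qed
  finally show ?thesis .
qed

definition tpr :: "bool \<Rightarrow> (vix \<Rightarrow>\<^sub>0 'e \<times> 'o) \<Rightarrow> (vix \<Rightarrow>\<^sub>0 'e \<times> 'o)" where
  "tpr p u = Poly_Mapping.mapp (\<lambda>v x. if p \<noteq> odd_ix v then (0, snd x) else (fst x, 0)) u"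

lemma lk_tpr: "lk (tpr p u) v = (if p \<noteq> odd_ix v then (0, snd (lk u v)) else (fst (lk u v), 0))"
  by (auto simp: tpr_def lookup_mapp in_keys_iff when_def prod_eq_iff)

lemma subspace_tens_part: "subspace (tens_part p :: (vix \<Rightarrow>\<^sub>0 'e \<times> 'o) set)"
  by (auto simp: subspace_def tens_part_def lk_simps)

end

locale superfield_L = superfield mul d form r e n m
  for mul :: "'e::real_vector \<times> 'o::real_vector \<Rightarrow> 'e \<times> 'o \<Rightarrow> 'e \<times> 'o"
    and d :: "'e \<times> 'o \<Rightarrow> 'e \<times> 'o" and form :: "'e \<times> 'o \<Rightarrow> 'e \<times> 'o \<Rightarrow> real"
    and r :: nat and e :: "cix \<Rightarrow> 'e \<times> 'o" and n m :: nat +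
  fixes L :: "('e \<times> 'o) set"
  assumes L: "isotropic_complement d form L"
begin

lemma L_props: "subspace L" "a \<in> L \<Longrightarrow> (fst a, 0) \<in> L" "a \<in> L \<Longrightarrow> (0, snd a) \<in> L"
  "a \<in> L \<Longrightarrow> b \<in> L \<Longrightarrow> form a b = 0" "\<exists>l x. l \<in> L \<and> a = l + d x"
proof -
  show "subspace L" "a \<in> L \<Longrightarrow> (fst a, 0) \<in> L" "a \<in> L \<Longrightarrow> (0, snd a) \<in> L" "a \<in> L \<Longrightarrow> b \<in> L \<Longrightarrow> form a b = 0"
    using L by (auto simp: isotropic_complement_def max_isotropic_def isotropic_def graded_subspace_def)
  have "a \<in> {l + d x | l x. l \<in> L}" using L by (simp add: isotropic_complement_def)
  then show "\<exists>l x. l \<in> L \<and> a = l + d x" by blast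
qed

lemma subspace_tensV: "subspace (tensV n m L)"
  unfolding subspace_def tensV_def
proof (intro conjI ballI allI)
  show "0 \<in> {u. Poly_Mapping.keys u \<subseteq> VV \<and> (\<forall>v. lk u v \<in> L)}" by (simp add: subspace_0[OF L_props(1)])
  fix x y c
  assume x: "x \<in> {u. Poly_Mapping.keys u \<subseteq> VV \<and> (\<forall>v. lk u v \<in> L)}"
  show "c *\<^sub>R x \<in> {u. Poly_Mapping.keys u \<subseteq> VV \<and> (\<forall>v. lk u v \<in> L)}"
    using x by (auto simp: lk_simps in_keys_iff subspace_scale[OF L_props(1)])
  assume y: "y \<in> {u. Poly_Mapping.keys u \<subseteq> VV \<and> (\<forall>v. lk u v \<in> L)}"
  show "x + y \<in> {u. Poly_Mapping.keys u \<subseteq> VV \<and> (\<forall>v. lk u v \<in> L)}"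
    using x y Poly_Mapping.keys_add[of x y] by (auto simp: lk_simps subspace_add[OF L_props(1)])
qed

lemma tpr_props:
  assumes "u \<in> tensV n m L"
  shows "tpr p u \<in> tensV n m L \<inter> tens_part p" "u = tpr False u + tpr True u"
proof -
  have "Poly_Mapping.keys (tpr p u) \<subseteq> Poly_Mapping.keys u" by (auto simp: in_keys_iff lk_tpr zero_prod_def split: if_splits)
  then show "tpr p u \<in> tensV n m L \<inter> tens_part p"
    using assms L_props(2,3) by (auto simp: tensV_def tens_part_def lk_tpr)
  show "u = tpr False u + tpr True u"
    by (rule poly_mapping_eqI) (auto simp: lk_simps lk_tpr prod_eq_iff)
qed

lemma single_expand:
  assumes "Poly_Mapping.keys u \<subseteq> VV"
  shows "u = (\<Sum>v\<in>VV. \<Sum>a\<in>idx r. form (e (cdual a)) (lk u v) *\<^sub>R Poly_Mapping.single v (e a))"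
proof (rule poly_mapping_eqI)
  fix w
  have "lk (\<Sum>v\<in>VV. \<Sum>a\<in>idx r. form (e (cdual a)) (lk u v) *\<^sub>R Poly_Mapping.single v (e a)) w =
    (\<Sum>v\<in>VV. if v = w then \<Sum>a\<in>idx r. form (e (cdual a)) (lk u v) *\<^sub>R e a else 0)"
    unfolding lk_simps by (intro sum.cong refl) (auto simp: lookup_single)
  also have "\<dots> = lk u w"
    using assms e_complete[of "lk u w"] by (auto simp: in_keys_iff form_commute)
  finally show "lk u w = lk (\<Sum>v\<in>VV. \<Sum>a\<in>idx r. form (e (cdual a)) (lk u v) *\<^sub>R Poly_Mapping.single v (e a)) w" by simp
qed

definition sgl :: "(vix \<Rightarrow>\<^sub>0 'e \<times> 'o) set" where
  "sgl = (\<lambda>(v, a). Poly_Mapping.single v (e a)) ` (VV \<times> idx r)"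

lemma tensV_span: "tensV n m L \<subseteq> span sgl"
proof
  fix u assume "u \<in> tensV n m L"
  then have "Poly_Mapping.keys u \<subseteq> VV" by (simp add: tensV_def)
  from single_expand[OF this] show "u \<in> span sgl"
    by (rule ssubst) (intro span_sum span_scale span_base, auto simp: sgl_def)
qed

lemma finite_sgl: "finite sgl"
  by (simp add: sgl_def)

text \<open>Only the even part needs a normal form: an orthonormal basis whose vectors of square 1
  are listed first. The odd part may have any basis, since Berezin integration treats all of them
  alike.\<close>

lemma adapted_coords_exist: "\<exists>N M k b. adapted_coords d form n m L N M k b"
proof -
  let ?S = "\<lambda>p. tensV n m L \<inter> tens_part p"
  have sub: "subspace (?S p)" for p by (intro subspace_inter subspace_tensV subspace_tens_part)
  \<comment> \<open>A component of \<open>u\<close> is orthogonal to L by isotropy. Orthogonality to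
    d(L) follows by testing against simple tensors in one parity and from oddness of the form in the
    other, and A = L + d(L).\<close>
  have nondeg: "u = 0" if u: "u \<in> ?S False" and z: "\<And>u'. u' \<in> ?S False \<Longrightarrow> ft u u' = 0" for u
  proof (rule poly_mapping_eqI)
    fix v
    show "lk u v = lk 0 v"
    proof (cases "v \<in> VV")
      case False
      then show ?thesis using u by (auto simp: tensV_def in_keys_iff)
    next
      case True
      have uv: "lk u v \<in> graded_part (odd_ix v)" "lk u v \<in> L"
        using tens_partD[of u False v] u by (auto simp: tensV_def)
      have 1: "form (lk u v) (d x) = 0" if x: "x \<in> L" "x \<in> graded_part (odd_ix v)" for x
      proof -
        let ?u' = "Poly_Mapping.single (vhat v) x"
        have "?u' \<in> ?S False"
          using x True by (auto simp: tensV_def tens_part_def lookup_single when_def subspace_0[OF L_props(1)])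
        then have "ft u ?u' = 0" and u': "?u' \<in> tens_part False" by (auto intro: z)
        have ut: "u \<in> tens_part False" using u by simp
        have "ft u ?u' = (\<Sum>w\<in>VV. if w = v then sg (odd_ix v) * veta v * sg (False \<noteq> odd_ix v) * sg (odd_ix v \<and> \<not> False) *
            form (lk u v) (d x) else 0)"
          unfolding ft_homog[OF ut u']
          by (rule sum.cong[OF refl]) (auto simp: lookup_single when_def vhat_eq_iff)
        then have "veta v * sg (odd_ix v) * form (lk u v) (d x) = 0"
          using \<open>ft u ?u' = 0\<close> True by (simp add: sum.delta) (cases "odd_ix v"; simp)
        then show ?thesis by (cases v) auto
      qed
      have 2: "form (lk u v) (d x) = 0" if x: "x \<in> L" for x
      proof -
        have g: "form (lk u v) (d y) = 0" if y: "y \<in> L" "y \<in> graded_part q" for y q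
        proof (cases "q = odd_ix v")
          case False
          then show ?thesis using form_parity[OF uv(1) d_odd[OF y(2)]] by auto
        qed (use 1 y in auto)
        have "d x = d (fst x, 0) + d (0, snd x)" by (simp flip: d_simps(2))
        then show ?thesis using g[OF L_props(2)[OF x], of False] g[OF L_props(3)[OF x], of True] by simp
      qed
      have "lk u v = 0"
      proof (rule form_nondeg)
        fix y
        obtain l x where y: "l \<in> L" "y = l + d x" using L_props(5) by blast
        obtain l' x' where x: "l' \<in> L" "x = l' + d x'" using L_props(5) by blast
        show "form (lk u v) y = 0"
          using L_props(4)[OF uv(2) y(1)] 2[OF x(1)] by (simp add: y(2) x(2) d_square)
      qed
      then show ?thesis by simp
    qed
  qed
  obtain U where U: "finite U" "span U = ?S False" "independent U"
    "\<And>u v. u \<in> U \<Longrightarrow> v \<in> U \<Longrightarrow> u \<noteq> v \<Longrightarrow> ft u v = 0" "\<And>u. u \<in> U \<Longrightarrow> ft u u = 1 \<or> ft u u = -1"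
  proof (rule orthonormal_basis_exists[of ft "?S False" sgl])
    show "?S False \<subseteq> span sgl" using tensV_span by auto
    show "ft x y = ft y x" if "x \<in> ?S False" "y \<in> ?S False" for x y
      using ft_sym[of x False y] that by simp
  qed (use ft_linear sub finite_sgl nondeg in \<open>blast+\<close>)
  obtain U1 where U1: "U1 \<subseteq> ?S True" "independent U1" "?S True \<subseteq> span U1"
    by (rule maximal_independent_subset)
  have fU1: "finite U1"
    using independent_span_bound[OF finite_sgl U1(2)] U1(1) tensV_span by blast
  have sU1: "span U1 = ?S True" using span_minimal[OF U1(1) sub] U1(3) by auto
  define Up where "Up = {u\<in>U. ft u u = 1}"
  define Um where "Um = {u\<in>U. ft u u = -1}"
  have fin: "finite Up" "finite Um" using U(1) by (auto simp: Up_def Um_def)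
  have UU: "U = Up \<union> Um" "Up \<inter> Um = {}" using U(5) by (auto simp: Up_def Um_def)
  define k where "k = card Up" define N where "N = card Up + card Um" define M where "M = card U1"
  obtain fp fm f1 where f: "bij_betw fp {0..<card Up} Up" "bij_betw fm {0..<card Um} Um" "bij_betw f1 {0..<card U1} U1"
    using ex_bij_betw_nat_finite fin fU1 by metis
  \<comment> \<open>The vectors of square 1 occupy the indices below \<open>k\<close>, those of
    square -1 follow with an offset of \<open>k\<close>.\<close>
  define b where "b c = (case c of Ev i \<Rightarrow> if i < k then fp i else fm (i - k) | Od j \<Rightarrow> f1 j)" for c
  have kN: "k \<le> N" by (simp add: k_def N_def)
  have imp: "fp ` {..<k} = Up" "fm ` {..<card Um} = Um" "f1 ` {..<M} = U1"
    and inj: "inj_on fp {..<k}" "inj_on fm {..<card Um}" "inj_on f1 {..<M}"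
    using f by (auto simp: bij_betw_def k_def M_def atLeast0LessThan)
  have bp: "b (Ev i) \<in> Up" if "i < k" for i using that imp(1) by (auto simp: b_def)
  have bm: "b (Ev i) \<in> Um" if "k \<le> i" "i < N" for i
  proof -
    have "i - k < card Um" using that by (simp add: N_def k_def)
    then show ?thesis using that imp(2) by (auto simp: b_def)
  qed
  have bev: "b ` evs N = U"
  proof
    show "b ` evs N \<subseteq> U" using bp bm UU(1) by (auto, metis not_le)
    show "U \<subseteq> b ` evs N"
    proof
      fix u assume "u \<in> U"
      then consider i where "i < k" "u = fp i" | i where "i < card Um" "u = fm i"
        using UU(1) imp(1,2) by (metis Un_iff imageE lessThan_iff)
      then show "u \<in> b ` evs N"
      proof cases
        case 1
        then have "u = b (Ev i)" "i < N" using kN by (auto simp: b_def)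
        then show ?thesis by auto
      next
        case 2
        then have "u = b (Ev (k + i))" "k + i < N" by (auto simp: b_def N_def k_def)
        then show ?thesis by blast
      qed
    qed
  qed
  have bod: "b ` ods M = U1" using imp(3) by (auto simp: b_def image_image)
  have dis: "span U \<inter> span U1 = {0}"
  proof -
    have "u = 0" if "u \<in> ?S False" "u \<in> ?S True" for u
    proof (rule poly_mapping_eqI)
      fix v
      show "lk u v = lk 0 v"
        using tens_partD[of u False v] tens_partD[of u True v] that
        by (cases "odd_ix v") (auto simp: graded_part_def prod_eq_iff)
    qed
    then show ?thesis unfolding U(2) sU1 using subspace_0[OF sub] by auto
  qed
  have z: "0 \<notin> U1" using U1(2) dependent_zero by blast
  have injb: "inj_on b (evs N \<union> ods M)"
  proof (rule inj_onI)
    fix x y assume xy: "x \<in> evs N \<union> ods M" "y \<in> evs N \<union> ods M" "b x = b y"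
    have no: "\<not> (u \<in> U \<and> u \<in> U1)" for u
    proof
      assume u: "u \<in> U \<and> u \<in> U1"
      then have "u \<in> span U \<inter> span U1" by (simp add: span_base)
      then show False using u z unfolding dis by simp
    qed
    have ev: "\<exists>i<N. v = Ev i" if "v \<in> evs N" for v using that by auto
    have od: "\<exists>i<M. v = Od i" if "v \<in> ods M" for v using that by auto
    have bE: "b v \<in> U" if "v \<in> evs N" for v using that bev by (metis imageI)
    have bO: "b v \<in> U1" if "v \<in> ods M" for v using that bod by (metis imageI)
    consider i j where "x = Ev i" "y = Ev j" "i < N" "j < N" | i j where "x = Od i" "y = Od j" "i < M" "j < M"
      | "b x \<in> U" "b y \<in> U1" | "b x \<in> U1" "b y \<in> U"
    proof (cases "x \<in> evs N"; cases "y \<in> evs N")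
      assume "x \<in> evs N" "y \<in> evs N"
      then show thesis using ev[of x] ev[of y] that(1) by metis
    next
      assume "x \<in> evs N" "y \<notin> evs N"
      then show thesis using bE bO xy(2) that(3) by simp
    next
      assume "x \<notin> evs N" "y \<in> evs N"
      then show thesis using bE bO xy(1) that(4) by simp
    next
      assume "x \<notin> evs N" "y \<notin> evs N"
      then show thesis using xy(1,2) od[of x] od[of y] that(2) by (metis Un_iff)
    qed
    then show "x = y"
    proof cases
      case 1
      consider "i < k" "j < k" | "k \<le> i" "k \<le> j" | "i < k" "k \<le> j" | "k \<le> i" "j < k" by linarith
      then show ?thesis
      proof cases
        case 1
        then show ?thesis using \<open>x = _\<close> \<open>y = _\<close> xy(3) inj(1) by (auto simp: b_def inj_on_def)
      next
        case 2
        then have "i - k = j - k"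
          using \<open>x = _\<close> \<open>y = _\<close> \<open>i < N\<close> \<open>j < N\<close> xy(3) inj(2) by (auto simp: b_def inj_on_def N_def k_def)
        then show ?thesis using \<open>x = _\<close> \<open>y = _\<close> 2 by simp
      next
        case 3
        then show ?thesis using bp[of i] bm[of j] \<open>x = _\<close> \<open>y = _\<close> \<open>j < N\<close> xy(3) UU(2) by auto
      next
        case 4
        then show ?thesis using bp[of j] bm[of i] \<open>x = _\<close> \<open>y = _\<close> \<open>i < N\<close> xy(3) UU(2) by auto
      qed
    next
      case 2
      then show ?thesis using xy(3) inj(3) by (auto simp: b_def inj_on_def)
    qed (use no[of "b x"] no[of "b y"] xy(3) in auto)
  qed
  have im: "b ` (evs N \<union> ods M) = U \<union> U1" by (simp add: image_Un bev bod)
  have ind: "independent (b ` (evs N \<union> ods M))" unfolding im by (rule independent_Un[OF U(3) U1(2) dis])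
  have sp: "span (b ` (evs N \<union> ods M)) = tensV n m L"
  proof
    have "U \<union> U1 \<subseteq> tensV n m L" using span_superset[of U] U(2) U1(1) by auto
    then show "span (b ` (evs N \<union> ods M)) \<subseteq> tensV n m L" unfolding im by (rule span_minimal[OF _ subspace_tensV])
    show "tensV n m L \<subseteq> span (b ` (evs N \<union> ods M))"
    proof
      fix u assume u: "u \<in> tensV n m L"
      have "tpr False u \<in> span (U \<union> U1)" "tpr True u \<in> span (U \<union> U1)"
        using tpr_props(1)[OF u] U(2) sU1 span_mono[of U "U \<union> U1"] span_mono[of U1 "U \<union> U1"] by blast+
      then have "tpr False u + tpr True u \<in> span (U \<union> U1)" by (rule span_add)
      then show "u \<in> span (b ` (evs N \<union> ods M))" using tpr_props(2)[OF u] im by simp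
    qed
  qed
  have ftb: "ft (b (Ev i)) (b (Ev j)) = (if i = j then (if i < k then 1 else -1) else 0)" if ij: "i < N" "j < N" for i j
  proof (cases "i = j")
    case True
    then show ?thesis using bp[of i] bm[of i] ij by (cases "i < k") (auto simp: Up_def Um_def)
  next
    case False
    have "b (Ev i) \<noteq> b (Ev j)" using inj_onD[OF injb, of "Ev i" "Ev j"] ij False by auto
    moreover have "b (Ev i) \<in> U" "b (Ev j) \<in> U" using bev ij by auto
    ultimately show ?thesis using U(4) False by auto
  qed
  have "sigma d form n m (evs N) b = (1/2) *\<^sub>R (\<Sum>i<N. \<Sum>j<N. ft (b (Ev i)) (b (Ev j)) *\<^sub>R mon [Ev i, Ev j])"
  proof -
    have i: "inj_on Ev A" for A by (auto simp: inj_on_def)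
    show ?thesis unfolding sigma_def by (subst restr_two) (simp_all add: sum.reindex[OF i])
  qed
  also have "(\<Sum>i<N. \<Sum>j<N. ft (b (Ev i)) (b (Ev j)) *\<^sub>R mon [Ev i, Ev j]) =
      (\<Sum>i<N. \<Sum>j<N. if j = i then (if i < k then mon [Ev i, Ev i] else - mon [Ev i, Ev i]) else 0)"
    by (intro sum.cong refl) (auto simp: ftb)
  also have "\<dots> = (\<Sum>i<N. if i < k then mon [Ev i, Ev i] else - mon [Ev i, Ev i])"
    by (intro sum.cong refl) (simp add: sum.delta)
  also have "\<dots> = (\<Sum>i<k. mon [Ev i, Ev i]) - (\<Sum>i\<in>{k..<N}. mon [Ev i, Ev i])"
  proof -
    have u: "{..<N} = {..<k} \<union> {k..<N}" using kN by auto
    show ?thesis unfolding u by (subst sum.union_disjoint) (auto simp: sum_negf)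
  qed
  finally have "adapted_coords d form n m L N M k b"
    unfolding adapted_coords_def
    using injb ind sp kN bev bod U(2) U1(1) span_superset[of U] by auto
  then show ?thesis by blast
qed

end

subsection \<open>The functional as a Wick functional\<close>

lemma induced_linear:
  assumes "linear R"
  shows "induced (\<lambda>w. R (mon w)) f = R f"
proof -
  have k: "koszul_sym (\<lambda>w. R (mon w))"
    unfolding koszul_sym_def
  proof (intro allI)
    fix us vs and v w :: 'a
    have "mon (us @ [v, w] @ vs) = sg (odd_ix v \<and> odd_ix w) *\<^sub>R mon (us @ [w, v] @ vs)"
      using koszul_sym_mon unfolding koszul_sym_def by blast
    then show "R (mon (us @ [v, w] @ vs)) = sg (odd_ix v \<and> odd_ix w) *\<^sub>R R (mon (us @ [w, v] @ vs))"
      by (simp only: linear_scale[OF assms])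
  qed
  show ?thesis
    by (rule linear_eq_mon[OF linear_induced[OF k] assms]) (rule induced_mon[OF k])
qed

lemma restr_Suc:
  assumes "finite C"
  shows "restr C b (Suc l) F = (\<Sum>c\<in>C. mon [c] * restr C b l (\<lambda>us. F (b c # us)))"
proof -
  let ?W = "\<lambda>l. {cs. set cs \<subseteq> C \<and> length cs = l}"
  have W: "{cs. length cs = l \<and> set cs \<subseteq> C} = ?W l" for l by auto
  have "restr C b (Suc l) F = (\<Sum>cs\<in>(\<lambda>(cs, c). c # cs) ` (?W l \<times> C). F (map b cs) *\<^sub>R mon cs)"
    by (simp only: restr_def W lists_length_Suc_eq)
  also have "\<dots> = (\<Sum>(cs, c)\<in>?W l \<times> C. F (b c # map b cs) *\<^sub>R mon (c # cs))"
    by (subst sum.reindex) (auto simp: inj_on_def intro!: sum.cong)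
  also have "\<dots> = (\<Sum>cs\<in>?W l. \<Sum>c\<in>C. F (b c # map b cs) *\<^sub>R mon (c # cs))"
    by (rule sum.cartesian_product[symmetric])
  also have "\<dots> = (\<Sum>c\<in>C. \<Sum>cs\<in>?W l. F (b c # map b cs) *\<^sub>R mon (c # cs))"
    by (rule sum.swap)
  also have "\<dots> = (\<Sum>c\<in>C. mon [c] * restr C b l (\<lambda>us. F (b c # us)))"
  proof (rule sum.cong[OF refl])
    fix c
    show "(\<Sum>cs\<in>?W l. F (b c # map b cs) *\<^sub>R mon (c # cs)) = mon [c] * restr C b l (\<lambda>us. F (b c # us))"
      unfolding restr_def W sum_distrib_left
    proof (rule sum.cong[OF refl])
      fix cs show "F (b c # map b cs) *\<^sub>R mon (c # cs) = mon [c] * F (b c # map b cs) *\<^sub>R mon cs"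
        unfolding mon_Cons[of c cs] mult_scaleR_right ..
    qed
  qed
  finally show ?thesis .
qed

section \<open>Restriction of polynomials to L tensor V\<close>

locale adapted = superfield_L mul d form r e n m L
  for mul :: "'e::real_vector \<times> 'o::real_vector \<Rightarrow> 'e \<times> 'o \<Rightarrow> 'e \<times> 'o"
    and d :: "'e \<times> 'o \<Rightarrow> 'e \<times> 'o" and form :: "'e \<times> 'o \<Rightarrow> 'e \<times> 'o \<Rightarrow> real"
    and r :: nat and e :: "cix \<Rightarrow> 'e \<times> 'o" and n m :: nat and L :: "('e \<times> 'o) set" +
  fixes N M k :: nat and b :: "cix \<Rightarrow> vix \<Rightarrow>\<^sub>0 'e \<times> 'o"
  assumes ac: "adapted_coords d form n m L N M k b"
begin

abbreviation "C \<equiv> evs N \<union> ods M"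

lemma finC: "finite C" by simp

lemma b_part: "c \<in> C \<Longrightarrow> b c \<in> tens_part (odd_ix c)"
  using ac unfolding adapted_coords_def by (elim UnE conjE imageE) (auto simp: image_subset_iff)

lemma b_tensV: "c \<in> C \<Longrightarrow> b c \<in> tensV n m L"
  using ac span_base[of "b c" "b ` C"] unfolding adapted_coords_def by auto

lemma sigma_eq:
  assumes "C' \<subseteq> C"
  shows "sigma d form n m C' b = (1/2) *\<^sub>R (\<Sum>c\<in>C'. \<Sum>c'\<in>C'. ft (b c) (b c') *\<^sub>R mon [c, c'])"
  unfolding sigma_def by (subst restr_two) (use assms finC finite_subset in auto)

lemma q_sym: "c \<in> C \<Longrightarrow> c' \<in> C \<Longrightarrow> ft (b c') (b c) = sg (odd_ix c \<and> odd_ix c') * ft (b c) (b c')"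
proof (cases "odd_ix c = odd_ix c'")
  case True
  assume "c \<in> C" "c' \<in> C"
  then show ?thesis using ft_sym[OF b_part[of c], of "b c'"] b_part[of c'] True by simp
next
  case False
  assume "c \<in> C" "c' \<in> C"
  then show ?thesis using ft_parity[OF b_part[of c] b_part[of c'] False] ft_parity[OF b_part[of c'] b_part[of c]] False by auto
qed

sublocale gc: gauss_coords N M k "\<lambda>c c'. ft (b c) (b c')" "sigma d form n m (ods M) b"
proof unfold_locales
  show "k \<le> N" using ac by (simp add: adapted_coords_def)
  then have kN: "k \<le> N" .
  show "ft (b c') (b c) = sg (odd_ix c \<and> odd_ix c') * ft (b c) (b c')" if "c \<in> C" "c' \<in> C" for c c'
    by (rule q_sym[OF that])
  show "ft (b c) (b c') = 0" if "c \<in> C" "c' \<in> C" "odd_ix c \<noteq> odd_ix c'" for c c'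
    by (rule ft_parity[OF b_part[OF that(1)] b_part[OF that(2)] that(3)])
  show "sigma d form n m (ods M) b = (1/2) *\<^sub>R (\<Sum>c\<in>ods M. \<Sum>c'\<in>ods M. ft (b c) (b c') *\<^sub>R mon [c, c'])"
    by (rule sigma_eq) auto
  fix i assume i: "i < N"
  have wr: "wick_rotation N k" using kN by (simp add: wick_rotation_def)
  have lam: "wick_rotation.lam k i = (if i < k then 1 else -1)" by (rule wick_rotation.lam_def[OF wr])
  have p2: "pd (Ev i) (mon [c, c']) = (if c = Ev i then mon [c'] else 0) + (if c' = Ev i then mon [c] else 0)"
    if "c \<in> evs N" for c c'
    unfolding mon_Cons[of c "[c']"] pd_mult_gen using that by auto
  \<comment> \<open>The normal form is an identity between quadratic polynomials. Differentiating
    it, once through the matrix of the form and once through the squares, yields the identity of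
    linear forms.\<close>
  have "pd (Ev i) (sigma d form n m (evs N) b) =
     (1/2) *\<^sub>R (\<Sum>c\<in>evs N. \<Sum>c'\<in>evs N. ft (b c) (b c') *\<^sub>R pd (Ev i) (mon [c, c']))"
    by (subst sigma_eq) simp_all
  also have "\<dots> = (1/2) *\<^sub>R (\<Sum>c\<in>evs N. \<Sum>c'\<in>evs N. (if c = Ev i then ft (b c) (b c') *\<^sub>R mon [c'] else 0) +
      (if c' = Ev i then ft (b c) (b c') *\<^sub>R mon [c] else 0))"
    by (intro arg_cong[where f="\<lambda>x. (1/2) *\<^sub>R x"] sum.cong refl) (simp add: p2 scaleR_add_right)
  also have "\<dots> = (1/2) *\<^sub>R ((\<Sum>c\<in>evs N. ft (b (Ev i)) (b c) *\<^sub>R mon [c]) + (\<Sum>c\<in>evs N. ft (b c) (b (Ev i)) *\<^sub>R mon [c]))"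
  proof -
    have "(\<Sum>c\<in>evs N. \<Sum>c'\<in>evs N. if c = Ev i then ft (b c) (b c') *\<^sub>R mon [c'] else 0) =
      (\<Sum>c\<in>evs N. if c = Ev i then \<Sum>c'\<in>evs N. ft (b c) (b c') *\<^sub>R mon [c'] else 0)"
      by (rule sum.cong) auto
    then show ?thesis using i by (simp add: sum.distrib)
  qed
  also have "(\<Sum>c\<in>evs N. ft (b c) (b (Ev i)) *\<^sub>R mon [c]) = (\<Sum>c\<in>evs N. ft (b (Ev i)) (b c) *\<^sub>R mon [c])"
  proof (rule sum.cong[OF refl])
    fix c assume "c \<in> evs N"
    then show "ft (b c) (b (Ev i)) *\<^sub>R mon [c] = ft (b (Ev i)) (b c) *\<^sub>R mon [c]"
      using q_sym[of "Ev i" c] i by simp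
  qed
  finally have 1: "pd (Ev i) (sigma d form n m (evs N) b) = (\<Sum>c\<in>evs N. ft (b (Ev i)) (b c) *\<^sub>R mon [c])"
    by (simp flip: scaleR_2)
  have "pd (Ev i) (mon [Ev j, Ev j]) = (if j = i then 2 *\<^sub>R mon [Ev i] else 0)" for j
    unfolding mon_Cons[of "Ev j" "[Ev j]"] pd_mult_gen by (simp add: scaleR_2)
  then have "pd (Ev i) (sigma d form n m (evs N) b) =
     (1/2) *\<^sub>R ((\<Sum>j<k. if j = i then 2 *\<^sub>R mon [Ev i] else 0) - (\<Sum>j\<in>{k..<N}. if j = i then 2 *\<^sub>R mon [Ev i] else 0))"
    using ac unfolding adapted_coords_def by simp
  then have 2: "pd (Ev i) (sigma d form n m (evs N) b) = (if i < k then 1 else -1) *\<^sub>R mon [Ev i]"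
    using i kN by simp
  show "(\<Sum>c\<in>evs N. ft (b (Ev i)) (b c) *\<^sub>R mon [c]) = wick_rotation.lam k i *\<^sub>R mon [Ev i]"
    using 1 2 lam by simp
qed

definition crd :: "(vix \<Rightarrow>\<^sub>0 'e \<times> 'o) \<Rightarrow> cix \<times> vix \<Rightarrow> real" where
  "crd u i = (if i \<in> WW then form (e (cdual (fst i))) (lk u (snd i)) else 0)"

lemma linear_crd: "linear (\<lambda>u. crd u i)"
  unfolding crd_def by (rule linearI) (simp_all add: lk_simps)

definition rv :: "cix \<times> vix \<Rightarrow> cix spoly" where
  "rv i = (\<Sum>c\<in>C. crd (b c) i *\<^sub>R mon [c])"

lemma crd_parity:
  assumes "c \<in> C" "crd (b c) i \<noteq> 0"
  shows "odd_ix c = odd_ix i" "i \<in> WW"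
proof -
  show i: "i \<in> WW" using assms by (auto simp: crd_def split: if_splits)
  obtain a v where av: "i = (a, v)" "a \<in> idx r" "v \<in> VV" using i by auto
  have "e (cdual a) \<in> graded_part (\<not> odd_ix a)" using e_graded[of "cdual a"] av by simp
  from form_parity[OF this tens_partD[OF b_part[OF assms(1)], of v]]
  show "odd_ix c = odd_ix i" using assms(2) i by (auto simp: av crd_def)
qed

lemma rv_homog: "rv i \<in> homog (odd_ix i)"
  unfolding rv_def
proof (intro homog_sum)
  fix c assume c: "c \<in> C"
  show "crd (b c) i *\<^sub>R mon [c] \<in> homog (odd_ix i)"
    using crd_parity(1)[OF c, of i] homog_mon1[of c] by (cases "crd (b c) i = 0") auto
qed

text \<open>Restriction to L tensor V in the coordinates dual to \<open>b\<close>, as a substitution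
  homomorphism.\<close>

definition rho :: "(cix \<times> vix) spoly \<Rightarrow> cix spoly" where
  "rho = hom_ext rv"

lemmas linear_rho = linear_hom_ext[of rv, OF rv_homog, folded rho_def]
  and rho_mult = hom_ext_mult[of rv, OF rv_homog, folded rho_def]
  and rho_gen = hom_ext_gen[of rv, OF rv_homog, folded rho_def]
  and rho_one = hom_ext_one[of rv, OF rv_homog, folded rho_def]

lemmas rho_simps = linear_0[OF linear_rho] linear_add[OF linear_rho] linear_scale[OF linear_rho]
  linear_sum[OF linear_rho]

lemma rho_part: "rho f \<in> sym_part C UNIV"
proof (induction f rule: spoly_induct)
  case zero
  then show ?case by (simp add: rho_simps subspace_0)
next
  case (add c w f)
  have "rho (mon w) \<in> sym_part C UNIV" for w
  proof (induction w)
    case Nil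
    show ?case using sym_part_mon[of "[]" C UNIV] by (simp add: rho_one)
  next
    case (Cons i w)
    have "rv i \<in> sym_part C UNIV"
      unfolding rv_def by (intro subspace_sum subspace_scale subspace_sym_part sym_part_mon) auto
    then show ?case
      unfolding mon_Cons[of i w] rho_mult rho_gen by (rule sym_part_mult[OF _ Cons]) simp
  qed
  then show ?case using add
    by (simp add: rho_simps subspace_add subspace_scale)
qed

lemma pd_rho:
  assumes c: "c \<in> C"
  shows "pd c (rho f) = (\<Sum>i\<in>WW. crd (b c) i *\<^sub>R rho (pd i f))"
proof (rule linear_eq_gen[where f=f])
  show "linear (\<lambda>f. pd c (rho f))" "linear (\<lambda>f. \<Sum>i\<in>WW. crd (b c) i *\<^sub>R rho (pd i f))"
    by (intro linear_intros linear_fun_comp[OF linear_rho] linear_rho linear_pd)+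
  fix j f assume IH: "pd c (rho f) = (\<Sum>i\<in>WW. crd (b c) i *\<^sub>R rho (pd i f))"
  have "pd c (rv j) = (\<Sum>c'\<in>C. if c' = c then crd (b c) j *\<^sub>R 1 else 0)"
    unfolding rv_def pd_simps by (intro sum.cong refl) auto
  then have 1: "pd c (rv j) = crd (b c) j *\<^sub>R 1" using c by simp
  have "(\<Sum>i\<in>WW. crd (b c) i *\<^sub>R rho (pd i (mon [j] * f))) =
    (\<Sum>i\<in>WW. (if i = j then crd (b c) j *\<^sub>R rho f else 0) +
      sg (odd_ix c \<and> odd_ix j) *\<^sub>R (rv j * (crd (b c) i *\<^sub>R rho (pd i f))))"
  proof (intro sum.cong refl)
    fix i
    show "crd (b c) i *\<^sub>R rho (pd i (mon [j] * f)) = (if i = j then crd (b c) j *\<^sub>R rho f else 0) +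
      sg (odd_ix c \<and> odd_ix j) *\<^sub>R (rv j * (crd (b c) i *\<^sub>R rho (pd i f)))"
      using crd_parity(1)[OF c, of i]
      by (cases "crd (b c) i = 0") (auto simp: pd_mult_gen rho_simps rho_mult rho_gen scaleR_add_right)
  qed
  also have "\<dots> = crd (b c) j *\<^sub>R rho f + sg (odd_ix c \<and> odd_ix j) *\<^sub>R (rv j * pd c (rho f))"
    using crd_parity(2)[OF c, of j]
    by (cases "j \<in> WW") (auto simp: sum.distrib IH sum_distrib_left scaleR_sum_right)
  finally show "pd c (rho (mon [j] * f)) = (\<Sum>i\<in>WW. crd (b c) i *\<^sub>R rho (pd i (mon [j] * f)))"
    by (simp add: rho_mult rho_gen pd_mult[OF rv_homog] 1)
qed (simp add: rho_one rho_simps)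

abbreviation "K \<equiv> Km (hty L)"
abbreviation "EE \<equiv> W.wick K"

lemma hom: "homotopy (hty L)"
  by (rule homotopy_hty[OF L])

text \<open>Restricted to L tensor V, the coordinate (a, v) is up to sign the pairing with one
  vector u of L tensor V, built from the homotopy. The Schwinger-Dyson equation converts
  multiplication by such a pairing into the derivative along u, and the coordinates of u are the row
  of the propagator.\<close>

lemma II_wick_rec: "gc.II (rho (mon [i] * f)) = (\<Sum>j\<in>WW. K i j *\<^sub>R gc.II (rho (pd j f)))"
proof (cases "i \<in> WW")
  case False
  have "rv i = 0" unfolding rv_def using False by (intro sum.neutral) (auto simp: crd_def)
  moreover have "K i j = 0" for j using False by (auto simp: tens_def)
  ultimately show ?thesis by (simp add: rho_mult rho_gen linear_0[OF gc.linear_II])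
next
  case True
  obtain a v where i: "i = (a, v)" "a \<in> idx r" "v \<in> VV" using True by auto
  let ?y = "e (cdual a)"
  let ?s = "hty L ?y"
  \<comment> \<open>The vector u: the homotopy applied to the dual basis element, placed in the
    symplectically dual direction.\<close>
  let ?u = "Poly_Mapping.single (vhat v) ?s"
  let ?k = "veta v * sg (odd_ix v \<and> odd_ix a)"
  have yg: "?y \<in> graded_part (\<not> odd_ix a)" using e_graded[of "cdual a"] i by simp
  have sg': "?s \<in> graded_part (odd_ix a)" using hty_graded[OF L yg] by simp
  have sL: "?s \<in> L" by (rule hty_in[OF L])
  have uT: "?u \<in> tensV n m L"
    using sL i by (auto simp: tensV_def lookup_single when_def subspace_0[OF L_props(1)])
  have "?u \<in> span (b ` C)" using uT ac by (simp add: adapted_coords_def)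
  then obtain \<alpha> where al: "?u = (\<Sum>w\<in>b ` C. \<alpha> w *\<^sub>R w)" using span_finite[of "b ` C"] by auto
  have inj: "inj_on b C" using ac by (simp add: adapted_coords_def)
  have u: "?u = (\<Sum>c\<in>C. \<alpha> (b c) *\<^sub>R b c)" unfolding al by (simp add: sum.reindex[OF inj])
  have ftu: "ft ?u (b c') = ?k * crd (b c') i" if c': "c' \<in> C" for c'
  proof -
    let ?x = "lk (b c') v"
    have xL: "?x \<in> L" using b_tensV[OF c'] by (simp add: tensV_def)
    have xg: "?x \<in> graded_part (odd_ix c' \<noteq> odd_ix v)" by (rule tens_partD[OF b_part[OF c']])
    have t1: "twist True ?s = sg (odd_ix a) *\<^sub>R ?s" using twist_graded[OF sg', of True] by simp
    have "ft ?u (b c') = (\<Sum>w\<in>VV. if w = vhat v then sg (odd_ix v) * veta (vhat v) *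
        form (twist True ?s) (d (twist (odd_ix v) ?x)) else 0)"
      unfolding ft_eq by (intro sum.cong refl) (auto simp: lookup_single when_def linear_0[OF linear_twist])
    also have "\<dots> = sg (odd_ix v) * veta (vhat v) * form (twist True ?s) (d (twist (odd_ix v) ?x))"
      using i by simp
    also have "\<dots> = - veta v * sg (odd_ix a) * sg (odd_ix v \<and> (odd_ix c' \<noteq> odd_ix v)) * form ?s (d ?x)"
      unfolding t1 twist_graded[OF xg] veta_vhat by (cases "odd_ix v") simp_all
    also have "form ?s (d ?x) = - sg (odd_ix a) * form (d ?s) ?x"
      by (rule form_d_adj[OF sg'])
    also have "form (d ?s) ?x = form ?y ?x"
    proof -
      \<comment> \<open>The defect of d s from the identity lies in L and pairs to zero with values
        in L.\<close>
      have "d ?s = ?y - hty L (d ?y)" using d_hty[OF L, of ?y] by (simp add: eq_diff_eq)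
      then show ?thesis using L_props(4)[OF hty_in(1)[OF L, of "d ?y"] xL] by simp
    qed
    also have "form ?y ?x = crd (b c') i" using True by (simp add: crd_def i)
    also have "- veta v * sg (odd_ix a) * sg (odd_ix v \<and> (odd_ix c' \<noteq> odd_ix v)) * (- sg (odd_ix a) * crd (b c') i) =
       ?k * crd (b c') i"
      using crd_parity(1)[OF c', of i] i
      by (cases "crd (b c') i = 0"; cases "odd_ix v"; cases "odd_ix a") auto
    finally show ?thesis .
  qed
  have kk: "?k * ?k = 1" by (cases "odd_ix v \<and> odd_ix a") auto
  have "rv i = ?k *\<^sub>R (\<Sum>c\<in>C. ft ?u (b c) *\<^sub>R mon [c])"
    unfolding rv_def scaleR_sum_right
  proof (rule sum.cong[OF refl])
    fix c assume c: "c \<in> C"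
    have "?k * (?k * crd (b c) i) = crd (b c) i" by (metis kk mult.assoc mult_1)
    then show "crd (b c) i *\<^sub>R mon [c] = ?k *\<^sub>R ft ?u (b c) *\<^sub>R mon [c]"
      unfolding ftu[OF c] scaleR_scaleR by (simp only:)
  qed
  also have "(\<Sum>c\<in>C. ft ?u (b c) *\<^sub>R mon [c]) = (\<Sum>c\<in>C. \<alpha> (b c) *\<^sub>R (\<Sum>c'\<in>C. ft (b c) (b c') *\<^sub>R mon [c']))"
  proof -
    have ftx: "ft ?u x = (\<Sum>c\<in>C. \<alpha> (b c) * ft (b c) x)" for x
      unfolding u linear_sum[OF ft_linear(2)] linear_scale[OF ft_linear(2)] by simp
    show ?thesis
      unfolding ftx scaleR_sum_left scaleR_sum_right scaleR_scaleR by (rule sum.swap)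
  qed
  finally have rvi: "rv i = ?k *\<^sub>R (\<Sum>c\<in>C. \<alpha> (b c) *\<^sub>R (\<Sum>c'\<in>C. ft (b c) (b c') *\<^sub>R mon [c']))" .
  note IIs = linear_sum[OF gc.linear_II] linear_scale[OF gc.linear_II]
  have "gc.II (rho (mon [i] * f)) = ?k *\<^sub>R (\<Sum>c\<in>C. \<alpha> (b c) *\<^sub>R gc.II ((\<Sum>c'\<in>C. ft (b c) (b c') *\<^sub>R mon [c']) * rho f))"
    unfolding rho_mult rho_gen rvi mult_scaleR_left sum_distrib_right[of _ _ "rho f"] IIs ..
  also have "\<dots> = ?k *\<^sub>R (\<Sum>c\<in>C. \<alpha> (b c) *\<^sub>R gc.II (pd c (rho f)))"
    using gc.schwinger_dyson[of _ "rho f"] by (intro arg_cong[where f="\<lambda>x. ?k *\<^sub>R x"] sum.cong refl) simp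
  also have "\<dots> = ?k *\<^sub>R (\<Sum>c\<in>C. \<Sum>j\<in>WW. (\<alpha> (b c) * crd (b c) j) *\<^sub>R gc.II (rho (pd j f)))"
    by (intro arg_cong[where f="\<lambda>x. ?k *\<^sub>R x"] sum.cong refl) (simp only: pd_rho IIs scaleR_sum_right scaleR_scaleR)
  also have "\<dots> = (\<Sum>j\<in>WW. (?k * (\<Sum>c\<in>C. \<alpha> (b c) * crd (b c) j)) *\<^sub>R gc.II (rho (pd j f)))"
    by (subst sum.swap) (simp only: scaleR_sum_left[symmetric] scaleR_sum_right scaleR_scaleR)
  also have "\<dots> = (\<Sum>j\<in>WW. K i j *\<^sub>R gc.II (rho (pd j f)))"
  proof (intro sum.cong refl arg_cong[where f="\<lambda>x. x *\<^sub>R _"])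
    fix j assume j: "j \<in> WW"
    have "(\<Sum>c\<in>C. \<alpha> (b c) * crd (b c) j) = crd ?u j"
      unfolding u by (simp only: linear_sum[OF linear_crd] linear_scale[OF linear_crd] real_scaleR_def)
    then show "?k * (\<Sum>c\<in>C. \<alpha> (b c) * crd (b c) j) = K i j"
      using j True by (auto simp: crd_def tens_def i lookup_single when_def form_commute conj_commute)
  qed
  finally show ?thesis .
qed

lemma II_rho: "gc.II (rho f) = EE f *\<^sub>R gc.II 1"
proof -
  have "linear (\<lambda>f. gc.II (rho f))" by (rule linear_fun_comp[OF gc.linear_II linear_rho])
  from W.wick_unique[OF is_wick_Km[OF hom] this II_wick_rec] show ?thesis by (simp add: rho_one)
qed

text \<open>Every linear function on L tensor V extends to A tensor V, so each generator has a
  preimage.\<close>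

lemma rho_surj:
  assumes "set w \<subseteq> C"
  shows "\<exists>f. rho f = mon w"
  using assms
proof (induction w)
  case Nil
  then show ?case using rho_one by auto
next
  case (Cons c w)
  then obtain f where f: "rho f = mon w" by auto
  have c: "c \<in> C" using Cons by simp
  have ind: "independent (b ` C)" and inj: "inj_on b C" using ac by (auto simp: adapted_coords_def)
  \<comment> \<open>A linear extension of the coordinate \<open>c\<close>; its values on simple
    tensors are the coefficients of the preimage.\<close>
  obtain g where g: "linear g" "\<And>x. x \<in> b ` C \<Longrightarrow> g x = (if x = b c then 1 else (0::real))"
    using linear_independent_extend[OF ind, of "\<lambda>x. if x = b c then 1 else (0::real)"] by auto
  have gb: "g (b c') = (if c' = c then 1 else 0)" if "c' \<in> C" for c'
    using g(2)[of "b c'"] that c inj_onD[OF inj, of c' c] by auto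
  let ?f = "\<Sum>i\<in>WW. g (Poly_Mapping.single (snd i) (e (fst i))) *\<^sub>R mon [i]"
  have "rho ?f = (\<Sum>i\<in>WW. \<Sum>c'\<in>C. (g (Poly_Mapping.single (snd i) (e (fst i))) * crd (b c') i) *\<^sub>R mon [c'])"
    by (simp only: rho_simps rho_gen rv_def scaleR_sum_right scaleR_scaleR)
  also have "\<dots> = (\<Sum>c'\<in>C. (\<Sum>i\<in>WW. g (Poly_Mapping.single (snd i) (e (fst i))) * crd (b c') i) *\<^sub>R mon [c'])"
    by (subst sum.swap) (simp only: scaleR_sum_left)
  also have "\<dots> = (\<Sum>c'\<in>C. if c' = c then mon [c] else 0)"
  proof (intro sum.cong refl)
    fix c' assume c': "c' \<in> C"
    have "Poly_Mapping.keys (b c') \<subseteq> VV" using b_tensV[OF c'] by (simp add: tensV_def)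
    from arg_cong[OF single_expand[OF this], of g]
    have "g (b c') = (\<Sum>v\<in>VV. \<Sum>a\<in>idx r. form (e (cdual a)) (lk (b c') v) * g (Poly_Mapping.single v (e a)))"
      by (simp add: linear_sum[OF g(1)] linear_scale[OF g(1)])
    also have "\<dots> = (\<Sum>i\<in>WW. g (Poly_Mapping.single (snd i) (e (fst i))) * crd (b c') i)"
      unfolding sum_WW by (intro sum.cong refl) (simp add: crd_def)
    finally show "(\<Sum>i\<in>WW. g (Poly_Mapping.single (snd i) (e (fst i))) * crd (b c') i) *\<^sub>R mon [c'] =
      (if c' = c then mon [c] else 0)" unfolding gb[OF c', symmetric] by (auto simp: gb[OF c'])
  qed
  finally have "rho ?f = mon [c]" using c by simp
  then have "rho (?f * f) = mon (c # w)" by (simp only: rho_mult f flip: mon_Cons)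
  then show ?case by blast
qed

text \<open>If this vanished, \<open>II_rho\<close> would make the integral of every restricted
  polynomial vanish, and restriction is onto.\<close>

lemma II_one: "gc.II 1 \<noteq> 0"
proof
  assume z: "gc.II 1 = 0"
  obtain w where w: "set w \<subseteq> C" "gc.II (mon w) \<noteq> 0" using gc.II_nonzero by blast
  obtain f where "rho f = mon w" using rho_surj[OF w(1)] by blast
  then show False using II_rho[of f] w z by simp
qed

lemma super_integral_eq:
  assumes "f \<in> sym_part C UNIV"
  shows "super_integral d form n m N M k b f = gc.II f"
  using gc.wick_II[OF assms] by (simp add: super_integral_def gc.expo_def)

definition emb :: "'e \<times> 'o \<Rightarrow> (real \<times> 'e) \<times> ('o \<times> real)" where "emb x = hmk 0 x 0"

lemma emb_linear: "linear emb"
  by (rule linearI; rule hat_eqI; simp add: emb_def)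

lemma twist_twist [simp]: "twist q (twist q z) = z"
  by (simp add: twist_def prod_eq_iff)

lemma twist_emb: "emb (twist q x) = twist q (emb x)"
  by (simp add: emb_def hmk_def twist_def)

lemma htr_twist: "htr (twist q z) = sg q * htr z"
  by (simp add: htr_def twist_def)

lemma twist_hmul: "twist q (hmul x y) = hmul (twist q x) (twist q y)"
proof (rule linear_eq_graded[where a=x])
  show "linear (\<lambda>x. twist q (hmul x y))" "linear (\<lambda>x. hmul (twist q x) (twist q y))"
    by (rule linearI; simp)+
  fix p x assume x: "(x :: (real \<times> 'e) \<times> ('o \<times> real)) \<in> graded_part p"
  show "twist q (hmul x y) = hmul (twist q x) (twist q y)"
  proof (rule linear_eq_graded[where a=y])
    show "linear (\<lambda>y. twist q (hmul x y))" "linear (\<lambda>y. hmul (twist q x) (twist q y))"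
      by (rule linearI; simp)+
    fix p' y assume y: "(y :: (real \<times> 'e) \<times> ('o \<times> real)) \<in> graded_part p'"
    show "twist q (hmul x y) = hmul (twist q x) (twist q y)"
      unfolding twist_graded[OF hmul_graded[OF x y]] twist_graded[OF x] twist_graded[OF y]
        hmul_linear scaleR_scaleR
      by (cases q; cases p; cases p') simp_all
  qed
qed

lemma twist_foldl: "foldl hmul z (map (\<lambda>x. twist q (F x)) xs) = twist q (foldl hmul (twist q z) (map F xs))"
  by (induction xs arbitrary: z) (simp_all add: twist_hmul)

text \<open>\<open>psi_tensor\<close> with an arbitrary starting factor \<open>z\<close>, which
  holds the product of the arguments already read and makes induction on the word possible.\<close>

definition Tz :: "(real \<times> 'e) \<times> ('o \<times> real) \<Rightarrow> vix list \<Rightarrow> (vix \<Rightarrow>\<^sub>0 'e \<times> 'o) list \<Rightarrow> real" where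
  "Tz z w us = htr (foldl hmul z (map (\<lambda>i. emb (twist (odd_word (take i w)) (lk (us ! i) (w ! i)))) [0..<length w]))"

lemma twist_xor: "twist (p \<noteq> q) x = twist p (twist q x)"
  by (auto simp: twist_def sg_def)

text \<open>The first letter twists every later factor by its parity. The twist is a homomorphism
  and an involution, so it is moved onto the starting factor, at the price of the sign of the odd
  trace.\<close>

lemma Tz_Cons: "Tz z (v # w) (u # us) = sg (odd_ix v) * Tz (twist (odd_ix v) (hmul z (emb (lk u v)))) w us"
proof -
  have m: "map F [0..<length (v # w)] = F 0 # map (\<lambda>i. F (Suc i)) [0..<length w]" for F :: "nat \<Rightarrow> (real \<times> 'e) \<times> ('o \<times> real)"
    by (simp add: upt_conv_Cons map_Suc_upt[symmetric] del: upt_Suc)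
  show ?thesis
    unfolding Tz_def m by (simp add: twist_xor[unfolded not_iff] twist_emb twist_foldl htr_twist)
qed

lemma restr_linear_z: "restr C b l (\<lambda>us. c * F us) = c *\<^sub>R restr C b l F"
  by (simp add: restr_def scaleR_sum_right)

lemma rho_G: "rho (G z w) = restr C b (length w) (Tz z w)"
proof (induction w arbitrary: z)
  case Nil
  have "{cs. length cs = 0 \<and> set cs \<subseteq> C} = {[]}" by auto
  then show ?case by (simp add: restr_def Tz_def rho_simps rho_one)
next
  case (Cons v w)
  let ?q = "odd_ix v"
  have "restr C b (length (v # w)) (Tz z (v # w)) =
    (\<Sum>c\<in>C. mon [c] * sg ?q *\<^sub>R rho (G (twist ?q (hmul z (emb (lk (b c) v)))) w))"
    unfolding length_Cons restr_Suc[OF finC] Tz_Cons restr_linear_z Cons ..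
  also have "\<dots> = (\<Sum>c\<in>C. mon [c] * sg ?q *\<^sub>R (\<Sum>a\<in>idx r. crd (b c) (a, v) *\<^sub>R rho (G (twist ?q (hmul z (Eb a))) w)))"
  proof (intro sum.cong refl)
    fix c assume c: "c \<in> C"
    have cv: "form (e (cdual a)) (lk (b c) v) = crd (b c) (a, v)" if "a \<in> idx r" for a
    proof (cases "v \<in> VV")
      case False
      then have "lk (b c) v = 0" using b_tensV[OF c] by (auto simp: tensV_def in_keys_iff)
      then show ?thesis by (simp add: crd_def)
    qed (use that in \<open>simp add: crd_def\<close>)
    have "lk (b c) v = (\<Sum>a\<in>idx r. crd (b c) (a, v) *\<^sub>R e a)"
      using e_complete[of "lk (b c) v"] by (simp add: cv form_commute[of "lk (b c) v"])
    then have "emb (lk (b c) v) = (\<Sum>a\<in>idx r. crd (b c) (a, v) *\<^sub>R Eb a)"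
      by (simp add: linear_sum[OF emb_linear] linear_scale[OF emb_linear]) (simp add: emb_def Eb_def)
    moreover have "linear (\<lambda>x. rho (G (twist ?q (hmul z x)) w))"
      by (rule linear_fun_comp[OF linear_rho], rule linear_fun_comp[OF linear_G],
          rule linear_fun_comp[OF linear_twist], rule linearI) simp_all
    ultimately show "mon [c] * sg ?q *\<^sub>R rho (G (twist ?q (hmul z (emb (lk (b c) v)))) w) =
      mon [c] * sg ?q *\<^sub>R (\<Sum>a\<in>idx r. crd (b c) (a, v) *\<^sub>R rho (G (twist ?q (hmul z (Eb a))) w))"
      by (simp only: linear_sum[of "\<lambda>x. rho (G (twist ?q (hmul z x)) w)"] linear_scale[of "\<lambda>x. rho (G (twist ?q (hmul z x)) w)"])
  qed
  also have "\<dots> = (\<Sum>c\<in>C. \<Sum>a\<in>idx r. (sg ?q * crd (b c) (a, v)) *\<^sub>R (mon [c] * rho (G (twist ?q (hmul z (Eb a))) w)))"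
    by (intro sum.cong refl) (simp only: scaleR_sum_right sum_distrib_left mult_scaleR_right scaleR_scaleR)
  also have "\<dots> = rho (G z (v # w))"
    unfolding G.simps rho_simps rho_mult rho_gen rv_def sum_distrib_right mult_scaleR_left scaleR_sum_right scaleR_scaleR
    by (rule sum.swap)
  finally show ?case ..
qed

text \<open>Each further factor overwrites the coefficient of tau by a scalar product, so only the
  last one survives.\<close>

lemma foldl_emb: "foldl hmul (hmk 0 x t) (map emb ys) =
    (if ys = [] then hmk 0 x t else hmk 0 (foldl mul x ys) (form (foldl mul x (butlast ys)) (last ys)))"
proof (induction ys rule: rev_induct)
  case (snoc y ys)
  have h: "hmul (hmk 0 x t) (emb y) = hmk 0 (mul x y) (form x y)" for x t
    by (rule hat_eqI) (simp_all add: hmul_def emb_def)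
  show ?case by (cases "ys = []") (simp_all add: snoc h)
qed simp

text \<open>The reason for adjoining a unit and tau: the multilinear tensor becomes a trace. For
  fewer than two factors the trace is 0, in agreement with the convention in
  \<open>psi_tensor\<close>.\<close>

lemma htr_foldl: "htr (foldl hmul hone (map emb xs)) = (if length xs < 2 then 0 else mtilde mul form xs)"
proof (cases xs)
  case Nil
  then show ?thesis by (simp add: hone_def)
next
  case (Cons x ys)
  have "foldl hmul hone (map emb xs) = foldl hmul (hmk 0 x 0) (map emb ys)"
    by (simp add: Cons) (simp add: emb_def)
  then show ?thesis
    by (simp add: foldl_emb Cons mtilde_def)
qed

lemma Psi_eq: "Psi mul form C b h = rho (psi h)"
proof -
  have "psi_tensor mul form w us = Tz hone w us" for w us
    using htr_foldl[of "map (\<lambda>i. twist (odd_word (take i w)) (lk (us ! i) (w ! i))) [0..<length w]"]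
    by (simp add: psi_tensor_def Tz_def comp_def)
  then have "psi_tensor mul form w = Tz hone w" for w by (rule ext)
  then have "Psi mul form C b = induced (\<lambda>w. rho (psi (mon w)))"
    unfolding Psi_def psi_def GG_mon rho_G by simp
  then show ?thesis using induced_linear[OF linear_fun_comp[OF linear_rho linear_psi]] by simp
qed

lemma PP_sign: "PP hs = (-1) ^ (\<Sum>i<length hs. (length hs - 1 - i) * of_bool (parity (hs ! i))) *\<^sub>R prod_list (map psi hs)"
proof (induction hs)
  case (Cons h hs)
  have "(\<Sum>i<length (h # hs). (length (h # hs) - 1 - i) * of_bool (parity ((h # hs) ! i)) :: nat) =
    length hs * of_bool (parity h) + (\<Sum>i<length hs. (length hs - 1 - i) * of_bool (parity (hs ! i)))"
    unfolding length_Cons sum.lessThan_Suc_shift by simp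
  then show ?case
    unfolding PP.simps Cons psis_def
    by (simp add: power_add neg_one_power conj_commute mult.commute)
qed simp

lemma SAL_word_eq:
  "(-1) ^ (\<Sum>i<length hs. (length hs - 1 - i) * of_bool (parity (hs ! i))) * Re
        (super_integral d form n m N M k b (prod_list (map (Psi mul form C b) hs)) /
         super_integral d form n m N M k b 1) = EE (PP hs)"
proof -
  have "prod_list (map (Psi mul form C b) hs) = rho (prod_list (map psi hs))"
    by (induction hs) (simp_all add: rho_one rho_mult Psi_eq)
  then have "super_integral d form n m N M k b (prod_list (map (Psi mul form C b) hs)) =
      EE (prod_list (map psi hs)) *\<^sub>R gc.II 1"
    using super_integral_eq[OF rho_part] II_rho by simp
  moreover have "super_integral d form n m N M k b 1 = gc.II 1"
    using super_integral_eq[of 1] sym_part_mon[of "[]" C UNIV] by simp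
  ultimately show ?thesis
    unfolding PP_sign W.wick_simps[OF is_wick_Km[OF hom]] using II_one by (simp add: scaleR_conv_of_real)
qed

end

context superfield_L
begin

text \<open>The value obtained does not mention the coordinates, so the choice made in
  \<open>SAL_word\<close> is harmless.\<close>

lemma SAL_eq: "SAL mul d form n m L = HP (W.wick (Km (hty L)))"
proof -
  have "SAL_word mul d form n m L hs = W.wick (Km (hty L)) (PP hs)" for hs
  proof -
    obtain N M k b where sel: "(SOME (N, M, k, b). adapted_coords d form n m L N M k b) = (N, M, k, b)"
      by (cases "SOME (N, M, k, b). adapted_coords d form n m L N M k b") blast
    have "(\<lambda>(N, M, k, b). adapted_coords d form n m L N M k b) (SOME (N, M, k, b). adapted_coords d form n m L N M k b)"
      by (rule someI_ex) (use adapted_coords_exist in \<open>simp add: split_paired_Ex\<close>)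
    then have "adapted_coords d form n m L N M k b" unfolding sel by simp
    then interpret adapted mul d form r e n m L N M k b by unfold_locales
    show ?thesis unfolding SAL_word_def sel Let_def prod.case by (rule SAL_word_eq)
  qed
  then have "SAL_word mul d form n m L = (\<lambda>hs. W.wick (Km (hty L)) (PP hs))" by (rule ext)
  then show ?thesis unfolding SAL_def by (rule arg_cong)
qed

end

lemma ce_coboundary_diff:
  assumes "ce_coboundary n m f" "ce_coboundary n m g"
  shows "ce_coboundary n m (\<lambda>c. f c + g c)" "ce_coboundary n m (\<lambda>c. - f c)"
proof -
  obtain x y where x: "ce_cochain n m x" "\<forall>c\<in>rel_words n m. f c = x (ce_delta n m c)"
    and y: "ce_cochain n m y" "\<forall>c\<in>rel_words n m. g c = y (ce_delta n m c)"
    using assms unfolding ce_coboundary_def by blast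
  have "ce_cochain n m (\<lambda>c. x c + y c)" "ce_cochain n m (\<lambda>c. - x c)"
    using x(1) y(1) linear_scaleR_compose[of x "-1"]
    by (auto simp: ce_cochain_def intro: linear_add_compose)
  moreover have "\<forall>c\<in>rel_words n m. f c + g c = x (ce_delta n m c) + y (ce_delta n m c)"
    "\<forall>c\<in>rel_words n m. - f c = - x (ce_delta n m c)"
    using x(2) y(2) by auto
  ultimately show "ce_coboundary n m (\<lambda>c. f c + g c)" "ce_coboundary n m (\<lambda>c. - f c)"
    unfolding ce_coboundary_def by blast+
qed

lemma ce_class_eq:
  assumes "ce_coboundary n m (\<lambda>c. \<theta>' c - \<theta> c)"
  shows "ce_class n m \<theta> = ce_class n m \<theta>'"
proof -
  have "ce_coboundary n m (\<lambda>c. \<eta> c - \<theta>' c)" if "ce_coboundary n m (\<lambda>c. \<eta> c - \<theta> c)" for \<eta>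
    using ce_coboundary_diff(1)[OF that ce_coboundary_diff(2)[OF assms assms]] by simp
  moreover have "ce_coboundary n m (\<lambda>c. \<eta> c - \<theta> c)" if "ce_coboundary n m (\<lambda>c. \<eta> c - \<theta>' c)" for \<eta>
    using ce_coboundary_diff(1)[OF that assms] by simp
  ultimately show ?thesis unfolding ce_class_def by blast
qed

theorem theorem6p17:
  fixes mul :: "'e::real_vector \<times> 'o::real_vector \<Rightarrow> 'e \<times> 'o \<Rightarrow> 'e \<times> 'o"
    and d :: "'e \<times> 'o \<Rightarrow> 'e \<times> 'o"
    and form :: "'e \<times> 'o \<Rightarrow> 'e \<times> 'o \<Rightarrow> real"
    and n m :: nat
  assumes "contractible_odd_frobenius mul d form"
  shows "(\<forall>L. isotropic_complement d form L \<longrightarrow> ce_cocycle n m (SAL mul d form n m L)) \<and>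
    (\<forall>L L'. isotropic_complement d form L \<and> isotropic_complement d form L' \<longrightarrow>
       ce_class n m (SAL mul d form n m L) = ce_class n m (SAL mul d form n m L'))"
proof -
  interpret odd_frobenius mul d form using assms by (simp add: odd_frobenius_def)
  \<comment> \<open>The basis is fixed before any L is considered, so the functionals for L and L'
    live on the same polynomial algebra.\<close>
  obtain r e where re: "\<forall>a\<in>idx r. e a \<in> graded_part (odd_ix a)"
     "\<forall>a\<in>idx r. \<forall>b\<in>idx r. form (e a) (e b) = (if b = cdual a then 1 else 0)"
     "\<forall>x. x = (\<Sum>a\<in>idx r. form x (e (cdual a)) *\<^sub>R e a)"
    using dual_basis_exists by blast
  interpret superfield mul d form r e n m
    by unfold_locales (use re in blast)+
  have S: "SAL mul d form n m L = HP (W.wick (Km (hty L)))" if "isotropic_complement d form L" for L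
  proof -
    interpret superfield_L mul d form r e n m L by unfold_locales (rule that)
    show ?thesis by (rule SAL_eq)
  qed
  show ?thesis
  proof (intro conjI allI impI)
    fix L assume L: "isotropic_complement d form L"
    show "ce_cocycle n m (SAL mul d form n m L)"
      unfolding S[OF L] by (rule wick_cocycle[OF homotopy_hty[OF L]])
  next
    fix L L' assume L: "isotropic_complement d form L \<and> isotropic_complement d form L'"
    show "ce_class n m (SAL mul d form n m L) = ce_class n m (SAL mul d form n m L')"
      unfolding S[OF conjunct1[OF L]] S[OF conjunct2[OF L]]
      by (rule ce_class_eq[OF wick_coboundary]) (use L homotopy_hty in blast)+
  qed
qed

end
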